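(* Let $f:\Omega\times[0,T]^2\times\mathbb{R}^2\to\mathbb{R}$, written $f_u(s,y,z)=f_u(\omega,s,y,z)$ with $(u,s)\in[0,T]^2$, satisfy: - for all $(y,z)\in\mathbb{R}^2$, the map $(s,u,\omega)\mapsto f_u(\omega,s,y,z)$ is jointly measurable, and for each $u$ it is $\mathcal{F}_s$-adapted in $s$; - $f$ is Lipschitz continuous with linear growth in $(y,z)$, uniformly in $(s,u)$: there is a constant $C>0$ with $|f_u(s,y,z)-f_u(s,y',z')|\le C(|y-y'|+|z-z'|)$ and $|f_u(s,y,z)|\le C(1+|y|+|z|)$ for all $\omega,s,u,y,y',z,z'$. Let $\phi\in L^2_{\mathcal{F}_T}([0,T])$. Then there exists a unique solution $(Y,Z)=(Y_u,Z_u)_{u\in[0,T]}\in L^2_{\mathcal{F}}([0,T]^2)\times L^2_{\mathcal{F}}([0,T]^2)$ of $$Y_u(t)=\phi_u+\int_t^T f_u(s,Y_u(s),Z_u(s))\,ds-\int_t^T Z_u(s)\,dB(s),\qquad t\in[0,T],$$ for a.e. $u\in[0,T]$, almost surely.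
   Context: Fix $T>0$. $(\Omega,\mathcal{F},\mathbb{P})$ is a complete probability space carrying a one-dimensional Brownian motion $B=(B(t))_{t\in[0,T]}$, and $\mathbb{F}=(\mathcal{F}_t)_{t\in[0,T]}$ is the usual augmentation of the filtration generated by $B$. $L^2_{\mathcal{F}_T}([0,T])$ is the space of random fields $\phi:[0,T]\times\Omega\to\mathbb{R}$, $(u,\omega)\mapsto\phi_u(\omega)$, that are $\mathcal{F}_T\otimes\mathcal{B}([0,T])$-measurable with $\mathbb{E}[\int_0^T|\phi_u|^2\,du]<\infty$. $L^2_{\mathcal{F}}([0,T]^2)$ is the space of jointly measurable processes $(t,u,\omega)\mapsto Y_u(t,\omega)\in\mathbb{R}$ on $[0,T]^2\times\Omega$, $\mathbb{F}$-adapted in the variable $t$ for each $u$, with $\mathbb{E}[\int_0^T\int_0^T|Y_u(t)|^2\,du\,dt]<\infty$. The same space is used for $(s,u,\omega)\mapsto Z_u(s,\omega)$, with $\mathcal{F}_s$-adaptedness in $s$. Uniqueness is understood in these spaces, i.e. up to equality $dt\otimes du\otimes\mathbb{P}$-almost everywhere. *)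

theory Defs
  imports "HOL-Probability.Probability"
begin

text \<open>
  Processes are curried functions: \<open>X t \<omega>\<close> for a process, \<open>\<phi> u \<omega>\<close> for a random field and
  \<open>Y u t \<omega>\<close> for a field of processes. Only parameters in \<open>[0,T]\<close> and \<open>\<omega>\<close> in the space of \<open>M\<close>
  matter; the values elsewhere are unconstrained.
\<close>

definition lborel_upto :: "real \<Rightarrow> real measure" where
  "lborel_upto T = restrict_space lborel {0..T}"

definition brownian_motion :: "'a measure \<Rightarrow> real \<Rightarrow> (real \<Rightarrow> 'a \<Rightarrow> real) \<Rightarrow> bool" where
  "brownian_motion M T B \<longleftrightarrow>
     (\<forall>t\<in>{0..T}. B t \<in> borel_measurable M) \<and>
     (AE \<omega> in M. B 0 \<omega> = 0) \<and>
     (AE \<omega> in M. continuous_on {0..T} (\<lambda>t. B t \<omega>)) \<and>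
     (\<forall>s t. 0 \<le> s \<and> s < t \<and> t \<le> T \<longrightarrow>
        distributed M lborel (\<lambda>\<omega>. B t \<omega> - B s \<omega>) (normal_density 0 (sqrt (t - s)))) \<and>
     (\<forall>n \<tau>. (\<forall>i\<le>n. \<tau> i \<in> {0..T}) \<and> (\<forall>i<n. \<tau> i \<le> \<tau> (Suc i)) \<longrightarrow>
        prob_space.indep_vars M (\<lambda>_. borel) (\<lambda>i \<omega>. B (\<tau> (Suc i)) \<omega> - B (\<tau> i) \<omega>) {..<n::nat})"

text \<open>
  The sigma-algebra generated by \<open>B r\<close>, \<open>r \<in> [0, min s T]\<close>, and by the null sets of \<open>M\<close>.
  When \<open>M\<close> is complete, the latter are all subsets of sets of measure zero.
\<close>

definition completed_history ::
  "'a measure \<Rightarrow> real \<Rightarrow> (real \<Rightarrow> 'a \<Rightarrow> real) \<Rightarrow> real \<Rightarrow> 'a set set" where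
  "completed_history M T B s =
     sigma_sets (space M)
       ({B r -` A \<inter> space M | r A. 0 \<le> r \<and> r \<le> T \<and> r \<le> s \<and> A \<in> sets borel} \<union> null_sets M)"

text \<open>
  The right-continuous version. Histories do not grow after \<open>T\<close>, so at \<open>t = T\<close> the
  intersection is the completed history at \<open>T\<close> itself. Each \<open>brownian_filtration M T B t\<close>
  only serves as a sigma-algebra on the space of \<open>M\<close>; its measure part is irrelevant.
\<close>

definition brownian_filtration ::
  "'a measure \<Rightarrow> real \<Rightarrow> (real \<Rightarrow> 'a \<Rightarrow> real) \<Rightarrow> real \<Rightarrow> 'a measure" where
  "brownian_filtration M T B t = sigma (space M) (\<Inter>s\<in>{t<..}. completed_history M T B s)"

definition adapted_upto ::
  "real \<Rightarrow> (real \<Rightarrow> 'a measure) \<Rightarrow> (real \<Rightarrow> 'a \<Rightarrow> real) \<Rightarrow> bool" where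
  "adapted_upto T F X \<longleftrightarrow> (\<forall>t\<in>{0..T}. X t \<in> borel_measurable (F t))"

definition L2_terminal ::
  "'a measure \<Rightarrow> real \<Rightarrow> (real \<Rightarrow> 'a measure) \<Rightarrow> (real \<Rightarrow> 'a \<Rightarrow> real) set" where
  "L2_terminal M T F =
     {\<phi>. (\<lambda>(u, \<omega>). \<phi> u \<omega>) \<in> borel_measurable (lborel_upto T \<Otimes>\<^sub>M F T) \<and>
         (\<integral>\<^sup>+\<omega>. (\<integral>\<^sup>+u. ennreal ((\<phi> u \<omega>)\<^sup>2) \<partial>lborel_upto T) \<partial>M) < \<infinity>}"

definition L2_adapted_field ::
  "'a measure \<Rightarrow> real \<Rightarrow> (real \<Rightarrow> 'a measure) \<Rightarrow> (real \<Rightarrow> real \<Rightarrow> 'a \<Rightarrow> real) set" where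
  "L2_adapted_field M T F =
     {Y. (\<lambda>(t, u, \<omega>). Y u t \<omega>) \<in>
           borel_measurable (lborel_upto T \<Otimes>\<^sub>M (lborel_upto T \<Otimes>\<^sub>M M)) \<and>
         (\<forall>u\<in>{0..T}. adapted_upto T F (Y u)) \<and>
         (\<integral>\<^sup>+\<omega>. (\<integral>\<^sup>+t. (\<integral>\<^sup>+u. ennreal ((Y u t \<omega>)\<^sup>2) \<partial>lborel_upto T) \<partial>lborel_upto T) \<partial>M) < \<infinity>}"

text \<open>
  A simple process is \<open>\<Sum>i<n. \<xi> i * indicator (\<tau> i, \<tau> (i+1)]\<close> with bounded coefficients \<open>\<xi> i\<close>
  measurable at time \<open>\<tau> i\<close>.
\<close>

definition simple_process ::
  "real \<Rightarrow> (real \<Rightarrow> 'a measure) \<Rightarrow> nat \<Rightarrow> (nat \<Rightarrow> real) \<Rightarrow> (nat \<Rightarrow> 'a \<Rightarrow> real) \<Rightarrow> bool" where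
  "simple_process T F n \<tau> \<xi> \<longleftrightarrow>
     (\<forall>i\<le>n. \<tau> i \<in> {0..T}) \<and>
     (\<forall>i<n. \<tau> i \<le> \<tau> (Suc i)) \<and>
     (\<forall>i<n. \<xi> i \<in> borel_measurable (F (\<tau> i)) \<and> bounded (\<xi> i ` space (F (\<tau> i))))"

definition simple_value ::
  "nat \<Rightarrow> (nat \<Rightarrow> real) \<Rightarrow> (nat \<Rightarrow> 'a \<Rightarrow> real) \<Rightarrow> real \<Rightarrow> 'a \<Rightarrow> real" where
  "simple_value n \<tau> \<xi> t \<omega> = (\<Sum>i<n. \<xi> i \<omega> * indicator {\<tau> i<..\<tau> (Suc i)} t)"

definition simple_ito_integral ::
  "(real \<Rightarrow> 'a \<Rightarrow> real) \<Rightarrow> nat \<Rightarrow> (nat \<Rightarrow> real) \<Rightarrow> (nat \<Rightarrow> 'a \<Rightarrow> real) \<Rightarrow> real \<Rightarrow> 'a \<Rightarrow> real" where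
  "simple_ito_integral B n \<tau> \<xi> t \<omega> =
     (\<Sum>i<n. \<xi> i \<omega> * (B (min (\<tau> (Suc i)) t) \<omega> - B (min (\<tau> i) t) \<omega>))"

text \<open>
  \<open>has_ito_integral M T F B H I\<close>: \<open>I\<close> is a version of the Ito integral process
  \<open>t \<mapsto> \<integral>\<^sub>0\<^sup>t H dB\<close> on \<open>[0,T]\<close> with almost surely continuous paths, the Ito integral being the
  \<open>L\<^sup>2\<close>-continuous extension from simple processes. By the Ito isometry such an \<open>I\<close> is
  determined by \<open>H\<close> up to indistinguishability and does not depend on the approximating
  sequence.
\<close>

definition has_ito_integral ::
  "'a measure \<Rightarrow> real \<Rightarrow> (real \<Rightarrow> 'a measure) \<Rightarrow> (real \<Rightarrow> 'a \<Rightarrow> real) \<Rightarrow>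
   (real \<Rightarrow> 'a \<Rightarrow> real) \<Rightarrow> (real \<Rightarrow> 'a \<Rightarrow> real) \<Rightarrow> bool" where
  "has_ito_integral M T F B H I \<longleftrightarrow>
     (\<lambda>(t, \<omega>). H t \<omega>) \<in> borel_measurable (lborel_upto T \<Otimes>\<^sub>M M) \<and>
     adapted_upto T F H \<and>
     adapted_upto T F I \<and>
     (AE \<omega> in M. continuous_on {0..T} (\<lambda>t. I t \<omega>)) \<and>
     (\<exists>n \<tau> \<xi>.
        (\<forall>k::nat. simple_process T F (n k) (\<tau> k) (\<xi> k)) \<and>
        (\<lambda>k. \<integral>\<^sup>+\<omega>. (\<integral>\<^sup>+t. ennreal ((simple_value (n k) (\<tau> k) (\<xi> k) t \<omega> - H t \<omega>)\<^sup>2)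
                 \<partial>lborel_upto T) \<partial>M) \<longlonglongrightarrow> 0 \<and>
        (\<forall>t\<in>{0..T}.
           (\<lambda>k. \<integral>\<^sup>+\<omega>. ennreal ((simple_ito_integral B (n k) (\<tau> k) (\<xi> k) t \<omega> - I t \<omega>)\<^sup>2) \<partial>M)
             \<longlonglongrightarrow> 0))"

text \<open>
  The exceptional null set of \<open>\<omega>\<close> may depend on \<open>u\<close> but not on \<open>t\<close>; the Ito integral
  \<open>\<integral>\<^sub>t\<^sup>T Z\<^sub>u dB\<close> is \<open>I T - I t\<close> for the continuous version \<open>I\<close>.
\<close>

definition bsde_field_solution ::
  "'a measure \<Rightarrow> real \<Rightarrow> (real \<Rightarrow> 'a measure) \<Rightarrow> (real \<Rightarrow> 'a \<Rightarrow> real) \<Rightarrow>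
   (real \<Rightarrow> 'a \<Rightarrow> real \<Rightarrow> real \<Rightarrow> real \<Rightarrow> real) \<Rightarrow> (real \<Rightarrow> 'a \<Rightarrow> real) \<Rightarrow>
   (real \<Rightarrow> real \<Rightarrow> 'a \<Rightarrow> real) \<Rightarrow> (real \<Rightarrow> real \<Rightarrow> 'a \<Rightarrow> real) \<Rightarrow> bool" where
  "bsde_field_solution M T F B f \<phi> Y Z \<longleftrightarrow>
     Y \<in> L2_adapted_field M T F \<and>
     Z \<in> L2_adapted_field M T F \<and>
     (AE u in lborel_upto T. \<exists>I. has_ito_integral M T F B (Z u) I \<and>
        (AE \<omega> in M. \<forall>t\<in>{0..T}.
           Y u t \<omega> = \<phi> u \<omega> + (LINT s:{t..T}|lborel. f u \<omega> s (Y u s \<omega>) (Z u s \<omega>))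
                     - (I T \<omega> - I t \<omega>)))"

end

theory Submission
  imports Defs
begin

text \<open>
  Without the Ito formula: if \<open>D t = \<integral>\<^sub>t\<^sup>T h ds - \<integral>\<^sub>t\<^sup>T H dB\<close> is adapted and \<open>S t = \<integral>\<^sub>t\<^sup>T h ds\<close>, orthogonality of Ito
  increments to the past gives \<open>E (S t)\<^sup>2 = E (D t)\<^sup>2 + E \<integral>\<^sub>t\<^sup>T H\<^sup>2 ds\<close> and \<open>E (S t)\<^sup>2 = 2 \<integral>\<^sub>t\<^sup>T E (h D) ds\<close>. Integrating
  against the weight \<open>\<beta> exp (\<beta> t)\<close> bounds the weighted \<open>L\<^sup>2\<close> norms of \<open>D\<close> and \<open>H\<close> by \<open>2 / \<beta>\<close> times that of \<open>h\<close>.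
  Hence for large \<open>\<beta>\<close> the map that freezes \<open>(Y, Z)\<close> in the driver and solves the resulting linear equation is
  a contraction. The linear equation is solved by the martingale representation of
  \<open>\<phi>\<^sub>u + \<integral>\<^sub>0\<^sup>T f\<^sub>u ds\<close>, carried out jointly in \<open>u\<close>: variables of the form \<open>c + \<integral> Z dB\<close> are dense, because a
  product of smooth functions of \<open>B\<close> at finitely many times is approximated by expanding the heat
  semigroup to second order along fine partitions.
\<close>

section \<open>Square integrable functions\<close>

text \<open>The obstacle that shapes the development is the parameter \<open>u\<close>. Solving the
  equation separately for each \<open>u\<close> gives no joint measurability, while
  \<open>L2_adapted_field\<close> asks for adaptedness at every \<open>(u, t)\<close>, not just
  almost every one. Hence limits are taken along geometrically fast sequences and written with the
  total operator \<open>lim\<close>: such a limit is jointly measurable, and measurable for each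
  \<open>F t\<close>, because its terms are, and it is the right limit for almost every
  \<open>u\<close> without any selection of representatives. What is not such a limit is the time
  integral of an adapted field: its integrand is jointly measurable but need not be progressive, so
  it is treated by a modification on product spaces and by the null sets in the filtration. Two
  further points concern the filtration. Independence of increments from the right-continuous
  version is not part of the definition of Brownian motion and is recovered by moving the left
  endpoint slightly to the right. And paths are made continuous everywhere by a change on a null
  set, which the Ito integral does not notice.\<close>

abbreviation L0 :: "'b measure \<Rightarrow> ('b \<Rightarrow> 'c :: topological_space) set" where
  "L0 \<equiv> borel_measurable"

abbreviation sq_norm :: "'b measure \<Rightarrow> ('b \<Rightarrow> real) \<Rightarrow> ennreal" where
  "sq_norm N X \<equiv> \<integral>\<^sup>+x. ennreal ((X x)\<^sup>2) \<partial>N"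

abbreviation uncurried :: "('b \<Rightarrow> 'c \<Rightarrow> 'd) \<Rightarrow> 'b \<times> 'c \<Rightarrow> 'd" where
  "uncurried X \<equiv> \<lambda>p. X (fst p) (snd p)"

lemma ennreal_sq_add_le: "ennreal ((x + y)\<^sup>2) \<le> 2 * ennreal (x\<^sup>2) + 2 * ennreal (y\<^sup>2)"
proof -
  have "(x + y)\<^sup>2 \<le> 2 * x\<^sup>2 + 2 * y\<^sup>2"
    using sum_squares_bound[of x y] by (simp add: power2_sum)
  then have "ennreal ((x + y)\<^sup>2) \<le> ennreal (2 * x\<^sup>2 + 2 * y\<^sup>2)"
    by (rule ennreal_leI)
  also have "\<dots> = 2 * ennreal (x\<^sup>2) + 2 * ennreal (y\<^sup>2)"
    by (simp add: ennreal_plus ennreal_mult)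
  finally show ?thesis .
qed

lemma nn_integral_sq_add_le:
  fixes X Y :: "'b \<Rightarrow> real"
  assumes [measurable]: "X \<in> L0 N" "Y \<in> L0 N"
  shows "sq_norm N (\<lambda>x. X x + Y x) \<le>
    2 * sq_norm N X + 2 * sq_norm N Y"
proof -
  have "sq_norm N (\<lambda>x. X x + Y x) \<le> (\<integral>\<^sup>+x. 2 * ennreal ((X x)\<^sup>2) + 2 * ennreal ((Y x)\<^sup>2) \<partial>N)"
    by (intro nn_integral_mono ennreal_sq_add_le)
  also have "\<dots> = 2 * sq_norm N X + 2 * sq_norm N Y"
    by (simp add: nn_integral_add nn_integral_cmult)
  finally show ?thesis .
qed

definition sq_integrable :: "'b measure \<Rightarrow> ('b \<Rightarrow> real) \<Rightarrow> bool" where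
  "sq_integrable N X \<longleftrightarrow> X \<in> L0 N \<and> integrable N (\<lambda>x. (X x)\<^sup>2)"

lemma sq_integrable_iff:
  assumes "X \<in> L0 N"
  shows "sq_integrable N X \<longleftrightarrow> (sq_norm N X) < \<infinity>"
  using assms by (auto simp: sq_integrable_def integrable_iff_bounded)

lemma sq_integrable_nn_integral:
  assumes "sq_integrable N X"
  shows "sq_norm N X = ennreal (\<integral>x. (X x)\<^sup>2 \<partial>N)"
  using assms by (intro nn_integral_eq_integral) (auto simp: sq_integrable_def)

lemma sq_integrable_mult:
  assumes "sq_integrable N X" "sq_integrable N Y"
  shows "integrable N (\<lambda>x. X x * Y x)"
proof (rule Bochner_Integration.integrable_bound)
  show "integrable N (\<lambda>x. (X x)\<^sup>2 + (Y x)\<^sup>2)" using assms by (auto simp: sq_integrable_def)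
  show "(\<lambda>x. X x * Y x) \<in> L0 N" using assms by (auto simp: sq_integrable_def)
  have "\<bar>a * b\<bar> \<le> a\<^sup>2 + b\<^sup>2" for a b :: real
  proof -
    have "2 * (\<bar>a\<bar> * \<bar>b\<bar>) \<le> a\<^sup>2 + b\<^sup>2" using sum_squares_bound[of "\<bar>a\<bar>" "\<bar>b\<bar>"] by simp
    moreover have "0 \<le> \<bar>a\<bar> * \<bar>b\<bar>" by simp
    ultimately show ?thesis unfolding abs_mult by linarith
  qed
  then show "AE x in N. norm (X x * Y x) \<le> norm ((X x)\<^sup>2 + (Y x)\<^sup>2)" by simp
qed

lemma sq_integrable_add:
  assumes "sq_integrable N X" "sq_integrable N Y"
  shows "sq_integrable N (\<lambda>x. X x + Y x)"
proof -
  have "integrable N (\<lambda>x. (X x)\<^sup>2 + (Y x)\<^sup>2 + 2 * (X x * Y x))"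
    using sq_integrable_mult[OF assms] assms by (simp add: sq_integrable_def)
  then show ?thesis using assms by (simp add: sq_integrable_def power2_sum mult.assoc borel_measurable_add)
qed

lemma sq_integrable_cmult:
  "sq_integrable N X \<Longrightarrow> sq_integrable N (\<lambda>x. c * X x)"
  by (auto simp: sq_integrable_def power_mult_distrib)

lemma sq_integrable_minus:
  "sq_integrable N X \<Longrightarrow> sq_integrable N (\<lambda>x. - X x)"
  by (auto simp: sq_integrable_def)

lemma sq_integrable_diff:
  assumes "sq_integrable N X" "sq_integrable N Y"
  shows "sq_integrable N (\<lambda>x. X x - Y x)"
  using sq_integrable_add[OF assms(1) sq_integrable_minus[OF assms(2)]] by simp

lemma sq_integrable_bounded:
  assumes "finite_measure N" "X \<in> L0 N" "\<And>x. x \<in> space N \<Longrightarrow> \<bar>X x\<bar> \<le> K"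
  shows "sq_integrable N X"
proof -
  interpret finite_measure N by fact
  have "(X x)\<^sup>2 \<le> K\<^sup>2" if "x \<in> space N" for x using assms(3)[OF that] by (simp add: abs_le_square_iff[symmetric])
  then have "integrable N (\<lambda>x. (X x)\<^sup>2)"
    using assms(2) by (intro integrable_const_bound[where B="K\<^sup>2"]) auto
  then show ?thesis using assms(2) by (simp add: sq_integrable_def)
qed

lemma sq_integrable_integrable:
  assumes "finite_measure N" "sq_integrable N X"
  shows "integrable N X"
proof -
  have "sq_integrable N (\<lambda>_. 1)" by (rule sq_integrable_bounded[OF assms(1), where K=1]) auto
  from sq_integrable_mult[OF assms(2) this] show ?thesis by simp
qed

text \<open>The integral of \<open>(t * X + Y)^2\<close> is a nonnegative quadratic in
  \<open>t\<close>, so evaluate it at its minimum \<open>- c / a\<close>. If \<open>a = 0\<close> it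
  is affine, and a nonnegative affine function has zero slope.\<close>

lemma integral_mult_sq_le:
  assumes "sq_integrable N X" "sq_integrable N Y"
  shows "(\<integral>x. X x * Y x \<partial>N)\<^sup>2 \<le> (\<integral>x. (X x)\<^sup>2 \<partial>N) * (\<integral>x. (Y x)\<^sup>2 \<partial>N)"
proof -
  define a b c where "a = (\<integral>x. (X x)\<^sup>2 \<partial>N)" and "b = (\<integral>x. (Y x)\<^sup>2 \<partial>N)" and "c = (\<integral>x. X x * Y x \<partial>N)"
  note [simp] = sq_integrable_mult[OF assms]
  have i: "integrable N (\<lambda>x. (X x)\<^sup>2)" "integrable N (\<lambda>x. (Y x)\<^sup>2)" using assms by (auto simp: sq_integrable_def)
  have q: "0 \<le> t\<^sup>2 * a + 2 * t * c + b" for t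
  proof -
    have "0 \<le> (\<integral>x. (t * X x + Y x)\<^sup>2 \<partial>N)" by simp
    also have "\<dots> = (\<integral>x. t\<^sup>2 * (X x)\<^sup>2 + (2 * t) * (X x * Y x) + (Y x)\<^sup>2 \<partial>N)"
      by (intro Bochner_Integration.integral_cong) (auto simp: power2_eq_square algebra_simps)
    also have "\<dots> = t\<^sup>2 * a + 2 * t * c + b" using i by (simp add: a_def b_def c_def)
    finally show ?thesis .
  qed
  have a0: "0 \<le> a" by (simp add: a_def)
  show ?thesis
  proof (cases "a = 0")
    case True
    have "c = 0"
    proof (rule ccontr)
      assume "c \<noteq> 0"
      \<comment> \<open>At this point the affine function takes the value -1.\<close>
      with q[of "- (b + 1) / (2 * c)"] True show False by (simp add: field_simps)
    qed
    then show ?thesis using True by (simp add: a_def b_def c_def)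
  next
    case False
    then have "a > 0" using a0 by simp
    have "0 \<le> (c\<^sup>2 / a) - 2 * (c\<^sup>2 / a) + b"
      using q[of "- c / a"] False by (simp add: power2_eq_square field_simps)
    then have "c\<^sup>2 / a \<le> b" by simp
    then have "c\<^sup>2 \<le> a * b" using \<open>a > 0\<close> by (simp add: field_simps)
    then show ?thesis by (simp add: a_def b_def c_def)
  qed
qed

lemma integral_mult_le_sqrt:
  assumes "sq_integrable N X" "sq_integrable N Y"
  shows "\<bar>\<integral>x. X x * Y x \<partial>N\<bar> \<le> sqrt (\<integral>x. (X x)\<^sup>2 \<partial>N) * sqrt (\<integral>x. (Y x)\<^sup>2 \<partial>N)"
  using integral_mult_sq_le[OF assms] by (metis real_sqrt_abs real_sqrt_le_mono real_sqrt_mult)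

text \<open>Convergence is stated with nonnegative integrals because \<open>Y\<close> is not yet
  known to be square integrable. One index at finite distance settles that, after which the
  convergence can be read in the reals.\<close>

lemma sq_integrable_limit:
  assumes X: "\<And>k. sq_integrable N (X k)" and [measurable]: "Y \<in> L0 N"
    and lim: "(\<lambda>k. \<integral>\<^sup>+x. ennreal ((X k x - Y x)\<^sup>2) \<partial>N) \<longlonglongrightarrow> 0"
  shows "sq_integrable N Y"
    and "(\<lambda>k. \<integral>x. (X k x - Y x)\<^sup>2 \<partial>N) \<longlonglongrightarrow> 0"
proof -
  have "eventually (\<lambda>k. sq_norm N (\<lambda>x. X k x - Y x) < 1) sequentially"
    by (rule order_tendstoD(2)[OF lim]) simp
  then obtain k where k: "sq_norm N (\<lambda>x. X k x - Y x) < 1"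
    by (auto simp: eventually_sequentially)
  have m[measurable]: "X k \<in> L0 N" for k using X[of k] by (simp add: sq_integrable_def)
  have "sq_integrable N (\<lambda>x. X k x - Y x)"
    by (subst sq_integrable_iff) (auto intro: less_trans[OF k])
  from sq_integrable_diff[OF X[of k] this] show Y: "sq_integrable N Y" by simp
  have "(\<lambda>k. ennreal (\<integral>x. (X k x - Y x)\<^sup>2 \<partial>N)) \<longlonglongrightarrow> ennreal 0"
    using lim by (simp add: sq_integrable_nn_integral[OF sq_integrable_diff[OF X Y]])
  then show "(\<lambda>k. \<integral>x. (X k x - Y x)\<^sup>2 \<partial>N) \<longlonglongrightarrow> 0"
    by (subst (asm) tendsto_ennreal_iff) auto
qed

text \<open>Continuity of the inner product: the difference of the products splits into one
  quadratic and two linear terms in the errors, each bounded by Cauchy--Schwarz.\<close>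

lemma integral_mult_tendsto:
  assumes X: "\<And>k. sq_integrable N (X k)" and X': "sq_integrable N X'"
    and Y: "\<And>k. sq_integrable N (Y k)" and Y': "sq_integrable N Y'"
    and limX: "(\<lambda>k. \<integral>x. (X k x - X' x)\<^sup>2 \<partial>N) \<longlonglongrightarrow> 0"
    and limY: "(\<lambda>k. \<integral>x. (Y k x - Y' x)\<^sup>2 \<partial>N) \<longlonglongrightarrow> 0"
  shows "(\<lambda>k. \<integral>x. X k x * Y k x \<partial>N) \<longlonglongrightarrow> (\<integral>x. X' x * Y' x \<partial>N)"
proof -
  define p q where "p k = (\<integral>x. (X k x - X' x)\<^sup>2 \<partial>N)" and "q k = (\<integral>x. (Y k x - Y' x)\<^sup>2 \<partial>N)" for k
  define a b where "a = (\<integral>x. (X' x)\<^sup>2 \<partial>N)" and "b = (\<integral>x. (Y' x)\<^sup>2 \<partial>N)"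
  have dX: "sq_integrable N (\<lambda>x. X k x - X' x)" and dY: "sq_integrable N (\<lambda>x. Y k x - Y' x)" for k
    using X X' Y Y' by (auto intro: sq_integrable_diff)
  have bnd: "\<bar>(\<integral>x. X k x * Y k x \<partial>N) - (\<integral>x. X' x * Y' x \<partial>N)\<bar>
     \<le> sqrt (p k) * sqrt (q k) + sqrt (p k) * sqrt b + sqrt a * sqrt (q k)" for k
  proof -
    have "(\<integral>x. X k x * Y k x \<partial>N) - (\<integral>x. X' x * Y' x \<partial>N) = (\<integral>x. X k x * Y k x - X' x * Y' x \<partial>N)"
      using sq_integrable_mult[OF X Y] sq_integrable_mult[OF X' Y'] by simp
    also have "\<dots> = (\<integral>x. (X k x - X' x) * (Y k x - Y' x) + (X k x - X' x) * Y' x + X' x * (Y k x - Y' x) \<partial>N)"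
      by (intro Bochner_Integration.integral_cong) (auto simp: algebra_simps)
    also have "\<dots> = (\<integral>x. (X k x - X' x) * (Y k x - Y' x) \<partial>N) + (\<integral>x. (X k x - X' x) * Y' x \<partial>N)
        + (\<integral>x. X' x * (Y k x - Y' x) \<partial>N)"
      using sq_integrable_mult[OF dX dY] sq_integrable_mult[OF dX Y'] sq_integrable_mult[OF X' dY]
      by simp
    finally show ?thesis
      using integral_mult_le_sqrt[OF dX dY, of k k] integral_mult_le_sqrt[OF dX Y', of k]
        integral_mult_le_sqrt[OF X' dY, of k]
      unfolding p_def q_def a_def b_def by linarith
  qed
  have "(\<lambda>k. sqrt (p k) * sqrt (q k) + sqrt (p k) * sqrt b + sqrt a * sqrt (q k))
      \<longlonglongrightarrow> sqrt 0 * sqrt 0 + sqrt 0 * sqrt b + sqrt a * sqrt 0"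
    using limX limY unfolding p_def[symmetric] q_def[symmetric] by (intro tendsto_intros)
  then have lim: "(\<lambda>k. sqrt (p k) * sqrt (q k) + sqrt (p k) * sqrt b + sqrt a * sqrt (q k)) \<longlonglongrightarrow> 0"
    by (simp only: real_sqrt_zero mult_zero_left mult_zero_right add_0_left)
  have "(\<lambda>k. (\<integral>x. X k x * Y k x \<partial>N) - (\<integral>x. X' x * Y' x \<partial>N)) \<longlonglongrightarrow> 0"
    by (rule Lim_null_comparison[OF always_eventually lim]) (simp only: real_norm_def bnd simp_thms)
  then show ?thesis by (simp add: LIM_zero_iff)
qed

text \<open>The weight \<open>4 ^ k\<close> forces increments of size at most
  \<open>sqrt s * (1/2) ^ k\<close>, hence absolute convergence with a tail of at most
  \<open>2 * sqrt s * (1/2) ^ k\<close>; squaring gives the factor \<open>4 * (1/4) ^ k\<close>. The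
  same weight recurs wherever a limit is built.\<close>

lemma fast_cauchy_sequence:
  fixes a :: "nat \<Rightarrow> real"
  assumes S: "(\<Sum>k. ennreal (4 ^ k * (a (Suc k) - a k)\<^sup>2)) < \<infinity>"
  shows "convergent a"
    and "ennreal ((a k - lim a)\<^sup>2) \<le> ennreal (4 * (1/4) ^ k) * (\<Sum>k. ennreal (4 ^ k * (a (Suc k) - a k)\<^sup>2))"
proof -
  define d where "d k = a (Suc k) - a k" for k
  have "(\<Sum>k. ennreal (4 ^ k * (a (Suc k) - a k)\<^sup>2)) < top" using S by simp
  then obtain s where s: "0 \<le> s" "(\<Sum>k. ennreal (4 ^ k * (a (Suc k) - a k)\<^sup>2)) = ennreal s"
    unfolding less_top_ennreal by blast
  have p4: "((2::real) ^ k)\<^sup>2 = 4 ^ k" for k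
    by (simp add: power2_eq_square power_mult_distrib[symmetric])
  have d: "\<bar>d k\<bar> \<le> sqrt s * (1/2) ^ k" for k
  proof -
    have "ennreal (4 ^ k * (d k)\<^sup>2) \<le> ennreal s"
      using sum_le_suminf[of "\<lambda>k. ennreal (4 ^ k * (a (Suc k) - a k)\<^sup>2)" "{k}"]
      unfolding s(2) by (simp add: d_def)
    then have "4 ^ k * (d k)\<^sup>2 \<le> s" using s(1) by simp
    moreover have "(2 ^ k * \<bar>d k\<bar>)\<^sup>2 = 4 ^ k * (d k)\<^sup>2"
      using p4[of k] by (simp add: power_mult_distrib)
    ultimately have "(2 ^ k * \<bar>d k\<bar>)\<^sup>2 \<le> s" by simp
    then have "2 ^ k * \<bar>d k\<bar> \<le> sqrt s" by (rule real_le_rsqrt)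
    then show ?thesis by (simp add: power_one_over field_simps)
  qed
  have g: "summable (\<lambda>i. sqrt s * (1/2) ^ (i + k))" for k
    by (auto simp: power_add intro!: summable_mult summable_mult2 summable_geometric)
  have sd: "summable (\<lambda>i. \<bar>d (i + k)\<bar>)" for k
    by (rule summable_comparison_test'[OF g[of k], where N=0]) (use d in simp)
  have sd': "summable (\<lambda>i. d (i + k))" for k
    by (rule summable_rabs_cancel[OF sd])
  have tel: "(\<Sum>i<n. d (i + k)) = a (n + k) - a k" for n k
    by (induction n) (auto simp: d_def)
  have "(\<lambda>n. a (n + k) - a k) \<longlonglongrightarrow> (\<Sum>i. d (i + k))" for k
    using summable_LIMSEQ[OF sd'[of k]] unfolding tel .
  then have "(\<lambda>n. (a (n + k) - a k) + a k) \<longlonglongrightarrow> (\<Sum>i. d (i + k)) + a k" for k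
    by (intro tendsto_add) auto
  then have "(\<lambda>n. a (n + k)) \<longlonglongrightarrow> (\<Sum>i. d (i + k)) + a k" for k by simp
  then have L: "a \<longlonglongrightarrow> (\<Sum>i. d (i + k)) + a k" for k
    by (rule LIMSEQ_offset)
  then show "convergent a" by (auto simp: convergent_def)
  have "a k - lim a = - (\<Sum>i. d (i + k))" using limI[OF L[of k]] by simp
  also have "\<bar>\<dots>\<bar> \<le> (\<Sum>i. \<bar>d (i + k)\<bar>)" using summable_rabs[OF sd[of k]] by simp
  also have "\<dots> \<le> (\<Sum>i. sqrt s * (1/2) ^ (i + k))" by (intro suminf_le sd g d)
  also have "\<dots> = sqrt s * (1/2) ^ k * (\<Sum>i. (1/2) ^ i)"
    by (subst suminf_mult[symmetric]) (auto simp: power_add mult_ac intro!: summable_geometric)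
  also have "\<dots> = 2 * sqrt s * (1/2) ^ k" by (simp add: suminf_geometric)
  finally have "(a k - lim a)\<^sup>2 \<le> (2 * sqrt s * (1/2) ^ k)\<^sup>2"
    by (metis abs_ge_zero power2_abs power_mono)
  also have "\<dots> = 4 * (1/4) ^ k * s"
    using s(1) p4[of k] by (simp add: power_mult_distrib power_divide)
  finally show "ennreal ((a k - lim a)\<^sup>2) \<le> ennreal (4 * (1/4) ^ k) * (\<Sum>k. ennreal (4 ^ k * (a (Suc k) - a k)\<^sup>2))"
    unfolding s(2) using s(1) by (subst ennreal_mult[symmetric]) (auto intro!: ennreal_leI)
qed

lemma nn_integral_suminf_sq:
  fixes X :: "nat \<Rightarrow> 'b \<Rightarrow> real"
  assumes [measurable]: "\<And>k. X k \<in> L0 N"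
  shows "(\<integral>\<^sup>+x. (\<Sum>k. ennreal (4 ^ k * (X (Suc k) x - X k x)\<^sup>2)) \<partial>N) =
    (\<Sum>k. 4 ^ k * sq_norm N (\<lambda>x. X (Suc k) x - X k x))"
  by (simp add: nn_integral_suminf ennreal_mult nn_integral_cmult ennreal_power[symmetric])

text \<open>Completeness of the space of square integrable functions, with a distinguished limit.
  Since \<open>lim\<close> is a total function of the terms, the limit inherits measurability from
  them for any sigma-algebra, while convergence is only claimed almost everywhere.\<close>

lemma fast_cauchy_L2:
  fixes X :: "nat \<Rightarrow> 'b \<Rightarrow> real"
  assumes [measurable]: "\<And>k. X k \<in> L0 N"
    and S: "(\<Sum>k. 4 ^ k * sq_norm N (\<lambda>x. X (Suc k) x - X k x)) < \<infinity>"
  shows "AE x in N. convergent (\<lambda>k. X k x)"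
    and "sq_norm N (\<lambda>x. X k x - lim (\<lambda>k. X k x)) \<le>
      ennreal (4 * (1/4) ^ k) * (\<Sum>k. 4 ^ k * sq_norm N (\<lambda>x. X (Suc k) x - X k x))"
    and "(\<lambda>k. \<integral>\<^sup>+x. ennreal ((X k x - lim (\<lambda>k. X k x))\<^sup>2) \<partial>N) \<longlonglongrightarrow> 0"
proof -
  let ?S = "\<lambda>x. \<Sum>k. ennreal (4 ^ k * (X (Suc k) x - X k x)\<^sup>2)"
  have fin: "(\<integral>\<^sup>+x. ?S x \<partial>N) < \<infinity>" using S by (subst nn_integral_suminf_sq) auto
  then have "AE x in N. ?S x \<noteq> \<infinity>" by (intro nn_integral_PInf_AE) auto
  then have AE: "AE x in N. ?S x < \<infinity>" by eventually_elim (simp add: less_top)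
  then show "AE x in N. convergent (\<lambda>k. X k x)" by eventually_elim (rule fast_cauchy_sequence)
  have le: "sq_norm N (\<lambda>x. X k x - lim (\<lambda>k. X k x)) \<le>
      ennreal (4 * (1/4) ^ k) * (\<Sum>k. 4 ^ k * sq_norm N (\<lambda>x. X (Suc k) x - X k x))" for k
  proof -
    have "sq_norm N (\<lambda>x. X k x - lim (\<lambda>k. X k x)) \<le> (\<integral>\<^sup>+x. ennreal (4 * (1/4) ^ k) * ?S x \<partial>N)"
    proof (rule nn_integral_mono_AE)
      show "AE x in N. ennreal ((X k x - lim (\<lambda>k. X k x))\<^sup>2) \<le> ennreal (4 * (1/4) ^ k) * ?S x"
        using AE by eventually_elim (rule fast_cauchy_sequence(2))
    qed
    also have "\<dots> = ennreal (4 * (1/4) ^ k) * (\<integral>\<^sup>+x. ?S x \<partial>N)"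
      by (intro nn_integral_cmult) auto
    finally show ?thesis by (subst (asm) nn_integral_suminf_sq) auto
  qed
  show "sq_norm N (\<lambda>x. X k x - lim (\<lambda>k. X k x)) \<le>
      ennreal (4 * (1/4) ^ k) * (\<Sum>k. 4 ^ k * sq_norm N (\<lambda>x. X (Suc k) x - X k x))" by (rule le)
  have "(\<Sum>k. 4 ^ k * sq_norm N (\<lambda>x. X (Suc k) x - X k x)) < top" using S by simp
  then obtain s where s: "0 \<le> s" "(\<Sum>k. 4 ^ k * sq_norm N (\<lambda>x. X (Suc k) x - X k x)) = ennreal s"
    unfolding less_top_ennreal by blast
  have "(\<lambda>k. 4 * (1/4) ^ k * s) \<longlonglongrightarrow> 4 * 0 * s"
    by (intro tendsto_intros LIMSEQ_realpow_zero) auto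
  then have "(\<lambda>k. ennreal (4 * (1/4) ^ k * s)) \<longlonglongrightarrow> ennreal 0" by (intro tendsto_ennrealI) simp
  then have z: "(\<lambda>k. ennreal (4 * (1/4) ^ k) * ennreal s) \<longlonglongrightarrow> 0" using s(1) by (simp add: ennreal_mult)
  show "(\<lambda>k. \<integral>\<^sup>+x. ennreal ((X k x - lim (\<lambda>k. X k x))\<^sup>2) \<partial>N) \<longlonglongrightarrow> 0"
  proof (rule tendsto_sandwich[OF _ _ tendsto_const z])
    show "\<forall>\<^sub>F k in sequentially. sq_norm N (\<lambda>x. X k x - lim (\<lambda>k. X k x)) \<le> ennreal (4 * (1/4) ^ k) * ennreal s"
      by (intro always_eventually allI) (rule le[unfolded s(2)])
  qed simp
qed

section \<open>Measurability in product spaces\<close>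

text \<open>Rounding to multiples of \<open>1 / (k + 1)\<close> takes countably many values, which
  reduces joint measurability to measurability at fixed arguments. It serves both the driver and
  processes with continuous paths.\<close>

lemma floor_mult_divide_approx:
  "\<bar>real_of_int \<lfloor>real (Suc k) * y\<rfloor> / real (Suc k) - y\<bar> \<le> inverse (real (Suc k))"
proof -
  define c where "c = real (Suc k)"
  have c: "c > 0" by (simp add: c_def)
  have "real_of_int \<lfloor>c * y\<rfloor> / c - y = (real_of_int \<lfloor>c * y\<rfloor> - c * y) / c"
    using c by (simp add: diff_divide_distrib)
  then have "\<bar>real_of_int \<lfloor>c * y\<rfloor> / c - y\<bar> = \<bar>real_of_int \<lfloor>c * y\<rfloor> - c * y\<bar> / c"
    using c by (simp add: abs_divide)
  also have "\<dots> \<le> 1 / c"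
  proof (rule divide_right_mono)
    show "\<bar>real_of_int \<lfloor>c * y\<rfloor> - c * y\<bar> \<le> 1" by linarith
  qed (use c in simp)
  finally show ?thesis by (simp add: c_def inverse_eq_divide)
qed

text \<open>Substitute rounded arguments, so that only countably many sections
  \<open>g x y z\<close> are involved; the Lipschitz bound makes the rounding error vanish in the
  limit.\<close>

lemma borel_measurable_lipschitz_compose:
  fixes g :: "'b \<Rightarrow> real \<Rightarrow> real \<Rightarrow> real"
  assumes g: "\<And>y z. (\<lambda>x. g x y z) \<in> L0 N"
    and lip: "\<And>x y z y' z'. x \<in> space N \<Longrightarrow> \<bar>g x y z - g x y' z'\<bar> \<le> C * (\<bar>y - y'\<bar> + \<bar>z - z'\<bar>)"
    and [measurable]: "Y \<in> L0 N" "Z \<in> L0 N"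
  shows "(\<lambda>x. g x (Y x) (Z x)) \<in> L0 N"
proof -
  define r where "r k y = real_of_int \<lfloor>real (Suc k) * y\<rfloor> / real (Suc k)" for k y
  have r: "\<bar>r k y - y\<bar> \<le> inverse (real (Suc k))" for k y
    unfolding r_def by (rule floor_mult_divide_approx)
  have m: "(\<lambda>x. g x (r k (Y x)) (r k (Z x))) \<in> L0 N" for k
  proof -
    have "(\<lambda>x. (\<lambda>p x. g x (real_of_int (fst p) / real (Suc k)) (real_of_int (snd p) / real (Suc k)))
        (\<lfloor>real (Suc k) * Y x\<rfloor>, \<lfloor>real (Suc k) * Z x\<rfloor>) x) \<in> L0 N"
      by (rule measurable_compose_countable) (use g in measurable)
    then show ?thesis by (simp add: r_def)
  qed
  show ?thesis
  proof (rule borel_measurable_LIMSEQ_real[OF _ m])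
    fix x assume x: "x \<in> space N"
    have bnd: "\<bar>g x (r k (Y x)) (r k (Z x)) - g x (Y x) (Z x)\<bar> \<le> \<bar>C\<bar> * (inverse (real (Suc k)) + inverse (real (Suc k)))" for k
    proof -
      have "\<bar>g x (r k (Y x)) (r k (Z x)) - g x (Y x) (Z x)\<bar> \<le> C * (\<bar>r k (Y x) - Y x\<bar> + \<bar>r k (Z x) - Z x\<bar>)"
        by (rule lip[OF x])
      also have "\<dots> \<le> \<bar>C\<bar> * (\<bar>r k (Y x) - Y x\<bar> + \<bar>r k (Z x) - Z x\<bar>)"
        by (intro mult_right_mono) auto
      also have "\<dots> \<le> \<bar>C\<bar> * (inverse (real (Suc k)) + inverse (real (Suc k)))"
        by (intro mult_left_mono add_mono r) auto
      finally show ?thesis .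
    qed
    have "(\<lambda>k. \<bar>C\<bar> * (inverse (real (Suc k)) + inverse (real (Suc k)))) \<longlonglongrightarrow> \<bar>C\<bar> * (0 + 0)"
      by (intro tendsto_intros LIMSEQ_inverse_real_of_nat)
    then have lim: "(\<lambda>k. \<bar>C\<bar> * (inverse (real (Suc k)) + inverse (real (Suc k)))) \<longlonglongrightarrow> 0" by simp
    have "(\<lambda>k. g x (r k (Y x)) (r k (Z x)) - g x (Y x) (Z x)) \<longlonglongrightarrow> 0"
      by (rule Lim_null_comparison[OF always_eventually lim]) (simp only: real_norm_def bnd simp_thms)
    then show "(\<lambda>k. g x (r k (Y x)) (r k (Z x))) \<longlonglongrightarrow> g x (Y x) (Z x)" by (simp add: LIM_zero_iff)
  qed
qed

lemma space_lborel_upto [simp]: "space (lborel_upto T) = {0..T}"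
  by (simp add: lborel_upto_def space_restrict_space)

lemma borel_measurable_continuous_process:
  fixes W :: "real \<Rightarrow> 'b \<Rightarrow> real"
  assumes T: "0 < T" and W: "\<And>t. t \<in> {0..T} \<Longrightarrow> W t \<in> L0 N"
    and cont: "\<And>w. w \<in> space N \<Longrightarrow> continuous_on {0..T} (\<lambda>t. W t w)"
  shows "(\<lambda>(t, w). W t w) \<in> L0 (lborel_upto T \<Otimes>\<^sub>M N)"
proof -
  \<comment> \<open>The clamp changes nothing for \<open>t\<close> in \<open>[0, T]\<close>. It
    makes the process at the rounded time measurable for every integer \<open>i\<close>, as the
    countable case split demands.\<close>
  define r where "r k t = max 0 (min T (real_of_int \<lfloor>real (Suc k) * t\<rfloor> / real (Suc k)))" for k t
  have id[measurable]: "(\<lambda>x. fst x) \<in> L0 (lborel_upto T \<Otimes>\<^sub>M N)"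
    unfolding lborel_upto_def
    by (rule measurable_compose[OF measurable_fst]) (simp add: measurable_restrict_space1)
  have m: "(\<lambda>x. W (r k (fst x)) (snd x)) \<in> L0 (lborel_upto T \<Otimes>\<^sub>M N)" for k
  proof -
    have W': "W (max 0 (min T (real_of_int i / real (Suc k)))) \<in> L0 N" for i
      using T by (intro W) auto
    have "(\<lambda>x. (\<lambda>i x. W (max 0 (min T (real_of_int i / real (Suc k)))) (snd x))
        \<lfloor>real (Suc k) * fst x\<rfloor> x) \<in> L0 (lborel_upto T \<Otimes>\<^sub>M N)"
      by (rule measurable_compose_countable) (use W' in measurable)
    then show ?thesis by (simp add: r_def)
  qed
  show ?thesis unfolding case_prod_beta
  proof (rule borel_measurable_LIMSEQ_real[OF _ m])
    fix x assume "x \<in> space (lborel_upto T \<Otimes>\<^sub>M N)"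
    then have x: "fst x \<in> {0..T}" "snd x \<in> space N" by (auto simp: space_pair_measure)
    have "\<bar>r k (fst x) - fst x\<bar> \<le> inverse (real (Suc k))" for k
    proof -
      have "\<bar>real_of_int \<lfloor>real (Suc k) * fst x\<rfloor> / real (Suc k) - fst x\<bar> \<le> inverse (real (Suc k))"
        by (rule floor_mult_divide_approx)
      then show ?thesis using x(1) unfolding r_def by auto
    qed
    then have "(\<lambda>k. r k (fst x) - fst x) \<longlonglongrightarrow> 0"
      by (intro Lim_null_comparison[OF always_eventually LIMSEQ_inverse_real_of_nat]) auto
    then have "(\<lambda>k. r k (fst x)) \<longlonglongrightarrow> fst x" by (simp add: LIM_zero_iff)
    then show "(\<lambda>k. W (r k (fst x)) (snd x)) \<longlonglongrightarrow> W (fst x) (snd x)"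
      using cont[OF x(2)] x(1) T
      by (auto simp: continuous_on_sequentially r_def comp_def)
  qed
qed

lemma subalgebra_pair:
  assumes "subalgebra M F"
  shows "subalgebra (S \<Otimes>\<^sub>M M) (S \<Otimes>\<^sub>M F)"
  using assms unfolding subalgebra_def
  by (auto simp: space_pair_measure sets_pair_measure intro!: sigma_sets_mono')

text \<open>Conditioning on the product with the full sigma-algebra of \<open>S\<close> acts on each section separately,
  because it can be computed on rectangles.\<close>

lemma section_measurable_modification:
  fixes X :: "'s \<times> 'a \<Rightarrow> real"
  assumes S: "finite_measure S" and M: "prob_space M" and F: "subalgebra M F"
    and X: "integrable (S \<Otimes>\<^sub>M M) X"
    and sec: "AE s in S. (\<lambda>w. X (s, w)) \<in> L0 F"
  shows "\<exists>X'. X' \<in> L0 (S \<Otimes>\<^sub>M F) \<and> integrable (S \<Otimes>\<^sub>M M) X' \<and> (AE p in S \<Otimes>\<^sub>M M. X p = X' p)"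
proof -
  interpret S: finite_measure S by fact
  interpret M: prob_space M by fact
  interpret P: pair_sigma_finite S M ..
  have finP: "finite_measure (S \<Otimes>\<^sub>M M)" by (intro finite_measure_pair_measure) unfold_locales
  interpret FS: finite_measure_subalgebra "M" F
    by unfold_locales (rule F)
  interpret PS: finite_measure_subalgebra "S \<Otimes>\<^sub>M M" "S \<Otimes>\<^sub>M F"
    using finP by (simp add: finite_measure_subalgebra_def finite_measure_subalgebra_axioms_def subalgebra_pair[OF F])
  define X' where "X' = real_cond_exp (S \<Otimes>\<^sub>M M) (S \<Otimes>\<^sub>M F) X"
  have X'i: "integrable (S \<Otimes>\<^sub>M M) X'" unfolding X'_def using X by (rule PS.real_cond_exp_int)
  have X'm[measurable]: "X' \<in> L0 (S \<Otimes>\<^sub>M F)" unfolding X'_def by simp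
  have spF: "space F = space M" using F by (simp add: subalgebra_def)
  have sec': "AE s in S. (\<lambda>w. X' (s, w)) \<in> L0 F"
    by (intro AE_I2) measurable
  have rect: "(\<integral>p. indicator (U \<times> A) p * X p \<partial>(S \<Otimes>\<^sub>M M)) = (\<integral>p. indicator (U \<times> A) p * X' p \<partial>(S \<Otimes>\<^sub>M M))"
    if [measurable]: "U \<in> sets S" "A \<in> sets M" for U A
  proof -
    \<comment> \<open>Truncation to \<open>[0, 1]\<close> gives a version of the conditional
      probability of \<open>A\<close> that is bounded everywhere, so that its products with
      integrable functions are integrable.\<close>
    define p where "p w = max 0 (min 1 (real_cond_exp M F (indicator A) w))" for w
    have pm[measurable]: "p \<in> L0 F" unfolding p_def by measurable
    have pmM[measurable]: "p \<in> L0 M" by (rule measurable_from_subalg[OF F pm])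
    have iA: "integrable M (indicator A :: _ \<Rightarrow> real)" by (simp add: M.emeasure_eq_measure)
    have peq: "AE w in M. real_cond_exp M F (indicator A) w = p w"
    proof -
      have "AE w in M. real_cond_exp M F (indicator A) w \<ge> 0"
        by (rule FS.real_cond_exp_pos) auto
      moreover have "AE w in M. real_cond_exp M F (indicator A) w \<le> real_cond_exp M F (\<lambda>_. 1) w"
        by (rule FS.real_cond_exp_mono[OF _ iA]) (auto simp: indicator_def)
      moreover have "AE w in M. real_cond_exp M F (\<lambda>_. 1) w = 1"
        by (rule FS.real_cond_exp_F_meas) auto
      ultimately show ?thesis by eventually_elim (auto simp: p_def)
    qed
    \<comment> \<open>If almost every section of \<open>V\<close> is \<open>F\<close>-measurable,
      the indicator of \<open>A\<close> may be replaced by \<open>p\<close> inside the sections.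
      Both \<open>X\<close> and its conditional expectation \<open>X'\<close> have this property,
      and \<open>p\<close> is measurable for the conditioning sigma-algebra, so the two have equal
      integrals over \<open>U \<times> A\<close>.\<close>
    have key: "(\<integral>q. indicator (U \<times> A) q * V q \<partial>(S \<Otimes>\<^sub>M M)) = (\<integral>q. (indicator U (fst q) * p (snd q)) * V q \<partial>(S \<Otimes>\<^sub>M M))"
      if Vi: "integrable (S \<Otimes>\<^sub>M M) V" and Vs: "AE s in S. (\<lambda>w. V (s, w)) \<in> L0 F" for V
    proof -
      have [measurable]: "V \<in> L0 (S \<Otimes>\<^sub>M M)" using Vi by auto
      have "U \<times> A \<in> sets (S \<Otimes>\<^sub>M M)" by measurable
      from integrable_mult_indicator[OF this Vi]
      have i1: "integrable (S \<Otimes>\<^sub>M M) (\<lambda>q. indicator (U \<times> A) q * V q)" by simp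
      have i2: "integrable (S \<Otimes>\<^sub>M M) (\<lambda>q. (indicator U (fst q) * p (snd q)) * V q)"
        by (rule Bochner_Integration.integrable_bound[OF Vi]) (auto simp: indicator_def p_def abs_mult intro!: mult_left_le_one_le)
      have "(\<integral>q. indicator (U \<times> A) q * V q \<partial>(S \<Otimes>\<^sub>M M)) = (\<integral>s. (\<integral>w. indicator (U \<times> A) (s, w) * V (s, w) \<partial>M) \<partial>S)"
        using P.integral_fst'[OF i1] by simp
      also have "\<dots> = (\<integral>s. (\<integral>w. (indicator U s * p w) * V (s, w) \<partial>M) \<partial>S)"
      proof (rule integral_cong_AE)
        show "AE s in S. (\<integral>w. indicator (U \<times> A) (s, w) * V (s, w) \<partial>M) = (\<integral>w. indicator U s * p w * V (s, w) \<partial>M)"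
          using Vs P.AE_integrable_fst'[OF Vi] AE_space
        proof eventually_elim
          case (elim s)
          have [measurable]: "(\<lambda>w. V (s, w)) \<in> L0 M"
            by (rule measurable_from_subalg[OF F elim(1)])
          have iVA: "integrable M (\<lambda>w. V (s, w) * indicator A w)"
            using integrable_mult_indicator[OF \<open>A \<in> sets M\<close> elim(2)] by (simp add: mult.commute)
          have "(\<integral>w. V (s, w) * indicator A w \<partial>M) = (\<integral>w. V (s, w) * real_cond_exp M F (indicator A) w \<partial>M)"
            by (rule FS.real_cond_exp_intg(2)[symmetric, OF iVA elim(1)]) auto
          also have "\<dots> = (\<integral>w. V (s, w) * p w \<partial>M)"
          proof (rule integral_cong_AE)
            show "AE w in M. V (s, w) * real_cond_exp M F (indicator A) w = V (s, w) * p w"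
              using peq by eventually_elim simp
          qed auto
          finally have e: "(\<integral>w. V (s, w) * indicator A w \<partial>M) = (\<integral>w. V (s, w) * p w \<partial>M)" .
          have "(\<integral>w. indicator (U \<times> A) (s, w) * V (s, w) \<partial>M) = (\<integral>w. indicator U s * (V (s, w) * indicator A w) \<partial>M)"
            by (intro Bochner_Integration.integral_cong) (auto simp: indicator_def)
          also have "\<dots> = indicator U s * (\<integral>w. V (s, w) * p w \<partial>M)"
            using e by simp
          also have "\<dots> = (\<integral>w. indicator U s * (V (s, w) * p w) \<partial>M)" by simp
          finally show ?case by (simp add: mult_ac)
        qed
      qed (measurable)
      also have "\<dots> = (\<integral>q. (indicator U (fst q) * p (snd q)) * V q \<partial>(S \<Otimes>\<^sub>M M))"
        using P.integral_fst'[OF i2] by simp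
      finally show ?thesis .
    qed
    have "(\<integral>q. (indicator U (fst q) * p (snd q)) * X' q \<partial>(S \<Otimes>\<^sub>M M)) = (\<integral>q. (indicator U (fst q) * p (snd q)) * X q \<partial>(S \<Otimes>\<^sub>M M))"
      unfolding X'_def
    proof (rule PS.real_cond_exp_intg(2))
      show "integrable (S \<Otimes>\<^sub>M M) (\<lambda>q. (indicator U (fst q) * p (snd q)) * X q)"
        by (rule Bochner_Integration.integrable_bound[OF X]) (use X in \<open>auto simp: indicator_def p_def abs_mult intro!: mult_left_le_one_le\<close>)
      show "X \<in> L0 (S \<Otimes>\<^sub>M M)" using X by auto
    qed measurable
    then show ?thesis using key[OF X sec] key[OF X'i sec'] by simp
  qed
  have XI: "integrable (S \<Otimes>\<^sub>M M) (\<lambda>p. indicator A p * X p)" if "A \<in> sets (S \<Otimes>\<^sub>M M)" for A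
    using integrable_mult_indicator[OF that X] by simp
  have X'I: "integrable (S \<Otimes>\<^sub>M M) (\<lambda>p. indicator A p * X' p)" if "A \<in> sets (S \<Otimes>\<^sub>M M)" for A
    using integrable_mult_indicator[OF that X'i] by simp
  \<comment> \<open>Equality on rectangles extends to all measurable sets by a Dynkin argument;
    integrability of \<open>X\<close> and \<open>X'\<close> gives the step to countable disjoint
    unions.\<close>
  have all: "(\<integral>p. indicator A p * X p \<partial>(S \<Otimes>\<^sub>M M)) = (\<integral>p. indicator A p * X' p \<partial>(S \<Otimes>\<^sub>M M))"
    if "A \<in> sets (S \<Otimes>\<^sub>M M)" for A
    using Int_stable_pair_measure_generator pair_measure_closed that[unfolded sets_pair_measure]
  proof (induction rule: sigma_sets_induct_disjoint)
    case (basic A)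
    then show ?case using rect by auto
  next
    case empty
    then show ?case by simp
  next
    case (compl A)
    let ?O = "space S \<times> space M"
    have A: "A \<in> sets (S \<Otimes>\<^sub>M M)" using compl(1) by (simp add: sets_pair_measure)
    have e: "(\<integral>p. indicator (?O - A) p * V p \<partial>(S \<Otimes>\<^sub>M M)) = (\<integral>p. indicator ?O p * V p \<partial>(S \<Otimes>\<^sub>M M)) - (\<integral>p. indicator A p * V p \<partial>(S \<Otimes>\<^sub>M M))"
      if V: "integrable (S \<Otimes>\<^sub>M M) V" for V :: "_ \<Rightarrow> real"
    proof -
      have O: "?O \<in> sets (S \<Otimes>\<^sub>M M)" by simp
      have i: "integrable (S \<Otimes>\<^sub>M M) (\<lambda>p. indicator ?O p * V p)" "integrable (S \<Otimes>\<^sub>M M) (\<lambda>p. indicator A p * V p)"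
        using integrable_mult_indicator[OF O V] integrable_mult_indicator[OF A V] by simp_all
      have "A \<subseteq> ?O" using sets.sets_into_space[OF A] by (simp add: space_pair_measure)
      then have "(\<integral>p. indicator (?O - A) p * V p \<partial>(S \<Otimes>\<^sub>M M)) = (\<integral>p. indicator ?O p * V p - indicator A p * V p \<partial>(S \<Otimes>\<^sub>M M))"
        by (intro Bochner_Integration.integral_cong) (auto simp: indicator_def)
      also have "\<dots> = (\<integral>p. indicator ?O p * V p \<partial>(S \<Otimes>\<^sub>M M)) - (\<integral>p. indicator A p * V p \<partial>(S \<Otimes>\<^sub>M M))"
        by (rule Bochner_Integration.integral_diff[OF i])
      finally show ?thesis .
    qed
    show ?case unfolding e[OF X] e[OF X'i] using compl rect[OF sets.top sets.top] by simp
  next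
    case (union A)
    have A: "A i \<in> sets (S \<Otimes>\<^sub>M M)" for i using union(2) by (auto simp: sets_pair_measure)
    have e: "(LINT p:(\<Union>i. A i)|(S \<Otimes>\<^sub>M M). V p) = (\<Sum>i. LINT p:(A i)|(S \<Otimes>\<^sub>M M). V p)"
      if V: "integrable (S \<Otimes>\<^sub>M M) V" for V :: "_ \<Rightarrow> real"
    proof (rule lebesgue_integral_countable_add[OF A])
      show "set_integrable (S \<Otimes>\<^sub>M M) (\<Union>i. A i) V"
        unfolding set_integrable_def using A by (intro integrable_mult_indicator V) auto
    qed (use union(1) in \<open>auto simp: disjoint_family_on_def\<close>)
    show ?case using e[OF X] e[OF X'i] union(3) by (simp add: set_lebesgue_integral_def)
  qed
  have "AE p in S \<Otimes>\<^sub>M M. X p = X' p"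
    by (rule density_unique_real[OF X X'i]) (simp add: set_lebesgue_integral_def all)
  then show ?thesis using X'm X'i by (intro exI[of _ X'] conjI)
qed

section \<open>Brownian motion and elementary integrands\<close>

lemma sq_integrable_bounded_mult:
  assumes "sq_integrable N X" "Y \<in> L0 N" "\<And>x. x \<in> space N \<Longrightarrow> \<bar>Y x\<bar> \<le> K"
  shows "sq_integrable N (\<lambda>x. Y x * X x)"
proof -
  have [measurable]: "X \<in> L0 N" and i: "integrable N (\<lambda>x. (X x)\<^sup>2)"
    using assms(1) by (simp_all add: sq_integrable_def)
  note [measurable] = assms(2)
  have "integrable N (\<lambda>x. (Y x * X x)\<^sup>2)"
  proof (rule Bochner_Integration.integrable_bound)
    show "integrable N (\<lambda>x. K\<^sup>2 * (X x)\<^sup>2)" using i by simp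
    show "AE x in N. norm ((Y x * X x)\<^sup>2) \<le> norm (K\<^sup>2 * (X x)\<^sup>2)"
    proof (rule AE_I2)
      fix x assume "x \<in> space N"
      then have "\<bar>Y x\<bar> \<le> \<bar>K\<bar>" using assms(3)[of x] by linarith
      then have "(Y x)\<^sup>2 \<le> K\<^sup>2" by (simp add: abs_le_square_iff)
      then show "norm ((Y x * X x)\<^sup>2) \<le> norm (K\<^sup>2 * (X x)\<^sup>2)"
        by (simp add: power_mult_distrib mult_right_mono)
    qed
  qed measurable
  then show ?thesis by (simp add: sq_integrable_def)
qed

text \<open>Continuity and the initial value are required at every point of the space; the given
  Brownian motion satisfies them after a change on a null set. Independence is stated for events of
  \<open>F s\<close>, the form in which the right-continuous filtration supplies it.\<close>

locale wiener = prob_space M for M :: "'a measure" +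
  fixes T :: real and F :: "real \<Rightarrow> 'a measure" and W :: "real \<Rightarrow> 'a \<Rightarrow> real"
  assumes T_pos: "0 < T"
    and F_sub: "\<And>t. 0 \<le> t \<Longrightarrow> t \<le> T \<Longrightarrow> subalgebra M (F t)"
    and F_mono: "\<And>s t. 0 \<le> s \<Longrightarrow> s \<le> t \<Longrightarrow> t \<le> T \<Longrightarrow> sets (F s) \<subseteq> sets (F t)"
    and F_null: "\<And>t A. 0 \<le> t \<Longrightarrow> t \<le> T \<Longrightarrow> A \<in> null_sets M \<Longrightarrow> A \<in> sets (F t)"
    and W_adapted: "\<And>t. 0 \<le> t \<Longrightarrow> t \<le> T \<Longrightarrow> W t \<in> L0 (F t)"
    and W_continuous: "\<And>w. w \<in> space M \<Longrightarrow> continuous_on {0..T} (\<lambda>t. W t w)"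
    and W_0: "\<And>w. w \<in> space M \<Longrightarrow> W 0 w = 0"
    and W_normal: "\<And>s t. 0 \<le> s \<Longrightarrow> s < t \<Longrightarrow> t \<le> T \<Longrightarrow>
          distributed M lborel (\<lambda>w. W t w - W s w) (normal_density 0 (sqrt (t - s)))"
    and W_indep: "\<And>s t A B. 0 \<le> s \<Longrightarrow> s \<le> t \<Longrightarrow> t \<le> T \<Longrightarrow> A \<in> sets (F s) \<Longrightarrow> B \<in> sets borel \<Longrightarrow>
          prob (A \<inter> ((\<lambda>w. W t w - W s w) -` B \<inter> space M)) =
          prob A * prob ((\<lambda>w. W t w - W s w) -` B \<inter> space M)"
begin

lemma space_F: "0 \<le> t \<Longrightarrow> t \<le> T \<Longrightarrow> space (F t) = space M"
  using F_sub[of t] by (simp add: subalgebra_def)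

lemma measurable_F_M:
  "X \<in> L0 (F t) \<Longrightarrow> 0 \<le> t \<Longrightarrow> t \<le> T \<Longrightarrow> X \<in> L0 M"
  by (rule measurable_from_subalg[OF F_sub])

lemma measurable_F_mono:
  "X \<in> L0 (F s) \<Longrightarrow> 0 \<le> s \<Longrightarrow> s \<le> t \<Longrightarrow> t \<le> T \<Longrightarrow> X \<in> L0 (F t)"
  by (rule measurable_from_subalg) (auto simp: subalgebra_def space_F F_mono)

text \<open>The two preimages of a Borel set differ by null sets, and these belong to
  \<open>F t\<close>. Adaptedness can thus be moved along almost sure equality.\<close>

lemma measurable_F_AE_cong:
  fixes X Y :: "'a \<Rightarrow> real"
  assumes Y: "Y \<in> L0 (F t)" and t: "0 \<le> t" "t \<le> T"
    and X: "X \<in> L0 M" and eq: "AE w in M. X w = Y w"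
  shows "X \<in> L0 (F t)"
proof (rule measurableI)
  fix A :: "real set" assume A: "A \<in> sets borel"
  have [measurable]: "Y \<in> L0 M" by (rule measurable_F_M[OF Y t])
  note [measurable] = X A
  let ?X = "X -` A \<inter> space M" and ?Y = "Y -` A \<inter> space M"
  have "AE w in M. w \<notin> ?X - ?Y" "AE w in M. w \<notin> ?Y - ?X" using eq by (auto elim!: eventually_mono)
  then have "?X - ?Y \<in> null_sets M" "?Y - ?X \<in> null_sets M"
    by (subst AE_iff_null_sets; measurable)+
  then have "?X - ?Y \<in> sets (F t)" "?Y - ?X \<in> sets (F t)" using F_null[OF t] by auto
  moreover have "?Y \<in> sets (F t)" using measurable_sets[OF Y A] t by (simp add: space_F)
  ultimately have "(?Y - (?Y - ?X)) \<union> (?X - ?Y) \<in> sets (F t)" by blast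
  moreover have "(?Y - (?Y - ?X)) \<union> (?X - ?Y) = ?X" by blast
  ultimately show "X -` A \<inter> space (F t) \<in> sets (F t)" using t by (simp add: space_F)
qed simp

lemma W_measurable: "0 \<le> t \<Longrightarrow> t \<le> T \<Longrightarrow> W t \<in> L0 M"
  by (rule measurable_F_M[OF W_adapted])

lemma W_measurable_F: "0 \<le> s \<Longrightarrow> s \<le> t \<Longrightarrow> t \<le> T \<Longrightarrow> W s \<in> L0 (F t)"
  using measurable_F_mono[OF W_adapted[of s]] by auto

text \<open>The degenerate case \<open>s = t\<close> is treated apart, since a normal law is only
  given for \<open>s < t\<close>. The fourth moment is there to control squared Taylor
  errors.\<close>

lemma W_increment_moments:
  assumes st: "0 \<le> s" "s \<le> t" "t \<le> T"
  shows "integrable M (\<lambda>w. (W t w - W s w) ^ k)"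
    and "(\<integral>w. (W t w - W s w) \<partial>M) = 0"
    and "(\<integral>w. (W t w - W s w)\<^sup>2 \<partial>M) = t - s"
    and "(\<integral>w. (W t w - W s w) ^ 4 \<partial>M) = 3 * (t - s)\<^sup>2"
proof -
  consider "s = t" | "s < t" using st by linarith
  then have "integrable M (\<lambda>w. (W t w - W s w) ^ k) \<and> (\<integral>w. (W t w - W s w) \<partial>M) = 0 \<and>
    (\<integral>w. (W t w - W s w)\<^sup>2 \<partial>M) = t - s \<and> (\<integral>w. (W t w - W s w) ^ 4 \<partial>M) = 3 * (t - s)\<^sup>2"
  proof cases
    case 1
    then show ?thesis by (cases k) auto
  next
    case 2
    let ?d = "normal_density 0 (sqrt (t - s))"
    have pos: "0 < sqrt (t - s)" using 2 by simp
    note D = W_normal[OF st(1) 2 st(3)]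
    have e: "(\<integral>w. (W t w - W s w) ^ j \<partial>M) = (\<integral>x. ?d x * x ^ j \<partial>lborel)" for j
      using distributed_integral[OF D, of "\<lambda>x. x ^ j"] by simp
    have "integrable M (\<lambda>w. (W t w - W s w) ^ k)"
      using distributed_integrable[OF D, of "\<lambda>x. x ^ k"] integrable_normal_moment[OF pos, of 0 k] by simp
    moreover have "(\<integral>w. (W t w - W s w) ^ 1 \<partial>M) = 0"
      unfolding e using integral_normal_moment_odd[OF pos, of 0 0] by simp
    moreover have "(\<integral>w. (W t w - W s w)\<^sup>2 \<partial>M) = t - s"
      unfolding e using integral_normal_moment_even[OF pos, of 0 1] 2 by simp
    moreover have "(\<integral>w. (W t w - W s w) ^ 4 \<partial>M) = 3 * (t - s)\<^sup>2"
      unfolding e using integral_normal_moment_even[OF pos, of 0 2] 2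
      by (simp add: fact_numeral power2_eq_square field_simps)
    ultimately show ?thesis by simp
  qed
  then show "integrable M (\<lambda>w. (W t w - W s w) ^ k)" "(\<integral>w. (W t w - W s w) \<partial>M) = 0"
    "(\<integral>w. (W t w - W s w)\<^sup>2 \<partial>M) = t - s" "(\<integral>w. (W t w - W s w) ^ 4 \<partial>M) = 3 * (t - s)\<^sup>2"
    by auto
qed

lemma sq_integrable_increment:
  assumes "0 \<le> s" "s \<le> T" "0 \<le> t" "t \<le> T"
  shows "sq_integrable M (\<lambda>w. W t w - W s w)"
proof (cases "s \<le> t")
  case True
  then show ?thesis using assms W_increment_moments(1)[of s t 2] W_measurable[of s] W_measurable[of t]
    by (simp add: sq_integrable_def)
next
  case False
  then have "sq_integrable M (\<lambda>w. W s w - W t w)" using assms W_increment_moments(1)[of t s 2] W_measurable[of s] W_measurable[of t]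
    by (simp add: sq_integrable_def)
  from sq_integrable_minus[OF this] show ?thesis by simp
qed

lemma indep_increment:
  assumes st: "0 \<le> s" "s \<le> t" "t \<le> T" and X: "X \<in> L0 (F s)"
  shows "indep_var borel X borel (\<lambda>w. W t w - W s w)"
proof -
  have t: "0 \<le> t" and s: "s \<le> T" using st by auto
  have [measurable]: "X \<in> L0 M" by (rule measurable_F_M[OF X st(1) s])
  have [measurable]: "W t \<in> L0 M" "W s \<in> L0 M"
    using W_measurable t st s by auto
  let ?D = "\<lambda>w. W t w - W s w"
  have stable: "Int_stable {Y -` A \<inter> space M |A. A \<in> sets borel}" for Y :: "'a \<Rightarrow> real"
    unfolding Int_stable_def
  proof safe
    fix A B :: "real set" assume "A \<in> sets borel" "B \<in> sets borel"
    then show "\<exists>C. Y -` A \<inter> space M \<inter> (Y -` B \<inter> space M) = Y -` C \<inter> space M \<and> C \<in> sets borel"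
      by (intro exI[of _ "A \<inter> B"]) auto
  qed
  have "indep_set {X -` A \<inter> space M |A. A \<in> sets borel} {?D -` A \<inter> space M |A. A \<in> sets borel}"
  proof (rule indep_setI)
    fix a b assume "a \<in> {X -` A \<inter> space M |A. A \<in> sets borel}" "b \<in> {?D -` A \<inter> space M |A. A \<in> sets borel}"
    then obtain A B where AB: "a = X -` A \<inter> space M" "b = ?D -` B \<inter> space M" "A \<in> sets borel" "B \<in> sets borel" by auto
    have "a \<in> sets (F s)" using measurable_sets[OF X AB(3)] st s by (simp add: space_F AB(1))
    from W_indep[OF st this AB(4)] show "prob (a \<inter> b) = prob a * prob b" by (simp add: AB(2))
  qed (auto intro: measurable_sets)
  from indep_set_sigma_sets[OF this stable stable] show ?thesis
    unfolding indep_var_eq by simp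
qed

lemma expectation_mult_increment:
  assumes st: "0 \<le> s" "s \<le> t" "t \<le> T" and X: "X \<in> L0 (F s)" "integrable M X"
  shows "integrable M (\<lambda>w. X w * (W t w - W s w))" "(\<integral>w. X w * (W t w - W s w) \<partial>M) = 0"
proof -
  have i: "integrable M (\<lambda>w. W t w - W s w)" using W_increment_moments(1)[OF st, of 1] by simp
  show "integrable M (\<lambda>w. X w * (W t w - W s w))"
    by (rule indep_var_integrable[OF indep_increment[OF st X(1)] X(2) i])
  show "(\<integral>w. X w * (W t w - W s w) \<partial>M) = 0"
    using indep_var_lebesgue_integral[OF indep_increment[OF st X(1)] X(2) i] W_increment_moments(2)[OF st] by simp
qed

lemma expectation_mult_increment_sq:
  assumes st: "0 \<le> s" "s \<le> t" "t \<le> T" and X: "X \<in> L0 (F s)" "integrable M X"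
  shows "integrable M (\<lambda>w. X w * (W t w - W s w)\<^sup>2)"
    "(\<integral>w. X w * (W t w - W s w)\<^sup>2 \<partial>M) = (\<integral>w. X w \<partial>M) * (t - s)"
proof -
  have i: "integrable M (\<lambda>w. (W t w - W s w)\<^sup>2)" using W_increment_moments(1)[OF st, of 2] by simp
  have "indep_var borel (id \<circ> X) borel ((\<lambda>x. x\<^sup>2) \<circ> (\<lambda>w. W t w - W s w))"
    by (rule indep_var_compose[OF indep_increment[OF st X(1)]]) auto
  then have ind: "indep_var borel X borel (\<lambda>w. (W t w - W s w)\<^sup>2)" by (simp add: comp_def)
  show "integrable M (\<lambda>w. X w * (W t w - W s w)\<^sup>2)"
    by (rule indep_var_integrable[OF ind X(2) i])
  show "(\<integral>w. X w * (W t w - W s w)\<^sup>2 \<partial>M) = (\<integral>w. X w \<partial>M) * (t - s)"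
    using indep_var_lebesgue_integral[OF ind X(2) i] W_increment_moments(3)[OF st] by simp
qed

end

text \<open>An unordered list of weighted intervals instead of a partition: sums become
  concatenations, and overlapping steps need no common refinement. Partitions reappear only in the
  comparison with \<open>simple_process\<close>.\<close>

definition el_val :: "(real \<times> real \<times> ('a \<Rightarrow> real)) list \<Rightarrow> real \<Rightarrow> 'a \<Rightarrow> real" where
  "el_val L t w = (\<Sum>(a, b, \<xi>)\<leftarrow>L. \<xi> w * indicator {a<..b} t)"

definition el_scale :: "real \<Rightarrow> (real \<times> real \<times> ('a \<Rightarrow> real)) list \<Rightarrow> (real \<times> real \<times> ('a \<Rightarrow> real)) list" where
  "el_scale c L = map (\<lambda>(a, b, \<xi>). (a, b, \<lambda>w. c * \<xi> w)) L"

text \<open>The integrand multiplied by the indicator of \<open>{s<..}\<close>, again as a list; a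
  step that ends before \<open>s\<close> becomes empty. Statements about the increment from
  \<open>s\<close> to \<open>T\<close> thus reduce to statements about the whole interval.\<close>

definition el_cut :: "real \<Rightarrow> (real \<times> real \<times> ('a \<Rightarrow> real)) list \<Rightarrow> (real \<times> real \<times> ('a \<Rightarrow> real)) list" where
  "el_cut s L = map (\<lambda>(a, b, \<xi>). (max a s, max b s, \<xi>)) L"

lemma el_val_simps [simp]:
  "el_val [] t w = 0"
  "el_val ((a, b, \<xi>) # L) t w = \<xi> w * indicator {a<..b} t + el_val L t w"
  "el_val (L @ L') t w = el_val L t w + el_val L' t w"
  by (simp_all add: el_val_def)

lemma el_val_scale [simp]: "el_val (el_scale c L) t w = c * el_val L t w"
  by (induction L) (auto simp: el_scale_def el_val_def algebra_simps)

lemma el_val_cut: "el_val (el_cut s L) t w = indicator {s<..} t * el_val L t w"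
proof (induction L)
  case (Cons x L)
  obtain a b \<xi> where x: "x = (a, b, \<xi>)" by (cases x) auto
  have "indicator {max a s<..max b s} t = indicator {s<..} t * (indicator {a<..b} t :: real)"
    by (auto simp: indicator_def)
  then show ?case using Cons by (simp add: x el_cut_def el_val_def algebra_simps)
qed (simp add: el_cut_def)

context wiener
begin

definition el_int :: "(real \<times> real \<times> ('a \<Rightarrow> real)) list \<Rightarrow> real \<Rightarrow> 'a \<Rightarrow> real" where
  "el_int L t w = (\<Sum>(a, b, \<xi>)\<leftarrow>L. \<xi> w * (W (min b t) w - W (min a t) w))"

lemma el_int_simps [simp]:
  "el_int [] t w = 0"
  "el_int ((a, b, \<xi>) # L) t w = \<xi> w * (W (min b t) w - W (min a t) w) + el_int L t w"
  "el_int (L @ L') t w = el_int L t w + el_int L' t w"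
  by (simp_all add: el_int_def)

lemma el_int_scale [simp]: "el_int (el_scale c L) t w = c * el_int L t w"
  by (induction L) (auto simp: el_scale_def el_int_def algebra_simps)

definition elementary_step :: "real \<Rightarrow> real \<Rightarrow> ('a \<Rightarrow> real) \<Rightarrow> bool" where
  "elementary_step a b \<xi> \<longleftrightarrow> 0 \<le> a \<and> a \<le> b \<and> b \<le> T \<and> \<xi> \<in> L0 (F a) \<and>
     (\<exists>K. \<forall>w\<in>space M. \<bar>\<xi> w\<bar> \<le> K)"

definition elementary :: "(real \<times> real \<times> ('a \<Rightarrow> real)) list \<Rightarrow> bool" where
  "elementary L \<longleftrightarrow> (\<forall>(a, b, \<xi>)\<in>set L. elementary_step a b \<xi>)"

lemma elementary_simps [simp]:
  "elementary []"
  "elementary ((a, b, \<xi>) # L) \<longleftrightarrow> elementary_step a b \<xi> \<and> elementary L"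
  "elementary (L @ L') \<longleftrightarrow> elementary L \<and> elementary L'"
  unfolding elementary_def by (simp_all add: ball_Un)

lemma elementary_scale: "elementary L \<Longrightarrow> elementary (el_scale c L)"
proof (induction L)
  case (Cons x L)
  obtain a b \<xi> where x: "x = (a, b, \<xi>)" by (cases x) auto
  from Cons x obtain K where K: "\<forall>w\<in>space M. \<bar>\<xi> w\<bar> \<le> K" by (auto simp: elementary_step_def)
  then have "\<forall>w\<in>space M. \<bar>c * \<xi> w\<bar> \<le> \<bar>c\<bar> * K" by (simp add: abs_mult mult_left_mono)
  then show ?case using Cons by (auto simp: x el_scale_def elementary_step_def)
qed (simp add: el_scale_def)

lemma elementary_cut: 
  assumes "0 \<le> s" "s \<le> T"
  shows "elementary L \<Longrightarrow> elementary (el_cut s L)"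
proof (induction L)
  case (Cons x L)
  obtain a b \<xi> where x: "x = (a, b, \<xi>)" by (cases x) auto
  with Cons assms have "\<xi> \<in> L0 (F (max a s))"
    by (auto simp: elementary_step_def intro!: measurable_F_mono[of \<xi> a])
  then show ?case using Cons assms by (auto simp: x el_cut_def elementary_step_def)
qed (simp add: el_cut_def)

lemma el_int_cut:
  assumes "0 \<le> s" "s \<le> T"
  shows "elementary L \<Longrightarrow> el_int (el_cut s L) T w = el_int L T w - el_int L s w"
proof (induction L)
  case (Cons x L)
  obtain a b \<xi> where x: "x = (a, b, \<xi>)" by (cases x) auto
  then have ab: "0 \<le> a" "a \<le> b" "b \<le> T" using Cons by (auto simp: elementary_step_def)
  have "W (min (max b s) T) w - W (min (max a s) T) w
      = (W (min b T) w - W (min a T) w) - (W (min b s) w - W (min a s) w)"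
    using ab assms by (auto simp: min_def max_def)
  then have "\<xi> w * (W (min (max b s) T) w - W (min (max a s) T) w)
      = \<xi> w * (W (min b T) w - W (min a T) w) - \<xi> w * (W (min b s) w - W (min a s) w)"
    by (simp only: right_diff_distrib)
  then show ?case using Cons by (simp add: x el_cut_def)
qed (simp add: el_cut_def)

lemma el_int_measurable_F:
  assumes t: "0 \<le> t" "t \<le> T"
  shows "elementary L \<Longrightarrow> el_int L t \<in> L0 (F t)"
proof (induction L)
  case Nil
  have "el_int [] t = (\<lambda>_. 0)" by (auto simp: fun_eq_iff)
  then show ?case by simp
next
  case (Cons x L)
  obtain a b \<xi> where x: "x = (a, b, \<xi>)" by (cases x) auto
  then have ab: "0 \<le> a" "a \<le> b" "b \<le> T" "\<xi> \<in> L0 (F a)" using Cons by (auto simp: elementary_step_def)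
  have L[measurable]: "el_int L t \<in> L0 (F t)" using Cons x by simp
  show ?case
  proof (cases "a \<le> t")
    case True
    then have [measurable]: "\<xi> \<in> L0 (F t)" "W (min b t) \<in> L0 (F t)" "W (min a t) \<in> L0 (F t)"
      using ab t by (auto intro!: measurable_F_mono[of \<xi> a] W_measurable_F)
    have "el_int (x # L) t = (\<lambda>w. \<xi> w * (W (min b t) w - W (min a t) w) + el_int L t w)" by (simp add: x fun_eq_iff)
    then show ?thesis by simp
  next
    case False
    then have "el_int (x # L) t = el_int L t" using ab by (simp add: x fun_eq_iff min_def)
    then show ?thesis using L by simp
  qed
qed

lemma el_val_measurable_F:
  assumes t: "0 \<le> t" "t \<le> T"
  shows "elementary L \<Longrightarrow> el_val L t \<in> L0 (F t)"
proof (induction L)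
  case Nil
  have "el_val [] t = (\<lambda>_. 0)" by (auto simp: fun_eq_iff)
  then show ?case by simp
next
  case (Cons x L)
  obtain a b \<xi> where x: "x = (a, b, \<xi>)" by (cases x) auto
  then have ab: "0 \<le> a" "a \<le> b" "b \<le> T" "\<xi> \<in> L0 (F a)" using Cons by (auto simp: elementary_step_def)
  have L[measurable]: "el_val L t \<in> L0 (F t)" using Cons x by simp
  show ?case
  proof (cases "a \<le> t")
    case True
    then have [measurable]: "\<xi> \<in> L0 (F t)"
      using ab t by (auto intro!: measurable_F_mono[of \<xi> a])
    have "el_val (x # L) t = (\<lambda>w. \<xi> w * indicator {a<..b} t + el_val L t w)" by (simp add: x fun_eq_iff)
    then show ?thesis by simp
  next
    case False
    then have "el_val (x # L) t = el_val L t" using ab by (simp add: x fun_eq_iff)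
    then show ?thesis using L by simp
  qed
qed

lemma sq_integrable_el_int:
  assumes t: "0 \<le> t" "t \<le> T"
  shows "elementary L \<Longrightarrow> sq_integrable M (el_int L t)"
proof (induction L)
  case Nil
  have "el_int [] t = (\<lambda>_. 0)" by (auto simp: fun_eq_iff)
  then show ?case by (simp add: sq_integrable_def)
next
  case (Cons x L)
  obtain a b \<xi> where x: "x = (a, b, \<xi>)" by (cases x) auto
  from Cons x obtain K where ab: "0 \<le> a" "a \<le> b" "b \<le> T" "\<xi> \<in> L0 (F a)" and K: "\<And>w. w \<in> space M \<Longrightarrow> \<bar>\<xi> w\<bar> \<le> K"
    by (auto simp: elementary_step_def)
  have "sq_integrable M (\<lambda>w. \<xi> w * (W (min b t) w - W (min a t) w))"
    using ab t by (intro sq_integrable_bounded_mult[OF sq_integrable_increment _ K] measurable_F_M[OF ab(4)]) auto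
  from sq_integrable_add[OF this Cons.IH] Cons.prems show ?case
    by (simp add: x fun_eq_iff[symmetric])
qed

lemma el_int_measurable: "elementary L \<Longrightarrow> 0 \<le> t \<Longrightarrow> t \<le> T \<Longrightarrow> el_int L t \<in> L0 M"
  using sq_integrable_el_int by (auto simp: sq_integrable_def)

lemma integrable_bounded_F:
  fixes X :: "'a \<Rightarrow> real"
  assumes "X \<in> L0 M" "\<And>w. w \<in> space M \<Longrightarrow> \<bar>X w\<bar> \<le> K"
  shows "integrable M X"
  using assms by (intro integrable_const_bound[where B=K]) auto

text \<open>Split \<open>W q - W c\<close> at \<open>p\<close>: the later increment has mean zero
  against the past, and the remaining square of \<open>W p - W c\<close> is independent of
  \<open>\<zeta>\<close>.\<close>

lemma expectation_mult_increments_common_start: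
  assumes c: "0 \<le> c" "c \<le> p" "p \<le> q" "q \<le> T"
    and \<zeta>: "\<zeta> \<in> L0 (F c)" "\<And>w. w \<in> space M \<Longrightarrow> \<bar>\<zeta> w\<bar> \<le> K"
  shows "(\<integral>w. \<zeta> w * ((W p w - W c w) * (W q w - W c w)) \<partial>M) = (\<integral>w. \<zeta> w \<partial>M) * (p - c)"
proof -
  have \<zeta>M[measurable]: "\<zeta> \<in> L0 M" using c by (intro measurable_F_M[OF \<zeta>(1)]) auto
  have \<zeta>i: "integrable M \<zeta>" by (rule integrable_bounded_F[OF \<zeta>M \<zeta>(2)])
  have p: "p \<le> T" "0 \<le> p" using c by auto
  note 1 = expectation_mult_increment_sq[OF c(1,2) p(1) \<zeta>(1) \<zeta>i]
  have "sq_integrable M (\<lambda>w. \<zeta> w * (W p w - W c w))"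
    using c p by (intro sq_integrable_bounded_mult[OF sq_integrable_increment \<zeta>M \<zeta>(2)]) auto
  then have X: "integrable M (\<lambda>w. \<zeta> w * (W p w - W c w))"
    by (rule sq_integrable_integrable[OF finite_measure_axioms])
  have XF: "(\<lambda>w. \<zeta> w * (W p w - W c w)) \<in> L0 (F p)"
    using measurable_F_mono[OF \<zeta>(1) c(1,2) p(1)] W_measurable_F[of p p] W_measurable_F[of c p] c p by simp
  note 2 = expectation_mult_increment[OF p(2) c(3,4) XF X]
  have "(\<integral>w. \<zeta> w * ((W p w - W c w) * (W q w - W c w)) \<partial>M)
      = (\<integral>w. \<zeta> w * (W p w - W c w)\<^sup>2 + \<zeta> w * (W p w - W c w) * (W q w - W p w) \<partial>M)"
    by (intro Bochner_Integration.integral_cong refl) (simp add: power2_eq_square algebra_simps)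
  also have "\<dots> = (\<integral>w. \<zeta> w \<partial>M) * (p - c)"
    using Bochner_Integration.integral_add[OF 1(1) 2(1)] 1(2) 2(2) by simp
  finally show ?thesis .
qed

lemma elementary_step_measurable:
  assumes "elementary_step a b \<xi>"
  shows "\<xi> \<in> L0 M"
  using assms by (intro measurable_F_M[of \<xi> a]) (auto simp: elementary_step_def)

text \<open>A later increment has mean zero against the past, so only the overlap of the two
  intervals contributes. With \<open>a \<le> c\<close> both coefficients are known at
  \<open>c\<close>; if the first interval reaches beyond \<open>c\<close>, its increment is split
  there.\<close>

lemma step_inner_product_aux:
  assumes 1: "elementary_step a b \<xi>" and 2: "elementary_step c d \<eta>" and ac: "a \<le> c"
  shows "(\<integral>w. (\<xi> w * (W b w - W a w)) * (\<eta> w * (W d w - W c w)) \<partial>M)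
    = (\<integral>w. \<xi> w * \<eta> w \<partial>M) * max 0 (min b d - max a c)"
proof -
  from 1 2 obtain K K' where ab: "0 \<le> a" "a \<le> b" "b \<le> T" "\<xi> \<in> L0 (F a)" "\<And>w. w \<in> space M \<Longrightarrow> \<bar>\<xi> w\<bar> \<le> K"
    and cd: "0 \<le> c" "c \<le> d" "d \<le> T" "\<eta> \<in> L0 (F c)" "\<And>w. w \<in> space M \<Longrightarrow> \<bar>\<eta> w\<bar> \<le> K'"
    by (auto simp: elementary_step_def)
  have cT: "c \<le> T" and aT: "a \<le> T" using cd ab by auto
  have \<xi>c[measurable]: "\<xi> \<in> L0 (F c)" by (rule measurable_F_mono[OF ab(4,1) ac cT])
  note [measurable] = cd(4) elementary_step_measurable[OF 1] elementary_step_measurable[OF 2]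
  have \<zeta>: "(\<lambda>w. \<xi> w * \<eta> w) \<in> L0 (F c)" by measurable
  have \<zeta>b: "\<bar>\<xi> w * \<eta> w\<bar> \<le> K * K'" if "w \<in> space M" for w
    unfolding abs_mult using ab(5)[OF that] cd(5)[OF that] by (intro mult_mono) auto
  have \<zeta>M: "(\<lambda>w. \<xi> w * \<eta> w) \<in> L0 M" by measurable
  have X: "(\<lambda>w. \<xi> w * \<eta> w * (W q w - W a w)) \<in> L0 (F c)"
      "integrable M (\<lambda>w. \<xi> w * \<eta> w * (W q w - W a w))" if "a \<le> q" "q \<le> c" for q
  proof -
    note [measurable] = W_measurable_F[of a c] W_measurable_F[of q c]
    show "(\<lambda>w. \<xi> w * \<eta> w * (W q w - W a w)) \<in> L0 (F c)"
      using \<zeta> W_measurable_F[of a c] W_measurable_F[of q c] ab ac cT that by simp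
    have "sq_integrable M (\<lambda>w. (\<xi> w * \<eta> w) * (W q w - W a w))"
      using ab that cT by (intro sq_integrable_bounded_mult[OF sq_integrable_increment \<zeta>M \<zeta>b]) auto
    then show "integrable M (\<lambda>w. \<xi> w * \<eta> w * (W q w - W a w))"
      by (rule sq_integrable_integrable[OF finite_measure_axioms])
  qed
  show ?thesis
  proof (cases "b \<le> c")
    case True
    have "(\<integral>w. (\<xi> w * (W b w - W a w)) * (\<eta> w * (W d w - W c w)) \<partial>M)
        = (\<integral>w. (\<xi> w * \<eta> w * (W b w - W a w)) * (W d w - W c w) \<partial>M)"
      by (intro Bochner_Integration.integral_cong refl) (simp add: algebra_simps)
    also have "\<dots> = 0" by (rule expectation_mult_increment(2)[OF cd(1-3) X[OF ab(2) True]])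
    finally show ?thesis using True ac by simp
  next
    case False
    then have cb: "c \<le> b" by simp
    let ?m = "min b d"
    have m: "c \<le> ?m" using cb cd by simp
    note 3 = expectation_mult_increment[OF cd(1-3) X[OF ac order_refl]]
    have 4: "(\<integral>w. (\<xi> w * \<eta> w) * ((W b w - W c w) * (W d w - W c w)) \<partial>M) = (\<integral>w. \<xi> w * \<eta> w \<partial>M) * (?m - c)"
    proof (cases "b \<le> d")
      case True
      from expectation_mult_increments_common_start[OF cd(1) cb True cd(3) \<zeta> \<zeta>b] True show ?thesis by simp
    next
      case False
      then have db: "d \<le> b" by simp
      from expectation_mult_increments_common_start[OF cd(1,2) db ab(3) \<zeta> \<zeta>b] db show ?thesis
        by (simp add: mult.commute mult.left_commute)
    qed
    have i4: "integrable M (\<lambda>w. (\<xi> w * \<eta> w) * ((W b w - W c w) * (W d w - W c w)))"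
    proof -
      have "sq_integrable M (\<lambda>w. (\<xi> w * \<eta> w) * (W b w - W c w))"
        using ab cd cT by (intro sq_integrable_bounded_mult[OF sq_integrable_increment \<zeta>M \<zeta>b]) auto
      moreover have "sq_integrable M (\<lambda>w. W d w - W c w)" using cd cT by (intro sq_integrable_increment) auto
      ultimately have "integrable M (\<lambda>w. (\<xi> w * \<eta> w) * (W b w - W c w) * (W d w - W c w))"
        by (rule sq_integrable_mult)
      then show ?thesis by (simp only: mult.assoc)
    qed
    have "(\<integral>w. (\<xi> w * (W b w - W a w)) * (\<eta> w * (W d w - W c w)) \<partial>M)
        = (\<integral>w. (\<xi> w * \<eta> w * (W c w - W a w)) * (W d w - W c w) + (\<xi> w * \<eta> w) * ((W b w - W c w) * (W d w - W c w)) \<partial>M)"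
      by (intro Bochner_Integration.integral_cong refl) (simp add: algebra_simps)
    also have "\<dots> = (\<integral>w. \<xi> w * \<eta> w \<partial>M) * (?m - c)"
      using Bochner_Integration.integral_add[OF 3(1) i4] 3(2) 4 by simp
    finally show ?thesis using m ac by (simp add: max_def)
  qed
qed

lemma step_inner_product:
  assumes 1: "elementary_step a b \<xi>" and 2: "elementary_step c d \<eta>"
  shows "(\<integral>w. (\<xi> w * (W b w - W a w)) * (\<eta> w * (W d w - W c w)) \<partial>M)
    = (\<integral>w. \<xi> w * \<eta> w \<partial>M) * max 0 (min b d - max a c)"
proof (cases "a \<le> c")
  case True
  then show ?thesis by (rule step_inner_product_aux[OF 1 2])
next
  case False
  then have "c \<le> a" by simp
  from step_inner_product_aux[OF 2 1 this] show ?thesis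
    by (simp add: mult.commute min.commute max.commute)
qed

end

lemma finite_measure_lborel_upto: "finite_measure (lborel_upto T)"
  by (rule finite_measureI) (simp add: lborel_upto_def emeasure_restrict_space emeasure_lborel_Icc_eq)

lemma borel_measurable_lborel_upto:
  "g \<in> L0 borel \<Longrightarrow> g \<in> L0 (lborel_upto T)"
  by (simp add: lborel_upto_def measurable_restrict_space1)

lemma measurable_ident_lborel_upto: "(\<lambda>t. t) \<in> L0 (lborel_upto T)"
  by (rule borel_measurable_lborel_upto) simp

section \<open>Ito isometry and orthogonality for elementary integrands\<close>

context wiener
begin

abbreviation lu :: "real measure" where
  "lu \<equiv> lborel_upto T"

abbreviation TM :: "(real \<times> 'a) measure" where
  "TM \<equiv> lu \<Otimes>\<^sub>M M"

lemma finite_measure_TM: "finite_measure TM"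
  by (intro finite_measure_pair_measure finite_measure_lborel_upto finite_measure_axioms)

lemma pair_sigma_finite_TM: "pair_sigma_finite lu M"
  using finite_measure_lborel_upto[of T]
  by (auto simp: pair_sigma_finite_def finite_measure_def sigma_finite_measure_axioms)

lemma fst_measurable_TM [measurable]: "fst \<in> L0 TM"
  by (rule measurable_compose[OF measurable_fst measurable_ident_lborel_upto])

lemma el_val_measurable: "elementary L \<Longrightarrow> (\<lambda>p. el_val L (fst p) (snd p)) \<in> L0 TM"
proof (induction L)
  case (Cons x L)
  obtain a b \<xi> where x: "x = (a, b, \<xi>)" by (cases x) auto
  have [measurable]: "\<xi> \<in> L0 M" using Cons x by (auto intro: elementary_step_measurable)
  have [measurable]: "(\<lambda>p. el_val L (fst p) (snd p)) \<in> L0 TM" using Cons x by simp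
  have "(\<lambda>p. \<xi> (snd p) * indicator {a<..b} (fst p) + el_val L (fst p) (snd p)) \<in> L0 TM"
    by measurable
  then show ?case by (simp add: x)
qed simp

lemma el_val_bounded: "elementary L \<Longrightarrow> \<exists>K. \<forall>t. \<forall>w\<in>space M. \<bar>el_val L t w\<bar> \<le> K"
proof (induction L)
  case (Cons x L)
  obtain a b \<xi> where x: "x = (a, b, \<xi>)" by (cases x) auto
  from Cons x obtain K where K: "\<forall>t. \<forall>w\<in>space M. \<bar>el_val L t w\<bar> \<le> K" by auto
  from Cons x obtain K' where K': "\<forall>w\<in>space M. \<bar>\<xi> w\<bar> \<le> K'" by (auto simp: elementary_step_def)
  have "\<bar>el_val (x # L) t w\<bar> \<le> K' + K" if "w \<in> space M" for t w
  proof -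
    have "\<bar>\<xi> w * indicator {a<..b} t\<bar> \<le> K'" using K' that by (auto simp: indicator_def)
    moreover have "\<bar>el_val L t w\<bar> \<le> K" using K that by blast
    moreover have "el_val (x # L) t w = \<xi> w * indicator {a<..b} t + el_val L t w" by (simp add: x)
    ultimately show ?thesis by linarith
  qed
  then show ?case by blast
qed (auto intro: exI[of _ 0])

lemma sq_integrable_el_val: "elementary L \<Longrightarrow> sq_integrable TM (\<lambda>p. el_val L (fst p) (snd p))"
proof -
  assume L: "elementary L"
  obtain K where K: "\<forall>t. \<forall>w\<in>space M. \<bar>el_val L t w\<bar> \<le> K" using el_val_bounded[OF L] by blast
  show ?thesis
    by (rule sq_integrable_bounded[OF finite_measure_TM el_val_measurable[OF L], where K=K])
      (use K in \<open>auto simp: space_pair_measure\<close>)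
qed

lemma integral_TM_step:
  assumes "0 \<le> a" "b \<le> T" and \<zeta>: "\<zeta> \<in> L0 M" "\<And>w. w \<in> space M \<Longrightarrow> \<bar>\<zeta> w\<bar> \<le> K"
  shows "(\<integral>p. \<zeta> (snd p) * indicator {a<..b} (fst p) \<partial>TM) = (\<integral>w. \<zeta> w \<partial>M) * max 0 (b - a)"
proof -
  interpret P: pair_sigma_finite lu M by (rule pair_sigma_finite_TM)
  interpret TM: finite_measure TM by (rule finite_measure_TM)
  note [measurable] = \<zeta>(1)
  have i: "integrable TM (\<lambda>p. \<zeta> (snd p) * indicator {a<..b} (fst p))"
  proof (rule TM.integrable_const_bound[where B="\<bar>K\<bar>"])
    have "\<bar>\<zeta> w\<bar> \<le> \<bar>K\<bar>" if "w \<in> space M" for w using \<zeta>(2)[OF that] by linarith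
    then show "AE p in TM. norm (\<zeta> (snd p) * indicator {a<..b} (fst p)) \<le> \<bar>K\<bar>"
      by (intro AE_I2) (auto simp: space_pair_measure indicator_def)
  qed measurable
  have len: "(\<integral>t. indicator {a<..b} t \<partial>lu) = max 0 (b - a)"
  proof -
    have "(\<integral>t. indicator {a<..b} t \<partial>lu) = (\<integral>t. indicator {0..T} t * (indicator {a<..b} t :: real) \<partial>lborel)"
      unfolding lborel_upto_def
      using integral_restrict_space[of "{0..T}" lborel "indicator {a<..b} :: real \<Rightarrow> real"] by simp
    also have "\<dots> = (\<integral>t. indicator {a<..b} t \<partial>lborel)"
      using assms(1,2) by (intro Bochner_Integration.integral_cong) (auto simp: indicator_def)
    also have "\<dots> = max 0 (b - a)" by (cases "a \<le> b") auto
    finally show ?thesis .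
  qed
  have "(\<integral>p. \<zeta> (snd p) * indicator {a<..b} (fst p) \<partial>TM) = (\<integral>t. (\<integral>w. \<zeta> w * indicator {a<..b} t \<partial>M) \<partial>lu)"
    using P.integral_fst'[OF i] by simp
  also have "\<dots> = (\<integral>t. (\<integral>w. \<zeta> w \<partial>M) * indicator {a<..b} t \<partial>lu)" by simp
  also have "\<dots> = (\<integral>w. \<zeta> w \<partial>M) * max 0 (b - a)" by (simp only: integral_mult_right_zero len)
  finally show ?thesis .
qed

lemma sq_integrable_step:
  assumes "elementary_step a b \<xi>"
  shows "sq_integrable M (\<lambda>w. \<xi> w * (W b w - W a w))"
    and "sq_integrable TM (\<lambda>p. \<xi> (snd p) * indicator {a<..b} (fst p))"
proof -
  have T: "a \<le> T" "b \<le> T" using assms by (auto simp: elementary_step_def)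
  have "elementary [(a, b, \<xi>)]" using assms by simp
  note 1 = sq_integrable_el_int[OF _ _ this, of T] sq_integrable_el_val[OF this]
  have "el_int [(a, b, \<xi>)] T = (\<lambda>w. \<xi> w * (W b w - W a w))" using T by (simp add: fun_eq_iff min_def)
  with 1(1) T_pos show "sq_integrable M (\<lambda>w. \<xi> w * (W b w - W a w))" by simp
  show "sq_integrable TM (\<lambda>p. \<xi> (snd p) * indicator {a<..b} (fst p))" using 1(2) by simp
qed

lemma step_isometry:
  assumes 1: "elementary_step a b \<xi>" and 2: "elementary_step c d \<eta>"
  shows "(\<integral>w. (\<xi> w * (W b w - W a w)) * (\<eta> w * (W d w - W c w)) \<partial>M)
    = (\<integral>p. (\<xi> (snd p) * indicator {a<..b} (fst p)) * (\<eta> (snd p) * indicator {c<..d} (fst p)) \<partial>TM)"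
proof -
  from 1 2 obtain K K' where ab: "0 \<le> a" "a \<le> b" "b \<le> T" "\<And>w. w \<in> space M \<Longrightarrow> \<bar>\<xi> w\<bar> \<le> K"
    and cd: "0 \<le> c" "c \<le> d" "d \<le> T" "\<And>w. w \<in> space M \<Longrightarrow> \<bar>\<eta> w\<bar> \<le> K'"
    by (auto simp: elementary_step_def)
  note [measurable] = elementary_step_measurable[OF 1] elementary_step_measurable[OF 2]
  have \<zeta>b: "\<bar>\<xi> w * \<eta> w\<bar> \<le> K * K'" if "w \<in> space M" for w
    unfolding abs_mult using ab(4)[OF that] cd(4)[OF that] by (intro mult_mono) auto
  have "(\<integral>p. (\<xi> (snd p) * indicator {a<..b} (fst p)) * (\<eta> (snd p) * indicator {c<..d} (fst p)) \<partial>TM)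
      = (\<integral>p. (\<xi> (snd p) * \<eta> (snd p)) * indicator {max a c<..min b d} (fst p) \<partial>TM)"
    by (intro Bochner_Integration.integral_cong refl) (auto simp: indicator_def)
  also have "\<dots> = (\<integral>w. \<xi> w * \<eta> w \<partial>M) * max 0 (min b d - max a c)"
    by (rule integral_TM_step[where \<zeta>="\<lambda>w. \<xi> w * \<eta> w" and K="K * K'"]) (use ab cd \<zeta>b in auto)
  finally show ?thesis using step_inner_product[OF 1 2] by simp
qed

text \<open>Because the steps of a list may overlap, the isometry is proved as a bilinear identity:
  step against step, step against list, list against list.\<close>

lemma el_isometry_step:
  assumes 1: "elementary_step a b \<xi>"
  shows "elementary L \<Longrightarrow> (\<integral>w. (\<xi> w * (W b w - W a w)) * el_int L T w \<partial>M)
    = (\<integral>p. (\<xi> (snd p) * indicator {a<..b} (fst p)) * el_val L (fst p) (snd p) \<partial>TM)"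
proof (induction L)
  case (Cons x L)
  obtain c d \<eta> where x: "x = (c, d, \<eta>)" by (cases x) auto
  then have 2: "elementary_step c d \<eta>" and L: "elementary L" using Cons by auto
  have T: "min c T = c" "min d T = d" using 2 by (auto simp: elementary_step_def)
  have sL: "sq_integrable TM (\<lambda>p. el_val L (fst p) (snd p))" by (rule sq_integrable_el_val[OF L])
  have sI: "sq_integrable M (el_int L T)" using L T_pos by (intro sq_integrable_el_int) auto
  note s1 = sq_integrable_step[OF 1] and s2 = sq_integrable_step[OF 2]
  have "(\<integral>w. (\<xi> w * (W b w - W a w)) * el_int (x # L) T w \<partial>M)
     = (\<integral>w. (\<xi> w * (W b w - W a w)) * (\<eta> w * (W d w - W c w)) + (\<xi> w * (W b w - W a w)) * el_int L T w \<partial>M)"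
    by (simp add: x T distrib_left)
  also have "\<dots> = (\<integral>w. (\<xi> w * (W b w - W a w)) * (\<eta> w * (W d w - W c w)) \<partial>M) + (\<integral>w. (\<xi> w * (W b w - W a w)) * el_int L T w \<partial>M)"
    by (rule Bochner_Integration.integral_add[OF sq_integrable_mult[OF s1(1) s2(1)] sq_integrable_mult[OF s1(1) sI]])
  also have "\<dots> = (\<integral>p. (\<xi> (snd p) * indicator {a<..b} (fst p)) * (\<eta> (snd p) * indicator {c<..d} (fst p)) \<partial>TM)
      + (\<integral>p. (\<xi> (snd p) * indicator {a<..b} (fst p)) * el_val L (fst p) (snd p) \<partial>TM)"
    unfolding step_isometry[OF 1 2] Cons.IH[OF L] ..
  also have "\<dots> = (\<integral>p. (\<xi> (snd p) * indicator {a<..b} (fst p)) * (\<eta> (snd p) * indicator {c<..d} (fst p))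
      + (\<xi> (snd p) * indicator {a<..b} (fst p)) * el_val L (fst p) (snd p) \<partial>TM)"
    by (rule Bochner_Integration.integral_add[symmetric, OF sq_integrable_mult[OF s1(2) s2(2)] sq_integrable_mult[OF s1(2) sL]])
  also have "\<dots> = (\<integral>p. (\<xi> (snd p) * indicator {a<..b} (fst p)) * el_val (x # L) (fst p) (snd p) \<partial>TM)"
    by (simp add: x distrib_left)
  finally show ?case .
qed simp

lemma el_isometry:
  assumes L': "elementary L'"
  shows "elementary L \<Longrightarrow> (\<integral>w. el_int L T w * el_int L' T w \<partial>M)
    = (\<integral>p. el_val L (fst p) (snd p) * el_val L' (fst p) (snd p) \<partial>TM)"
proof (induction L)
  case (Cons x L)
  obtain c d \<eta> where x: "x = (c, d, \<eta>)" by (cases x) auto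
  then have 2: "elementary_step c d \<eta>" and L: "elementary L" using Cons by auto
  have T: "min c T = c" "min d T = d" using 2 by (auto simp: elementary_step_def)
  have sL: "sq_integrable TM (\<lambda>p. el_val K (fst p) (snd p))" if "elementary K" for K
    by (rule sq_integrable_el_val[OF that])
  have sI: "sq_integrable M (el_int K T)" if "elementary K" for K using that T_pos by (intro sq_integrable_el_int) auto
  note s2 = sq_integrable_step[OF 2]
  have "(\<integral>w. el_int (x # L) T w * el_int L' T w \<partial>M)
     = (\<integral>w. (\<eta> w * (W d w - W c w)) * el_int L' T w + el_int L T w * el_int L' T w \<partial>M)"
    by (simp add: x T distrib_right)
  also have "\<dots> = (\<integral>w. (\<eta> w * (W d w - W c w)) * el_int L' T w \<partial>M) + (\<integral>w. el_int L T w * el_int L' T w \<partial>M)"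
    by (rule Bochner_Integration.integral_add[OF sq_integrable_mult[OF s2(1) sI[OF L']] sq_integrable_mult[OF sI[OF L] sI[OF L']]])
  also have "\<dots> = (\<integral>p. (\<eta> (snd p) * indicator {c<..d} (fst p)) * el_val L' (fst p) (snd p) \<partial>TM)
      + (\<integral>p. el_val L (fst p) (snd p) * el_val L' (fst p) (snd p) \<partial>TM)"
    unfolding el_isometry_step[OF 2 L'] Cons.IH[OF L] ..
  also have "\<dots> = (\<integral>p. (\<eta> (snd p) * indicator {c<..d} (fst p)) * el_val L' (fst p) (snd p)
      + el_val L (fst p) (snd p) * el_val L' (fst p) (snd p) \<partial>TM)"
    by (rule Bochner_Integration.integral_add[symmetric, OF sq_integrable_mult[OF s2(2) sL[OF L']] sq_integrable_mult[OF sL[OF L] sL[OF L']]])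
  also have "\<dots> = (\<integral>p. el_val (x # L) (fst p) (snd p) * el_val L' (fst p) (snd p) \<partial>TM)"
    by (simp add: x distrib_right)
  finally show ?case .
qed simp

lemma el_isometry_from:
  assumes "elementary L" and s: "0 \<le> s" "s \<le> T"
  shows "(\<integral>w. (el_int L T w - el_int L s w)\<^sup>2 \<partial>M) = (\<integral>p. indicator {s<..} (fst p) * (el_val L (fst p) (snd p))\<^sup>2 \<partial>TM)"
proof -
  note c = elementary_cut[OF s assms(1)]
  have "(\<integral>w. (el_int L T w - el_int L s w)\<^sup>2 \<partial>M) = (\<integral>w. el_int (el_cut s L) T w * el_int (el_cut s L) T w \<partial>M)"
    by (simp add: el_int_cut[OF s assms(1)] power2_eq_square)
  also have "\<dots> = (\<integral>p. el_val (el_cut s L) (fst p) (snd p) * el_val (el_cut s L) (fst p) (snd p) \<partial>TM)"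
    by (rule el_isometry[OF c c])
  also have "\<dots> = (\<integral>p. indicator {s<..} (fst p) * (el_val L (fst p) (snd p))\<^sup>2 \<partial>TM)"
    by (intro Bochner_Integration.integral_cong) (auto simp: el_val_cut power2_eq_square indicator_def)
  finally show ?thesis .
qed

text \<open>The martingale property, tested against square integrable \<open>X\<close> known at
  \<open>s\<close> instead of phrased by conditional expectation. After the cut every step starts at
  some \<open>a' \<ge> s\<close>, so that the product of its coefficient with \<open>X\<close> is
  known at its start.\<close>

lemma expectation_mult_el_int:
  assumes s: "0 \<le> s" "s \<le> T" and X: "X \<in> L0 (F s)" "sq_integrable M X"
  shows "elementary L \<Longrightarrow> (\<integral>w. X w * (el_int L T w - el_int L s w) \<partial>M) = 0"
proof -
  have "elementary L \<Longrightarrow> (\<integral>w. X w * el_int (el_cut s L) T w \<partial>M) = 0"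
  proof (induction L)
    case (Cons x L)
    obtain a b \<xi> where x: "x = (a, b, \<xi>)" by (cases x) auto
    define a' b' where "a' = max a s" and "b' = max b s"
    have cut: "el_cut s (x # L) = (a', b', \<xi>) # el_cut s L" by (simp add: el_cut_def x a'_def b'_def)
    from elementary_cut[OF s Cons.prems] have 1: "elementary_step a' b' \<xi>" and cL: "elementary (el_cut s L)"
      by (auto simp: cut)
    then obtain K where ab: "0 \<le> a'" "a' \<le> b'" "b' \<le> T" "\<xi> \<in> L0 (F a')" and K: "\<And>w. w \<in> space M \<Longrightarrow> \<bar>\<xi> w\<bar> \<le> K"
      by (auto simp: elementary_step_def)
    have sa: "s \<le> a'" "a' \<le> T" using ab by (auto simp: a'_def)
    have T: "min a' T = a'" "min b' T = b'" using ab by auto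
    have Xm: "(\<lambda>w. \<xi> w * X w) \<in> L0 (F a')"
      using ab(4) measurable_F_mono[OF X(1) s(1) sa] by simp
    have Xi: "integrable M (\<lambda>w. \<xi> w * X w)"
      by (rule sq_integrable_integrable[OF finite_measure_axioms sq_integrable_bounded_mult[OF X(2) elementary_step_measurable[OF 1] K]])
    note 2 = expectation_mult_increment[OF ab(1-3) Xm Xi]
    have "(\<integral>w. X w * el_int (el_cut s (x # L)) T w \<partial>M) = (\<integral>w. (\<xi> w * X w) * (W b' w - W a' w) + X w * el_int (el_cut s L) T w \<partial>M)"
      by (simp add: cut T algebra_simps)
    also have "\<dots> = 0"
      using Bochner_Integration.integral_add[OF 2(1) sq_integrable_mult[OF X(2) sq_integrable_el_int[OF _ _ cL, of T]]]
        2(2) Cons T_pos by (simp add: x)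
    finally show ?case .
  qed (simp add: el_cut_def)
  then show "elementary L \<Longrightarrow> ?thesis" by (simp add: el_int_cut[OF s])
qed

end

section \<open>The Ito integral\<close>

context wiener
begin

lemma el_int_continuous:
  assumes w: "w \<in> space M"
  shows "elementary L \<Longrightarrow> continuous_on {0..T} (\<lambda>t. el_int L t w)"
proof (induction L)
  case (Cons x L)
  obtain a b \<xi> where x: "x = (a, b, \<xi>)" by (cases x) auto
  then have ab: "0 \<le> a" "a \<le> b" "b \<le> T" using Cons by (auto simp: elementary_step_def)
  have "continuous_on {0..T} (\<lambda>t. W (min c t) w)" if "0 \<le> c" "c \<le> T" for c
    by (rule continuous_on_compose2[OF W_continuous[OF w]]) (use that in \<open>auto intro!: continuous_intros\<close>)
  from this[of a] this[of b] ab Cons show ?case by (auto simp: x intro!: continuous_intros)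
qed simp

text \<open>Kolmogorov's argument: decompose by the first time in \<open>S\<close> at which the
  level is reached. This event is known at that time, so the later increment has mean zero against
  the process on it, and the second moment at \<open>T\<close> over the event is at least
  \<open>c^2\<close> times its probability.\<close>

lemma maximal_inequality_finite:
  assumes L: "elementary L" and S: "finite S" "S \<subseteq> {0..T}" and c: "0 < c"
  shows "c\<^sup>2 * prob {w\<in>space M. \<exists>s\<in>S. c \<le> \<bar>el_int L s w\<bar>} \<le> (\<integral>w. (el_int L T w)\<^sup>2 \<partial>M)"
proof -
  define A where "A s = {w\<in>space M. c \<le> \<bar>el_int L s w\<bar> \<and> (\<forall>r\<in>{r\<in>S. r < s}. \<bar>el_int L r w\<bar> < c)}" for s
  have sT: "sq_integrable M (el_int L T)" using L T_pos by (intro sq_integrable_el_int) auto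
  have AF: "A s \<in> sets (F s)" if s: "s \<in> S" for s
  proof -
    have s': "0 \<le> s" "s \<le> T" using s S by auto
    have m: "el_int L r \<in> L0 (F s)" if "r \<in> S" "r \<le> s" for r
      using that S s' L by (intro measurable_F_mono[OF el_int_measurable_F]) auto
    have "{w\<in>space (F s). c \<le> \<bar>el_int L s w\<bar> \<and> (\<forall>r\<in>{r\<in>S. r < s}. \<bar>el_int L r w\<bar> < c)} \<in> sets (F s)"
    proof (intro sets.sets_Collect_conj sets.sets_Collect_finite_All)
      note [measurable] = m[OF s order_refl]
      show "{w\<in>space (F s). c \<le> \<bar>el_int L s w\<bar>} \<in> sets (F s)" by measurable
    next
      fix r assume "r \<in> {r\<in>S. r < s}"
      then have [measurable]: "el_int L r \<in> L0 (F s)" using m by auto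
      show "{w\<in>space (F s). \<bar>el_int L r w\<bar> < c} \<in> sets (F s)" by measurable
    qed (use S in auto)
    then show ?thesis by (simp add: A_def space_F s')
  qed
  have AM: "A s \<in> sets M" if s: "s \<in> S" for s
  proof -
    have "0 \<le> s" "s \<le> T" using s S by auto
    then show ?thesis using AF[OF s] F_sub[of s] by (auto simp: subalgebra_def)
  qed
  have le: "c\<^sup>2 * prob (A s) \<le> (\<integral>w. indicator (A s) w * (el_int L T w)\<^sup>2 \<partial>M)" if s: "s \<in> S" for s
  proof -
    have s': "0 \<le> s" "s \<le> T" using s S by auto
    have ss: "sq_integrable M (el_int L s)" using L s' by (intro sq_integrable_el_int) auto
    let ?X = "\<lambda>w. indicator (A s) w * el_int L s w"
    have X: "?X \<in> L0 (F s)" using AF[OF s] el_int_measurable_F[OF s' L] by measurable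
    have iAM: "(indicator (A s) :: 'a \<Rightarrow> real) \<in> L0 M" using AM[OF s] by simp
    have sX: "sq_integrable M ?X"
      by (rule sq_integrable_bounded_mult[OF ss iAM, where K=1]) (auto simp: indicator_def)
    have sXT: "sq_integrable M (\<lambda>w. indicator (A s) w * el_int L T w)"
      by (rule sq_integrable_bounded_mult[OF sT iAM, where K=1]) (auto simp: indicator_def)
    have o: "(\<integral>w. ?X w * (el_int L T w - el_int L s w) \<partial>M) = 0"
      by (rule expectation_mult_el_int[OF s' X sX L])
    have i1: "integrable M (\<lambda>w. ?X w * (el_int L T w - el_int L s w))"
      by (rule sq_integrable_mult[OF sX sq_integrable_diff[OF sT ss]])
    have i2: "integrable M (\<lambda>w. c\<^sup>2 * indicator (A s) w)" using AM[OF s] by (simp add: emeasure_eq_measure)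
    have "(\<lambda>w. (indicator (A s) w * el_int L T w)\<^sup>2) = (\<lambda>w. indicator (A s) w * (el_int L T w)\<^sup>2)"
      by (auto simp: fun_eq_iff indicator_def)
    then have i3: "integrable M (\<lambda>w. indicator (A s) w * (el_int L T w)\<^sup>2)"
      using sXT by (simp add: sq_integrable_def)
    have "c\<^sup>2 * prob (A s) = (\<integral>w. c\<^sup>2 * indicator (A s) w + 2 * (?X w * (el_int L T w - el_int L s w)) \<partial>M)"
      using o i1 i2 AM[OF s] by simp
    also have "\<dots> \<le> (\<integral>w. indicator (A s) w * (el_int L T w)\<^sup>2 \<partial>M)"
    proof (rule integral_mono)
      show "integrable M (\<lambda>w. c\<^sup>2 * indicator (A s) w + 2 * (?X w * (el_int L T w - el_int L s w)))"
        using i1 i2 by simp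
      fix w
      show "c\<^sup>2 * indicator (A s) w + 2 * (?X w * (el_int L T w - el_int L s w)) \<le> indicator (A s) w * (el_int L T w)\<^sup>2"
      proof (cases "w \<in> A s")
        case True
        \<comment> \<open>The added cross term has zero integral; with it the inequality holds
          pointwise, because \<open>?y^2 - ?x^2 - 2 * ?x * (?y - ?x)\<close> is a square.\<close>
        let ?x = "el_int L s w" and ?y = "el_int L T w"
        have "c \<le> \<bar>?x\<bar>" using True by (simp add: A_def)
        then have "c\<^sup>2 \<le> ?x\<^sup>2" using c by (simp add: abs_le_square_iff[symmetric])
        moreover have "0 \<le> (?y - ?x)\<^sup>2" by simp
        moreover have "?y\<^sup>2 = ?x\<^sup>2 + 2 * (?x * (?y - ?x)) + (?y - ?x)\<^sup>2" by (simp add: power2_eq_square algebra_simps)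
        ultimately have "c\<^sup>2 + 2 * (?x * (?y - ?x)) \<le> ?y\<^sup>2" by linarith
        then show ?thesis using True by simp
      qed simp
    qed (rule i3)
    finally show ?thesis .
  qed
  have disj: "disjoint_family_on A S"
    unfolding disjoint_family_on_def
  proof (intro ballI impI)
    fix r s assume "r \<in> S" "s \<in> S" "r \<noteq> s"
    then show "A r \<inter> A s = {}" unfolding A_def by (cases "r < s") force+
  qed
  have sub: "{w\<in>space M. \<exists>s\<in>S. c \<le> \<bar>el_int L s w\<bar>} \<subseteq> (\<Union>s\<in>S. A s)"
  proof
    fix w assume w: "w \<in> {w\<in>space M. \<exists>s\<in>S. c \<le> \<bar>el_int L s w\<bar>}"
    let ?R = "{s\<in>S. c \<le> \<bar>el_int L s w\<bar>}"
    have R: "finite ?R" "?R \<noteq> {}" using w S by auto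
    have "Min ?R \<in> ?R" by (rule Min_in[OF R])
    moreover have "\<bar>el_int L r w\<bar> < c" if "r \<in> S" "r < Min ?R" for r
    proof (rule ccontr)
      assume "\<not> \<bar>el_int L r w\<bar> < c"
      then have "Min ?R \<le> r" using that R by (intro Min_le) auto
      with that show False by simp
    qed
    ultimately show "w \<in> (\<Union>s\<in>S. A s)" using w unfolding A_def by blast
  qed
  have UM: "(\<Union>s\<in>S. A s) \<in> sets M" using AM S by auto
  have "c\<^sup>2 * prob {w\<in>space M. \<exists>s\<in>S. c \<le> \<bar>el_int L s w\<bar>} \<le> c\<^sup>2 * prob (\<Union>s\<in>S. A s)"
    by (intro mult_left_mono finite_measure_mono sub UM) simp
  also have "prob (\<Union>s\<in>S. A s) = (\<Sum>s\<in>S. prob (A s))"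
    using disj AM S by (intro finite_measure_finite_Union) auto
  also have "c\<^sup>2 * (\<Sum>s\<in>S. prob (A s)) \<le> (\<Sum>s\<in>S. \<integral>w. indicator (A s) w * (el_int L T w)\<^sup>2 \<partial>M)"
    unfolding sum_distrib_left by (intro sum_mono le)
  also have "\<dots> = (\<integral>w. (\<Sum>s\<in>S. indicator (A s) w * (el_int L T w)\<^sup>2) \<partial>M)"
  proof (rule Bochner_Integration.integral_sum[symmetric])
    fix s assume "s \<in> S"
    from integrable_mult_indicator[OF AM[OF this], of "\<lambda>w. (el_int L T w)\<^sup>2"] sT
    show "integrable M (\<lambda>w. indicator (A s) w * (el_int L T w)\<^sup>2)" by (simp add: sq_integrable_def)
  qed
  also have "\<dots> \<le> (\<integral>w. (el_int L T w)\<^sup>2 \<partial>M)"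
  proof (rule integral_mono)
    show "integrable M (\<lambda>w. \<Sum>s\<in>S. indicator (A s) w * (el_int L T w)\<^sup>2)"
    proof (rule Bochner_Integration.integrable_sum)
      fix s assume "s \<in> S"
      from integrable_mult_indicator[OF AM[OF this], of "\<lambda>w. (el_int L T w)\<^sup>2"] sT
      show "integrable M (\<lambda>w. indicator (A s) w * (el_int L T w)\<^sup>2)" by (simp add: sq_integrable_def)
    qed
    show "integrable M (\<lambda>w. (el_int L T w)\<^sup>2)" using sT by (simp add: sq_integrable_def)
    fix w
    have "(\<Sum>s\<in>S. indicator (A s) w :: real) = indicator (\<Union>s\<in>S. A s) w"
      by (rule indicator_UN_disjoint[OF S(1) disj, symmetric])
    then have "(\<Sum>s\<in>S. indicator (A s) w :: real) \<le> 1" by (simp add: indicator_def)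
    then have "(\<Sum>s\<in>S. indicator (A s) w) * (el_int L T w)\<^sup>2 \<le> 1 * (el_int L T w)\<^sup>2"
      by (intro mult_right_mono) auto
    then show "(\<Sum>s\<in>S. indicator (A s) w * (el_int L T w)\<^sup>2) \<le> (el_int L T w)\<^sup>2" by (simp add: sum_distrib_right)
  qed
  finally show ?thesis by simp
qed

text \<open>The rational times are an increasing union of finite sets, and continuity extends the
  bound from them to all times. An exceptional event is produced rather than a bound on a supremum,
  so that nothing need be said about measurability of the latter.\<close>

lemma maximal_inequality:
  assumes L: "elementary L" and c: "0 < c"
  shows "\<exists>E\<in>sets M. prob E \<le> (\<integral>w. (el_int L T w)\<^sup>2 \<partial>M) / c\<^sup>2 \<and>
    (\<forall>w\<in>space M - E. \<forall>t\<in>{0..T}. \<bar>el_int L t w\<bar> \<le> c)"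
proof -
  define Q where "Q = \<rat> \<inter> {0..T}"
  have Q: "countable Q" "Q \<noteq> {}" unfolding Q_def using T_pos countable_rat by auto
  define S where "S n = from_nat_into Q ` {..n}" for n
  have S: "finite (S n)" "S n \<subseteq> {0..T}" for n
    using from_nat_into[OF Q(2)] by (auto simp: S_def Q_def)
  define E where "E n = {w\<in>space M. \<exists>s\<in>S n. c \<le> \<bar>el_int L s w\<bar>}" for n
  have EM: "E n \<in> sets M" for n
    unfolding E_def
  proof (rule sets.sets_Collect_finite_Ex)
    fix s assume "s \<in> S n"
    then have [measurable]: "el_int L s \<in> L0 M" using S(2)[of n] L by (intro el_int_measurable) auto
    show "{w\<in>space M. c \<le> \<bar>el_int L s w\<bar>} \<in> sets M" by measurable
  qed (rule S)
  have inc: "incseq E"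
  proof (rule incseq_SucI)
    fix n
    have "S n \<subseteq> S (Suc n)" unfolding S_def by (intro image_mono) auto
    then show "E n \<subseteq> E (Suc n)" unfolding E_def by blast
  qed
  have le: "prob (E n) \<le> (\<integral>w. (el_int L T w)\<^sup>2 \<partial>M) / c\<^sup>2" for n
    using maximal_inequality_finite[OF L S c, of n] c by (simp add: E_def field_simps)
  have "(\<lambda>n. prob (E n)) \<longlonglongrightarrow> prob (\<Union>n. E n)"
    by (rule finite_Lim_measure_incseq) (use EM inc in auto)
  then have "prob (\<Union>n. E n) \<le> (\<integral>w. (el_int L T w)\<^sup>2 \<partial>M) / c\<^sup>2"
    by (rule LIMSEQ_le_const2) (use le in auto)
  moreover have "\<bar>el_int L t w\<bar> \<le> c" if w: "w \<in> space M - (\<Union>n. E n)" and t: "t \<in> {0..T}" for t w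
  proof (rule ccontr)
    assume "\<not> \<bar>el_int L t w\<bar> \<le> c"
    then have e: "0 < \<bar>el_int L t w\<bar> - c" by simp
    have "continuous_on {0..T} (\<lambda>t. el_int L t w)" using w by (intro el_int_continuous L) auto
    then obtain \<delta> where \<delta>: "\<delta> > 0" "\<And>s. s \<in> {0..T} \<Longrightarrow> dist s t < \<delta> \<Longrightarrow> dist (el_int L s w) (el_int L t w) < \<bar>el_int L t w\<bar> - c"
      using t e unfolding continuous_on_iff by blast
    \<comment> \<open>This leaves room for a rational time near \<open>t\<close> and inside
      \<open>[0, T]\<close>, also when \<open>t\<close> is an endpoint.\<close>
    have "max 0 (t - \<delta>) < min T (t + \<delta>)" using t \<delta>(1) T_pos by auto
    then obtain q where q: "q \<in> \<rat>" "max 0 (t - \<delta>) < q" "q < min T (t + \<delta>)" using Rats_dense_in_real by blast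
    then have qQ: "q \<in> Q" "dist q t < \<delta>" by (auto simp: Q_def dist_real_def)
    then have "dist (el_int L q w) (el_int L t w) < \<bar>el_int L t w\<bar> - c" by (intro \<delta>(2)) (auto simp: Q_def)
    then have "c \<le> \<bar>el_int L q w\<bar>" unfolding dist_real_def by linarith
    moreover obtain n where "q = from_nat_into Q n" using from_nat_into_surj[OF Q(1) qQ(1)] by metis
    then have "q \<in> S n" by (auto simp: S_def)
    ultimately have "w \<in> E n" using w by (auto simp: E_def)
    then show False using w by blast
  qed
  ultimately show ?thesis using EM by (intro bexI[of _ "\<Union>n. E n"]) auto
qed

definition el_diff :: "(real \<times> real \<times> ('a \<Rightarrow> real)) list \<Rightarrow> (real \<times> real \<times> ('a \<Rightarrow> real)) list \<Rightarrow> (real \<times> real \<times> ('a \<Rightarrow> real)) list" where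
  "el_diff L L' = L @ el_scale (- 1) L'"

lemma el_diff_simps [simp]:
  "el_val (el_diff L L') t w = el_val L t w - el_val L' t w"
  "el_int (el_diff L L') t w = el_int L t w - el_int L' t w"
  "elementary L \<Longrightarrow> elementary L' \<Longrightarrow> elementary (el_diff L L')"
  by (simp_all add: el_diff_def elementary_scale)

lemma el_int_0: "elementary L \<Longrightarrow> el_int L 0 w = 0"
proof (induction L)
  case (Cons x L)
  obtain a b \<xi> where x: "x = (a, b, \<xi>)" by (cases x) auto
  then have "min a 0 = 0" "min b 0 = 0" using Cons by (auto simp: elementary_step_def)
  then show ?case using Cons by (simp add: x)
qed simp

lemma nn_integral_el_int:
  assumes L: "elementary L"
  shows "sq_norm M (\<lambda>w. el_int L T w) = sq_norm TM (\<lambda>p. el_val L (fst p) (snd p))"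
proof -
  have "sq_integrable M (el_int L T)" using L T_pos by (intro sq_integrable_el_int) auto
  then show ?thesis
    using el_isometry[OF L L] by (simp add: sq_integrable_nn_integral sq_integrable_el_val[OF L] power2_eq_square[symmetric])
qed

text \<open>The value at \<open>t\<close> is orthogonal to the increment from \<open>t\<close> to
  \<open>T\<close>, so second moments increase with time.\<close>

lemma nn_integral_el_int_le:
  assumes L: "elementary L" and t: "0 \<le> t" "t \<le> T"
  shows "sq_norm M (\<lambda>w. el_int L t w) \<le> sq_norm TM (\<lambda>p. el_val L (fst p) (snd p))"
proof -
  have sT: "sq_integrable M (el_int L T)" using L T_pos by (intro sq_integrable_el_int) auto
  have st: "sq_integrable M (el_int L t)" by (rule sq_integrable_el_int[OF t L])
  have sd: "sq_integrable M (\<lambda>w. el_int L T w - el_int L t w)" by (rule sq_integrable_diff[OF sT st])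
  note o = expectation_mult_el_int[OF t el_int_measurable_F[OF t L] st L]
  have "(\<integral>w. (el_int L t w)\<^sup>2 \<partial>M) = (\<integral>w. (el_int L t w)\<^sup>2 + 2 * (el_int L t w * (el_int L T w - el_int L t w)) \<partial>M)"
    using o sq_integrable_mult[OF st sd] st by (simp add: sq_integrable_def)
  also have "\<dots> \<le> (\<integral>w. (el_int L T w)\<^sup>2 \<partial>M)"
  proof (rule integral_mono)
    show "integrable M (\<lambda>w. (el_int L t w)\<^sup>2 + 2 * (el_int L t w * (el_int L T w - el_int L t w)))"
      using sq_integrable_mult[OF st sd] st by (simp add: sq_integrable_def)
    fix w
    have "0 \<le> (el_int L T w - el_int L t w)\<^sup>2" by simp
    then show "(el_int L t w)\<^sup>2 + 2 * (el_int L t w * (el_int L T w - el_int L t w)) \<le> (el_int L T w)\<^sup>2"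
      by (simp add: power2_eq_square algebra_simps)
  qed (use sT in \<open>simp add: sq_integrable_def\<close>)
  finally show ?thesis
    unfolding nn_integral_el_int[OF L, symmetric] by (simp add: sq_integrable_nn_integral sT st ennreal_leI)
qed

text \<open>The list form of \<open>has_ito_integral\<close>, without continuity of paths. The
  approximating sequence is kept as an argument so that the sequences of two integrals can be
  subtracted term by term.\<close>

definition ito_approx :: "(nat \<Rightarrow> (real \<times> real \<times> ('a \<Rightarrow> real)) list) \<Rightarrow> (real \<Rightarrow> 'a \<Rightarrow> real) \<Rightarrow> (real \<Rightarrow> 'a \<Rightarrow> real) \<Rightarrow> bool" where
  "ito_approx L H I \<longleftrightarrow> (\<forall>k. elementary (L k)) \<and>
     (uncurried H) \<in> L0 TM \<and>
     (\<forall>t\<in>{0..T}. H t \<in> L0 (F t)) \<and> (\<forall>t\<in>{0..T}. I t \<in> L0 (F t)) \<and>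
     (\<lambda>k. \<integral>\<^sup>+p. ennreal ((el_val (L k) (fst p) (snd p) - H (fst p) (snd p))\<^sup>2) \<partial>TM) \<longlonglongrightarrow> 0 \<and>
     (\<forall>t\<in>{0..T}. (\<lambda>k. \<integral>\<^sup>+w. ennreal ((el_int (L k) t w - I t w)\<^sup>2) \<partial>M) \<longlonglongrightarrow> 0)"

text \<open>Borel--Cantelli turns the maximal inequality into uniform convergence of the paths.\<close>

lemma ito_integral_construction:
  assumes L: "\<And>k. elementary (L k)"
    and fast: "(\<Sum>k. 4 ^ k * sq_norm TM (\<lambda>p. el_val (L (Suc k)) (fst p) (snd p) - el_val (L k) (fst p) (snd p))) < \<infinity>"
  shows "AE w in M. continuous_on {0..T} (\<lambda>t. lim (\<lambda>k. el_int (L k) t w))"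
    and "t \<in> {0..T} \<Longrightarrow> (\<lambda>w. lim (\<lambda>k. el_int (L k) t w)) \<in> L0 (F t)"
    and "t \<in> {0..T} \<Longrightarrow> (\<lambda>k. \<integral>\<^sup>+w. ennreal ((el_int (L k) t w - lim (\<lambda>k. el_int (L k) t w))\<^sup>2) \<partial>M) \<longlonglongrightarrow> 0"
proof -
  let ?D = "\<lambda>k. el_diff (L (Suc k)) (L k)"
  have D: "elementary (?D k)" for k using L by simp
  define d where "d k = (\<integral>w. (el_int (?D k) T w)\<^sup>2 \<partial>M)" for k
  have d0: "0 \<le> d k" for k by (simp add: d_def)
  have dnn: "sq_norm TM (\<lambda>p. el_val (L (Suc k)) (fst p) (snd p) - el_val (L k) (fst p) (snd p)) = ennreal (d k)" for k
  proof -
    have "sq_integrable M (el_int (?D k) T)" using D T_pos by (intro sq_integrable_el_int) auto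
    then have "sq_norm TM (\<lambda>p. el_val (?D k) (fst p) (snd p)) = ennreal (d k)"
      unfolding nn_integral_el_int[OF D, symmetric] d_def by (rule sq_integrable_nn_integral)
    then show ?thesis by simp
  qed
  have "(\<Sum>k. ennreal (4 ^ k * d k)) \<noteq> \<infinity>"
    using fast unfolding dnn by (simp add: ennreal_mult d0 ennreal_power[symmetric])
  then have sum: "summable (\<lambda>k. 4 ^ k * d k)"
    by (intro summable_suminf_not_top) (auto simp: d0)
  \<comment> \<open>The level \<open>(1/2) ^ k\<close> costs a factor \<open>4 ^ k\<close> in the
    maximal inequality, exactly what the assumed summability affords.\<close>
  have "\<exists>E\<in>sets M. prob E \<le> d k / ((1/2) ^ k)\<^sup>2 \<and>
    (\<forall>w\<in>space M - E. \<forall>t\<in>{0..T}. \<bar>el_int (?D k) t w\<bar> \<le> (1/2) ^ k)" for k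
    unfolding d_def by (rule maximal_inequality[OF D]) simp
  then obtain E where E: "\<And>k. E k \<in> sets M" "\<And>k. prob (E k) \<le> d k / ((1/2) ^ k)\<^sup>2"
    "\<And>k w t. w \<in> space M - E k \<Longrightarrow> t \<in> {0..T} \<Longrightarrow> \<bar>el_int (?D k) t w\<bar> \<le> (1/2) ^ k" by metis
  have p4: "d k / ((1/2) ^ k)\<^sup>2 = 4 ^ k * d k" for k
    by (simp add: power2_eq_square power_one_over power_mult_distrib[symmetric] field_simps)
  have sumE: "summable (\<lambda>k. prob (E k))"
    by (rule summable_comparison_test'[OF sum, where N=0]) (use E(2) p4 in simp)
  have "AE w in M. eventually (\<lambda>k. w \<in> space M - E k) sequentially"
    by (rule borel_cantelli_AE1[OF E(1) _ sumE]) (simp add: emeasure_eq_measure)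
  then show "AE w in M. continuous_on {0..T} (\<lambda>t. lim (\<lambda>k. el_int (L k) t w))"
    using AE_space
  proof eventually_elim
    case (elim w)
    have ev: "eventually (\<lambda>k. \<forall>t\<in>{0..T}. norm (el_int (?D k) t w) \<le> (1/2) ^ k) sequentially"
      using elim(1) by eventually_elim (use E(3) in auto)
    \<comment> \<open>The bound on the differences holds from an index on that depends on
      \<open>w\<close>; an eventual bound is enough for uniform convergence of the telescoping
      series.\<close>
    have ul: "uniform_limit {0..T} (\<lambda>n t. \<Sum>k<n. el_int (?D k) t w) (\<lambda>t. suminf (\<lambda>k. el_int (?D k) t w)) sequentially"
      by (rule Weierstrass_m_test_ev[OF ev]) simp
    have tel: "(\<Sum>k<n. el_int (?D k) t w) = el_int (L n) t w - el_int (L 0) t w" for n t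
      by (induction n) simp_all
    have c: "continuous_on {0..T} (\<lambda>t. el_int (L n) t w)" for n by (rule el_int_continuous[OF elim(2) L])
    have cs: "continuous_on {0..T} (\<lambda>t. suminf (\<lambda>k. el_int (?D k) t w))"
    proof (rule uniform_limit_theorem[OF _ ul])
      show "eventually (\<lambda>n. continuous_on {0..T} (\<lambda>t. \<Sum>k<n. el_int (?D k) t w)) sequentially"
        unfolding tel by (intro always_eventually allI continuous_intros c)
    qed simp
    have "lim (\<lambda>k. el_int (L k) t w) = suminf (\<lambda>k. el_int (?D k) t w) + el_int (L 0) t w" if t: "t \<in> {0..T}" for t
    proof (rule limI)
      have "(\<lambda>n. el_int (L n) t w - el_int (L 0) t w) \<longlonglongrightarrow> suminf (\<lambda>k. el_int (?D k) t w)"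
        using tendsto_uniform_limitI[OF ul t] unfolding tel .
      from tendsto_add[OF this tendsto_const[of "el_int (L 0) t w"]]
      show "(\<lambda>n. el_int (L n) t w) \<longlonglongrightarrow> suminf (\<lambda>k. el_int (?D k) t w) + el_int (L 0) t w" by simp
    qed
    then have "continuous_on {0..T} (\<lambda>t. lim (\<lambda>k. el_int (L k) t w)) \<longleftrightarrow>
        continuous_on {0..T} (\<lambda>t. suminf (\<lambda>k. el_int (?D k) t w) + el_int (L 0) t w)"
      by (intro continuous_on_cong) auto
    then show ?case using cs c by (auto simp del: el_diff_simps intro!: continuous_intros)
  qed
  {
    assume t: "t \<in> {0..T}"
    then have t': "0 \<le> t" "t \<le> T" by auto
    show "(\<lambda>w. lim (\<lambda>k. el_int (L k) t w)) \<in> L0 (F t)"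
      by (rule borel_measurable_lim_metric) (rule el_int_measurable_F[OF t' L])
    have "(\<Sum>k. 4 ^ k * sq_norm M (\<lambda>w. el_int (L (Suc k)) t w - el_int (L k) t w)) \<le>
      (\<Sum>k. 4 ^ k * sq_norm TM (\<lambda>p. el_val (L (Suc k)) (fst p) (snd p) - el_val (L k) (fst p) (snd p)))"
    proof (intro suminf_le mult_left_mono)
      fix k
      show "sq_norm M (\<lambda>w. el_int (L (Suc k)) t w - el_int (L k) t w) \<le>
        (sq_norm TM (\<lambda>p. el_val (L (Suc k)) (fst p) (snd p) - el_val (L k) (fst p) (snd p)))"
        using nn_integral_el_int_le[OF D[of k] t'] by simp
    qed auto
    then have "(\<Sum>k. 4 ^ k * sq_norm M (\<lambda>w. el_int (L (Suc k)) t w - el_int (L k) t w)) < \<infinity>"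
      using fast by (rule le_less_trans)
    then show "(\<lambda>k. \<integral>\<^sup>+w. ennreal ((el_int (L k) t w - lim (\<lambda>k. el_int (L k) t w))\<^sup>2) \<partial>M) \<longlonglongrightarrow> 0"
      by (intro fast_cauchy_L2(3)) (use t' L in \<open>auto intro: el_int_measurable\<close>)
  }
qed

lemma ito_approx_construction:
  assumes L: "\<And>k. elementary (L k)"
    and fast: "(\<Sum>k. 4 ^ k * sq_norm TM (\<lambda>p. el_val (L (Suc k)) (fst p) (snd p) - el_val (L k) (fst p) (snd p))) < \<infinity>"
  shows "ito_approx L (\<lambda>t w. lim (\<lambda>k. el_val (L k) t w)) (\<lambda>t w. lim (\<lambda>k. el_int (L k) t w))"
  unfolding ito_approx_def
proof (intro conjI allI ballI)
  show "(\<lambda>p. lim (\<lambda>k. el_val (L k) (fst p) (snd p))) \<in> L0 TM"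
    by (intro borel_measurable_lim_metric el_val_measurable L)
  show "(\<lambda>k. \<integral>\<^sup>+p. ennreal ((el_val (L k) (fst p) (snd p) - lim (\<lambda>k. el_val (L k) (fst p) (snd p)))\<^sup>2) \<partial>TM) \<longlonglongrightarrow> 0"
    by (intro fast_cauchy_L2(3) el_val_measurable L fast)
  fix t assume "t \<in> {0..T}"
  then show "(\<lambda>w. lim (\<lambda>k. el_val (L k) t w)) \<in> L0 (F t)"
    by (intro borel_measurable_lim_metric el_val_measurable_F L) auto
qed (use ito_integral_construction[OF L fast] L in auto)

lemma ito_approx_diff:
  assumes "ito_approx L H I" "ito_approx L' H' I'"
  shows "ito_approx (\<lambda>k. el_diff (L k) (L' k)) (\<lambda>t w. H t w - H' t w) (\<lambda>t w. I t w - I' t w)"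
proof -
  have tends: "(\<lambda>k. \<integral>\<^sup>+x. ennreal (((X k x - X' k x) - (Y x - Y' x))\<^sup>2) \<partial>N) \<longlonglongrightarrow> 0"
    if m: "\<And>k. X k \<in> L0 N" "\<And>k. X' k \<in> L0 N" "Y \<in> L0 N" "Y' \<in> L0 N"
      and l: "(\<lambda>k. \<integral>\<^sup>+x. ennreal ((X k x - Y x)\<^sup>2) \<partial>N) \<longlonglongrightarrow> 0"
      "(\<lambda>k. \<integral>\<^sup>+x. ennreal ((X' k x - Y' x)\<^sup>2) \<partial>N) \<longlonglongrightarrow> 0"
    for X X' :: "nat \<Rightarrow> 'c \<Rightarrow> real" and Y Y' and N
  proof (rule tendsto_sandwich[OF _ _ tendsto_const])
    note [measurable] = m
    have "(\<lambda>k. 2 * sq_norm N (\<lambda>x. X k x - Y x) + 2 * sq_norm N (\<lambda>x. X' k x - Y' x)) \<longlonglongrightarrow> 2 * 0 + 2 * 0"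
      by (intro tendsto_add ennreal_tendsto_cmult l) auto
    then show "(\<lambda>k. 2 * sq_norm N (\<lambda>x. X k x - Y x) + 2 * sq_norm N (\<lambda>x. X' k x - Y' x)) \<longlonglongrightarrow> 0" by simp
    show "eventually (\<lambda>k. sq_norm N (\<lambda>x. (X k x - X' k x) - (Y x - Y' x))
        \<le> 2 * sq_norm N (\<lambda>x. X k x - Y x) + 2 * sq_norm N (\<lambda>x. X' k x - Y' x)) sequentially"
    proof (intro always_eventually allI)
      fix k
      have 1: "(\<lambda>x. X k x - Y x) \<in> L0 N" "(\<lambda>x. - (X' k x - Y' x)) \<in> L0 N" by measurable
      have "X k x - Y x + - (X' k x - Y' x) = (X k x - X' k x) - (Y x - Y' x)" for x by simp
      then show "sq_norm N (\<lambda>x. (X k x - X' k x) - (Y x - Y' x))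
        \<le> 2 * sq_norm N (\<lambda>x. X k x - Y x) + 2 * sq_norm N (\<lambda>x. X' k x - Y' x)"
        using nn_integral_sq_add_le[OF 1] by (simp only: power2_minus)
    qed
  qed simp
  have *: "\<forall>k. elementary (L k)" "\<forall>k. elementary (L' k)" using assms by (auto simp: ito_approx_def)
  show ?thesis
    unfolding ito_approx_def
  proof (intro conjI allI ballI)
    show "(\<lambda>k. \<integral>\<^sup>+p. ennreal ((el_val (el_diff (L k) (L' k)) (fst p) (snd p) - (H (fst p) (snd p) - H' (fst p) (snd p)))\<^sup>2) \<partial>TM) \<longlonglongrightarrow> 0"
      using assms unfolding el_diff_simps ito_approx_def by (intro tends el_val_measurable) auto
    fix t assume t: "t \<in> {0..T}"
    then have m: "I t \<in> L0 M" "I' t \<in> L0 M" "\<And>k. el_int (L k) t \<in> L0 M"  "\<And>k. el_int (L' k) t \<in> L0 M"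
      using assms by (auto simp: ito_approx_def intro: measurable_F_M el_int_measurable)
    show "(\<lambda>k. \<integral>\<^sup>+w. ennreal ((el_int (el_diff (L k) (L' k)) t w - (I t w - I' t w))\<^sup>2) \<partial>M) \<longlonglongrightarrow> 0"
      using assms t unfolding el_diff_simps ito_approx_def by (intro tends m) auto
  qed (use assms in \<open>auto simp: ito_approx_def intro!: borel_measurable_diff\<close>)
qed

text \<open>Identities for elementary integrands pass to the limit because both sides are continuous
  bilinear expressions in mean square. The a priori estimate uses no other property of the
  integral.\<close>

lemma ito_approx_facts:
  assumes a: "ito_approx L H I"
  shows "sq_integrable TM (uncurried H)"
    and "t \<in> {0..T} \<Longrightarrow> sq_integrable M (I t)"
    and "s \<in> {0..T} \<Longrightarrow> X \<in> L0 (F s) \<Longrightarrow> sq_integrable M X \<Longrightarrow> (\<integral>w. X w * (I T w - I s w) \<partial>M) = 0"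
    and "s \<in> {0..T} \<Longrightarrow> (\<integral>w. (I T w - I s w)\<^sup>2 \<partial>M) = (\<integral>p. indicator {s<..} (fst p) * (H (fst p) (snd p))\<^sup>2 \<partial>TM)"
    and "t \<in> {0..T} \<Longrightarrow> (\<integral>w. (I t w)\<^sup>2 \<partial>M) \<le> (\<integral>p. (H (fst p) (snd p))\<^sup>2 \<partial>TM)"
proof -
  have L: "elementary (L k)" for k using a by (simp add: ito_approx_def)
  have H[measurable]: "uncurried H \<in> L0 TM" using a by (simp add: ito_approx_def)
  have IM: "I t \<in> L0 M" if "t \<in> {0..T}" for t
    using a that by (auto simp: ito_approx_def intro!: measurable_F_M)
  have lH: "(\<lambda>k. \<integral>\<^sup>+p. ennreal ((el_val (L k) (fst p) (snd p) - H (fst p) (snd p))\<^sup>2) \<partial>TM) \<longlonglongrightarrow> 0"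
    using a by (simp add: ito_approx_def)
  have lI: "(\<lambda>k. \<integral>\<^sup>+w. ennreal ((el_int (L k) t w - I t w)\<^sup>2) \<partial>M) \<longlonglongrightarrow> 0" if "t \<in> {0..T}" for t
    using a that by (simp add: ito_approx_def)
  note sH = sq_integrable_limit[OF sq_integrable_el_val[OF L] H lH]
  show 1: "sq_integrable TM (uncurried H)" by (rule sH(1))
  have sL: "sq_integrable M (el_int (L k) t)" if "t \<in> {0..T}" for t k using that L by (intro sq_integrable_el_int) auto
  show 2: "sq_integrable M (I t)" if "t \<in> {0..T}" for t
    by (rule sq_integrable_limit(1)[OF sL[OF that] IM[OF that] lI[OF that]])
  have sI: "(\<lambda>k. \<integral>w. (el_int (L k) t w - I t w)\<^sup>2 \<partial>M) \<longlonglongrightarrow> 0" if "t \<in> {0..T}" for t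
    by (rule sq_integrable_limit(2)[OF sL[OF that] IM[OF that] lI[OF that]])
  have TT: "T \<in> {0..T}" using T_pos by simp
  have dl: "(\<lambda>k. \<integral>w. ((el_int (L k) T w - el_int (L k) s w) - (I T w - I s w))\<^sup>2 \<partial>M) \<longlonglongrightarrow> 0" if s: "s \<in> {0..T}" for s
  proof (rule tendsto_sandwich[OF _ _ tendsto_const])
    have dT: "sq_integrable M (\<lambda>w. el_int (L k) T w - I T w)" and ds: "sq_integrable M (\<lambda>w. el_int (L k) s w - I s w)" for k
      by (intro sq_integrable_diff sL 2 s TT)+
    have "(\<lambda>k. 2 * (\<integral>w. (el_int (L k) T w - I T w)\<^sup>2 \<partial>M) + 2 * (\<integral>w. (el_int (L k) s w - I s w)\<^sup>2 \<partial>M)) \<longlonglongrightarrow> 2 * 0 + 2 * 0"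
      by (intro tendsto_intros sI[OF TT] sI[OF s])
    then show "(\<lambda>k. 2 * (\<integral>w. (el_int (L k) T w - I T w)\<^sup>2 \<partial>M) + 2 * (\<integral>w. (el_int (L k) s w - I s w)\<^sup>2 \<partial>M)) \<longlonglongrightarrow> 0" by simp
    show "eventually (\<lambda>k. (\<integral>w. ((el_int (L k) T w - el_int (L k) s w) - (I T w - I s w))\<^sup>2 \<partial>M)
      \<le> 2 * (\<integral>w. (el_int (L k) T w - I T w)\<^sup>2 \<partial>M) + 2 * (\<integral>w. (el_int (L k) s w - I s w)\<^sup>2 \<partial>M)) sequentially"
    proof (intro always_eventually allI)
      fix k
      have i: "integrable M (\<lambda>w. (el_int (L k) T w - I T w)\<^sup>2)" "integrable M (\<lambda>w. (el_int (L k) s w - I s w)\<^sup>2)"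
        using dT ds by (simp_all add: sq_integrable_def)
      have "(\<integral>w. ((el_int (L k) T w - el_int (L k) s w) - (I T w - I s w))\<^sup>2 \<partial>M)
        \<le> (\<integral>w. 2 * (el_int (L k) T w - I T w)\<^sup>2 + 2 * (el_int (L k) s w - I s w)\<^sup>2 \<partial>M)"
      proof (rule integral_mono)
        show "integrable M (\<lambda>w. ((el_int (L k) T w - el_int (L k) s w) - (I T w - I s w))\<^sup>2)"
          using sq_integrable_diff[OF sq_integrable_diff[OF sL[OF TT] sL[OF s]] sq_integrable_diff[OF 2[OF TT] 2[OF s]]]
          by (simp add: sq_integrable_def)
        show "integrable M (\<lambda>w. 2 * (el_int (L k) T w - I T w)\<^sup>2 + 2 * (el_int (L k) s w - I s w)\<^sup>2)"
          using i by simp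
        fix w
        have "((a - b) - (c - e))\<^sup>2 \<le> 2 * (a - c)\<^sup>2 + 2 * (b - e)\<^sup>2" for a b c e :: real
        proof -
          have "0 \<le> ((a - c) + (b - e))\<^sup>2" by simp
          then show ?thesis by (simp add: power2_eq_square algebra_simps)
        qed
        then show "((el_int (L k) T w - el_int (L k) s w) - (I T w - I s w))\<^sup>2 \<le> 2 * (el_int (L k) T w - I T w)\<^sup>2 + 2 * (el_int (L k) s w - I s w)\<^sup>2" .
      qed
      then show "(\<integral>w. ((el_int (L k) T w - el_int (L k) s w) - (I T w - I s w))\<^sup>2 \<partial>M)
        \<le> 2 * (\<integral>w. (el_int (L k) T w - I T w)\<^sup>2 \<partial>M) + 2 * (\<integral>w. (el_int (L k) s w - I s w)\<^sup>2 \<partial>M)" using i by simp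
    qed
  qed simp
  {
    assume s: "s \<in> {0..T}" and X: "X \<in> L0 (F s)" "sq_integrable M X"
    have l: "(\<lambda>k. \<integral>w. X w * (el_int (L k) T w - el_int (L k) s w) \<partial>M) \<longlonglongrightarrow> (\<integral>w. X w * (I T w - I s w) \<partial>M)"
      by (rule integral_mult_tendsto[OF X(2) X(2) sq_integrable_diff[OF sL[OF TT] sL[OF s]] sq_integrable_diff[OF 2[OF TT] 2[OF s]] _ dl[OF s]]) simp
    have z: "(\<integral>w. X w * (el_int (L k) T w - el_int (L k) s w) \<partial>M) = 0" for k
      using s by (intro expectation_mult_el_int X L) auto
    show "(\<integral>w. X w * (I T w - I s w) \<partial>M) = 0"
      by (rule LIMSEQ_unique[OF l]) (simp only: z tendsto_const)
  }
  {
    assume s: "s \<in> {0..T}"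
    have l1: "(\<lambda>k. \<integral>w. (el_int (L k) T w - el_int (L k) s w) * (el_int (L k) T w - el_int (L k) s w) \<partial>M) \<longlonglongrightarrow> (\<integral>w. (I T w - I s w) * (I T w - I s w) \<partial>M)"
      by (intro integral_mult_tendsto sq_integrable_diff sL 2 dl s TT)
    have e: "(\<integral>w. (el_int (L k) T w - el_int (L k) s w) * (el_int (L k) T w - el_int (L k) s w) \<partial>M)
        = (\<integral>p. (indicator {s<..} (fst p) * el_val (L k) (fst p) (snd p)) * el_val (L k) (fst p) (snd p) \<partial>TM)" for k
      using el_isometry_from[OF L, of s k] s by (simp only: power2_eq_square mult.assoc atLeastAtMost_iff simp_thms)
    have l2: "(\<lambda>k. \<integral>p. (indicator {s<..} (fst p) * el_val (L k) (fst p) (snd p)) * el_val (L k) (fst p) (snd p) \<partial>TM)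
        \<longlonglongrightarrow> (\<integral>p. (indicator {s<..} (fst p) * H (fst p) (snd p)) * H (fst p) (snd p) \<partial>TM)"
    proof (rule integral_mult_tendsto[OF _ _ sq_integrable_el_val[OF L] 1 _ sH(2)])
      have im: "(\<lambda>p. indicator {s<..} (fst p)) \<in> L0 TM" by measurable
      show b: "sq_integrable TM (\<lambda>p. indicator {s<..} (fst p) * el_val (L k) (fst p) (snd p))" for k
        by (rule sq_integrable_bounded_mult[OF sq_integrable_el_val[OF L] im, where K=1]) (auto simp: indicator_def)
      show b': "sq_integrable TM (\<lambda>p. indicator {s<..} (fst p) * H (fst p) (snd p))"
        by (rule sq_integrable_bounded_mult[OF 1 im, where K=1]) (auto simp: indicator_def)
      show "(\<lambda>k. \<integral>p. (indicator {s<..} (fst p) * el_val (L k) (fst p) (snd p) - indicator {s<..} (fst p) * H (fst p) (snd p))\<^sup>2 \<partial>TM) \<longlonglongrightarrow> 0"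
      proof (rule tendsto_sandwich[OF _ _ tendsto_const sH(2)])
        show "eventually (\<lambda>k. (\<integral>p. (indicator {s<..} (fst p) * el_val (L k) (fst p) (snd p) - indicator {s<..} (fst p) * H (fst p) (snd p))\<^sup>2 \<partial>TM)
            \<le> (\<integral>p. (el_val (L k) (fst p) (snd p) - H (fst p) (snd p))\<^sup>2 \<partial>TM)) sequentially"
        proof (intro always_eventually allI integral_mono)
          fix k
          show "integrable TM (\<lambda>p. (indicator {s<..} (fst p) * el_val (L k) (fst p) (snd p) - indicator {s<..} (fst p) * H (fst p) (snd p))\<^sup>2)"
            using sq_integrable_diff[OF b b'] by (simp add: sq_integrable_def)
          show "integrable TM (\<lambda>p. (el_val (L k) (fst p) (snd p) - H (fst p) (snd p))\<^sup>2)"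
            using sq_integrable_diff[OF sq_integrable_el_val[OF L] 1] by (simp add: sq_integrable_def)
        qed (auto simp: indicator_def)
      qed simp
    qed
    have "(\<integral>w. (I T w - I s w) * (I T w - I s w) \<partial>M) = (\<integral>p. (indicator {s<..} (fst p) * H (fst p) (snd p)) * H (fst p) (snd p) \<partial>TM)"
      by (rule LIMSEQ_unique[OF l1[unfolded e] l2])
    then show "(\<integral>w. (I T w - I s w)\<^sup>2 \<partial>M) = (\<integral>p. indicator {s<..} (fst p) * (H (fst p) (snd p))\<^sup>2 \<partial>TM)"
      by (simp only: power2_eq_square mult.assoc)
  }
  {
    assume t: "t \<in> {0..T}"
    have l1: "(\<lambda>k. \<integral>w. el_int (L k) t w * el_int (L k) t w \<partial>M) \<longlonglongrightarrow> (\<integral>w. I t w * I t w \<partial>M)"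
      by (intro integral_mult_tendsto sL 2 sI t)
    have l2: "(\<lambda>k. \<integral>p. el_val (L k) (fst p) (snd p) * el_val (L k) (fst p) (snd p) \<partial>TM) \<longlonglongrightarrow> (\<integral>p. H (fst p) (snd p) * H (fst p) (snd p) \<partial>TM)"
      by (intro integral_mult_tendsto sq_integrable_el_val L 1 sH(2))
    have le: "(\<integral>w. el_int (L k) t w * el_int (L k) t w \<partial>M) \<le> (\<integral>p. el_val (L k) (fst p) (snd p) * el_val (L k) (fst p) (snd p) \<partial>TM)" for k
    proof -
      have "ennreal (\<integral>w. (el_int (L k) t w)\<^sup>2 \<partial>M) \<le> ennreal (\<integral>p. (el_val (L k) (fst p) (snd p))\<^sup>2 \<partial>TM)"
        unfolding sq_integrable_nn_integral[OF sL[OF t], symmetric] sq_integrable_nn_integral[OF sq_integrable_el_val[OF L], symmetric]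
        using t by (intro nn_integral_el_int_le L) auto
      moreover have "0 \<le> (\<integral>p. (el_val (L k) (fst p) (snd p))\<^sup>2 \<partial>TM)" by simp
      ultimately have "(\<integral>w. (el_int (L k) t w)\<^sup>2 \<partial>M) \<le> (\<integral>p. (el_val (L k) (fst p) (snd p))\<^sup>2 \<partial>TM)"
        by (simp only: ennreal_le_iff)
      then show ?thesis by (simp only: power2_eq_square)
    qed
    have "(\<integral>w. I t w * I t w \<partial>M) \<le> (\<integral>p. H (fst p) (snd p) * H (fst p) (snd p) \<partial>TM)"
      by (rule LIMSEQ_le[OF l1 l2]) (use le in blast)
    then show "(\<integral>w. (I t w)\<^sup>2 \<partial>M) \<le> (\<integral>p. (H (fst p) (snd p))\<^sup>2 \<partial>TM)" by (simp only: power2_eq_square)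
  }
qed

section \<open>Lists of steps and simple processes on a partition\<close>

lemma sum_if_telescope:
  fixes G :: "nat \<Rightarrow> real"
  assumes "p \<le> q" "q \<le> n"
  shows "(\<Sum>j<n. (if p \<le> j \<and> j < q then c else 0) * (G (Suc j) - G j)) = c * (G q - G p)"
proof -
  have "(\<Sum>j<n. (if p \<le> j \<and> j < q then c else 0) * (G (Suc j) - G j)) = (\<Sum>j\<in>{p..<q}. c * (G (Suc j) - G j))"
    using assms by (intro sum.mono_neutral_cong_right) auto
  also have "\<dots> = c * (G q - G p)"
    by (simp add: sum_distrib_left[symmetric] sum_Suc_diff'[OF assms(1)])
  finally show ?thesis .
qed

text \<open>A step with endpoints on the grid is spread over all cells between them. Its value and
  its integral are then telescoping sums, so the coefficients of different steps can simply be added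
  cell by cell.\<close>

lemma elementary_on_grid:
  assumes \<tau>: "\<And>i. i \<le> n \<Longrightarrow> \<tau> i \<in> {0..T}" "\<And>i. i < n \<Longrightarrow> \<tau> i \<le> \<tau> (Suc i)"
  shows "elementary L \<Longrightarrow> (\<forall>(a, b, \<xi>)\<in>set L. a \<in> \<tau> ` {..n} \<and> b \<in> \<tau> ` {..n}) \<Longrightarrow>
    \<exists>\<xi>'. (\<forall>i<n. \<xi>' i \<in> L0 (F (\<tau> i)) \<and> (\<exists>K. \<forall>w\<in>space M. \<bar>\<xi>' i w\<bar> \<le> K)) \<and>
      (\<forall>t w. simple_value n \<tau> \<xi>' t w = el_val L t w) \<and>
      (\<forall>t w. simple_ito_integral W n \<tau> \<xi>' t w = el_int L t w)"
proof (induction L)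
  case Nil
  show ?case by (intro exI[of _ "\<lambda>_ _. 0"]) (auto simp: simple_value_def simple_ito_integral_def)
next
  case (Cons x L)
  obtain a b \<xi> where x: "x = (a, b, \<xi>)" by (cases x) auto
  have mono: "\<tau> i \<le> \<tau> j" if "i \<le> j" "j \<le> n" for i j
    using that(1,2)
  proof (induction rule: dec_induct)
    case (step m)
    then show ?case using \<tau>(2)[of m] by simp
  qed simp
  have "elementary L" "\<forall>(a, b, \<xi>)\<in>set L. a \<in> \<tau> ` {..n} \<and> b \<in> \<tau> ` {..n}"
    using Cons.prems by (simp_all add: x)
  from Cons.IH[OF this] obtain \<xi>' where
      \<xi>'0: "\<forall>i<n. \<xi>' i \<in> L0 (F (\<tau> i)) \<and> (\<exists>K. \<forall>w\<in>space M. \<bar>\<xi>' i w\<bar> \<le> K)"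
      "\<forall>t w. simple_value n \<tau> \<xi>' t w = el_val L t w"
      "\<forall>t w. simple_ito_integral W n \<tau> \<xi>' t w = el_int L t w" by (elim exE conjE)
  have \<xi>': "\<xi>' i \<in> L0 (F (\<tau> i))" "\<exists>K. \<forall>w\<in>space M. \<bar>\<xi>' i w\<bar> \<le> K" if "i < n" for i
    using \<xi>'0(1) that by simp_all
  have \<xi>'v: "simple_value n \<tau> \<xi>' t w = el_val L t w"
      "simple_ito_integral W n \<tau> \<xi>' t w = el_int L t w" for t w
    using \<xi>'0(2,3) by simp_all
  have abg: "a \<in> \<tau> ` {..n}" "b \<in> \<tau> ` {..n}" using Cons.prems by (simp_all add: x)
  have 1: "elementary_step a b \<xi>" using Cons x by simp
  \<comment> \<open>The grid may list a point repeatedly. For \<open>a = b\<close> one index is used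
    twice; for \<open>a < b\<close> monotonicity orders any two indices.\<close>
  have "\<exists>p q. p \<le> q \<and> q \<le> n \<and> \<tau> p = a \<and> \<tau> q = b"
  proof (cases "a = b")
    case True
    then show ?thesis using abg by auto
  next
    case False
    then have ab: "a < b" using 1 by (auto simp: elementary_step_def)
    obtain p q where pq: "p \<le> n" "q \<le> n" "\<tau> p = a" "\<tau> q = b" using abg by auto
    have "p \<le> q"
    proof (rule ccontr)
      assume "\<not> p \<le> q"
      then have "\<tau> q \<le> \<tau> p" using pq by (intro mono) auto
      then show False using pq ab by simp
    qed
    then show ?thesis using pq by auto
  qed
  then obtain p q where pq: "p \<le> q" "q \<le> n" "\<tau> p = a" "\<tau> q = b" by auto
  define \<eta> where "\<eta> i w = \<xi>' i w + (if p \<le> i \<and> i < q then \<xi> w else 0)" for i w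
  have m1: "\<eta> i \<in> L0 (F (\<tau> i))" if i: "i < n" for i
  proof (cases "p \<le> i \<and> i < q")
    case True
    have "\<tau> p \<le> \<tau> i" "\<tau> i \<in> {0..T}" using True i by (intro mono \<tau>(1); simp)+
    then have "\<xi> \<in> L0 (F (\<tau> i))"
      using 1 unfolding elementary_step_def pq(3) by (intro measurable_F_mono[of \<xi> a "\<tau> i"]) simp_all
    with \<xi>'(1)[OF i] have "(\<lambda>w. \<xi>' i w + \<xi> w) \<in> L0 (F (\<tau> i))" by (rule borel_measurable_add)
    then show ?thesis using True by (simp add: \<eta>_def[abs_def])
  next
    case False
    then have "\<eta> i = \<xi>' i" unfolding \<eta>_def[abs_def] by auto
    then show ?thesis using \<xi>'(1)[OF i] by simp
  qed
  have m2: "\<exists>K. \<forall>w\<in>space M. \<bar>\<eta> i w\<bar> \<le> K" if i: "i < n" for i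
  proof -
    obtain K K' where K: "\<forall>w\<in>space M. \<bar>\<xi>' i w\<bar> \<le> K" "\<forall>w\<in>space M. \<bar>\<xi> w\<bar> \<le> K'"
      using \<xi>'(2)[OF i] 1 by (auto simp: elementary_step_def)
    have "\<bar>\<eta> i w\<bar> \<le> K + K'" if w: "w \<in> space M" for w
    proof -
      have "0 \<le> K'" using bspec[OF K(2) w] by linarith
      then have "\<bar>if p \<le> i \<and> i < q then \<xi> w else 0\<bar> \<le> K'" using bspec[OF K(2) w] by simp
      then show ?thesis using bspec[OF K(1) w] unfolding \<eta>_def by linarith
    qed
    then show ?thesis by blast
  qed
  have m3: "simple_value n \<tau> \<eta> t w = el_val (x # L) t w" for t w
  proof -
    \<comment> \<open>The indicator of a half-open interval is an increment of this function of the
      index, so that it telescopes just as the increments of \<open>W\<close> do.\<close>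
    define G :: "nat \<Rightarrow> real" where "G j = of_bool (t \<le> \<tau> j)" for j
    have ind: "indicator {\<tau> i<..\<tau> j} t = G j - G i" if "i \<le> j" "j \<le> n" for i j
      using mono[OF that] by (auto simp: G_def indicator_def)
    have "simple_value n \<tau> \<eta> t w = (\<Sum>j<n. \<xi>' j w * indicator {\<tau> j<..\<tau> (Suc j)} t + (if p \<le> j \<and> j < q then \<xi> w else 0) * (G (Suc j) - G j))"
      unfolding simple_value_def
    proof (intro sum.cong refl)
      fix j assume "j \<in> {..<n}"
      then have "indicator {\<tau> j<..\<tau> (Suc j)} t = G (Suc j) - G j" by (intro ind) auto
      then show "\<eta> j w * indicator {\<tau> j<..\<tau> (Suc j)} t = \<xi>' j w * indicator {\<tau> j<..\<tau> (Suc j)} t + (if p \<le> j \<and> j < q then \<xi> w else 0) * (G (Suc j) - G j)"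
        by (simp only: \<eta>_def distrib_right)
    qed
    also have "\<dots> = simple_value n \<tau> \<xi>' t w + \<xi> w * (G q - G p)"
      by (simp only: sum.distrib sum_if_telescope[OF pq(1,2)] simple_value_def)
    also have "\<dots> = el_val (x # L) t w" using ind[OF pq(1,2)] by (simp add: x \<xi>'v(1) pq)
    finally show ?thesis .
  qed
  have m4: "simple_ito_integral W n \<tau> \<eta> t w = el_int (x # L) t w" for t w
  proof -
    define G where "G j = W (min (\<tau> j) t) w" for j
    have "simple_ito_integral W n \<tau> \<eta> t w = (\<Sum>j<n. \<xi>' j w * (W (min (\<tau> (Suc j)) t) w - W (min (\<tau> j) t) w) + (if p \<le> j \<and> j < q then \<xi> w else 0) * (G (Suc j) - G j))"
      unfolding simple_ito_integral_def by (intro sum.cong refl) (simp only: \<eta>_def G_def distrib_right)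
    also have "\<dots> = simple_ito_integral W n \<tau> \<xi>' t w + \<xi> w * (G q - G p)"
      by (simp only: sum.distrib sum_if_telescope[OF pq(1,2)] simple_ito_integral_def)
    also have "\<dots> = el_int (x # L) t w" by (simp add: x \<xi>'v(2) pq G_def)
    finally show ?thesis .
  qed
  show ?case
    by (intro exI[of _ \<eta>] conjI allI impI m1 m2 m3 m4)
qed

lemma elementary_simple_process:
  assumes L: "elementary L"
  shows "\<exists>n \<tau> \<xi>. simple_process T F n \<tau> \<xi> \<and>
      (\<forall>t w. simple_value n \<tau> \<xi> t w = el_val L t w) \<and>
      (\<forall>t w. simple_ito_integral W n \<tau> \<xi> t w = el_int L t w)"
proof -
  \<comment> \<open>The point \<open>0\<close> is included so that the grid is nonempty even for the
    empty list.\<close>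
  define E where "E = {0} \<union> fst ` set L \<union> (fst \<circ> snd) ` set L"
  have ab: "0 \<le> a \<and> a \<le> T \<and> 0 \<le> b \<and> b \<le> T" if "(a, b, \<xi>) \<in> set L" for a b \<xi>
    using bspec[OF L[unfolded elementary_def] that] by (auto simp: elementary_step_def)
  have "E \<subseteq> {0..T}"
  proof
    fix e assume "e \<in> E"
    then consider "e = 0" | a b \<xi> where "(a, b, \<xi>) \<in> set L" "e = a \<or> e = b" unfolding E_def by auto
    then show "e \<in> {0..T}" by cases (use ab T_pos in auto)
  qed
  then have E: "finite E" "E \<noteq> {}" "E \<subseteq> {0..T}" by (auto simp: E_def)
  define xs where "xs = sorted_list_of_set E"
  have xs: "sorted xs" "set xs = E" "xs \<noteq> []" using E by (auto simp: xs_def)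
  define n where "n = length xs - 1"
  have n: "length xs = Suc n" using xs(3) by (cases xs) (auto simp: n_def)
  let ?\<tau> = "\<lambda>i. xs ! i"
  have \<tau>: "?\<tau> i \<in> {0..T}" if "i \<le> n" for i using that n xs(2) E(3) nth_mem[of i xs] by auto
  have \<tau>': "?\<tau> i \<le> ?\<tau> (Suc i)" if "i < n" for i using that n xs(1) by (auto simp: sorted_iff_nth_mono)
  have "set xs = (!) xs ` {..<length xs}" by (auto simp: set_conv_nth)
  then have Eg: "E = (!) xs ` {..n}" unfolding n xs(2) lessThan_Suc_atMost .
  have "\<forall>(a, b, \<xi>)\<in>set L. a \<in> (!) xs ` {..n} \<and> b \<in> (!) xs ` {..n}"
  proof clarify
    fix a b \<xi> assume "(a, b, \<xi>) \<in> set L"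
    from imageI[OF this, of fst] imageI[OF this, of "fst \<circ> snd"]
    have "a \<in> E" "b \<in> E" by (simp_all add: E_def)
    then show "a \<in> (!) xs ` {..n} \<and> b \<in> (!) xs ` {..n}" unfolding Eg by (rule conjI)
  qed
  note grid = this
  have "\<exists>\<xi>. (\<forall>i<n. \<xi> i \<in> L0 (F (?\<tau> i)) \<and> (\<exists>K. \<forall>w\<in>space M. \<bar>\<xi> i w\<bar> \<le> K)) \<and>
      (\<forall>t w. simple_value n ?\<tau> \<xi> t w = el_val L t w) \<and>
      (\<forall>t w. simple_ito_integral W n ?\<tau> \<xi> t w = el_int L t w)"
    by (rule elementary_on_grid[OF _ _ L grid]) (rule \<tau> \<tau>', assumption)+
  then obtain \<xi> where
      \<xi>0: "\<forall>i<n. \<xi> i \<in> L0 (F (?\<tau> i)) \<and> (\<exists>K. \<forall>w\<in>space M. \<bar>\<xi> i w\<bar> \<le> K)"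
      and v: "\<forall>t w. simple_value n ?\<tau> \<xi> t w = el_val L t w"
      "\<forall>t w. simple_ito_integral W n ?\<tau> \<xi> t w = el_int L t w" by (elim exE conjE)
  have \<xi>: "\<xi> i \<in> L0 (F (?\<tau> i))" "\<exists>K. \<forall>w\<in>space M. \<bar>\<xi> i w\<bar> \<le> K" if "i < n" for i
    using \<xi>0 that by simp_all
  have "simple_process T F n ?\<tau> \<xi>"
    unfolding simple_process_def
  proof (intro conjI allI impI)
    fix i assume i: "i < n"
    obtain K where "\<forall>w\<in>space M. \<bar>\<xi> i w\<bar> \<le> K" using \<xi>(2)[OF i] by blast
    then show "bounded (\<xi> i ` space (F (?\<tau> i)))"
      using \<tau>[of i] i by (auto simp: bounded_iff space_F intro!: exI[of _ K])
  next
    show "?\<tau> i \<in> {0..T}" if "i \<le> n" for i by (rule \<tau>[OF that])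
    show "?\<tau> i \<le> ?\<tau> (Suc i)" if "i < n" for i by (rule \<tau>'[OF that])
    show "\<xi> i \<in> L0 (F (?\<tau> i))" if "i < n" for i by (rule \<xi>(1)[OF that])
  qed
  then show ?thesis using v by blast
qed

lemma simple_process_elementary:
  assumes "simple_process T F n \<tau> \<xi>"
  shows "\<exists>L. elementary L \<and> (\<forall>t w. el_val L t w = simple_value n \<tau> \<xi> t w) \<and>
      (\<forall>t w. el_int L t w = simple_ito_integral W n \<tau> \<xi> t w)"
proof (intro exI conjI allI)
  let ?L = "map (\<lambda>i. (\<tau> i, \<tau> (Suc i), \<xi> i)) [0..<n]"
  show "elementary ?L"
    unfolding elementary_def
  proof safe
    fix a b \<zeta> assume "(a, b, \<zeta>) \<in> set ?L"
    then obtain i where i: "i < n" "a = \<tau> i" "b = \<tau> (Suc i)" "\<zeta> = \<xi> i" by auto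
    have \<tau>: "\<tau> i \<in> {0..T}" "\<tau> (Suc i) \<in> {0..T}" using assms i by (auto simp: simple_process_def)
    have "bounded (\<xi> i ` space (F (\<tau> i)))" using assms i by (auto simp: simple_process_def)
    then obtain K where "\<And>x. x \<in> \<xi> i ` space M \<Longrightarrow> \<bar>x\<bar> \<le> K" using \<tau> by (auto simp: bounded_iff space_F)
    then have "\<exists>K. \<forall>w\<in>space M. \<bar>\<xi> i w\<bar> \<le> K" by auto
    then show "elementary_step a b \<zeta>" using assms i \<tau> by (auto simp: simple_process_def elementary_step_def)
  qed
  show "el_val ?L t w = simple_value n \<tau> \<xi> t w" for t w
    by (simp add: el_val_def simple_value_def comp_def interv_sum_list_conv_sum_set_nat atLeast0LessThan)
  show "el_int ?L t w = simple_ito_integral W n \<tau> \<xi> t w" for t w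
    by (simp add: el_int_def simple_ito_integral_def comp_def interv_sum_list_conv_sum_set_nat atLeast0LessThan)
qed

lemma nn_integral_TM_swap:
  assumes "uncurried g \<in> L0 TM"
  shows "(\<integral>\<^sup>+w. (\<integral>\<^sup>+t. g t w \<partial>lu) \<partial>M) = (\<integral>\<^sup>+p. g (fst p) (snd p) \<partial>TM)"
  using pair_sigma_finite.nn_integral_snd[OF pair_sigma_finite_TM assms] by simp

lemma has_ito_integral_if_ito_approx:
  assumes a: "ito_approx L H I" and c: "AE w in M. continuous_on {0..T} (\<lambda>t. I t w)"
  shows "has_ito_integral M T F W H I"
proof -
  have L: "elementary (L k)" for k using a by (simp add: ito_approx_def)
  have H[measurable]: "uncurried H \<in> L0 TM" using a by (simp add: ito_approx_def)
  have "\<forall>k. \<exists>n \<tau> \<xi>. simple_process T F n \<tau> \<xi> \<and>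
      (\<forall>t w. simple_value n \<tau> \<xi> t w = el_val (L k) t w) \<and>
      (\<forall>t w. simple_ito_integral W n \<tau> \<xi> t w = el_int (L k) t w)"
    using elementary_simple_process[OF L] by blast
  then obtain n \<tau> \<xi> where s: "\<And>k. simple_process T F (n k) (\<tau> k) (\<xi> k)"
      "\<And>k t w. simple_value (n k) (\<tau> k) (\<xi> k) t w = el_val (L k) t w"
      "\<And>k t w. simple_ito_integral W (n k) (\<tau> k) (\<xi> k) t w = el_int (L k) t w" by metis
  have e: "(\<integral>\<^sup>+w. sq_norm lu (\<lambda>t. el_val (L k) t w - H t w) \<partial>M)
      = sq_norm TM (\<lambda>p. el_val (L k) (fst p) (snd p) - H (fst p) (snd p))" for k
    by (intro nn_integral_TM_swap measurable_compose[OF _ measurable_ennreal] borel_measurable_power borel_measurable_diff el_val_measurable L H)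
  show ?thesis
    unfolding has_ito_integral_def
  proof (intro conjI exI)
    show "\<forall>k. simple_process T F (n k) (\<tau> k) (\<xi> k)" using s by simp
  qed (use a c in \<open>auto simp: ito_approx_def adapted_upto_def case_prod_beta' s(2,3) e\<close>)
qed

lemma ito_approx_if_has_ito_integral:
  assumes h: "has_ito_integral M T F W H I"
  shows "\<exists>L. ito_approx L H I"
proof -
  obtain n \<tau> \<xi> where s: "\<And>k. simple_process T F (n k) (\<tau> k) (\<xi> k)"
    and lH: "(\<lambda>k. \<integral>\<^sup>+w. sq_norm lu (\<lambda>t. simple_value (n k) (\<tau> k) (\<xi> k) t w - H t w) \<partial>M) \<longlonglongrightarrow> 0"
    and lI: "\<And>t. t \<in> {0..T} \<Longrightarrow> (\<lambda>k. \<integral>\<^sup>+w. ennreal ((simple_ito_integral W (n k) (\<tau> k) (\<xi> k) t w - I t w)\<^sup>2) \<partial>M) \<longlonglongrightarrow> 0"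
    using h unfolding has_ito_integral_def by blast
  have H[measurable]: "uncurried H \<in> L0 TM"
    using h by (simp add: has_ito_integral_def case_prod_beta')
  from simple_process_elementary[OF s] obtain L where L: "\<And>k. elementary (L k)"
      "\<And>k t w. el_val (L k) t w = simple_value (n k) (\<tau> k) (\<xi> k) t w"
      "\<And>k t w. el_int (L k) t w = simple_ito_integral W (n k) (\<tau> k) (\<xi> k) t w" by metis
  have e: "(\<integral>\<^sup>+w. sq_norm lu (\<lambda>t. el_val (L k) t w - H t w) \<partial>M)
      = sq_norm TM (\<lambda>p. el_val (L k) (fst p) (snd p) - H (fst p) (snd p))" for k
    by (intro nn_integral_TM_swap measurable_compose[OF _ measurable_ennreal] borel_measurable_power borel_measurable_diff el_val_measurable L H)
  have "ito_approx L H I"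
    unfolding ito_approx_def
  proof (intro conjI ballI allI)
    show "(\<lambda>k. \<integral>\<^sup>+p. ennreal ((el_val (L k) (fst p) (snd p) - H (fst p) (snd p))\<^sup>2) \<partial>TM) \<longlonglongrightarrow> 0"
      unfolding e[symmetric] unfolding L(2) by (rule lH)
    fix t assume "t \<in> {0..T}"
    then show "(\<lambda>k. \<integral>\<^sup>+w. ennreal ((el_int (L k) t w - I t w)\<^sup>2) \<partial>M) \<longlonglongrightarrow> 0"
      unfolding L(3) by (rule lI)
  qed (use h H L(1) in \<open>auto simp: has_ito_integral_def adapted_upto_def\<close>)
  then show ?thesis by blast
qed

end

section \<open>Martingale representation\<close>

text \<open>The last bound makes \<open>g'\<close> the derivative of \<open>g\<close>, with a second
  order error controlled uniformly. Inequalities are used instead of derivatives because they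
  survive averaging with the same constant, and also multiplication, with no differentiation under
  an integral.\<close>

definition smooth_pair :: "real \<Rightarrow> (real \<Rightarrow> real) \<Rightarrow> (real \<Rightarrow> real) \<Rightarrow> bool" where
  "smooth_pair K g g' \<longleftrightarrow> g \<in> L0 borel \<and> g' \<in> L0 borel \<and>
     (\<forall>x. \<bar>g x\<bar> \<le> K \<and> \<bar>g' x\<bar> \<le> K) \<and>
     (\<forall>x h. \<bar>g (x + h) - g x\<bar> \<le> K * \<bar>h\<bar> \<and> \<bar>g (x + h) - g x - g' x * h\<bar> \<le> K * h\<^sup>2)"

lemma smooth_pairD:
  assumes "smooth_pair K g g'"
  shows "g \<in> L0 borel" "g' \<in> L0 borel" "\<bar>g x\<bar> \<le> K" "\<bar>g' x\<bar> \<le> K"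
    "\<bar>g (x + h) - g x\<bar> \<le> K * \<bar>h\<bar>" "\<bar>g (x + h) - g x - g' x * h\<bar> \<le> K * h\<^sup>2" "0 \<le> K"
proof -
  show "\<bar>g x\<bar> \<le> K" using assms by (simp add: smooth_pair_def)
  then show "0 \<le> K" by linarith
qed (use assms in \<open>simp_all add: smooth_pair_def\<close>)

text \<open>Leibniz rule with remainder: the second order error splits into three terms, each at
  most \<open>K * J * h^2\<close>, whence the factor 3.\<close>

lemma smooth_pair_mult:
  assumes g: "smooth_pair K g g'" and f: "smooth_pair J f f'"
  shows "smooth_pair (3 * (K * J)) (\<lambda>x. g x * f x) (\<lambda>x. g' x * f x + g x * f' x)"
proof -
  note G = smooth_pairD[OF g] and F = smooth_pairD[OF f]
  note [measurable] = G(1,2) F(1,2)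
  have KJ: "0 \<le> K * J" using G(7) F(7) by simp
  have b: "\<bar>a * b\<bar> \<le> A * B" if "\<bar>a\<bar> \<le> A" "\<bar>b\<bar> \<le> B" for a b A B :: real
    using that by (simp add: abs_mult mult_mono)
  show ?thesis
    unfolding smooth_pair_def
  proof (intro conjI allI)
    show "(\<lambda>x. g x * f x) \<in> L0 borel" by measurable
    show "(\<lambda>x. g' x * f x + g x * f' x) \<in> L0 borel" by measurable
    fix x
    show "\<bar>g x * f x\<bar> \<le> 3 * (K * J)" using b[OF G(3) F(3), of x x] KJ by linarith
    show "\<bar>g' x * f x + g x * f' x\<bar> \<le> 3 * (K * J)"
      using b[OF G(4) F(3), of x x] b[OF G(3) F(4), of x x] KJ by linarith
    fix h
    have 1: "\<bar>(g (x + h) - g x) * f (x + h)\<bar> \<le> (K * \<bar>h\<bar>) * J" by (rule b[OF G(5) F(3)])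
    have 2: "\<bar>g x * (f (x + h) - f x)\<bar> \<le> K * (J * \<bar>h\<bar>)" by (rule b[OF G(3) F(5)])
    have "g (x + h) * f (x + h) - g x * f x = (g (x + h) - g x) * f (x + h) + g x * (f (x + h) - f x)"
      by (simp add: algebra_simps)
    then show "\<bar>g (x + h) * f (x + h) - g x * f x\<bar> \<le> 3 * (K * J) * \<bar>h\<bar>"
    proof -
      assume that: "g (x + h) * f (x + h) - g x * f x = (g (x + h) - g x) * f (x + h) + g x * (f (x + h) - f x)"
      have "0 \<le> (K * J) * \<bar>h\<bar>" using KJ by simp
      moreover
      have "(K * \<bar>h\<bar>) * J = (K * J) * \<bar>h\<bar>" "K * (J * \<bar>h\<bar>) = (K * J) * \<bar>h\<bar>" "3 * (K * J) * \<bar>h\<bar> = 3 * ((K * J) * \<bar>h\<bar>)"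
        by (simp_all only: mult_ac)
      ultimately show ?thesis using that 1 2 by linarith
    qed
    have h: "\<bar>h\<bar> * \<bar>h\<bar> = h\<^sup>2" by (simp add: power2_eq_square)
    have 3: "\<bar>(g (x + h) - g x - g' x * h) * f (x + h)\<bar> \<le> (K * h\<^sup>2) * J" by (rule b[OF G(6) F(3)])
    have 4: "\<bar>(g' x * h) * (f (x + h) - f x)\<bar> \<le> (K * \<bar>h\<bar>) * (J * \<bar>h\<bar>)"
      by (intro b[OF b] G(4) F(5)) simp
    have 5: "\<bar>g x * (f (x + h) - f x - f' x * h)\<bar> \<le> K * (J * h\<^sup>2)" by (rule b[OF G(3) F(6)])
    have e: "g (x + h) * f (x + h) - g x * f x - (g' x * f x + g x * f' x) * h
        = (g (x + h) - g x - g' x * h) * f (x + h) + (g' x * h) * (f (x + h) - f x) + g x * (f (x + h) - f x - f' x * h)"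
      by (simp add: algebra_simps)
    have "(K * \<bar>h\<bar>) * (J * \<bar>h\<bar>) = K * J * h\<^sup>2" unfolding h[symmetric] by (simp only: mult_ac)
    moreover have "(K * h\<^sup>2) * J = K * J * h\<^sup>2" "K * (J * h\<^sup>2) = K * J * h\<^sup>2" by (simp_all only: mult_ac)
    ultimately have "\<bar>g (x + h) * f (x + h) - g x * f x - (g' x * f x + g x * f' x) * h\<bar> \<le> 3 * (K * J * h\<^sup>2)"
      using 3 4 5 unfolding e by linarith
    then show "\<bar>g (x + h) * f (x + h) - g x * f x - (g' x * f x + g x * f' x) * h\<bar> \<le> 3 * (K * J) * h\<^sup>2"
      by (simp only: mult.assoc)
  qed
qed

lemma arctan_increment:
  "\<bar>arctan (x + h) - arctan x\<bar> \<le> \<bar>h\<bar>" "\<bar>arctan (x + h) - arctan x - inverse (1 + x\<^sup>2) * h\<bar> \<le> h\<^sup>2"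
proof -
  have "\<exists>y. \<bar>y - x\<bar> \<le> \<bar>h\<bar> \<and> arctan (x + h) - arctan x = inverse (1 + y\<^sup>2) * h"
  proof (cases h "0 :: real" rule: linorder_cases)
    case less
    then obtain z where "z > x + h" "z < x" "arctan x - arctan (x + h) = (x - (x + h)) * inverse (1 + z\<^sup>2)"
      using MVT2[of "x + h" x arctan "\<lambda>z. inverse (1 + z\<^sup>2)"] DERIV_arctan by auto
    then show ?thesis using less by (intro exI[of _ z]) (auto simp: algebra_simps)
  next
    case greater
    then obtain z where "z > x" "z < x + h" "arctan (x + h) - arctan x = ((x + h) - x) * inverse (1 + z\<^sup>2)"
      using MVT2[of x "x + h" arctan "\<lambda>z. inverse (1 + z\<^sup>2)"] DERIV_arctan by auto
    then show ?thesis using greater by (intro exI[of _ z]) (auto simp: algebra_simps)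
  qed auto
  then obtain y where y: "\<bar>y - x\<bar> \<le> \<bar>h\<bar>" "arctan (x + h) - arctan x = inverse (1 + y\<^sup>2) * h" by auto
  have p: "1 \<le> 1 + z\<^sup>2" for z :: real by simp
  have "\<bar>inverse (1 + y\<^sup>2) * h\<bar> \<le> 1 * \<bar>h\<bar>"
    unfolding abs_mult using p[of y] by (intro mult_right_mono) (auto simp: inverse_le_1_iff)
  then show "\<bar>arctan (x + h) - arctan x\<bar> \<le> \<bar>h\<bar>" by (simp add: y)
  \<comment> \<open>The derivative of \<open>arctan\<close> is 1-Lipschitz because
    \<open>|x + y| \<le> (1 + y^2) * (1 + x^2)\<close>.\<close>
  have "\<bar>inverse (1 + y\<^sup>2) - inverse (1 + x\<^sup>2)\<bar> \<le> \<bar>y - x\<bar>"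
  proof -
    let ?D = "(1 + y\<^sup>2) * (1 + x\<^sup>2)"
    have D: "?D > 0" using p[of x] p[of y] by (intro mult_pos_pos) linarith+
    have "inverse (1 + y\<^sup>2) - inverse (1 + x\<^sup>2) = ((1 + x\<^sup>2) - (1 + y\<^sup>2)) / ?D"
    proof -
      have "1 + x\<^sup>2 \<noteq> 0" "1 + y\<^sup>2 \<noteq> 0" using p[of x] p[of y] by linarith+
      then show ?thesis by (simp add: divide_simps)
    qed
    also have "\<dots> = (x - y) * (x + y) / ?D" by (simp add: power2_eq_square algebra_simps)
    finally have e: "\<bar>inverse (1 + y\<^sup>2) - inverse (1 + x\<^sup>2)\<bar> = \<bar>x - y\<bar> * \<bar>x + y\<bar> / ?D"
      using D by (simp add: abs_mult)
    have "2 * \<bar>x\<bar> \<le> 1 + x\<^sup>2" "2 * \<bar>y\<bar> \<le> 1 + y\<^sup>2"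
      using sum_squares_bound[of 1 "\<bar>x\<bar>"] sum_squares_bound[of 1 "\<bar>y\<bar>"] by simp_all
    moreover have "\<bar>x + y\<bar> \<le> \<bar>x\<bar> + \<bar>y\<bar>" by (rule abs_triangle_ineq)
    moreover have "?D = 1 + y\<^sup>2 + x\<^sup>2 + y\<^sup>2 * x\<^sup>2" by (simp add: algebra_simps)
    moreover have "0 \<le> y\<^sup>2 * x\<^sup>2" "0 \<le> x\<^sup>2" "0 \<le> y\<^sup>2" by simp_all
    ultimately have "\<bar>x + y\<bar> \<le> ?D" by linarith
    then have "\<bar>x - y\<bar> * \<bar>x + y\<bar> \<le> \<bar>x - y\<bar> * ?D" by (rule mult_left_mono) simp
    then show ?thesis unfolding e using D by (simp add: pos_divide_le_eq abs_minus_commute)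
  qed
  then have "\<bar>inverse (1 + y\<^sup>2) - inverse (1 + x\<^sup>2)\<bar> * \<bar>h\<bar> \<le> \<bar>h\<bar> * \<bar>h\<bar>"
    using y(1) by (intro mult_right_mono) linarith+
  then show "\<bar>arctan (x + h) - arctan x - inverse (1 + x\<^sup>2) * h\<bar> \<le> h\<^sup>2"
    unfolding y(2) by (simp add: abs_mult[symmetric] left_diff_distrib power2_eq_square)
qed

text \<open>The shift by \<open>m\<close> makes the approximation converge to \<open>1\<close> also at \<open>x = a\<close>.\<close>

definition half_line_approx :: "nat \<Rightarrow> real \<Rightarrow> real \<Rightarrow> real" where
  "half_line_approx m a x = 1 / 2 - arctan ((real m)\<^sup>2 * (x - a) - real m) / pi"

lemma half_line_approx_bounds: "0 \<le> half_line_approx m a x" "half_line_approx m a x \<le> 1"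
proof -
  have "\<bar>arctan y\<bar> \<le> pi / 2" for y using arctan_bounded[of y] by auto
  then have "\<bar>arctan ((real m)\<^sup>2 * (x - a) - real m)\<bar> / pi \<le> 1 / 2" by (simp add: divide_simps)
  then have "\<bar>arctan ((real m)\<^sup>2 * (x - a) - real m) / pi\<bar> \<le> 1 / 2" by (simp add: abs_divide)
  then show "0 \<le> half_line_approx m a x" "half_line_approx m a x \<le> 1" unfolding half_line_approx_def by linarith+
qed

lemma half_line_approx_smooth: "\<exists>K g'. smooth_pair K (half_line_approx m a) g'"
proof (intro exI)
  let ?c = "(real m)\<^sup>2"
  let ?y = "\<lambda>x. ?c * (x - a) - real m"
  \<comment> \<open>One summand for each bound: \<open>1\<close> for the values, the square of
    \<open>m\<close> for the slope, its fourth power for the second order error.\<close>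
  let ?K = "1 + ?c + ?c\<^sup>2"
  have pi1: "1 \<le> pi" using pi_gt3 by linarith
  have d: "\<bar>z / pi\<bar> \<le> \<bar>z\<bar>" for z :: real
    using pi1 by (simp add: abs_divide divide_le_eq mult_le_cancel_left1)
  have q: "0 \<le> ?c" "0 \<le> ?c\<^sup>2" by simp_all
  show "smooth_pair ?K (half_line_approx m a) (\<lambda>x. - (?c * inverse (1 + (?y x)\<^sup>2)) / pi)"
    unfolding smooth_pair_def
  proof (intro conjI allI)
    show "half_line_approx m a \<in> L0 borel"
      unfolding half_line_approx_def[abs_def] by measurable
    show "(\<lambda>x. - (?c * inverse (1 + (?y x)\<^sup>2)) / pi) \<in> L0 borel" by measurable
    fix x
    show "\<bar>half_line_approx m a x\<bar> \<le> ?K" using half_line_approx_bounds[of m a x] q by linarith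
    have "\<bar>inverse (1 + (?y x)\<^sup>2)\<bar> \<le> 1" by (simp add: inverse_le_1_iff)
    then have "\<bar>?c * inverse (1 + (?y x)\<^sup>2)\<bar> \<le> ?c * 1" unfolding abs_mult by (intro mult_mono) auto
    then show "\<bar>- (?c * inverse (1 + (?y x)\<^sup>2)) / pi\<bar> \<le> ?K"
      using d[of "- (?c * inverse (1 + (?y x)\<^sup>2))"] q by linarith
    fix h
    have s: "?y (x + h) = ?y x + ?c * h" by (simp add: algebra_simps)
    have e: "half_line_approx m a (x + h) - half_line_approx m a x = - ((arctan (?y x + ?c * h) - arctan (?y x)) / pi)"
      unfolding half_line_approx_def s by (simp add: diff_divide_distrib)
    have "\<bar>(arctan (?y x + ?c * h) - arctan (?y x)) / pi\<bar> \<le> ?c * \<bar>h\<bar>"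
      using d[of "arctan (?y x + ?c * h) - arctan (?y x)"] arctan_increment(1)[of "?y x" "?c * h"] q
      by (simp add: abs_mult)
    moreover have "?c * \<bar>h\<bar> \<le> ?K * \<bar>h\<bar>" using q by (intro mult_right_mono) auto
    ultimately show "\<bar>half_line_approx m a (x + h) - half_line_approx m a x\<bar> \<le> ?K * \<bar>h\<bar>"
      unfolding e abs_minus_cancel by linarith
    have e2: "half_line_approx m a (x + h) - half_line_approx m a x - - (?c * inverse (1 + (?y x)\<^sup>2)) / pi * h
       = - ((arctan (?y x + ?c * h) - arctan (?y x) - inverse (1 + (?y x)\<^sup>2) * (?c * h)) / pi)"
      unfolding e by (simp add: diff_divide_distrib)
    have "\<bar>(arctan (?y x + ?c * h) - arctan (?y x) - inverse (1 + (?y x)\<^sup>2) * (?c * h)) / pi\<bar> \<le> (?c * h)\<^sup>2"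
      using d[of "arctan (?y x + ?c * h) - arctan (?y x) - inverse (1 + (?y x)\<^sup>2) * (?c * h)"] arctan_increment(2)[of "?y x" "?c * h"] by linarith
    moreover have "(?c * h)\<^sup>2 \<le> ?K * h\<^sup>2" unfolding power_mult_distrib using q by (intro mult_right_mono) auto
    ultimately show "\<bar>half_line_approx m a (x + h) - half_line_approx m a x - - (?c * inverse (1 + (?y x)\<^sup>2)) / pi * h\<bar> \<le> ?K * h\<^sup>2"
      unfolding e2 abs_minus_cancel by linarith
  qed
qed

text \<open>The argument of \<open>arctan\<close> is \<open>m * (m * (x - a) - 1)\<close>: it tends
  to infinity if \<open>x > a\<close> and is at most \<open>- m\<close> otherwise.\<close>

lemma half_line_approx_tendsto: "(\<lambda>m. half_line_approx m a x) \<longlonglongrightarrow> indicator {..a} x"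
proof -
  define d where "d = x - a"
  have m: "filterlim (\<lambda>m. real m) at_top sequentially" by (rule filterlim_real_sequentially)
  have eq: "(real m)\<^sup>2 * d - real m = real m * (- 1 + real m * d)" for m by (simp add: power2_eq_square algebra_simps)
  show ?thesis
  proof (cases "d > 0")
    case True
    have "filterlim (\<lambda>m. - 1 + real m * d) at_top sequentially"
      by (rule filterlim_tendsto_add_at_top[OF tendsto_const filterlim_at_top_mult_tendsto_pos[OF tendsto_const True m]])
    then have "filterlim (\<lambda>m. real m * (- 1 + real m * d)) at_top sequentially"
      by (rule filterlim_at_top_mult_at_top[OF m])
    then have "((\<lambda>m. arctan ((real m)\<^sup>2 * d - real m)) \<longlongrightarrow> pi / 2) sequentially"
      unfolding eq by (rule filterlim_compose[OF tendsto_arctan_at_top])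
    then have "(\<lambda>m. 1 / 2 - arctan ((real m)\<^sup>2 * d - real m) / pi) \<longlonglongrightarrow> 1 / 2 - (pi / 2) / pi"
      by (intro tendsto_intros) auto
    then show ?thesis using True by (simp add: half_line_approx_def d_def)
  next
    case False
    have le: "real m \<le> - ((real m)\<^sup>2 * d - real m)" for m
      using False by (simp add: mult_nonneg_nonpos)
    have "filterlim (\<lambda>m. - ((real m)\<^sup>2 * d - real m)) at_top sequentially"
      by (rule filterlim_at_top_mono[OF m always_eventually]) (use le in blast)
    then have "filterlim (\<lambda>m. (real m)\<^sup>2 * d - real m) at_bot sequentially"
      by (subst filterlim_uminus_at_bot)
    then have "((\<lambda>m. arctan ((real m)\<^sup>2 * d - real m)) \<longlongrightarrow> - (pi / 2)) sequentially"
      by (rule filterlim_compose[OF tendsto_arctan_at_bot])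
    then have "(\<lambda>m. 1 / 2 - arctan ((real m)\<^sup>2 * d - real m) / pi) \<longlonglongrightarrow> 1 / 2 - (- (pi / 2)) / pi"
      by (intro tendsto_intros) auto
    then show ?thesis using False by (simp add: half_line_approx_def d_def)
  qed
qed

section \<open>Heat semigroup, second order expansion and density of elementary integrals\<close>

context wiener
begin

text \<open>The joint law of a variable known at \<open>s\<close> and the following increment is a
  product, so Fubini allows \<open>Z\<close> to be frozen. The target \<open>N\<close> is arbitrary
  because \<open>Z\<close> is a pair in one application and a single number in another.\<close>

lemma integral_freeze:
  fixes \<Phi> :: "'b \<times> real \<Rightarrow> real"
  assumes st: "0 \<le> s" "s \<le> t" "t \<le> T" and Z: "Z \<in> measurable (F s) N"
    and \<Phi>[measurable]: "\<Phi> \<in> L0 (N \<Otimes>\<^sub>M borel)"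
    and i: "integrable M (\<lambda>w. \<Phi> (Z w, W t w - W s w))"
  shows "(\<integral>w. \<Phi> (Z w, W t w - W s w) \<partial>M) = (\<integral>w. (\<integral>w'. \<Phi> (Z w, W t w' - W s w') \<partial>M) \<partial>M)"
proof -
  let ?D = "\<lambda>w. W t w - W s w"
  have s: "s \<le> T" and t: "0 \<le> t" using st by auto
  have [measurable]: "Z \<in> measurable M N" by (rule measurable_from_subalg[OF F_sub[OF st(1) s] Z])
  have [measurable]: "W t \<in> L0 M" "W s \<in> L0 M" using W_measurable t s st by auto
  interpret ZN: prob_space "distr M N Z" by (rule prob_space_distr) measurable
  interpret DN: prob_space "distr M borel ?D" by (rule prob_space_distr) measurable
  interpret P: pair_sigma_finite "distr M N Z" "distr M borel ?D" ..
  have eq: "distr M N Z \<Otimes>\<^sub>M distr M borel ?D = distr M (N \<Otimes>\<^sub>M borel) (\<lambda>w. (Z w, ?D w))"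
  proof (rule pair_measure_eqI)
    fix A B assume "A \<in> sets (distr M N Z)" "B \<in> sets (distr M borel ?D)"
    then have [measurable]: "A \<in> sets N" "B \<in> sets borel" by auto
    have ZF: "Z -` A \<inter> space M \<in> sets (F s)" using measurable_sets[OF Z \<open>A \<in> sets N\<close>] st s by (simp add: space_F)
    have "(\<lambda>w. (Z w, ?D w)) -` (A \<times> B) \<inter> space M = (Z -` A \<inter> space M) \<inter> (?D -` B \<inter> space M)" by auto
    then show "emeasure (distr M N Z) A * emeasure (distr M borel ?D) B = emeasure (distr M (N \<Otimes>\<^sub>M borel) (\<lambda>w. (Z w, ?D w))) (A \<times> B)"
      using W_indep[OF st ZF, of B] by (simp add: emeasure_distr emeasure_eq_measure ennreal_mult')
  next
    show "sigma_finite_measure (distr M N Z)" by (rule ZN.sigma_finite_measure_axioms)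
    show "sigma_finite_measure (distr M borel ?D)" by (rule DN.sigma_finite_measure_axioms)
    show "sets (distr M N Z \<Otimes>\<^sub>M distr M borel ?D) = sets (distr M (N \<Otimes>\<^sub>M borel) (\<lambda>w. (Z w, ?D w)))"
      unfolding sets_distr by (rule sets_pair_measure_cong) (rule sets_distr)+
  qed
  have "integrable (distr M (N \<Otimes>\<^sub>M borel) (\<lambda>w. (Z w, ?D w))) \<Phi>"
    using i by (subst integrable_distr_eq) auto
  then have i': "integrable (distr M N Z \<Otimes>\<^sub>M distr M borel ?D) \<Phi>" unfolding eq .
  have "(\<integral>w. \<Phi> (Z w, ?D w) \<partial>M) = (\<integral>q. \<Phi> q \<partial>distr M (N \<Otimes>\<^sub>M borel) (\<lambda>w. (Z w, ?D w)))"
    by (subst integral_distr) auto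
  also have "\<dots> = (\<integral>z. (\<integral>h. \<Phi> (z, h) \<partial>distr M borel ?D) \<partial>distr M N Z)"
    unfolding eq[symmetric] by (rule P.integral_fst'[OF i', symmetric])
  also have "\<dots> = (\<integral>w. (\<integral>h. \<Phi> (Z w, h) \<partial>distr M borel ?D) \<partial>M)"
    by (rule integral_distr) auto
  also have "\<dots> = (\<integral>w. (\<integral>w'. \<Phi> (Z w, ?D w') \<partial>M) \<partial>M)"
  proof (intro Bochner_Integration.integral_cong refl)
    fix w assume "w \<in> space M"
    then have "Z w \<in> space N" using measurable_space[OF \<open>Z \<in> measurable M N\<close>] by simp
    then show "(\<integral>h. \<Phi> (Z w, h) \<partial>distr M borel ?D) = (\<integral>w'. \<Phi> (Z w, ?D w') \<partial>M)"
      by (intro integral_distr) auto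
  qed
  finally show ?thesis .
qed

text \<open>The heat semigroup over the time span \<open>t - s\<close>, written as an expectation
  over the increment of \<open>W\<close> itself rather than with the Gaussian kernel.\<close>

definition heat :: "real \<Rightarrow> real \<Rightarrow> (real \<Rightarrow> real) \<Rightarrow> real \<Rightarrow> real" where
  "heat s t g x = (\<integral>w. g (x + (W t w - W s w)) \<partial>M)"

lemma abs_expectation_le:
  fixes X :: "'a \<Rightarrow> real"
  assumes "X \<in> L0 M" "\<And>w. w \<in> space M \<Longrightarrow> \<bar>X w\<bar> \<le> K"
  shows "\<bar>\<integral>w. X w \<partial>M\<bar> \<le> K"
proof -
  have "\<bar>\<integral>w. X w \<partial>M\<bar> \<le> (\<integral>w. \<bar>X w\<bar> \<partial>M)" by (rule integral_abs_bound)
  also have "\<dots> \<le> (\<integral>w. K \<partial>M)"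
  proof (rule integral_mono)
    show "integrable M (\<lambda>w. \<bar>X w\<bar>)" using integrable_bounded_F[OF assms] by simp
  qed (use assms in auto)
  finally show ?thesis by (simp add: prob_space)
qed

text \<open>Averaging preserves all four bounds with the same \<open>K\<close>. This uniformity in
  \<open>s\<close> is what lets the expansion errors be summed over a partition.\<close>

lemma heat_smooth_pair:
  assumes g: "smooth_pair K g g'" and st: "0 \<le> s" "s \<le> T" "0 \<le> t" "t \<le> T"
  shows "smooth_pair K (heat s t g) (heat s t g')"
proof -
  note G = smooth_pairD[OF g]
  note [measurable] = G(1,2) W_measurable[OF st(1,2)] W_measurable[OF st(3,4)]
  have i: "integrable M (\<lambda>w. g (x + (W t w - W s w)))" "integrable M (\<lambda>w. g' (x + (W t w - W s w)))" for x
    by (rule integrable_bounded_F[of _ K]; use G in measurable)+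
  have m: "heat s t f \<in> L0 borel" if [measurable]: "f \<in> L0 borel" for f
    unfolding heat_def[abs_def] by (rule borel_measurable_lebesgue_integral) measurable
  show ?thesis
    unfolding smooth_pair_def
  proof (intro conjI allI)
    fix x h
    show "\<bar>heat s t g x\<bar> \<le> K" "\<bar>heat s t g' x\<bar> \<le> K"
      unfolding heat_def by (rule abs_expectation_le; use G in measurable)+
    let ?y = "\<lambda>w. x + (W t w - W s w)"
    have yh: "?y w + h = (x + h) + (W t w - W s w)" for w by simp
    have e: "heat s t g (x + h) - heat s t g x = (\<integral>w. g (?y w + h) - g (?y w) \<partial>M)"
      unfolding yh heat_def using i by simp
    show "\<bar>heat s t g (x + h) - heat s t g x\<bar> \<le> K * \<bar>h\<bar>"
      unfolding e by (rule abs_expectation_le) (measurable, rule G(5))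
    have i2: "integrable M (\<lambda>w. g (?y w + h) - g (?y w))"
      unfolding yh using i by simp
    have e2: "heat s t g (x + h) - heat s t g x - heat s t g' x * h = (\<integral>w. g (?y w + h) - g (?y w) - g' (?y w) * h \<partial>M)"
      unfolding e unfolding heat_def using i2 i[of x] by simp
    show "\<bar>heat s t g (x + h) - heat s t g x - heat s t g' x * h\<bar> \<le> K * h\<^sup>2"
      unfolding e2 by (rule abs_expectation_le) (measurable, rule G(6))
  qed (use m G in auto)
qed

text \<open>Freeze the increment from \<open>r\<close> to \<open>s\<close> and average over the one
  from \<open>s\<close> to \<open>t\<close>.\<close>

lemma heat_semigroup:
  assumes r: "0 \<le> r" "r \<le> s" "s \<le> t" "t \<le> T" and g: "smooth_pair K g g'"
  shows "heat r t g x = (\<integral>w. heat s t g (x + (W s w - W r w)) \<partial>M)"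
proof -
  note G = smooth_pairD[OF g]
  have sT: "s \<le> T" and s0: "0 \<le> s" and t0: "0 \<le> t" and rT: "r \<le> T" using r by auto
  note [measurable] = G(1,2) W_measurable[OF s0 sT] W_measurable[OF t0 r(4)] W_measurable[OF r(1) rT]
  have Z: "(\<lambda>w. W s w - W r w) \<in> L0 (F s)"
    using W_measurable_F[of s s] W_measurable_F[of r s] r sT s0 by simp
  have \<Phi>: "(\<lambda>q. g (x + (fst q + snd q))) \<in> L0 (borel \<Otimes>\<^sub>M borel)" by measurable
  have "integrable M (\<lambda>w. g (x + ((W s w - W r w) + (W t w - W s w))))"
    by (rule integrable_bounded_F[of _ K]) (measurable, rule G(3))
  from integral_freeze[OF s0 r(3,4) Z \<Phi>] this show ?thesis
    unfolding heat_def by (simp add: algebra_simps)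
qed

lemma heat_refl: "heat t t g x = g x"
  by (simp add: heat_def prob_space)

text \<open>Since \<open>heat p q f (W p w)\<close> is the conditional mean of
  \<open>f (W q w)\<close> at time \<open>p\<close>, this is a centred error: the part of
  \<open>f (W q w)\<close> that a constant known at \<open>p\<close> plus one elementary step fails
  to capture.\<close>

definition remainder :: "real \<Rightarrow> real \<Rightarrow> (real \<Rightarrow> real) \<Rightarrow> (real \<Rightarrow> real) \<Rightarrow> 'a \<Rightarrow> real" where
  "remainder p q f f' w = f (W q w) - heat p q f (W p w) - f' (W p w) * (W q w - W p w)"

text \<open>The remainder is a Taylor error minus its conditional mean. The former is at most
  \<open>K\<close> times the squared increment, whose second moment is \<open>3 * (q - p)^2\<close>,
  and the latter is at most \<open>K * (q - p)\<close>; bounding the square of a difference by twice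
  the squares gives \<open>2 * 3 + 2 = 8\<close>. Orthogonality to the past follows by
  freezing.\<close>

lemma remainder_props:
  assumes pq: "0 \<le> p" "p \<le> q" "q \<le> T" and f: "smooth_pair K f f'"
  shows "remainder p q f f' \<in> L0 (F q)"
    and "sq_integrable M (remainder p q f f')"
    and "(\<integral>w. (remainder p q f f' w)\<^sup>2 \<partial>M) \<le> 8 * K\<^sup>2 * (q - p)\<^sup>2"
    and "Y \<in> L0 (F p) \<Longrightarrow> sq_integrable M Y \<Longrightarrow> (\<integral>w. Y w * remainder p q f f' w \<partial>M) = 0"
proof -
  note G = smooth_pairD[OF f]
  have q0: "0 \<le> q" and pT: "p \<le> T" using pq by auto
  let ?D = "\<lambda>w. W q w - W p w"
  define \<rho> where "\<rho> x h = f (x + h) - f x - f' x * h" for x h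
  define R where "R x = (\<integral>w. \<rho> x (?D w) \<partial>M)" for x
  have [measurable]: "(\<lambda>z. \<rho> (fst z) (snd z)) \<in> L0 (borel \<Otimes>\<^sub>M borel)"
    unfolding \<rho>_def using G(1,2) by measurable
  note [measurable] = G(1,2) W_measurable[OF q0 pq(3)] W_measurable[OF pq(1) pT]
  have \<rho>x[measurable]: "\<rho> x \<in> L0 borel" for x unfolding \<rho>_def[abs_def] by measurable
  have R[measurable]: "R \<in> L0 borel"
    unfolding R_def[abs_def]
    by (rule borel_measurable_lebesgue_integral) (simp add: case_prod_beta' \<rho>_def, measurable)
  have D2: "integrable M (\<lambda>w. (?D w)\<^sup>2)" and D4: "integrable M (\<lambda>w. (?D w) ^ 4)"
    and D1: "integrable M (\<lambda>w. ?D w)"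
    using W_increment_moments(1)[OF pq, of 2] W_increment_moments(1)[OF pq, of 4] W_increment_moments(1)[OF pq, of 1] by simp_all
  have i\<rho>: "integrable M (\<lambda>w. \<rho> x (?D w))" for x
    by (rule Bochner_Integration.integrable_bound[of _ "\<lambda>w. K * (?D w)\<^sup>2"])
      (use D2 G(6) G(7) in \<open>auto simp: \<rho>_def intro!: AE_I2\<close>)
  have Rb: "\<bar>R x\<bar> \<le> K * (q - p)" for x
  proof -
    have "\<bar>R x\<bar> \<le> (\<integral>w. \<bar>\<rho> x (?D w)\<bar> \<partial>M)" unfolding R_def by (rule integral_abs_bound)
    also have "\<dots> \<le> (\<integral>w. K * (?D w)\<^sup>2 \<partial>M)"
      by (rule integral_mono) (use i\<rho> D2 G(6) in \<open>auto simp: \<rho>_def\<close>)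
    also have "\<dots> = K * (q - p)" using W_increment_moments(3)[OF pq] by simp
    finally show ?thesis .
  qed
  have heatR: "heat p q f x = f x + R x" for x
  proof -
    have "R x = (\<integral>w. f (x + ?D w) - f x - f' x * ?D w \<partial>M)" by (simp add: R_def \<rho>_def)
    also have "\<dots> = heat p q f x - f x"
    proof -
      have "integrable M (\<lambda>w. f (x + ?D w))" by (rule integrable_bounded_F[of _ K]) (measurable, rule G(3))
      then show ?thesis using D1 W_increment_moments(2)[OF pq] by (simp add: heat_def prob_space)
    qed
    finally show ?thesis by simp
  qed
  have e: "remainder p q f f' w = \<rho> (W p w) (?D w) - R (W p w)" for w
    unfolding remainder_def heatR \<rho>_def by simp
  have WF: "W p \<in> L0 (F p)" "W p \<in> L0 (F q)" "W q \<in> L0 (F q)"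
    using pq pT q0 by (auto intro: W_measurable_F)
  have heatm: "heat p q f \<in> L0 borel" unfolding heatR[abs_def] by measurable
  show "remainder p q f f' \<in> L0 (F q)"
    unfolding remainder_def[abs_def] using WF heatm by measurable
  have rm[measurable]: "remainder p q f f' \<in> L0 M"
    unfolding remainder_def[abs_def] using heatm by measurable
  have K0: "0 \<le> K" by (rule G(7))
  have bound: "(remainder p q f f' w)\<^sup>2 \<le> 2 * K\<^sup>2 * (?D w) ^ 4 + 2 * K\<^sup>2 * (q - p)\<^sup>2" for w
  proof -
    have 1: "(\<rho> (W p w) (?D w))\<^sup>2 \<le> (K * (?D w)\<^sup>2)\<^sup>2"
      using G(6)[of "W p w" "?D w"] K0 by (simp add: \<rho>_def abs_le_square_iff[symmetric])
    have 2: "(R (W p w))\<^sup>2 \<le> (K * (q - p))\<^sup>2"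
      using Rb[of "W p w"] K0 pq by (simp add: abs_le_square_iff[symmetric])
    have "0 \<le> (\<rho> (W p w) (?D w) + R (W p w))\<^sup>2" by simp
    then have "(remainder p q f f' w)\<^sup>2 \<le> 2 * (\<rho> (W p w) (?D w))\<^sup>2 + 2 * (R (W p w))\<^sup>2"
      unfolding e by (simp add: power2_eq_square algebra_simps)
    also have "\<dots> \<le> 2 * (K * (?D w)\<^sup>2)\<^sup>2 + 2 * (K * (q - p))\<^sup>2" using 1 2 by simp
    also have "\<dots> = 2 * K\<^sup>2 * (?D w) ^ 4 + 2 * K\<^sup>2 * (q - p)\<^sup>2" by (simp add: power_mult_distrib)
    finally show ?thesis .
  qed
  have ib: "integrable M (\<lambda>w. 2 * K\<^sup>2 * (?D w) ^ 4 + 2 * K\<^sup>2 * (q - p)\<^sup>2)" using D4 by simp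
  have ir: "integrable M (\<lambda>w. (remainder p q f f' w)\<^sup>2)"
  proof (rule Bochner_Integration.integrable_bound[OF ib])
    show "AE w in M. norm ((remainder p q f f' w)\<^sup>2) \<le> norm (2 * K\<^sup>2 * (?D w) ^ 4 + 2 * K\<^sup>2 * (q - p)\<^sup>2)"
    proof (rule AE_I2)
      fix w
      show "norm ((remainder p q f f' w)\<^sup>2) \<le> norm (2 * K\<^sup>2 * (?D w) ^ 4 + 2 * K\<^sup>2 * (q - p)\<^sup>2)"
        using bound[of w] zero_le_power2[of "remainder p q f f' w"] unfolding real_norm_def by linarith
    qed
  qed measurable
  show sq: "sq_integrable M (remainder p q f f')" using ir by (simp add: sq_integrable_def)
  have "(\<integral>w. (remainder p q f f' w)\<^sup>2 \<partial>M) \<le> (\<integral>w. 2 * K\<^sup>2 * (?D w) ^ 4 + 2 * K\<^sup>2 * (q - p)\<^sup>2 \<partial>M)"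
    by (rule integral_mono[OF ir ib bound])
  also have "\<dots> = 8 * K\<^sup>2 * (q - p)\<^sup>2" using D4 W_increment_moments(4)[OF pq] by (simp add: prob_space)
  finally show "(\<integral>w. (remainder p q f f' w)\<^sup>2 \<partial>M) \<le> 8 * K\<^sup>2 * (q - p)\<^sup>2" .
  {
    assume Y: "Y \<in> L0 (F p)" "sq_integrable M Y"
    have YM[measurable]: "Y \<in> L0 M" using Y(2) by (simp add: sq_integrable_def)
    have RW: "(\<lambda>w. R (W p w)) \<in> L0 M" by measurable
    have sR: "sq_integrable M (\<lambda>w. R (W p w))"
      by (rule sq_integrable_bounded[OF finite_measure_axioms RW Rb])
    have "sq_integrable M (\<lambda>w. remainder p q f f' w + R (W p w))" by (rule sq_integrable_add[OF sq sR])
    then have s\<rho>: "sq_integrable M (\<lambda>w. \<rho> (W p w) (?D w))" unfolding e by simp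
    \<comment> \<open>The factor \<open>Y\<close> is frozen together with \<open>W p\<close>, on
      which the Taylor error depends.\<close>
    have Z: "(\<lambda>w. (Y w, W p w)) \<in> measurable (F p) (borel \<Otimes>\<^sub>M borel)" using Y(1) WF(1) by measurable
    define \<Phi> where "\<Phi> z = fst (fst z) * \<rho> (snd (fst z)) (snd z)" for z :: "(real \<times> real) \<times> real"
    have \<Phi>: "\<Phi> \<in> L0 ((borel \<Otimes>\<^sub>M borel) \<Otimes>\<^sub>M borel)"
      unfolding \<Phi>_def \<rho>_def by measurable
    have i1: "integrable M (\<lambda>w. Y w * \<rho> (W p w) (?D w))" by (rule sq_integrable_mult[OF Y(2) s\<rho>])
    have "(\<integral>w. Y w * \<rho> (W p w) (?D w) \<partial>M) = (\<integral>w. Y w * R (W p w) \<partial>M)"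
      using integral_freeze[OF pq Z \<Phi>] i1 by (simp add: \<Phi>_def R_def)
    then have "(\<integral>w. Y w * \<rho> (W p w) (?D w) - Y w * R (W p w) \<partial>M) = 0"
      using i1 sq_integrable_mult[OF Y(2) sR] by simp
    then show "(\<integral>w. Y w * remainder p q f f' w \<partial>M) = 0" by (simp only: e right_diff_distrib)
  }
qed

text \<open>The errors of the one-step expansions along a partition are orthogonal and of second order
  in the mesh, so that their sum tends to zero with the mesh.\<close>

lemma one_step_approx:
  assumes st: "0 \<le> s" "s \<le> t" "t \<le> T" and X: "X \<in> L0 (F s)" "\<And>w. w \<in> space M \<Longrightarrow> \<bar>X w\<bar> \<le> B"
    and g: "smooth_pair K g g'" and m: "0 < (m::nat)"
  shows "\<exists>L. elementary L \<and> sq_integrable M (\<lambda>w. X w * g (W t w) - X w * heat s t g (W s w) - el_int L T w) \<and>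
     (\<integral>w. (X w * g (W t w) - X w * heat s t g (W s w) - el_int L T w)\<^sup>2 \<partial>M) \<le> (8 * B\<^sup>2 * K\<^sup>2 * (t - s)\<^sup>2) / real m"
proof -
  define \<delta> where "\<delta> = (t - s) / real m"
  have \<delta>0: "0 \<le> \<delta>" using st m by (simp add: \<delta>_def)
  define r where "r k = s + real k * \<delta>" for k
  have m\<delta>: "real m * \<delta> = t - s" using m by (simp add: \<delta>_def)
  have r0: "r 0 = s" and rm: "r m = t" using m\<delta> by (simp_all add: r_def)
  have rS: "r (Suc k) - r k = \<delta>" for k by (simp add: r_def algebra_simps)
  have rmono: "r k \<le> r (Suc k)" for k using rS[of k] \<delta>0 by linarith
  have sr: "s \<le> r k" for k using \<delta>0 by (simp add: r_def)
  have rr: "r k \<le> r l" if "k \<le> l" for k l by (rule lift_Suc_mono_le[of r, OF rmono that])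
  have rT: "0 \<le> r k" "r k \<le> T" if "k \<le> m" for k
    using sr[of k] st rr[OF that] rm by auto
  \<comment> \<open>\<open>v k (W (r k) w)\<close> is the conditional mean of
    \<open>g (W t w)\<close> at time \<open>r k\<close>; it runs from
    \<open>heat s t g (W s w)\<close> to \<open>g (W t w)\<close>.\<close>
  define v where "v k = heat (r k) t g" for k
  define v' where "v' k = heat (r k) t g'" for k
  have t0: "0 \<le> t" using st by auto
  have v: "smooth_pair K (v k) (v' k)" if "k \<le> m" for k
    unfolding v_def v'_def by (rule heat_smooth_pair[OF g rT[OF that] t0 st(3)])
  define e where "e k = remainder (r k) (r (Suc k)) (v (Suc k)) (v' (Suc k))" for k
  have heatw: "heat (r k) (r (Suc k)) (v (Suc k)) x = v k x" if "k < m" for k x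
  proof -
    have "r (Suc k) \<le> t" using rr[of "Suc k" m] that rm by simp
    then have "heat (r k) t g x = (\<integral>w. heat (r (Suc k)) t g (x + (W (r (Suc k)) w - W (r k) w)) \<partial>M)"
      using that st by (intro heat_semigroup[OF _ rmono _ _ g] rT) auto
    then show ?thesis unfolding v_def heat_def[of "r k" "r (Suc k)"] by simp
  qed
  have XM: "X \<in> L0 M" using st by (intro measurable_F_M[OF X(1)]) auto
  define D where "D n w = (\<Sum>k<n. X w * e k w)" for n w
  have e1: "e k \<in> L0 (F (r (Suc k)))" "sq_integrable M (e k)"
      "(\<integral>w. (e k w)\<^sup>2 \<partial>M) \<le> 8 * K\<^sup>2 * \<delta>\<^sup>2"
      "\<And>Y. Y \<in> L0 (F (r k)) \<Longrightarrow> sq_integrable M Y \<Longrightarrow> (\<integral>w. Y w * e k w \<partial>M) = 0" if k: "k < m" for k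
  proof -
    have "0 \<le> r k" "r (Suc k) \<le> T" "smooth_pair K (v (Suc k)) (v' (Suc k))" using rT[of k] rT[of "Suc k"] v[of "Suc k"] k by auto
    note rem = remainder_props[OF this(1) rmono this(2,3)]
    show "e k \<in> L0 (F (r (Suc k)))" "sq_integrable M (e k)" unfolding e_def by (rule rem(1), rule rem(2))
    show "(\<integral>w. (e k w)\<^sup>2 \<partial>M) \<le> 8 * K\<^sup>2 * \<delta>\<^sup>2" using rem(3) unfolding e_def rS .
    show "(\<integral>w. Y w * e k w \<partial>M) = 0" if "Y \<in> L0 (F (r k))" "sq_integrable M Y" for Y
      unfolding e_def by (rule rem(4)[OF that])
  qed
  have Xe: "sq_integrable M (\<lambda>w. X w * e k w)" if "k < m" for k
    by (rule sq_integrable_bounded_mult[OF e1(2)[OF that] XM X(2)])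
  have B0: "0 \<le> B\<^sup>2" by simp
  have D: "D n \<in> L0 (F (r n)) \<and> sq_integrable M (D n) \<and>
      (\<integral>w. (D n w)\<^sup>2 \<partial>M) \<le> real n * (B\<^sup>2 * (8 * K\<^sup>2 * \<delta>\<^sup>2))" if "n \<le> m" for n
    using that
  proof (induction n)
    case 0
    have "D 0 = (\<lambda>_. 0)" by (simp add: D_def fun_eq_iff)
    then show ?case by (simp add: sq_integrable_def)
  next
    case (Suc n)
    then have n: "n < m" "n \<le> m" "Suc n \<le> m" by auto
    have IH: "D n \<in> L0 (F (r n))" "sq_integrable M (D n)" "(\<integral>w. (D n w)\<^sup>2 \<partial>M) \<le> real n * (B\<^sup>2 * (8 * K\<^sup>2 * \<delta>\<^sup>2))"
      using Suc.IH[OF n(2)] by auto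
    have DS: "D (Suc n) = (\<lambda>w. D n w + X w * e n w)" by (simp add: D_def fun_eq_iff)
    have m1: "D n \<in> L0 (F (r (Suc n)))" "X \<in> L0 (F (r (Suc n)))" "X \<in> L0 (F (r n))"
      using measurable_F_mono[OF IH(1) rT(1)[OF n(2)] rmono rT(2)[OF n(3)]]
        measurable_F_mono[OF X(1) st(1) sr rT(2)[OF n(3)]] measurable_F_mono[OF X(1) st(1) sr rT(2)[OF n(2)]] by auto
    have a: "D (Suc n) \<in> L0 (F (r (Suc n)))"
      unfolding DS using m1 e1(1)[OF n(1)] by (intro borel_measurable_add borel_measurable_times)
    have b: "sq_integrable M (D (Suc n))" unfolding DS by (rule sq_integrable_add[OF IH(2) Xe[OF n(1)]])
    have XD: "sq_integrable M (\<lambda>w. X w * D n w)" by (rule sq_integrable_bounded_mult[OF IH(2) XM X(2)])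
    have XDF: "(\<lambda>w. X w * D n w) \<in> L0 (F (r n))" using m1(3) IH(1) by (rule borel_measurable_times)
    have z: "(\<integral>w. (X w * D n w) * e n w \<partial>M) = 0" by (rule e1(4)[OF n(1) XDF XD])
    have iz: "integrable M (\<lambda>w. (X w * D n w) * e n w)" by (rule sq_integrable_mult[OF XD e1(2)[OF n(1)]])
    have ie: "integrable M (\<lambda>w. (X w * e n w)\<^sup>2)" and iD: "integrable M (\<lambda>w. (D n w)\<^sup>2)" and ien: "integrable M (\<lambda>w. (e n w)\<^sup>2)"
      using Xe[OF n(1)] IH(2) e1(2)[OF n(1)] by (simp_all add: sq_integrable_def)
    have "(\<integral>w. (X w * e n w)\<^sup>2 \<partial>M) \<le> (\<integral>w. B\<^sup>2 * (e n w)\<^sup>2 \<partial>M)"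
    proof (rule integral_mono[OF ie])
      show "integrable M (\<lambda>w. B\<^sup>2 * (e n w)\<^sup>2)" using ien by simp
      fix w assume "w \<in> space M"
      then have "(X w)\<^sup>2 \<le> B\<^sup>2" using X(2)[of w] by (simp add: abs_le_square_iff[symmetric])
      then show "(X w * e n w)\<^sup>2 \<le> B\<^sup>2 * (e n w)\<^sup>2" unfolding power_mult_distrib by (rule mult_right_mono) simp
    qed
    also have "\<dots> \<le> B\<^sup>2 * (8 * K\<^sup>2 * \<delta>\<^sup>2)" using e1(3)[OF n(1)] by (simp add: mult_left_mono)
    finally have c: "(\<integral>w. (X w * e n w)\<^sup>2 \<partial>M) \<le> B\<^sup>2 * (8 * K\<^sup>2 * \<delta>\<^sup>2)" .
    have "(\<integral>w. (D (Suc n) w)\<^sup>2 \<partial>M) = (\<integral>w. (D n w)\<^sup>2 + 2 * ((X w * D n w) * e n w) + (X w * e n w)\<^sup>2 \<partial>M)"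
      unfolding DS by (intro Bochner_Integration.integral_cong refl) (simp add: power2_eq_square algebra_simps)
    also have "\<dots> = (\<integral>w. (D n w)\<^sup>2 \<partial>M) + (\<integral>w. (X w * e n w)\<^sup>2 \<partial>M)" using iz ie iD z by simp
    also have "\<dots> \<le> real n * (B\<^sup>2 * (8 * K\<^sup>2 * \<delta>\<^sup>2)) + B\<^sup>2 * (8 * K\<^sup>2 * \<delta>\<^sup>2)" using IH(3) c by linarith
    also have "\<dots> = real (Suc n) * (B\<^sup>2 * (8 * K\<^sup>2 * \<delta>\<^sup>2))" by (simp add: distrib_right)
    finally show ?case using a b by blast
  qed
  \<comment> \<open>On each cell the function \<open>v (Suc k)\<close> of the right endpoint is
    expanded, hence the index \<open>Suc k\<close> of the derivative; it is evaluated at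
    \<open>W (r k)\<close> so that the coefficient is known at the start of the cell.\<close>
  define L where "L = map (\<lambda>k. (r k, r (Suc k), \<lambda>w. X w * v' (Suc k) (W (r k) w))) [0..<m]"
  have el: "elementary L"
    unfolding elementary_def
  proof safe
    fix a b \<xi> assume "(a, b, \<xi>) \<in> set L"
    then obtain k where k: "k < m" "a = r k" "b = r (Suc k)" "\<xi> = (\<lambda>w. X w * v' (Suc k) (W (r k) w))"
      by (auto simp: L_def)
    have km: "k \<le> m" "Suc k \<le> m" using k by auto
    note G = smooth_pairD[OF v[OF km(2)]]
    have "X \<in> L0 (F (r k))" by (rule measurable_F_mono[OF X(1) st(1) sr rT(2)[OF km(1)]])
    moreover have "(\<lambda>w. v' (Suc k) (W (r k) w)) \<in> L0 (F (r k))"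
      by (rule measurable_compose[OF W_adapted[OF rT[OF km(1)]] G(2)])
    ultimately have 1: "\<xi> \<in> L0 (F a)" unfolding k by (rule borel_measurable_times)
    have "\<bar>\<xi> w\<bar> \<le> B * K" if "w \<in> space M" for w
      unfolding k abs_mult using X(2)[OF that] G(4) by (intro mult_mono) auto
    then show "elementary_step a b \<xi>"
      unfolding elementary_step_def using 1 rT[OF km(1)] rT[OF km(2)] rmono[of k] k(2,3) by auto
  qed
  have elint: "el_int L T w = (\<Sum>k<m. X w * v' (Suc k) (W (r k) w) * (W (r (Suc k)) w - W (r k) w))" for w
  proof -
    have "el_int L T w = (\<Sum>k<m. X w * v' (Suc k) (W (r k) w) * (W (min (r (Suc k)) T) w - W (min (r k) T) w))"
      by (simp add: el_int_def L_def comp_def interv_sum_list_conv_sum_set_nat atLeast0LessThan)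
    also have "\<dots> = (\<Sum>k<m. X w * v' (Suc k) (W (r k) w) * (W (r (Suc k)) w - W (r k) w))"
    proof (rule sum.cong[OF refl])
      fix k assume "k \<in> {..<m}"
      then have "min (r (Suc k)) T = r (Suc k)" "min (r k) T = r k" using rT[of k] rT[of "Suc k"] by auto
      then show "X w * v' (Suc k) (W (r k) w) * (W (min (r (Suc k)) T) w - W (min (r k) T) w) = X w * v' (Suc k) (W (r k) w) * (W (r (Suc k)) w - W (r k) w)"
        by (simp only:)
    qed
    finally show ?thesis .
  qed
  have main: "X w * g (W t w) - X w * heat s t g (W s w) - el_int L T w = D m w" for w
  proof -
    have "D m w = (\<Sum>k<m. X w * (v (Suc k) (W (r (Suc k)) w) - v k (W (r k) w)) - X w * v' (Suc k) (W (r k) w) * (W (r (Suc k)) w - W (r k) w))"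
      unfolding D_def
    proof (rule sum.cong[OF refl])
      fix k assume "k \<in> {..<m}"
      then show "X w * e k w = X w * (v (Suc k) (W (r (Suc k)) w) - v k (W (r k) w)) - X w * v' (Suc k) (W (r k) w) * (W (r (Suc k)) w - W (r k) w)"
        by (simp add: e_def remainder_def heatw right_diff_distrib mult.assoc)
    qed
    also have "\<dots> = X w * (\<Sum>k<m. v (Suc k) (W (r (Suc k)) w) - v k (W (r k) w)) - el_int L T w"
      by (subst sum_subtractf) (simp only: sum_distrib_left elint)
    also have "(\<Sum>k<m. v (Suc k) (W (r (Suc k)) w) - v k (W (r k) w)) = v m (W (r m) w) - v 0 (W (r 0) w)"
      by (rule sum_lessThan_telescope)
    also have "\<dots> = g (W t w) - heat s t g (W s w)" unfolding v_def r0 rm heat_refl ..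
    finally show ?thesis by (simp add: right_diff_distrib)
  qed
  have "real m * (B\<^sup>2 * (8 * K\<^sup>2 * \<delta>\<^sup>2)) = (8 * B\<^sup>2 * K\<^sup>2 * (t - s)\<^sup>2) / real m"
    using m by (simp add: \<delta>_def power_divide power2_eq_square)
  then show ?thesis using D[OF order_refl] el by (intro exI[of _ L]) (simp add: main)
qed

text \<open>Membership in the mean square closure of constants plus elementary integrals. Smallness
  of a nonnegative integral includes square integrability of \<open>X\<close>.\<close>

definition approximable :: "('a \<Rightarrow> real) \<Rightarrow> bool" where
  "approximable X \<longleftrightarrow> X \<in> L0 M \<and>
     (\<forall>\<epsilon>>0. \<exists>c L. elementary L \<and> (sq_norm M (\<lambda>w. X w - c - el_int L T w)) < ennreal \<epsilon>)"

text \<open>The last factor \<open>g (W t w)\<close> may be traded for its conditional mean at the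
  earlier time \<open>s\<close>, because the difference is nearly an elementary integral.\<close>

lemma approximable_step:
  assumes st: "0 \<le> s" "s \<le> t" "t \<le> T" and X: "X \<in> L0 (F s)" "\<And>w. w \<in> space M \<Longrightarrow> \<bar>X w\<bar> \<le> B"
    and g: "smooth_pair K g g'" and a: "approximable (\<lambda>w. X w * heat s t g (W s w))"
  shows "approximable (\<lambda>w. X w * g (W t w))"
  unfolding approximable_def
proof (intro conjI allI impI)
  have XM: "X \<in> L0 M" using st by (intro measurable_F_M[OF X(1)]) auto
  have "W t \<in> L0 M" using st by (intro W_measurable) auto
  then have gW: "(\<lambda>w. g (W t w)) \<in> L0 M" using smooth_pairD(1)[OF g] by (rule measurable_compose)
  show 1: "(\<lambda>w. X w * g (W t w)) \<in> L0 M" by (rule borel_measurable_times[OF XM gW])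
  have 2: "(\<lambda>w. X w * heat s t g (W s w)) \<in> L0 M" using a by (simp add: approximable_def)
  fix \<epsilon> :: real assume \<epsilon>: "\<epsilon> > 0"
  then have "\<epsilon> / 4 > 0" by simp
  with a obtain c L where L: "elementary L" "sq_norm M (\<lambda>w. X w * heat s t g (W s w) - c - el_int L T w) < ennreal (\<epsilon> / 4)"
    unfolding approximable_def by blast
  let ?A = "8 * B\<^sup>2 * K\<^sup>2 * (t - s)\<^sup>2"
  \<comment> \<open>Enough cells to push the expansion error below \<open>\<epsilon> / 4\<close>.
    Two errors of that size, with the factor 2 from the square of a sum, stay below
    \<open>\<epsilon>\<close>.\<close>
  obtain m :: nat where m: "?A / (\<epsilon> / 4) < real m" using reals_Archimedean2 by blast
  have A0: "0 \<le> ?A" by simp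
  have m0: "0 < m" using m A0 \<epsilon> by (cases m) (auto simp: divide_less_0_iff zero_less_mult_iff not_less)
  from one_step_approx[OF st X g m0] obtain L' where L': "elementary L'"
      "sq_integrable M (\<lambda>w. X w * g (W t w) - X w * heat s t g (W s w) - el_int L' T w)"
      "(\<integral>w. (X w * g (W t w) - X w * heat s t g (W s w) - el_int L' T w)\<^sup>2 \<partial>M) \<le> ?A / real m" by blast
  have "?A / real m < \<epsilon> / 4" using m m0 \<epsilon> by (simp add: divide_less_eq mult.commute)
  then have 3: "sq_norm M (\<lambda>w. X w * g (W t w) - X w * heat s t g (W s w) - el_int L' T w) < ennreal (\<epsilon> / 4)"
    unfolding sq_integrable_nn_integral[OF L'(2)] using L'(3) \<epsilon> by (intro ennreal_lessI) auto
  have T: "0 \<le> T" using T_pos by simp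
  note [measurable] = 1 2 el_int_measurable[OF L(1) T order_refl] el_int_measurable[OF L'(1) T order_refl]
  have "sq_norm M (\<lambda>w. X w * g (W t w) - c - el_int (L @ L') T w) =
      (sq_norm M (\<lambda>w. (X w * g (W t w) - X w * heat s t g (W s w) - el_int L' T w) + (X w * heat s t g (W s w) - c - el_int L T w)))"
    by (simp add: algebra_simps)
  also have "\<dots> \<le> 2 * sq_norm M (\<lambda>w. X w * g (W t w) - X w * heat s t g (W s w) - el_int L' T w)
      + 2 * sq_norm M (\<lambda>w. X w * heat s t g (W s w) - c - el_int L T w)"
    by (rule nn_integral_sq_add_le) measurable
  also have "\<dots> < 2 * ennreal (\<epsilon> / 4) + 2 * ennreal (\<epsilon> / 4)"
    by (intro add_strict_mono ennreal_mult_strict_left_mono 3 L(2)) auto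
  also have "\<dots> = ennreal \<epsilon>"
  proof -
    have "2 * ennreal (\<epsilon> / 4) = ennreal (2 * (\<epsilon> / 4))" using \<epsilon> by (subst ennreal_mult) auto
    then show ?thesis using \<epsilon> by (simp add: ennreal_plus[symmetric] del: ennreal_plus)
  qed
  finally show "\<exists>c L. elementary L \<and> (sq_norm M (\<lambda>w. X w * g (W t w) - c - el_int L T w)) < ennreal \<epsilon>"
    using L(1) L'(1) by (intro exI[of _ c] exI[of _ "L @ L'"]) simp
qed

lemma approximable_const: "approximable (\<lambda>w. c)"
  unfolding approximable_def by (auto intro!: exI[of _ c] exI[of _ "[]"])

lemma approximable_cong:
  "approximable X \<Longrightarrow> (\<And>w. w \<in> space M \<Longrightarrow> X w = Y w) \<Longrightarrow> approximable Y"
proof -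
  assume a: "approximable X" and e: "\<And>w. w \<in> space M \<Longrightarrow> X w = Y w"
  have "X \<in> L0 M \<longleftrightarrow> Y \<in> L0 M" by (rule measurable_cong[OF e])
  moreover have "sq_norm M (\<lambda>w. X w - c - el_int L T w) = sq_norm M (\<lambda>w. Y w - c - el_int L T w)" for c L
    by (rule nn_integral_cong) (simp add: e)
  ultimately show ?thesis using a unfolding approximable_def by simp
qed

definition path_product :: "(real \<times> (real \<Rightarrow> real)) list \<Rightarrow> 'a \<Rightarrow> real" where
  "path_product xs w = (\<Prod>(r, g)\<leftarrow>xs. g (W r w))"

lemma path_product_simps [simp]:
  "path_product [] w = 1" "path_product ((r, g) # xs) w = g (W r w) * path_product xs w"
  by (simp_all add: path_product_def)

lemma path_product_measurable_bounded:
  assumes s: "0 \<le> s" "s \<le> T"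
  shows "(\<forall>(r, g)\<in>set xs. 0 \<le> r \<and> r \<le> s \<and> (\<exists>K g'. smooth_pair K g g')) \<Longrightarrow>
    path_product xs \<in> L0 (F s) \<and> (\<exists>B. \<forall>w. \<bar>path_product xs w\<bar> \<le> B)"
proof (induction xs)
  case Nil
  have "path_product [] = (\<lambda>_. 1)" by (simp add: fun_eq_iff)
  then show ?case by auto
next
  case (Cons x xs)
  obtain r g where x: "x = (r, g)" by (cases x) auto
  from Cons.prems obtain K g' where g: "0 \<le> r" "r \<le> s" "smooth_pair K g g'" by (auto simp: x)
  have "\<forall>(r, g)\<in>set xs. 0 \<le> r \<and> r \<le> s \<and> (\<exists>K g'. smooth_pair K g g')" using Cons.prems by simp
  from Cons.IH[OF this] obtain B where B: "path_product xs \<in> L0 (F s)" "\<And>w. \<bar>path_product xs w\<bar> \<le> B" by auto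
  have e: "path_product (x # xs) = (\<lambda>w. g (W r w) * path_product xs w)" by (simp add: x fun_eq_iff)
  have "(\<lambda>w. g (W r w)) \<in> L0 (F s)"
    by (rule measurable_compose[OF W_measurable_F[OF g(1,2) s(2)] smooth_pairD(1)[OF g(3)]])
  then have "path_product (x # xs) \<in> L0 (F s)" unfolding e using B(1) by (rule borel_measurable_times)
  moreover have "\<bar>path_product (x # xs) w\<bar> \<le> K * B" for w
    unfolding e abs_mult using smooth_pairD(3)[OF g(3)] B(2) smooth_pairD(7)[OF g(3)] by (intro mult_mono) auto
  ultimately show ?case by blast
qed

text \<open>Times decrease along the list. The latest factor is averaged down to the previous time
  and merged with the factor there, which shortens the list; a single factor is averaged down to
  time \<open>0\<close>, where \<open>W\<close> vanishes and only a constant remains.\<close>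

lemma approximable_path_product:
  "(\<forall>(r, g)\<in>set xs. 0 \<le> r \<and> r \<le> T \<and> (\<exists>K g'. smooth_pair K g g')) \<Longrightarrow>
   sorted_wrt (\<lambda>p q. fst q \<le> fst p) xs \<Longrightarrow> approximable (path_product xs)"
proof (induction xs rule: length_induct)
  case (1 xs)
  show ?case
  proof (cases xs)
    case Nil
    then have "path_product xs = (\<lambda>_. 1)" by (simp add: fun_eq_iff)
    then show ?thesis by (simp add: approximable_const)
  next
    case (Cons x ys)
    obtain r g where x: "x = (r, g)" by (cases x) auto
    from 1(2) obtain K g' where g: "0 \<le> r" "r \<le> T" "smooth_pair K g g'" by (auto simp: x Cons)
    show ?thesis
    proof (cases ys)
      case Nil
      have "approximable (\<lambda>w. 1 * g (W r w))"
      proof (rule approximable_step[OF order_refl g(1,2) _ _ g(3), where B=1])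
        show "approximable (\<lambda>w. 1 * heat 0 r g (W 0 w))"
          by (rule approximable_cong[OF approximable_const[of "heat 0 r g 0"]]) (simp add: W_0)
      qed auto
      moreover have "path_product xs = (\<lambda>w. 1 * g (W r w))" by (simp add: fun_eq_iff Cons x Nil)
      ultimately show ?thesis by simp
    next
      case (Cons y zs)
      obtain s f where y: "y = (s, f)" by (cases y) auto
      from 1(2) obtain J f' where f: "0 \<le> s" "s \<le> T" "smooth_pair J f f'" by (auto simp: \<open>xs = x # ys\<close> Cons y)
      have sr: "s \<le> r" using 1(3) by (simp add: \<open>xs = x # ys\<close> Cons x y)
      \<comment> \<open>This list is shorter than \<open>xs\<close> but not part of it, hence the
        induction on length. The merged factor is smooth again as a product of smooth
        functions.\<close>
      let ?zs = "(s, \<lambda>x. f x * heat s r g x) # zs"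
      have IH: "approximable (path_product ?zs)"
      proof (rule 1(1)[rule_format])
        show "length ?zs < length xs" by (simp add: \<open>xs = x # ys\<close> Cons)
        show "sorted_wrt (\<lambda>p q. fst q \<le> fst p) ?zs" using 1(3) by (simp add: \<open>xs = x # ys\<close> Cons y)
        have "\<exists>K g'. smooth_pair K (\<lambda>x. f x * heat s r g x) g'"
          using smooth_pair_mult[OF f(3) heat_smooth_pair[OF g(3) f(1,2) g(1,2)]] by blast
        moreover have "case p of (r, g) \<Rightarrow> 0 \<le> r \<and> r \<le> T \<and> (\<exists>K g'. smooth_pair K g g')" if "p \<in> set zs" for p
          using 1(2) that by (simp add: \<open>xs = x # ys\<close> Cons)
        ultimately show "case p of (r, g) \<Rightarrow> 0 \<le> r \<and> r \<le> T \<and> (\<exists>K g'. smooth_pair K g g')" if "p \<in> set ?zs" for p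
          using that f by auto
      qed
      have le: "fst p \<le> s" if "p \<in> set zs" for p 
      proof -
        obtain a b where p: "p = (a, b)" by (cases p)
        show ?thesis using 1(3) that by (auto simp: \<open>xs = x # ys\<close> Cons y p)
      qed
      have "\<forall>(r, g)\<in>set ys. 0 \<le> r \<and> r \<le> s \<and> (\<exists>K g'. smooth_pair K g g')"
      proof
        fix p assume p: "p \<in> set ys"
        then have "case p of (r, g) \<Rightarrow> 0 \<le> r \<and> r \<le> T \<and> (\<exists>K g'. smooth_pair K g g')" using 1(2) by (simp add: \<open>xs = x # ys\<close>)
        moreover have "fst p \<le> s" using p le[of p] by (auto simp: Cons y)
        ultimately show "case p of (r, g) \<Rightarrow> 0 \<le> r \<and> r \<le> s \<and> (\<exists>K g'. smooth_pair K g g')" by auto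
      qed
      from path_product_measurable_bounded[OF f(1,2) this]
      obtain B where B: "path_product ys \<in> L0 (F s)" "\<And>w. \<bar>path_product ys w\<bar> \<le> B" by blast
      have "approximable (\<lambda>w. path_product ys w * g (W r w))"
      proof (rule approximable_step[OF f(1) sr g(2) B(1) B(2) g(3)])
        show "approximable (\<lambda>w. path_product ys w * heat s r g (W s w))"
          by (rule approximable_cong[OF IH]) (simp add: Cons y mult_ac)
      qed
      then show ?thesis by (rule approximable_cong) (simp add: \<open>xs = x # ys\<close> x mult.commute)
    qed
  qed
qed

end

lemma nn_integral_sq_dominated:
  fixes X :: "nat \<Rightarrow> 'b \<Rightarrow> real"
  assumes [measurable]: "\<And>m. X m \<in> L0 N" "Y \<in> L0 N" "G \<in> L0 N"
    and b: "\<And>m x. x \<in> space N \<Longrightarrow> \<bar>X m x\<bar> \<le> G x" and l: "\<And>x. x \<in> space N \<Longrightarrow> (\<lambda>m. X m x) \<longlonglongrightarrow> Y x"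
    and G: "sq_norm N G < \<infinity>"
  shows "(\<lambda>m. \<integral>\<^sup>+x. ennreal ((Y x - X m x)\<^sup>2) \<partial>N) \<longlonglongrightarrow> 0"
proof -
  have "(\<lambda>m. \<integral>\<^sup>+x. ennreal ((Y x - X m x)\<^sup>2) \<partial>N) \<longlonglongrightarrow> (\<integral>\<^sup>+x. 0 \<partial>N)"
  proof (rule nn_integral_dominated_convergence[where w="\<lambda>x. 4 * ennreal ((G x)\<^sup>2)"])
    show "AE x in N. ennreal ((Y x - X m x)\<^sup>2) \<le> 4 * ennreal ((G x)\<^sup>2)" for m
    proof (rule AE_I2)
      fix x assume x: "x \<in> space N"
      have "\<bar>Y x\<bar> \<le> G x"
        by (rule LIMSEQ_le_const2[OF tendsto_rabs[OF l[OF x]]]) (use b[OF x] in blast)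
      then have "\<bar>Y x - X m x\<bar> \<le> 2 * G x" using b[OF x, of m] by linarith
      then have "(Y x - X m x)\<^sup>2 \<le> (2 * G x)\<^sup>2" by (metis abs_ge_zero power2_abs power_mono)
      then have "ennreal ((Y x - X m x)\<^sup>2) \<le> ennreal (4 * (G x)\<^sup>2)" by (intro ennreal_leI) (simp add: power_mult_distrib)
      then show "ennreal ((Y x - X m x)\<^sup>2) \<le> 4 * ennreal ((G x)\<^sup>2)" by (simp add: ennreal_mult)
    qed
    show "(\<integral>\<^sup>+x. 4 * ennreal ((G x)\<^sup>2) \<partial>N) < \<infinity>" using G by (simp add: nn_integral_cmult ennreal_mult_less_top)
    show "AE x in N. (\<lambda>m. ennreal ((Y x - X m x)\<^sup>2)) \<longlonglongrightarrow> 0"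
    proof (rule AE_I2)
      fix x assume x: "x \<in> space N"
      have "(\<lambda>m. (Y x - X m x)\<^sup>2) \<longlonglongrightarrow> (Y x - Y x)\<^sup>2" by (intro tendsto_intros l x)
      then have "(\<lambda>m. ennreal ((Y x - X m x)\<^sup>2)) \<longlonglongrightarrow> ennreal ((Y x - Y x)\<^sup>2)" by (rule tendsto_ennrealI)
      then show "(\<lambda>m. ennreal ((Y x - X m x)\<^sup>2)) \<longlonglongrightarrow> 0" by simp
    qed
  qed measurable
  then show ?thesis by simp
qed

section \<open>Approximation jointly in the parameter\<close>

definition el_sec :: "real \<Rightarrow> (real \<times> real \<times> (real \<Rightarrow> 'a \<Rightarrow> real)) list \<Rightarrow> (real \<times> real \<times> ('a \<Rightarrow> real)) list" where
  "el_sec u L = map (\<lambda>(a, b, \<xi>). (a, b, \<xi> u)) L"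

lemma el_sec_simps [simp]:
  "el_sec u [] = []" "el_sec u ((a, b, \<xi>) # L) = (a, b, \<xi> u) # el_sec u L" "el_sec u (L @ L') = el_sec u L @ el_sec u L'"
  by (simp_all add: el_sec_def)

context wiener
begin

text \<open>Coefficients depend on \<open>u\<close> jointly measurably, but the intervals do not:
  the dependence on \<open>u\<close> is built from indicators of sets of parameters, for which
  common intervals suffice.\<close>

definition field_elementary :: "(real \<times> real \<times> (real \<Rightarrow> 'a \<Rightarrow> real)) list \<Rightarrow> bool" where
  "field_elementary L \<longleftrightarrow> (\<forall>(a, b, \<xi>)\<in>set L. 0 \<le> a \<and> a \<le> b \<and> b \<le> T \<and>
     (\<lambda>p. \<xi> (fst p) (snd p)) \<in> L0 (lu \<Otimes>\<^sub>M F a) \<and>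
     (\<exists>K. \<forall>u\<in>{0..T}. \<forall>w\<in>space M. \<bar>\<xi> u w\<bar> \<le> K))"

lemma field_elementary_simps [simp]:
  "field_elementary []"
  "field_elementary ((a, b, \<xi>) # L) \<longleftrightarrow> 0 \<le> a \<and> a \<le> b \<and> b \<le> T \<and>
     (\<lambda>p. \<xi> (fst p) (snd p)) \<in> L0 (lu \<Otimes>\<^sub>M F a) \<and>
     (\<exists>K. \<forall>u\<in>{0..T}. \<forall>w\<in>space M. \<bar>\<xi> u w\<bar> \<le> K) \<and> field_elementary L"
  "field_elementary (L @ L') \<longleftrightarrow> field_elementary L \<and> field_elementary L'"
  unfolding field_elementary_def by (simp_all add: ball_Un conj_assoc)

lemma measurable_section_F:
  assumes "(\<lambda>p. \<xi> (fst p) (snd p)) \<in> L0 (lu \<Otimes>\<^sub>M N)" "u \<in> {0..T}"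
  shows "\<xi> u \<in> L0 N"
  using measurable_compose_Pair1[OF _ assms(1), of u] assms(2) by simp

lemma elementary_sec: "u \<in> {0..T} \<Longrightarrow> field_elementary L \<Longrightarrow> elementary (el_sec u L)"
proof (induction L)
  case (Cons x L)
  obtain a b \<xi> where x: "x = (a, b, \<xi>)" by (cases x)
  have f: "0 \<le> a" "a \<le> b" "b \<le> T" "(\<lambda>p. \<xi> (fst p) (snd p)) \<in> L0 (lu \<Otimes>\<^sub>M F a)"
    and K: "\<exists>K. \<forall>u\<in>{0..T}. \<forall>w\<in>space M. \<bar>\<xi> u w\<bar> \<le> K" and L: "field_elementary L"
    using Cons.prems(2) by (simp_all add: x)
  have "elementary_step a b (\<xi> u)"
    unfolding elementary_step_def using f(1-3) measurable_section_F[OF f(4) Cons.prems(1)] K Cons.prems(1) by blast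
  then show ?case using Cons.IH[OF Cons.prems(1) L] by (simp add: x)
qed simp

lemma measurable_pair_F_M:
  assumes "g \<in> L0 (lu \<Otimes>\<^sub>M F t)" "0 \<le> t" "t \<le> T"
  shows "g \<in> L0 TM"
  by (rule measurable_from_subalg[OF subalgebra_pair[OF F_sub[OF assms(2,3)]] assms(1)])

lemma el_int_sec_measurable:
  assumes t: "0 \<le> t" "t \<le> T"
  shows "field_elementary L \<Longrightarrow> (\<lambda>p. el_int (el_sec (fst p) L) t (snd p)) \<in> L0 TM"
proof (induction L)
  case (Cons x L)
  obtain a b \<xi> where x: "x = (a, b, \<xi>)" by (cases x)
  have f: "0 \<le> a" "a \<le> b" "b \<le> T" "(\<lambda>p. \<xi> (fst p) (snd p)) \<in> L0 (lu \<Otimes>\<^sub>M F a)" and L: "field_elementary L"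
    using Cons.prems by (simp_all add: x)
  have aT: "a \<le> T" using f by simp
  have W: "(\<lambda>p. W s (snd p)) \<in> L0 TM" if "0 \<le> s" "s \<le> T" for s
    by (rule measurable_compose[OF measurable_snd W_measurable[OF that]])
  have "(\<lambda>p. \<xi> (fst p) (snd p) * (W (min b t) (snd p) - W (min a t) (snd p)) + el_int (el_sec (fst p) L) t (snd p)) \<in> L0 TM"
    using f t by (intro borel_measurable_add borel_measurable_times borel_measurable_diff W Cons.IH[OF L] measurable_pair_F_M[OF f(4) f(1) aT]) auto
  then show ?case by (simp add: x)
qed simp

text \<open>Here the first component of \<open>TM\<close> carries the parameter \<open>u\<close>,
  not the time. The constant of the scalar notion becomes a bounded function of
  \<open>u\<close>.\<close>

definition approximable_field :: "(real \<times> 'a \<Rightarrow> real) \<Rightarrow> bool" where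
  "approximable_field X \<longleftrightarrow> X \<in> L0 TM \<and>
     (\<forall>\<epsilon>>0. \<exists>c L. c \<in> L0 lu \<and> (\<exists>K. \<forall>u\<in>{0..T}. \<bar>c u\<bar> \<le> K) \<and> field_elementary L \<and>
        (sq_norm TM (\<lambda>p. X p - c (fst p) - el_int (el_sec (fst p) L) T (snd p))) < ennreal \<epsilon>)"

lemma approximable_fieldI:
  assumes X: "X \<in> L0 TM"
    and app: "\<And>\<epsilon>. \<epsilon> > 0 \<Longrightarrow> \<exists>X'. approximable_field X' \<and> (sq_norm TM (\<lambda>p. X p - X' p)) < ennreal \<epsilon>"
  shows "approximable_field X"
  unfolding approximable_field_def
proof (intro conjI allI impI X)
  fix \<epsilon> :: real assume "\<epsilon> > 0"
  then have e4: "\<epsilon> / 4 > 0" by simp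
  from app[OF this] obtain X' where X': "approximable_field X'" "sq_norm TM (\<lambda>p. X p - X' p) < ennreal (\<epsilon> / 4)" by blast
  from X'(1) e4 obtain c L where cL: "c \<in> L0 lu" "\<exists>K. \<forall>u\<in>{0..T}. \<bar>c u\<bar> \<le> K" "field_elementary L"
      "sq_norm TM (\<lambda>p. X' p - c (fst p) - el_int (el_sec (fst p) L) T (snd p)) < ennreal (\<epsilon> / 4)"
    unfolding approximable_field_def by blast
  have X'm: "X' \<in> L0 TM" using X'(1) by (simp add: approximable_field_def)
  have T: "0 \<le> T" using T_pos by simp
  have cm: "(\<lambda>p. c (fst p)) \<in> L0 TM" by (rule measurable_compose[OF measurable_fst cL(1)])
  note m = X X'm cm el_int_sec_measurable[OF T order_refl cL(3)]
  have "sq_norm TM (\<lambda>p. X p - c (fst p) - el_int (el_sec (fst p) L) T (snd p))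
      = sq_norm TM (\<lambda>p. (X p - X' p) + (X' p - c (fst p) - el_int (el_sec (fst p) L) T (snd p)))"
    by (simp add: algebra_simps)
  also have "\<dots> \<le> 2 * sq_norm TM (\<lambda>p. X p - X' p) + 2 * sq_norm TM (\<lambda>p. X' p - c (fst p) - el_int (el_sec (fst p) L) T (snd p))"
    by (rule nn_integral_sq_add_le) (intro borel_measurable_diff m)+
  also have "\<dots> < 2 * ennreal (\<epsilon> / 4) + 2 * ennreal (\<epsilon> / 4)"
    by (intro add_strict_mono ennreal_mult_strict_left_mono X'(2) cL(4)) auto
  also have "\<dots> = ennreal \<epsilon>"
  proof -
    have "2 * ennreal (\<epsilon> / 4) = ennreal (2 * (\<epsilon> / 4))" using e4 by (subst ennreal_mult) auto
    then show ?thesis using e4 by (simp add: ennreal_plus[symmetric] del: ennreal_plus)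
  qed
  finally show "\<exists>c L. c \<in> L0 lu \<and> (\<exists>K. \<forall>u\<in>{0..T}. \<bar>c u\<bar> \<le> K) \<and> field_elementary L \<and>
        (sq_norm TM (\<lambda>p. X p - c (fst p) - el_int (el_sec (fst p) L) T (snd p))) < ennreal \<epsilon>"
    using cL(1-3) by blast
qed

lemma approximable_field_limit:
  assumes X: "X \<in> L0 TM" and X': "\<And>m. approximable_field (X' m)"
    and lim: "(\<lambda>m. \<integral>\<^sup>+p. ennreal ((X p - X' m p)\<^sup>2) \<partial>TM) \<longlonglongrightarrow> 0"
  shows "approximable_field X"
proof (rule approximable_fieldI[OF X])
  fix \<epsilon> :: real assume "\<epsilon> > 0"
  then have "0 < ennreal \<epsilon>" by simp
  from order_tendstoD(2)[OF lim this] obtain m where "sq_norm TM (\<lambda>p. X p - X' m p) < ennreal \<epsilon>"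
    by (auto simp: eventually_sequentially)
  then show "\<exists>X'. approximable_field X' \<and> (sq_norm TM (\<lambda>p. X p - X' p)) < ennreal \<epsilon>" using X' by blast
qed

lemma approximable_field_cong_AE:
  assumes X: "X \<in> L0 TM" and X': "approximable_field X'" and e: "AE p in TM. X p = X' p"
  shows "approximable_field X"
proof (rule approximable_field_limit[OF X, of "\<lambda>_. X'"])
  have "sq_norm TM (\<lambda>p. X p - X' p) = (\<integral>\<^sup>+p. 0 \<partial>TM)"
    by (rule nn_integral_cong_AE) (use e in \<open>eventually_elim, simp\<close>)
  then show "(\<lambda>m. \<integral>\<^sup>+p. ennreal ((X p - X' p)\<^sup>2) \<partial>TM) \<longlonglongrightarrow> 0" by simp
qed (rule X')

lemma field_elementary_map:
  assumes [measurable]: "h \<in> L0 lu" and K': "\<forall>u\<in>{0..T}. \<bar>h u\<bar> \<le> K'"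
  shows "field_elementary L \<Longrightarrow> field_elementary (map (\<lambda>(a, b, \<xi>). (a, b, \<lambda>u w. h u * \<xi> u w)) L) \<and>
    (\<forall>u t w. el_int (el_sec u (map (\<lambda>(a, b, \<xi>). (a, b, \<lambda>u w. h u * \<xi> u w)) L)) t w = h u * el_int (el_sec u L) t w)"
proof (induction L)
  case (Cons x L)
  obtain a b \<xi> where x: "x = (a, b, \<xi>)" by (cases x)
  have f: "0 \<le> a" "a \<le> b" "b \<le> T" "(\<lambda>p. \<xi> (fst p) (snd p)) \<in> L0 (lu \<Otimes>\<^sub>M F a)"
    and K: "\<exists>K. \<forall>u\<in>{0..T}. \<forall>w\<in>space M. \<bar>\<xi> u w\<bar> \<le> K" and L: "field_elementary L"
    using Cons.prems by (simp_all add: x)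
  have "(\<lambda>p. h (fst p)) \<in> L0 (lu \<Otimes>\<^sub>M F a)" by (rule measurable_compose[OF measurable_fst assms(1)])
  then have m: "(\<lambda>p. h (fst p) * \<xi> (fst p) (snd p)) \<in> L0 (lu \<Otimes>\<^sub>M F a)" using f(4) by (rule borel_measurable_times)
  from K obtain K where K: "\<forall>u\<in>{0..T}. \<forall>w\<in>space M. \<bar>\<xi> u w\<bar> \<le> K" by blast
  have "\<forall>u\<in>{0..T}. \<forall>w\<in>space M. \<bar>h u * \<xi> u w\<bar> \<le> K' * K"
  proof (intro ballI)
    fix u w assume u: "u \<in> {0..T}" "w \<in> space M"
    have h: "\<bar>h u\<bar> \<le> K'" using K' u(1) by blast
    moreover have "\<bar>\<xi> u w\<bar> \<le> K" using K u by blast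
    moreover have "0 \<le> K'" using h by linarith
    ultimately show "\<bar>h u * \<xi> u w\<bar> \<le> K' * K" unfolding abs_mult by (intro mult_mono) auto
  qed
  then have "\<exists>K. \<forall>u\<in>{0..T}. \<forall>w\<in>space M. \<bar>h u * \<xi> u w\<bar> \<le> K" by blast
  then show ?case using Cons.IH[OF L] f m by (simp add: x algebra_simps)
qed simp

lemma approximable_field_add:
  assumes X: "approximable_field X" and Y: "approximable_field Y"
  shows "approximable_field (\<lambda>p. X p + d * Y p)"
  unfolding approximable_field_def
proof (intro conjI allI impI)
  have Xm: "X \<in> L0 TM" and Ym: "Y \<in> L0 TM" using X Y by (simp_all add: approximable_field_def)
  show "(\<lambda>p. X p + d * Y p) \<in> L0 TM" using Xm Ym by measurable
  fix \<epsilon> :: real assume \<epsilon>: "\<epsilon> > 0"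
  \<comment> \<open>Chosen so that
    \<open>2 * \<delta> + 2 * (d^2 * \<delta>) = \<epsilon> / 2\<close>.\<close>
  define \<delta> where "\<delta> = \<epsilon> / (4 * (1 + d\<^sup>2))"
  have d1: "1 + d\<^sup>2 > 0" by (simp add: add_pos_nonneg)
  have \<delta>: "\<delta> > 0" using \<epsilon> d1 by (simp add: \<delta>_def)
  from X \<delta> obtain c L where cL: "c \<in> L0 lu" "\<exists>K. \<forall>u\<in>{0..T}. \<bar>c u\<bar> \<le> K" "field_elementary L"
      "sq_norm TM (\<lambda>p. X p - c (fst p) - el_int (el_sec (fst p) L) T (snd p)) < ennreal \<delta>"
    unfolding approximable_field_def by blast
  from Y \<delta> obtain c' L' where cL': "c' \<in> L0 lu" "\<exists>K. \<forall>u\<in>{0..T}. \<bar>c' u\<bar> \<le> K" "field_elementary L'"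
      "sq_norm TM (\<lambda>p. Y p - c' (fst p) - el_int (el_sec (fst p) L') T (snd p)) < ennreal \<delta>"
    unfolding approximable_field_def by blast
  let ?L' = "map (\<lambda>(a, b, \<xi>). (a, b, \<lambda>u w. d * \<xi> u w)) L'"
  have dm: "(\<lambda>_. d) \<in> L0 lu" by simp
  have db: "\<forall>u\<in>{0..T}. \<bar>d\<bar> \<le> \<bar>d\<bar>" by simp
  note L'm = field_elementary_map[OF dm db cL'(3)]
  have T: "0 \<le> T" using T_pos by simp
  have cm: "(\<lambda>p. c (fst p)) \<in> L0 TM" by (rule measurable_compose[OF measurable_fst cL(1)])
  have cm': "(\<lambda>p. c' (fst p)) \<in> L0 TM" by (rule measurable_compose[OF measurable_fst cL'(1)])
  note m = Xm Ym cm cm' el_int_sec_measurable[OF T order_refl cL(3)] el_int_sec_measurable[OF T order_refl cL'(3)]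
  let ?A = "\<lambda>p. X p - c (fst p) - el_int (el_sec (fst p) L) T (snd p)"
  let ?B = "\<lambda>p. Y p - c' (fst p) - el_int (el_sec (fst p) L') T (snd p)"
  have Am: "?A \<in> L0 TM" and Bm: "?B \<in> L0 TM" by (intro borel_measurable_diff m)+
  have "sq_norm TM (\<lambda>p. X p + d * Y p - (c (fst p) + d * c' (fst p)) - el_int (el_sec (fst p) (L @ ?L')) T (snd p))
      = sq_norm TM (\<lambda>p. ?A p + d * ?B p)"
    using L'm by (simp add: algebra_simps)
  also have "\<dots> \<le> 2 * sq_norm TM ?A + 2 * sq_norm TM (\<lambda>p. d * ?B p)"
    by (rule nn_integral_sq_add_le) (intro borel_measurable_times borel_measurable_const Am Bm)+
  also have "sq_norm TM (\<lambda>p. d * ?B p) = ennreal (d\<^sup>2) * sq_norm TM ?B"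
    unfolding power_mult_distrib using Bm by (simp add: ennreal_mult nn_integral_cmult)
  also have "2 * sq_norm TM ?A + 2 * (ennreal (d\<^sup>2) * sq_norm TM ?B) \<le> 2 * ennreal \<delta> + 2 * (ennreal (d\<^sup>2) * ennreal \<delta>)"
    by (intro add_mono mult_left_mono less_imp_le[OF cL(4)] less_imp_le[OF cL'(4)]) auto
  also have "\<dots> = ennreal (\<epsilon> / 2)"
  proof -
    have "2 * ennreal \<delta> + 2 * (ennreal (d\<^sup>2) * ennreal \<delta>) = ennreal (2 * \<delta> + 2 * (d\<^sup>2 * \<delta>))"
      using \<delta> by (simp add: ennreal_mult ennreal_plus)
    also have "2 * \<delta> + 2 * (d\<^sup>2 * \<delta>) = \<epsilon> / 2"
    proof -
      have "e / (4 * q) * q = e / 4" if "q > 0" for e q :: real using that by simp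
      from this[OF d1] have "\<delta> * (1 + d\<^sup>2) = \<epsilon> / 4" unfolding \<delta>_def .
      then show ?thesis by (simp add: algebra_simps)
    qed
    finally show ?thesis .
  qed
  also have "\<dots> < ennreal \<epsilon>" using \<epsilon> by (intro ennreal_lessI) auto
  finally have lt: "sq_norm TM (\<lambda>p. X p + d * Y p - (c (fst p) + d * c' (fst p)) - el_int (el_sec (fst p) (L @ ?L')) T (snd p)) < ennreal \<epsilon>" .
  have "\<exists>K. \<forall>u\<in>{0..T}. \<bar>c u + d * c' u\<bar> \<le> K"
  proof -
    obtain K K' where K: "\<forall>u\<in>{0..T}. \<bar>c u\<bar> \<le> K" "\<forall>u\<in>{0..T}. \<bar>c' u\<bar> \<le> K'" using cL(2) cL'(2) by blast
    have "\<bar>c u + d * c' u\<bar> \<le> K + \<bar>d\<bar> * K'" if u: "u \<in> {0..T}" for u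
    proof -
      have "\<bar>d * c' u\<bar> \<le> \<bar>d\<bar> * K'" unfolding abs_mult using bspec[OF K(2) u] by (rule mult_left_mono) simp
      then show ?thesis using bspec[OF K(1) u] by linarith
    qed
    then show ?thesis by blast
  qed
  moreover have "(\<lambda>u. c u + d * c' u) \<in> L0 lu" using cL(1) cL'(1) by measurable
  moreover have "field_elementary (L @ ?L')" using cL(3) L'm by simp
  ultimately show "\<exists>c L. c \<in> L0 lu \<and> (\<exists>K. \<forall>u\<in>{0..T}. \<bar>c u\<bar> \<le> K) \<and> field_elementary L \<and>
        (sq_norm TM (\<lambda>p. X p + d * Y p - c (fst p) - el_int (el_sec (fst p) L) T (snd p))) < ennreal \<epsilon>"
    using lt by (intro exI[of _ "\<lambda>u. c u + d * c' u"] exI[of _ "L @ ?L'"] conjI)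
qed

lemma approximable_field_const: "approximable_field (\<lambda>_. c)"
  unfolding approximable_field_def
proof (intro conjI allI impI)
  fix \<epsilon> :: real assume "\<epsilon> > 0"
  then show "\<exists>c' L. c' \<in> L0 lu \<and> (\<exists>K. \<forall>u\<in>{0..T}. \<bar>c' u\<bar> \<le> K) \<and> field_elementary L \<and>
      (sq_norm TM (\<lambda>p. c - c' (fst p) - el_int (el_sec (fst p) L) T (snd p))) < ennreal \<epsilon>"
    by (intro exI[of _ "\<lambda>_. c"] exI[of _ "[]"] conjI exI[of _ "\<bar>c\<bar>"]) auto
qed simp

lemma approximable_field_sum:
  assumes "\<And>i. approximable_field (X i)"
  shows "approximable_field (\<lambda>p. \<Sum>i<(n::nat). X i p)"
proof (induction n)
  case 0
  then show ?case by (simp add: approximable_field_const)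
next
  case (Suc n)
  from approximable_field_add[OF this assms, of 1 n] show ?case by simp
qed

lemma approximable_field_product:
  assumes X: "approximable X" and U: "U \<in> sets lu"
  shows "approximable_field (\<lambda>p. indicator U (fst p) * X (snd p))"
  unfolding approximable_field_def
proof (intro conjI allI impI)
  have Xm[measurable]: "X \<in> L0 M" using X by (simp add: approximable_def)
  have U'[measurable]: "indicator U \<in> L0 lu" using U by (rule borel_measurable_indicator)
  have iU: "(\<lambda>p. indicator U (fst p) :: real) \<in> L0 TM" by (rule measurable_compose[OF measurable_fst U'])
  have XT: "(\<lambda>p. X (snd p)) \<in> L0 TM" by (rule measurable_compose[OF measurable_snd Xm])
  show "(\<lambda>p. indicator U (fst p) * X (snd p)) \<in> L0 TM" by (rule borel_measurable_times[OF iU XT])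
  fix \<epsilon> :: real assume \<epsilon>: "\<epsilon> > 0"
  \<comment> \<open>Integration over the parameter multiplies the error by the length
    \<open>T\<close>.\<close>
  then have "\<epsilon> / T > 0" using T_pos by simp
  with X obtain c L where L: "elementary L" "sq_norm M (\<lambda>w. X w - c - el_int L T w) < ennreal (\<epsilon> / T)"
    unfolding approximable_def by blast
  have T: "0 \<le> T" using T_pos by simp
  define L' where "L' = map (\<lambda>(a, b, \<xi>). (a, b, \<lambda>u w. indicator U u * \<xi> w)) L"
  have L': "field_elementary L' \<and> (\<forall>u. el_int (el_sec u L') T w = indicator U u * el_int L T w)" for w
    using L(1) unfolding L'_def
  proof (induction L)
    case (Cons x L)
    obtain a b \<xi> where x: "x = (a, b, \<xi>)" by (cases x)
    have 1: "elementary_step a b \<xi>" and L: "elementary L" using Cons.prems by (simp_all add: x)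
    then obtain K where f: "0 \<le> a" "a \<le> b" "b \<le> T" "\<xi> \<in> L0 (F a)" "\<forall>w\<in>space M. \<bar>\<xi> w\<bar> \<le> K"
      unfolding elementary_step_def by blast
    have "(\<lambda>p. indicator U (fst p) * \<xi> (snd p)) \<in> L0 (lu \<Otimes>\<^sub>M F a)"
      by (rule borel_measurable_times[OF measurable_compose[OF measurable_fst U'] measurable_compose[OF measurable_snd f(4)]])
    moreover have "\<forall>u\<in>{0..T}. \<forall>w\<in>space M. \<bar>indicator U u * \<xi> w\<bar> \<le> \<bar>K\<bar>"
    proof (intro ballI)
      fix u w assume "w \<in> space M"
      then have "\<bar>\<xi> w\<bar> \<le> K" using f(5) by blast
      then show "\<bar>indicator U u * \<xi> w\<bar> \<le> \<bar>K\<bar>" by (cases "u \<in> U") auto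
    qed
    then have "\<exists>K. \<forall>u\<in>{0..T}. \<forall>w\<in>space M. \<bar>indicator U u * \<xi> w\<bar> \<le> K" by blast
    ultimately show ?case using Cons.IH[OF L] f(1-3) by (simp add: x algebra_simps)
  qed simp
  note [measurable] = el_int_measurable[OF L(1) T order_refl]
  let ?A = "\<lambda>w. X w - c - el_int L T w"
  have "sq_norm TM (\<lambda>p. indicator U (fst p) * X (snd p) - indicator U (fst p) * c - el_int (el_sec (fst p) L') T (snd p))
      \<le> sq_norm TM (\<lambda>p. ?A (snd p))"
    using L' by (intro nn_integral_mono ennreal_leI) (auto simp: indicator_def)
  also have "\<dots> = (\<integral>\<^sup>+u. sq_norm M ?A \<partial>lu)"
    by (subst nn_integral_fst[symmetric]) simp_all
  also have "\<dots> = sq_norm M ?A * ennreal T"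
    using T by (simp add: lborel_upto_def emeasure_restrict_space)
  also have "\<dots> < ennreal (\<epsilon> / T) * ennreal T"
    using L(2) T_pos by (intro ennreal_mult_strict_right_mono) auto
  also have "\<dots> = ennreal \<epsilon>" using T_pos \<epsilon> by (simp add: ennreal_mult[symmetric])
  finally have lt: "sq_norm TM (\<lambda>p. indicator U (fst p) * X (snd p) - indicator U (fst p) * c - el_int (el_sec (fst p) L') T (snd p)) < ennreal \<epsilon>" .
  have "\<exists>K. \<forall>u\<in>{0..T}. \<bar>indicator U u * c\<bar> \<le> K" by (intro exI[of _ "\<bar>c\<bar>"]) (simp add: indicator_def)
  moreover have "(\<lambda>u. indicator U u * c) \<in> L0 lu" using U' by measurable
  ultimately show "\<exists>c L. c \<in> L0 lu \<and> (\<exists>K. \<forall>u\<in>{0..T}. \<bar>c u\<bar> \<le> K) \<and> field_elementary L \<and>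
        (sq_norm TM (\<lambda>p. indicator U (fst p) * X (snd p) - c (fst p) - el_int (el_sec (fst p) L) T (snd p))) < ennreal \<epsilon>"
    using lt L' by (intro exI[of _ "\<lambda>u. indicator U u * c"] exI[of _ L'] conjI) blast+
qed

text \<open>With lists of constraints, intersection of events becomes concatenation.\<close>

definition path_event :: "(real \<times> real) list \<Rightarrow> 'a set" where
  "path_event xs = {w\<in>space M. \<forall>(r, a)\<in>set xs. W r w \<le> a}"

lemma path_event_sets:
  assumes "\<forall>(r, a)\<in>set xs. 0 \<le> r \<and> r \<le> T"
  shows "path_event xs \<in> sets M"
  unfolding path_event_def
proof (rule sets.sets_Collect_finite_All)
  fix p assume p: "p \<in> set xs"
  obtain r a where ra: "p = (r, a)" by (cases p)
  have [measurable]: "W r \<in> L0 M" using assms p ra by (intro W_measurable) auto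
  show "{w\<in>space M. case p of (r, a) \<Rightarrow> W r w \<le> a} \<in> sets M" unfolding ra by simp
qed simp

lemma approximable_field_path_event:
  assumes xs: "\<forall>(r, a)\<in>set xs. 0 \<le> r \<and> r \<le> T" and U: "U \<in> sets lu"
  shows "approximable_field (indicator (U \<times> path_event xs))"
proof -
  \<comment> \<open>The constraints are put in order of decreasing time, as required for products of
    smooth functions of the path.\<close>
  define ys where "ys = rev (sort_key fst xs)"
  have ys: "set ys = set xs" by (simp add: ys_def)
  have srt: "sorted_wrt (\<lambda>p q. fst q \<le> fst p) ys"
    using sorted_sort_key[of fst xs] unfolding ys_def sorted_wrt_rev sorted_map .
  define zs where "zs m = map (\<lambda>(r, a). (r, half_line_approx m a)) ys" for m
  have zs: "approximable (path_product (zs m))" for m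
  proof (rule approximable_path_product)
    show "\<forall>(r, g)\<in>set (zs m). 0 \<le> r \<and> r \<le> T \<and> (\<exists>K g'. smooth_pair K g g')"
      using xs half_line_approx_smooth unfolding zs_def by (auto simp: ys)
    show "sorted_wrt (\<lambda>p q. fst q \<le> fst p) (zs m)"
      using srt unfolding zs_def sorted_wrt_map by (rule sorted_wrt_mono_rel[rotated]) auto
  qed
  have b: "\<bar>path_product (map (\<lambda>(r, a). (r, half_line_approx m a)) zs) w\<bar> \<le> 1" for m zs w
  proof (induction zs)
    case (Cons z zs)
    obtain r a where z: "z = (r, a)" by (cases z)
    show ?case using Cons half_line_approx_bounds[of m a "W r w"]
      by (simp add: z abs_mult mult_le_one)
  qed simp
  have lim: "(\<lambda>m. path_product (map (\<lambda>(r, a). (r, half_line_approx m a)) zs) w) \<longlonglongrightarrow> (if \<forall>(r, a)\<in>set zs. W r w \<le> a then 1 else 0)" for zs w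
  proof (induction zs)
    case (Cons z zs)
    obtain r a where z: "z = (r, a)" by (cases z)
    have e: "(if \<forall>(r, a)\<in>set (z # zs). W r w \<le> a then 1 else 0) =
        indicator {..a} (W r w) * (if \<forall>(r, a)\<in>set zs. W r w \<le> a then 1 else 0 :: real)"
      by (simp add: z indicator_def)
    show ?case unfolding e using tendsto_mult[OF half_line_approx_tendsto[of a "W r w"] Cons] by (simp add: z)
  qed simp
  have EM: "path_event xs \<in> sets M" by (rule path_event_sets[OF xs])
  have m: "indicator (U \<times> path_event xs) \<in> L0 TM" using EM U by (intro borel_measurable_indicator pair_measureI)
  have af: "approximable_field (\<lambda>p. indicator U (fst p) * path_product (zs m) (snd p))" for m
    by (rule approximable_field_product[OF zs U])
  show ?thesis
  proof (rule approximable_field_limit[OF m af])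
    show "(\<lambda>m. \<integral>\<^sup>+p. ennreal ((indicator (U \<times> path_event xs) p - indicator U (fst p) * path_product (zs m) (snd p))\<^sup>2) \<partial>TM) \<longlonglongrightarrow> 0"
    proof (rule nn_integral_sq_dominated[where G="\<lambda>_. 1"])
      show "(\<lambda>p. indicator U (fst p) * path_product (zs m) (snd p)) \<in> L0 TM" for m
        using af[of m] by (simp add: approximable_field_def)
      show "\<bar>indicator U (fst p) * path_product (zs m) (snd p)\<bar> \<le> 1" for m p
        using b[of m ys "snd p"] by (simp add: zs_def indicator_def)
      show "(\<lambda>m. indicator U (fst p) * path_product (zs m) (snd p)) \<longlonglongrightarrow> indicator (U \<times> path_event xs) p" if p: "p \<in> space TM" for p
      proof -
        have "indicator (U \<times> path_event xs) p = indicator U (fst p) * (if \<forall>(r, a)\<in>set ys. W r (snd p) \<le> a then 1 else 0 :: real)"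
          using p by (cases p) (simp add: ys path_event_def indicator_def space_pair_measure)
        then show ?thesis using tendsto_mult[OF tendsto_const lim[of ys "snd p"]] by (simp add: zs_def)
      qed
      show "(\<integral>\<^sup>+p. ennreal (1\<^sup>2) \<partial>TM) < \<infinity>"
        using finite_measure.emeasure_finite[OF finite_measure_TM, of "space TM"] by (simp add: less_top)
    qed (use m in auto)
  qed
qed

end

text \<open>Density of the elementary integrals rests on \<open>F T\<close> being generated by
  \<open>W\<close> and the null sets. Half-lines are enough as generators, and they are what
  \<open>half_line_approx\<close> approximates.\<close>

locale wiener_generated = wiener +
  assumes F_generated: "sets (F T) \<subseteq> sigma_sets (space M)
    ({W r -` {..a} \<inter> space M |r a. 0 \<le> r \<and> r \<le> T} \<union> null_sets M)"
begin

definition base_events :: "'a set set" where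
  "base_events = {path_event xs |xs. \<forall>(r, a)\<in>set xs. 0 \<le> r \<and> r \<le> T} \<union> null_sets M"

definition base_rectangles :: "(real \<times> 'a) set set" where
  "base_rectangles = {U \<times> A |U A. U \<in> sets lu \<and> A \<in> base_events}"

lemma base_events_sets: "A \<in> base_events \<Longrightarrow> A \<in> sets M"
  using path_event_sets by (auto simp: base_events_def)

lemma Int_stable_base_events: "Int_stable base_events"
  unfolding Int_stable_def
proof (intro ballI)
  fix A B assume A: "A \<in> base_events" and B: "B \<in> base_events"
  show "A \<inter> B \<in> base_events"
  proof (cases "A \<in> null_sets M \<or> B \<in> null_sets M")
    case True
    then have "A \<inter> B \<in> null_sets M"
      using base_events_sets[OF A] base_events_sets[OF B] null_set_Int1 null_set_Int2 by blast
    then show ?thesis by (simp add: base_events_def)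
  next
    case False
    then obtain xs ys where xs: "A = path_event xs" "\<forall>(r, a)\<in>set xs. 0 \<le> r \<and> r \<le> T"
      and ys: "B = path_event ys" "\<forall>(r, a)\<in>set ys. 0 \<le> r \<and> r \<le> T"
      using A B unfolding base_events_def by blast
    have "A \<inter> B = path_event (xs @ ys)" unfolding xs ys path_event_def by auto
    moreover have "\<forall>(r, a)\<in>set (xs @ ys). 0 \<le> r \<and> r \<le> T" using xs(2) ys(2) by (simp add: ball_Un)
    ultimately show ?thesis unfolding base_events_def by blast
  qed
qed

lemma Int_stable_base_rectangles: "Int_stable base_rectangles"
  unfolding Int_stable_def
proof (intro ballI)
  fix A B assume "A \<in> base_rectangles" "B \<in> base_rectangles"
  then obtain U C V D where e: "A = U \<times> C" "B = V \<times> D" "U \<in> sets lu" "V \<in> sets lu"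
      "C \<in> base_events" "D \<in> base_events" unfolding base_rectangles_def by blast
  have "A \<inter> B = (U \<inter> V) \<times> (C \<inter> D)" unfolding e by blast
  moreover have "C \<inter> D \<in> base_events" using Int_stable_base_events e(5,6) by (simp add: Int_stable_def)
  ultimately show "A \<inter> B \<in> base_rectangles" unfolding base_rectangles_def using e(3,4) by blast
qed

lemma base_rectangles_sets: "base_rectangles \<subseteq> sets TM"
  unfolding base_rectangles_def using base_events_sets by auto

lemma sets_pair_generated: "sets (lu \<Otimes>\<^sub>M F T) \<subseteq> sigma_sets (space TM) base_rectangles"
proof -
  have T: "0 \<le> T" using T_pos by simp
  have Pow: "base_rectangles \<subseteq> Pow (space TM)" using base_rectangles_sets sets.sets_into_space by blast
  interpret S: sigma_algebra "space TM" "sigma_sets (space TM) base_rectangles"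
    by (rule sigma_algebra_sigma_sets[OF Pow])
  have sp: "space M \<in> base_events"
  proof -
    have "space M = path_event []" by (simp add: path_event_def)
    then show ?thesis unfolding base_events_def by (intro UnI1 CollectI exI[of _ "[]"]) simp
  qed
  have h1: "U \<times> A \<in> sigma_sets (space TM) base_rectangles" if U: "U \<in> sets lu" and A: "A \<in> sigma_sets (space M) base_events" for U A
    using A
  proof (induction rule: sigma_sets.induct)
    case (Basic a)
    then show ?case using U unfolding base_rectangles_def
      by (intro sigma_sets.Basic CollectI exI[of _ U] exI[of _ a]) simp
  next
    case Empty
    then show ?case by (simp add: sigma_sets.Empty)
  next
    case (Compl a)
    have "U \<times> space M \<in> sigma_sets (space TM) base_rectangles"
      using U sp unfolding base_rectangles_def
      by (intro sigma_sets.Basic CollectI exI[of _ U] exI[of _ "space M"]) simp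
    then have "U \<times> space M - U \<times> a \<in> sigma_sets (space TM) base_rectangles" using Compl.IH by (rule S.Diff)
    moreover have "U \<times> space M - U \<times> a = U \<times> (space M - a)" by blast
    ultimately show ?case by simp
  next
    case (Union a)
    have "(\<Union>i. U \<times> a i) \<in> sigma_sets (space TM) base_rectangles" by (rule sigma_sets.Union[OF Union.IH])
    moreover have "(\<Union>i. U \<times> a i) = U \<times> (\<Union>i. a i)" by blast
    ultimately show ?case by simp
  qed
  have h2: "sets (F T) \<subseteq> sigma_sets (space M) base_events"
  proof (rule order_trans[OF F_generated sigma_sets_mono'])
    show "{W r -` {..a} \<inter> space M |r a. 0 \<le> r \<and> r \<le> T} \<union> null_sets M \<subseteq> base_events"
    proof (rule Un_least)
      show "{W r -` {..a} \<inter> space M |r a. 0 \<le> r \<and> r \<le> T} \<subseteq> base_events"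
      proof safe
        fix r a assume r: "0 \<le> r" "r \<le> T"
        have "W r -` {..a} \<inter> space M = path_event [(r, a)]" by (auto simp: path_event_def)
        then show "W r -` {..a} \<inter> space M \<in> base_events" unfolding base_events_def using r
          by (intro UnI1 CollectI exI[of _ "[(r, a)]"]) simp
      qed
    qed (simp add: base_events_def)
  qed
  have h3: "{a \<times> b |a b. a \<in> sets lu \<and> b \<in> sets (F T)} \<subseteq> sigma_sets (space TM) base_rectangles"
  proof
    fix C assume "C \<in> {a \<times> b |a b. a \<in> sets lu \<and> b \<in> sets (F T)}"
    then obtain a b where C: "C = a \<times> b" "a \<in> sets lu" "b \<in> sets (F T)" by (elim CollectE exE conjE)
    show "C \<in> sigma_sets (space TM) base_rectangles" unfolding C(1) by (rule h1[OF C(2) subsetD[OF h2 C(3)]])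
  qed
  have sp2: "space lu \<times> space (F T) = space TM" using T by (simp add: space_pair_measure space_F)
  show ?thesis unfolding sets_pair_measure sp2 by (rule S.sigma_sets_subset[OF h3])
qed

text \<open>The rectangles are intersection-stable, and approximability is preserved by complements
  and by countable disjoint unions, the latter through bounded convergence. A rectangle over a null
  set is approximated by \<open>0\<close>.\<close>

lemma approximable_field_indicator:
  assumes "A \<in> sigma_sets (space TM) base_rectangles"
  shows "approximable_field (indicator A)"
proof -
  have Pow: "base_rectangles \<subseteq> Pow (space TM)" using base_rectangles_sets sets.sets_into_space by blast
  have S: "sigma_sets (space TM) base_rectangles \<subseteq> sets TM" by (rule sets.sigma_sets_subset[OF base_rectangles_sets])
  show ?thesis
    using Int_stable_base_rectangles Pow assms
  proof (induction rule: sigma_sets_induct_disjoint)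
    case (basic A)
    then obtain U C where UC: "A = U \<times> C" "U \<in> sets lu" "C \<in> base_events" unfolding base_rectangles_def by blast
    show ?case
    proof (cases "C \<in> null_sets M")
      case True
      have m: "indicator A \<in> L0 TM" using basic base_rectangles_sets by (intro borel_measurable_indicator) blast
      show ?thesis
      proof (rule approximable_field_cong_AE[OF m approximable_field_const])
        interpret P: pair_sigma_finite lu M by (rule pair_sigma_finite_TM)
        have "U \<times> C \<in> null_sets TM"
          using UC(2) True base_events_sets[OF UC(3)] emeasure_pair_measure_Times[of U lu C] by (auto simp: null_sets_def)
        then have "AE p in TM. p \<notin> A" unfolding UC(1) by (rule AE_not_in)
        then show "AE p in TM. indicator A p = (0 :: real)" by eventually_elim simp
      qed
    next
      case False
      then show ?thesis using UC approximable_field_path_event unfolding base_events_def by blast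
    qed
  next
    case empty
    then show ?case using approximable_field_const[of 0] by simp
  next
    case (compl A)
    have m: "indicator (space TM - A) \<in> L0 TM" using compl(1) S by (intro borel_measurable_indicator) blast
    show ?case
      by (rule approximable_field_cong_AE[OF m approximable_field_add[OF approximable_field_const[of 1] compl(2), of "-1"]])
        (auto simp: indicator_def intro!: AE_I2)
  next
    case (union A)
    have A: "A i \<in> sets TM" for i using union(2) S by blast
    have m: "indicator (\<Union>i. A i) \<in> L0 TM" using A by (intro borel_measurable_indicator sets.countable_UN) auto
    have s: "(\<Sum>i<n. indicator (A i) p) = (indicator (\<Union>i<n. A i) p :: real)" for n p
      using union(1) by (intro indicator_UN_disjoint[symmetric]) (auto simp: disjoint_family_on_def)
    show ?case
    proof (rule approximable_field_limit[OF m approximable_field_sum[OF union(3)]])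
      show "(\<lambda>n. \<integral>\<^sup>+p. ennreal ((indicator (\<Union>i. A i) p - (\<Sum>i<n. indicator (A i) p))\<^sup>2) \<partial>TM) \<longlonglongrightarrow> 0"
      proof (rule nn_integral_sq_dominated[where G="\<lambda>_. 1"])
        show "(\<lambda>p. \<Sum>i<n. indicator (A i) p :: real) \<in> L0 TM" for n
          using A by (intro borel_measurable_sum borel_measurable_indicator)
        show "\<bar>\<Sum>i<n. indicator (A i) p :: real\<bar> \<le> 1" for n p unfolding s by (simp add: indicator_def)
        show "(\<lambda>n. \<Sum>i<n. indicator (A i) p :: real) \<longlonglongrightarrow> indicator (\<Union>i. A i) p" for p
          unfolding s by (rule LIMSEQ_indicator_UN)
        show "(\<integral>\<^sup>+p. ennreal (1\<^sup>2) \<partial>TM) < \<infinity>"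
          using finite_measure.emeasure_finite[OF finite_measure_TM, of "space TM"] by (simp add: less_top)
      qed (use m in auto)
    qed
  qed
qed

text \<open>Finiteness of the norm sits inside the conclusion so that the induction can hand it
  down: summands and members of the monotone sequence are dominated by the whole.\<close>

lemma approximable_field_nonneg:
  assumes "X \<in> L0 (lu \<Otimes>\<^sub>M F T)" "\<And>p. 0 \<le> X p"
  shows "sq_norm TM X < \<infinity> \<longrightarrow> approximable_field X"
  using assms
proof (induction rule: borel_measurable_induct_real)
  case (set A)
  then show ?case using sets_pair_generated approximable_field_indicator by blast
next
  case (mult u c)
  show ?case
  proof (cases "c = 0")
    case True
    then show ?thesis using approximable_field_const[of 0] by simp
  next
    case False
    show ?thesis
    proof
      assume f: "sq_norm TM (\<lambda>p. c * u p) < \<infinity>"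
      have um: "u \<in> L0 TM" using mult.hyps(2) T_pos by (intro measurable_pair_F_M[of u T]) auto
      have "sq_norm TM (\<lambda>p. c * u p) = ennreal (c\<^sup>2) * sq_norm TM u"
        using um by (simp add: power_mult_distrib ennreal_mult nn_integral_cmult)
      then have "sq_norm TM u < \<infinity>" using f False by (auto simp: ennreal_mult_less_top)
      then have "approximable_field u" using mult.IH by blast
      from approximable_field_add[OF approximable_field_const[of 0] this, of c] show "approximable_field (\<lambda>p. c * u p)" by simp
    qed
  qed
next
  case (add u v)
  show ?case
  proof
    assume f: "sq_norm TM (\<lambda>p. v p + u p) < \<infinity>"
    have "sq_norm TM u \<le> sq_norm TM (\<lambda>p. v p + u p)"
      by (intro nn_integral_mono ennreal_leI power_mono) (use add.hyps(2,4) in auto)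
    then have u: "approximable_field u" using f add.IH(1) le_less_trans by blast
    have "sq_norm TM v \<le> sq_norm TM (\<lambda>p. v p + u p)"
      by (intro nn_integral_mono ennreal_leI power_mono) (use add.hyps(2,4) in auto)
    then have v: "approximable_field v" using f add.IH(2) le_less_trans by blast
    from approximable_field_add[OF v u, of 1] show "approximable_field (\<lambda>p. v p + u p)" by simp
  qed
next
  case (seq U)
  have T: "0 \<le> T" using T_pos by simp
  have sp: "space (lu \<Otimes>\<^sub>M F T) = space TM" using T by (simp add: space_pair_measure space_F)
  have lim: "(\<lambda>i. U i p) \<longlonglongrightarrow> X p" if "p \<in> space TM" for p using seq.hyps(4) that unfolding sp .
  have le: "U i p \<le> X p" if "p \<in> space TM" for i p
    
  proof (rule incseq_le[OF _ lim[OF that]])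
    show "incseq (\<lambda>i. U i p)"
      unfolding incseq_def by (intro allI impI le_funD[OF incseqD[OF seq.hyps(3)]])
  qed
  have XM: "X \<in> L0 TM" by (rule measurable_pair_F_M[OF assms(1) T order_refl])
  have UM: "U i \<in> L0 TM" for i by (rule measurable_pair_F_M[OF seq.hyps(1) T order_refl])
  show ?case
  proof
    assume f: "sq_norm TM X < \<infinity>"
    have "sq_norm TM (\<lambda>p. U i p) \<le> sq_norm TM X" for i
      by (intro nn_integral_mono ennreal_leI power_mono le seq.hyps(2))
    then have "approximable_field (U i)" for i using f seq.IH le_less_trans by blast
    then show "approximable_field X"
    proof (rule approximable_field_limit[OF XM])
      show "(\<lambda>i. \<integral>\<^sup>+p. ennreal ((X p - U i p)\<^sup>2) \<partial>TM) \<longlonglongrightarrow> 0"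
        by (rule nn_integral_sq_dominated[OF UM XM XM _ lim f]) (use le seq.hyps(2) in simp)
    qed
  qed
qed

lemma approximable_field_if_measurable:
  assumes X: "X \<in> L0 (lu \<Otimes>\<^sub>M F T)" and f: "sq_norm TM X < \<infinity>"
  shows "approximable_field X"
proof -
  have "approximable_field (\<lambda>p. max 0 (X p))"
  proof (rule approximable_field_nonneg[rule_format])
    have "sq_norm TM (\<lambda>p. max 0 (X p)) \<le> sq_norm TM X"
      by (intro nn_integral_mono ennreal_leI) (simp add: max_def)
    then show "sq_norm TM (\<lambda>p. max 0 (X p)) < \<infinity>" using f by (rule le_less_trans)
  qed (use X in auto)
  moreover have "approximable_field (\<lambda>p. max 0 (- X p))"
  proof (rule approximable_field_nonneg[rule_format])
    have "sq_norm TM (\<lambda>p. max 0 (- X p)) \<le> sq_norm TM X"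
      by (intro nn_integral_mono ennreal_leI) (simp add: max_def)
    then show "sq_norm TM (\<lambda>p. max 0 (- X p)) < \<infinity>" using f by (rule le_less_trans)
  qed (use X in auto)
  ultimately have "approximable_field (\<lambda>p. max 0 (X p) + - 1 * max 0 (- X p))" by (rule approximable_field_add)
  moreover have "(\<lambda>p. max 0 (X p) + - 1 * max 0 (- X p)) = X" by (auto simp: fun_eq_iff max_def)
  ultimately show ?thesis by simp
qed

end

lemma ennreal_suminf_finite_tendsto_0:
  fixes a :: "nat \<Rightarrow> ennreal"
  assumes f: "(\<Sum>k. a k) \<noteq> \<infinity>"
  shows "a \<longlonglongrightarrow> 0"
proof -
  have le: "a k \<le> (\<Sum>k. a k)" for k using sum_le_suminf[of a "{k}"] by simp
  have lt: "a k < top" for k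
    by (rule le_less_trans[OF le]) (use f in \<open>simp add: less_top\<close>)
  have a: "ennreal (enn2real (a k)) = a k" for k by (rule ennreal_enn2real[OF lt])
  have "summable (\<lambda>k. enn2real (a k))"
  proof (rule summable_suminf_not_top)
    show "(\<Sum>k. ennreal (enn2real (a k))) \<noteq> top" unfolding a using f by simp
  qed simp
  then have "(\<lambda>k. ennreal (enn2real (a k))) \<longlonglongrightarrow> ennreal 0"
    by (intro tendsto_ennrealI summable_LIMSEQ_zero)
  then show ?thesis unfolding a by simp
qed

lemma ennreal_times_finite: "x < \<infinity> \<Longrightarrow> ennreal r * x < \<infinity>"
  by (simp add: ennreal_mult_less_top)

section \<open>Martingale representation with a parameter\<close>

context wiener
begin

abbreviation TTM :: "(real \<times> real \<times> 'a) measure" where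
  "TTM \<equiv> lu \<Otimes>\<^sub>M TM"

text \<open>\<open>TTM\<close> lists time before the parameter, as the space of fields does, whereas
  stochastic analysis is done at fixed \<open>u\<close>; hence Fubini with \<open>u\<close>
  outermost.\<close>

lemma nn_integral_TTM:
  assumes g[measurable]: "g \<in> L0 TTM"
  shows "(\<integral>\<^sup>+q. g q \<partial>TTM) = (\<integral>\<^sup>+u. (\<integral>\<^sup>+p. g (fst p, u, snd p) \<partial>TM) \<partial>lu)"
proof -
  interpret lu: finite_measure lu by (rule finite_measure_lborel_upto)
  interpret TM: finite_measure TM by (rule finite_measure_TM)
  interpret P: pair_sigma_finite lu lu ..
  define h where "h t u = (\<integral>\<^sup>+w. g (t, u, w) \<partial>M)" for t u
  have g': "(\<lambda>x. g (fst (fst x), snd (fst x), snd x)) \<in> L0 ((lu \<Otimes>\<^sub>M lu) \<Otimes>\<^sub>M M)"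
    by measurable
  have h: "uncurried h \<in> L0 (lu \<Otimes>\<^sub>M lu)"
    unfolding h_def using borel_measurable_nn_integral_fst[OF g'] by simp
  have m1: "(\<lambda>p. g (t, p)) \<in> L0 TM" if "t \<in> space lu" for t
    using that by measurable
  have m2: "(\<lambda>p. g (fst p, u, snd p)) \<in> L0 TM" if "u \<in> space lu" for u
    using that by measurable
  have "(\<integral>\<^sup>+q. g q \<partial>TTM) = (\<integral>\<^sup>+t. (\<integral>\<^sup>+p. g (t, p) \<partial>TM) \<partial>lu)"
    by (rule TM.nn_integral_fst[symmetric]) (rule g)
  also have "\<dots> = (\<integral>\<^sup>+t. (\<integral>\<^sup>+u. h t u \<partial>lu) \<partial>lu)"
    unfolding h_def by (intro nn_integral_cong nn_integral_fst[symmetric] m1)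
  also have "\<dots> = (\<integral>\<^sup>+u. (\<integral>\<^sup>+t. h t u \<partial>lu) \<partial>lu)"
    using P.Fubini[OF h] by simp
  also have "\<dots> = (\<integral>\<^sup>+u. (\<integral>\<^sup>+p. g (fst p, u, snd p) \<partial>TM) \<partial>lu)"
  proof (rule nn_integral_cong)
    fix u assume "u \<in> space lu"
    from nn_integral_fst[OF m2[OF this]]
    show "(\<integral>\<^sup>+t. h t u \<partial>lu) = (\<integral>\<^sup>+p. g (fst p, u, snd p) \<partial>TM)" by (simp add: h_def)
  qed
  finally show ?thesis .
qed

lemma W_measurable_TM: "uncurried W \<in> L0 TM"
proof -
  have "(\<lambda>(t, w). W t w) \<in> L0 TM"
    by (rule borel_measurable_continuous_process[OF T_pos _ W_continuous]) (auto intro: W_measurable)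
  then show ?thesis by (simp add: case_prod_beta')
qed

lemma fst_measurable_TTM [measurable]: "fst \<in> L0 TTM"
  by (rule measurable_compose[OF measurable_fst measurable_ident_lborel_upto])

lemma el_val_sec_measurable:
  "field_elementary L \<Longrightarrow> (\<lambda>q. el_val (el_sec (fst (snd q)) L) (fst q) (snd (snd q))) \<in> L0 TTM"
proof (induction L)
  case (Cons x L)
  obtain a b \<xi> where x: "x = (a, b, \<xi>)" by (cases x)
  have f: "0 \<le> a" "a \<le> b" "b \<le> T" "(\<lambda>p. \<xi> (fst p) (snd p)) \<in> L0 (lu \<Otimes>\<^sub>M F a)" and L: "field_elementary L"
    using Cons.prems by (simp_all add: x)
  have aT: "a \<le> T" using f by simp
  have \<xi>: "(\<lambda>q. \<xi> (fst (snd q)) (snd (snd q))) \<in> L0 TTM"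
    by (rule measurable_compose[OF measurable_snd measurable_pair_F_M[OF f(4) f(1) aT]])
  have i: "(\<lambda>q. indicator {a<..b} (fst q) :: real) \<in> L0 TTM" by measurable
  have "(\<lambda>q. \<xi> (fst (snd q)) (snd (snd q)) * indicator {a<..b} (fst q) + el_val (el_sec (fst (snd q)) L) (fst q) (snd (snd q))) \<in> L0 TTM"
    by (intro borel_measurable_add borel_measurable_times \<xi> i Cons.IH L)
  then show ?case by (simp add: x)
qed simp

lemma el_int_sec_measurable_TTM:
  "field_elementary L \<Longrightarrow> (\<lambda>q. el_int (el_sec (fst (snd q)) L) (fst q) (snd (snd q))) \<in> L0 TTM"
proof (induction L)
  case (Cons x L)
  obtain a b \<xi> where x: "x = (a, b, \<xi>)" by (cases x)
  have f: "0 \<le> a" "a \<le> b" "b \<le> T" "(\<lambda>p. \<xi> (fst p) (snd p)) \<in> L0 (lu \<Otimes>\<^sub>M F a)" and L: "field_elementary L"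
    using Cons.prems by (simp_all add: x)
  have aT: "a \<le> T" using f by simp
  have \<xi>: "(\<lambda>q. \<xi> (fst (snd q)) (snd (snd q))) \<in> L0 TTM"
    by (rule measurable_compose[OF measurable_snd measurable_pair_F_M[OF f(4) f(1) aT]])
  have W: "(\<lambda>q. W (min s (fst q)) (snd (snd q))) \<in> L0 TTM" if "0 \<le> s" for s
  proof -
    \<comment> \<open>The stopped time stays in \<open>{0..T}\<close>, so that joint measurability
      of \<open>W\<close> applies at it.\<close>
    have "(\<lambda>q. min s (fst q)) \<in> measurable TTM lu"
      unfolding lborel_upto_def
    proof (rule measurable_restrict_space2)
      show "(\<lambda>q. min s (fst q)) \<in> space (restrict_space lborel {0..T} \<Otimes>\<^sub>M (restrict_space lborel {0..T} \<Otimes>\<^sub>M M)) \<rightarrow> {0..T}"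
        using that by (auto simp: space_pair_measure space_restrict_space)
      have "(\<lambda>q. min s (fst q)) \<in> L0 TTM" by measurable
      then show "(\<lambda>q. min s (fst q)) \<in> measurable (restrict_space lborel {0..T} \<Otimes>\<^sub>M (restrict_space lborel {0..T} \<Otimes>\<^sub>M M)) lborel"
        by (simp add: lborel_upto_def)
    qed
    then have "(\<lambda>q. (min s (fst q), snd (snd q))) \<in> measurable TTM TM" by measurable
    from measurable_compose[OF this W_measurable_TM] show ?thesis by simp
  qed
  have b0: "0 \<le> b" using f by simp
  have "(\<lambda>q. \<xi> (fst (snd q)) (snd (snd q)) * (W (min b (fst q)) (snd (snd q)) - W (min a (fst q)) (snd (snd q)))
      + el_int (el_sec (fst (snd q)) L) (fst q) (snd (snd q))) \<in> L0 TTM"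
    by (intro borel_measurable_add borel_measurable_times borel_measurable_diff \<xi> W f(1) b0 Cons.IH L)
  then show ?case by (simp add: x)
qed simp

text \<open>A constant is orthogonal to an elementary integral. Through this identity the distance
  between two approximations of one variable controls their constants and their integrands
  separately.\<close>

lemma nn_integral_const_add_el_int:
  assumes L: "elementary L"
  shows "sq_norm M (\<lambda>w. c + el_int L T w) = ennreal (c\<^sup>2) + sq_norm TM (\<lambda>p. el_val L (fst p) (snd p))"
proof -
  have T: "0 \<le> T" using T_pos by simp
  have s: "sq_integrable M (el_int L T)" using T L by (intro sq_integrable_el_int) auto
  have sc: "sq_integrable M (\<lambda>_. d)" for d by (rule sq_integrable_bounded[OF finite_measure_axioms, of _ "\<bar>d\<bar>"]) auto
  have i: "integrable M (el_int L T)" by (rule sq_integrable_integrable[OF finite_measure_axioms s])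
  have i2: "integrable M (\<lambda>w. (el_int L T w)\<^sup>2)" using s by (simp add: sq_integrable_def)
  have z: "(\<integral>w. el_int L T w \<partial>M) = 0"
    using expectation_mult_el_int[OF order_refl T, of "\<lambda>_. 1" L] sc[of 1] L by (simp add: el_int_0)
  have "(\<integral>w. (c + el_int L T w)\<^sup>2 \<partial>M) = (\<integral>w. c\<^sup>2 + (2 * c) * el_int L T w + (el_int L T w)\<^sup>2 \<partial>M)"
    by (simp add: power2_sum algebra_simps)
  also have "\<dots> = c\<^sup>2 + (\<integral>w. (el_int L T w)\<^sup>2 \<partial>M)" using i i2 z by (simp add: prob_space)
  finally show ?thesis
    unfolding nn_integral_el_int[OF L, symmetric]
    by (simp add: sq_integrable_nn_integral[OF sq_integrable_add[OF sc s]] sq_integrable_nn_integral[OF s] ennreal_plus)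
qed

end

context wiener_generated
begin

text \<open>Approximation at geometric speed makes the constants, the integrands and, for almost
  every \<open>u\<close>, the integrals converge. Since \<open>Z\<close> and \<open>J\<close> are
  written with \<open>lim\<close>, they are jointly measurable and adapted for all \<open>u\<close>;
  only the representation itself is restricted to almost every \<open>u\<close>.\<close>

theorem field_representation:
  assumes X: "X \<in> L0 (lu \<Otimes>\<^sub>M F T)" and fin: "sq_norm TM X < \<infinity>"
  shows "\<exists>c Z J. c \<in> L0 lu \<and> (sq_norm lu c) < \<infinity> \<and>
    (\<lambda>q. Z (fst (snd q)) (fst q) (snd (snd q))) \<in> L0 TTM \<and>
    (\<lambda>q. J (fst (snd q)) (fst q) (snd (snd q))) \<in> L0 TTM \<and>
    (sq_norm TTM (\<lambda>q. Z (fst (snd q)) (fst q) (snd (snd q)))) < \<infinity> \<and>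
    (\<forall>u\<in>{0..T}. \<forall>t\<in>{0..T}. Z u t \<in> L0 (F t) \<and> J u t \<in> L0 (F t)) \<and>
    (AE u in lu. has_ito_integral M T F W (Z u) (J u) \<and> (AE w in M. X (u, w) = c u + J u T w))"
proof -
  have T: "0 \<le> T" using T_pos by simp
  interpret lu: finite_measure lu by (rule finite_measure_lborel_upto)
  interpret P: pair_sigma_finite lu M by (rule pair_sigma_finite_TM)
  have XM[measurable]: "X \<in> L0 TM" by (rule measurable_pair_F_M[OF X T order_refl])
  \<comment> \<open>The rate \<open>1/16\<close> leaves the ratio \<open>1/4\<close> after
    multiplication by the weight \<open>4 ^ k\<close> of \<open>fast_cauchy_L2\<close>.\<close>
  define Q where "Q k cL \<longleftrightarrow> fst cL \<in> L0 lu \<and> (\<exists>K. \<forall>u\<in>{0..T}. \<bar>fst cL u\<bar> \<le> K) \<and> field_elementary (snd cL) \<and>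
        (sq_norm TM (\<lambda>p. X p - fst cL (fst p) - el_int (el_sec (fst p) (snd cL)) T (snd p))) < ennreal ((1/16) ^ k)" for k :: nat and cL
  have "\<forall>k. \<exists>cL. Q k cL"
  proof
    fix k
    have "0 < (1 / 16 :: real) ^ k" by simp
    from approximable_field_if_measurable[OF X fin, unfolded approximable_field_def, THEN conjunct2, rule_format, OF this]
    obtain c L where "Q k (c, L)" unfolding Q_def fst_conv snd_conv by (elim exE)
    then show "\<exists>cL. Q k cL" by (rule exI)
  qed
  from choice[OF this] obtain cL where "\<forall>k. Q k (cL k)" by (elim exE)
  then have Q: "Q k (cL k)" for k by (rule spec)
  define c where "c k = fst (cL k)" for k
  define L where "L k = snd (cL k)" for k
  have c: "c k \<in> L0 lu" for k
    unfolding c_def by (rule conjunct1[OF Q[unfolded Q_def]])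
  have cb: "\<exists>K. \<forall>u\<in>{0..T}. \<bar>c k u\<bar> \<le> K" for k
    unfolding c_def by (rule conjunct1[OF conjunct2[OF Q[unfolded Q_def]]])
  have L: "field_elementary (L k)" for k
    unfolding L_def by (rule conjunct1[OF conjunct2[OF conjunct2[OF Q[unfolded Q_def]]]])
  have app: "sq_norm TM (\<lambda>p. X p - c k (fst p) - el_int (el_sec (fst p) (L k)) T (snd p)) < ennreal ((1/16) ^ k)" for k
    unfolding L_def c_def by (rule conjunct2[OF conjunct2[OF conjunct2[OF Q[unfolded Q_def]]]])
  note [measurable] = c
  have cTM[measurable]: "(\<lambda>p. c k (fst p)) \<in> L0 TM" for k by (rule measurable_compose[OF measurable_fst c])
  note [measurable] = el_int_sec_measurable[OF T order_refl L]
  have eL: "elementary (el_sec u (L k))" if "u \<in> {0..T}" for u k by (rule elementary_sec[OF that L])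
  define a where "a k u = sq_norm M (\<lambda>w. X (u, w) - c k u - el_int (el_sec u (L k)) T w)" for k u
  have am: "(\<lambda>p. ennreal ((X p - c k (fst p) - el_int (el_sec (fst p) (L k)) T (snd p))\<^sup>2)) \<in> L0 TM" for k by measurable
  have a_m[measurable]: "a k \<in> L0 lu" for k
    unfolding a_def[abs_def] using borel_measurable_nn_integral_fst[OF am[of k]] by simp
  have a_int: "(\<integral>\<^sup>+u. a k u \<partial>lu) \<le> ennreal ((1/16) ^ k)" for k
    using nn_integral_fst[OF am[of k]] less_imp_le[OF app[of k]] by (simp add: a_def)
  define v where "v k u = sq_norm TM (\<lambda>p. el_val (el_sec u (L (Suc k))) (fst p) (snd p) - el_val (el_sec u (L k)) (fst p) (snd p))" for k u
  have vm3: "(\<lambda>q. ennreal ((el_val (el_sec (fst (snd q)) (L (Suc k))) (fst q) (snd (snd q)) - el_val (el_sec (fst (snd q)) (L k)) (fst q) (snd (snd q)))\<^sup>2)) \<in> L0 TTM" for k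
    by (intro measurable_compose[OF _ measurable_ennreal] borel_measurable_power borel_measurable_diff el_val_sec_measurable L)
  have v_TTM: "sq_norm TTM (\<lambda>q. el_val (el_sec (fst (snd q)) (L (Suc k))) (fst q) (snd (snd q)) - el_val (el_sec (fst (snd q)) (L k)) (fst q) (snd (snd q)))
      = (\<integral>\<^sup>+u. v k u \<partial>lu)" for k
    using nn_integral_TTM[OF vm3[of k]] by (simp add: v_def)
  \<comment> \<open>The difference of two successive approximations is decomposed orthogonally on
    the left and bounded by the approximation errors on the right.\<close>
  have key: "ennreal ((c (Suc k) u - c k u)\<^sup>2) + v k u \<le> 2 * a (Suc k) u + 2 * a k u" if u: "u \<in> {0..T}" for k u
  proof -
    have Xu: "(\<lambda>w. X (u, w)) \<in> L0 M" by (rule measurable_compose_Pair1[OF _ XM]) (use u in simp)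
    have Iu: "el_int (el_sec u (L k)) T \<in> L0 M" for k by (rule el_int_measurable[OF eL[OF u] T order_refl])
    let ?A = "\<lambda>k w. X (u, w) - c k u - el_int (el_sec u (L k)) T w"
    have Am: "?A k \<in> L0 M" for k by (intro borel_measurable_diff Xu Iu borel_measurable_const)
    have nm: "(\<lambda>w. - ?A k w) \<in> L0 M" for k by (intro borel_measurable_uminus Am)
    let ?D = "el_diff (el_sec u (L (Suc k))) (el_sec u (L k))"
    have D: "elementary ?D" using eL[OF u] by simp
    have "ennreal ((c (Suc k) u - c k u)\<^sup>2) + v k u = sq_norm M (\<lambda>w. (c (Suc k) u - c k u) + el_int ?D T w)"
      unfolding nn_integral_const_add_el_int[OF D] v_def by simp
    also have "\<dots> = sq_norm M (\<lambda>w. - ?A (Suc k) w + ?A k w)" by (simp add: algebra_simps)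
    also have "\<dots> \<le> 2 * sq_norm M (\<lambda>w. - ?A (Suc k) w) + 2 * sq_norm M (\<lambda>w. ?A k w)"
      by (rule nn_integral_sq_add_le[OF nm Am])
    also have "\<dots> = 2 * a (Suc k) u + 2 * a k u" by (simp only: power2_minus a_def)
    finally show ?thesis .
  qed
  have cm: "(\<lambda>u. ennreal ((c (Suc k) u - c k u)\<^sup>2)) \<in> L0 lu" for k by measurable
  have v_m: "v k \<in> L0 lu" for k
  proof -
    have sf: "sigma_finite_measure TM" using finite_measure_TM by (simp add: finite_measure_def)
    have "(\<lambda>x. (fst (snd x), fst x, snd (snd x))) \<in> measurable (lu \<Otimes>\<^sub>M TM) TTM" by measurable
    from sigma_finite_measure.borel_measurable_nn_integral_fst[OF sf measurable_compose[OF this vm3[of k]]]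
    show ?thesis by (simp add: v_def[abs_def])
  qed
  have sumk: "(\<Sum>k. 4 ^ k * (\<integral>\<^sup>+u. ennreal ((c (Suc k) u - c k u)\<^sup>2) + v k u \<partial>lu)) < \<infinity>"
  proof -
    have "4 ^ k * (\<integral>\<^sup>+u. ennreal ((c (Suc k) u - c k u)\<^sup>2) + v k u \<partial>lu) \<le> ennreal (4 * (1/4) ^ k)" for k
    proof -
      have "(\<integral>\<^sup>+u. ennreal ((c (Suc k) u - c k u)\<^sup>2) + v k u \<partial>lu) \<le> (\<integral>\<^sup>+u. 2 * a (Suc k) u + 2 * a k u \<partial>lu)"
        by (intro nn_integral_mono key) simp
      also have "\<dots> = 2 * (\<integral>\<^sup>+u. a (Suc k) u \<partial>lu) + 2 * (\<integral>\<^sup>+u. a k u \<partial>lu)"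
        by (simp add: nn_integral_add nn_integral_cmult)
      also have "\<dots> \<le> 2 * ennreal ((1/16) ^ Suc k) + 2 * ennreal ((1/16) ^ k)" by (intro add_mono mult_left_mono a_int) auto
      also have "\<dots> = ennreal (2 * (1/16) ^ Suc k + 2 * (1/16) ^ k)"
      proof -
        have "2 * ennreal x + 2 * ennreal y = ennreal (2 * x + 2 * y)" if "0 \<le> x" "0 \<le> y" for x y
          using that by (simp add: ennreal_mult ennreal_plus)
        from this[of "(1/16) ^ Suc k" "(1/16) ^ k"] show ?thesis by simp
      qed
      also have "\<dots> \<le> ennreal (4 * (1/16) ^ k)" by (intro ennreal_leI) simp
      finally have "4 ^ k * (\<integral>\<^sup>+u. ennreal ((c (Suc k) u - c k u)\<^sup>2) + v k u \<partial>lu) \<le> 4 ^ k * ennreal (4 * (1/16) ^ k)"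
        by (rule mult_left_mono) simp
      also have "\<dots> = ennreal (4 ^ k * (4 * (1/16) ^ k))" by (simp add: ennreal_mult ennreal_power[symmetric])
      also have "4 ^ k * (4 * (1/16) ^ k) = 4 * (1/4 :: real) ^ k"
      proof -
        have "(4::real) ^ k * (1/16) ^ k = (1/4) ^ k" unfolding power_mult_distrib[symmetric] by simp
        then show ?thesis by simp
      qed
      finally show ?thesis .
    qed
    then have "(\<Sum>k. 4 ^ k * (\<integral>\<^sup>+u. ennreal ((c (Suc k) u - c k u)\<^sup>2) + v k u \<partial>lu)) \<le> (\<Sum>k. ennreal (4 * (1/4) ^ k))"
      by (intro suminf_le) auto
    also have "\<dots> < \<infinity>"
    proof -
      have s: "summable (\<lambda>k. 4 * (1/4 :: real) ^ k)" by (intro summable_mult summable_geometric) simp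
      have "(\<Sum>k. ennreal (4 * (1/4) ^ k)) = ennreal (\<Sum>k. 4 * (1/4) ^ k)" by (rule suminf_ennreal2[OF _ s]) simp
      then show ?thesis by simp
    qed
    finally show ?thesis .
  qed
  have sumc: "(\<Sum>k. 4 ^ k * sq_norm lu (\<lambda>u. c (Suc k) u - c k u)) < \<infinity>"
    by (rule le_less_trans[OF _ sumk]) (intro suminf_le mult_left_mono nn_integral_mono; simp)
  have sumv: "(\<Sum>k. 4 ^ k * sq_norm TTM (\<lambda>q. el_val (el_sec (fst (snd q)) (L (Suc k))) (fst q) (snd (snd q)) - el_val (el_sec (fst (snd q)) (L k)) (fst q) (snd (snd q)))) < \<infinity>"
    unfolding v_TTM by (rule le_less_trans[OF _ sumk]) (intro suminf_le mult_left_mono nn_integral_mono; simp)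
  define cc where "cc u = lim (\<lambda>k. c k u)" for u
  define Z where "Z u t w = lim (\<lambda>k. el_val (el_sec u (L k)) t w)" for u t w
  define J where "J u t w = lim (\<lambda>k. el_int (el_sec u (L k)) t w)" for u t w
  have cc_m[measurable]: "cc \<in> L0 lu" unfolding cc_def[abs_def] by (rule borel_measurable_lim_metric) (rule c)
  have Z_m: "(\<lambda>q. Z (fst (snd q)) (fst q) (snd (snd q))) \<in> L0 TTM"
    unfolding Z_def by (intro borel_measurable_lim_metric el_val_sec_measurable L)
  have J_m: "(\<lambda>q. J (fst (snd q)) (fst q) (snd (snd q))) \<in> L0 TTM"
    unfolding J_def by (intro borel_measurable_lim_metric el_int_sec_measurable_TTM L)
  have adapted: "Z u t \<in> L0 (F t) \<and> J u t \<in> L0 (F t)" if u: "u \<in> {0..T}" and t: "t \<in> {0..T}" for u t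
  proof -
    have t': "0 \<le> t" "t \<le> T" using t by auto
    show ?thesis unfolding Z_def[abs_def] J_def[abs_def]
      by (intro conjI borel_measurable_lim_metric el_val_measurable_F[OF t'] el_int_measurable_F[OF t'] eL u)
  qed
  have cc_fin: "sq_norm lu cc < \<infinity>"
  proof -
    have 1: "sq_norm lu (\<lambda>u. c 0 u - cc u) < \<infinity>"
      unfolding cc_def
      by (rule le_less_trans[OF fast_cauchy_L2(2)[OF c sumc, of 0]])
        (rule ennreal_times_finite[OF sumc])
    obtain K where K: "\<forall>u\<in>{0..T}. \<bar>c 0 u\<bar> \<le> K" using cb by blast
    have "sq_integrable lu (c 0)"
      by (rule sq_integrable_bounded[OF finite_measure_lborel_upto c, where K=K]) (use K in simp)
    then have 2: "sq_norm lu (\<lambda>u. c 0 u) < \<infinity>" unfolding sq_integrable_iff[OF c] .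
    have m: "(\<lambda>u. - (c 0 u - cc u)) \<in> L0 lu" by measurable
    have "sq_norm lu cc = sq_norm lu (\<lambda>u. c 0 u + - (c 0 u - cc u))" by simp
    also have "\<dots> \<le> 2 * sq_norm lu (\<lambda>u. c 0 u) + 2 * sq_norm lu (\<lambda>u. - (c 0 u - cc u))"
      by (rule nn_integral_sq_add_le[OF c m])
    also have "\<dots> < \<infinity>" unfolding power2_minus using 1 2 by (simp add: ennreal_mult_less_top)
    finally show ?thesis .
  qed
  have Z_fin: "sq_norm TTM (\<lambda>q. Z (fst (snd q)) (fst q) (snd (snd q))) < \<infinity>"
  proof -
    let ?e = "\<lambda>k q. el_val (el_sec (fst (snd q)) (L k)) (fst q) (snd (snd q))"
    let ?Z = "\<lambda>q. Z (fst (snd q)) (fst q) (snd (snd q))"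
    have em: "?e k \<in> L0 TTM" for k by (rule el_val_sec_measurable[OF L])
    have 1: "sq_norm TTM (\<lambda>q. ?e 0 q - ?Z q) < \<infinity>"
      unfolding Z_def
      by (rule le_less_trans[OF fast_cauchy_L2(2)[OF em sumv, of 0]])
        (rule ennreal_times_finite[OF sumv])
    have 2: "sq_norm TTM (\<lambda>q. ?e 0 q) < \<infinity>"
    proof -
      have eb: "field_elementary K \<Longrightarrow> \<exists>B. \<forall>q\<in>space TTM. \<bar>el_val (el_sec (fst (snd q)) K) (fst q) (snd (snd q))\<bar> \<le> B" for K
      proof (induction K)
        case (Cons x K)
        obtain a b \<xi> where x: "x = (a, b, \<xi>)" by (cases x)
        have "\<exists>B. \<forall>u\<in>{0..T}. \<forall>w\<in>space M. \<bar>\<xi> u w\<bar> \<le> B" "field_elementary K" using Cons.prems by (simp_all add: x)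
        with Cons.IH obtain B B' where B: "\<forall>u\<in>{0..T}. \<forall>w\<in>space M. \<bar>\<xi> u w\<bar> \<le> B"
          "\<forall>q\<in>space TTM. \<bar>el_val (el_sec (fst (snd q)) K) (fst q) (snd (snd q))\<bar> \<le> B'" by blast
        have "\<bar>el_val (el_sec (fst (snd q)) (x # K)) (fst q) (snd (snd q))\<bar> \<le> B + B'" if q: "q \<in> space TTM" for q
        proof -
          have "fst (snd q) \<in> {0..T}" "snd (snd q) \<in> space M" using q by (auto simp: space_pair_measure)
          then have "\<bar>\<xi> (fst (snd q)) (snd (snd q))\<bar> \<le> B" using B(1) by blast
          then have "\<bar>\<xi> (fst (snd q)) (snd (snd q)) * indicator {a<..b} (fst q)\<bar> \<le> B" by (cases "fst q \<in> {a<..b}") auto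
          then show ?thesis using bspec[OF B(2) q] unfolding x el_sec_simps el_val_simps by linarith
        qed
        then show ?case by blast
      qed (auto intro: exI[of _ 0])
      obtain B where B: "\<forall>q\<in>space TTM. \<bar>?e 0 q\<bar> \<le> B" using eb[OF L] by blast
      have "finite_measure TTM" by (intro finite_measure_pair_measure finite_measure_lborel_upto finite_measure_TM)
      then have "sq_integrable TTM (?e 0)" by (rule sq_integrable_bounded[OF _ em, where K=B]) (use B in blast)
      then show ?thesis unfolding sq_integrable_iff[OF em] .
    qed
    have m: "(\<lambda>q. - (?e 0 q - ?Z q)) \<in> L0 TTM" by (intro borel_measurable_uminus borel_measurable_diff em Z_m)
    have "sq_norm TTM ?Z = sq_norm TTM (\<lambda>q. ?e 0 q + - (?e 0 q - ?Z q))" by simp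
    also have "\<dots> \<le> 2 * sq_norm TTM (\<lambda>q. ?e 0 q) + 2 * sq_norm TTM (\<lambda>q. - (?e 0 q - ?Z q))"
      by (rule nn_integral_sq_add_le[OF em m])
    also have "\<dots> < \<infinity>" unfolding power2_minus using 1 2 by (simp add: ennreal_mult_less_top)
    finally show ?thesis .
  qed
  have "(\<integral>\<^sup>+u. (\<Sum>k. 4 ^ k * (ennreal ((c (Suc k) u - c k u)\<^sup>2) + v k u)) \<partial>lu) < \<infinity>"
    using sumk cm v_m by (simp add: nn_integral_suminf nn_integral_cmult)
  \<comment> \<open>Finiteness of the integrated series makes the series finite for almost every
    \<open>u\<close>; such sections satisfy the hypothesis of the scalar construction.\<close>
  then have "AE u in lu. (\<Sum>k. 4 ^ k * (ennreal ((c (Suc k) u - c k u)\<^sup>2) + v k u)) \<noteq> \<infinity>"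
    using cm v_m by (intro nn_integral_PInf_AE) auto
  moreover have "AE u in lu. (\<Sum>k. a k u) \<noteq> \<infinity>"
  proof (rule nn_integral_PInf_AE)
    have "(\<integral>\<^sup>+u. (\<Sum>k. a k u) \<partial>lu) = (\<Sum>k. (\<integral>\<^sup>+u. a k u \<partial>lu))" by (rule nn_integral_suminf) simp
    also have "\<dots> \<le> (\<Sum>k. ennreal ((1/16) ^ k))" by (intro suminf_le a_int) auto
    also have "\<dots> < \<infinity>"
    proof -
      have s: "summable (\<lambda>k. (1/16 :: real) ^ k)" by (intro summable_geometric) simp
      have "(\<Sum>k. ennreal ((1/16) ^ k)) = ennreal (\<Sum>k. (1/16) ^ k)" by (rule suminf_ennreal2[OF _ s]) simp
      then show ?thesis by simp
    qed
    finally show "(\<integral>\<^sup>+u. (\<Sum>k. a k u) \<partial>lu) \<noteq> \<infinity>" by simp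
  qed simp
  ultimately have "AE u in lu. has_ito_integral M T F W (Z u) (J u) \<and> (AE w in M. X (u, w) = cc u + J u T w)"
    using AE_space
  proof eventually_elim
    case (elim u)
    have u: "u \<in> {0..T}" using elim(3) by simp
    have S: "(\<Sum>k. 4 ^ k * (ennreal ((c (Suc k) u - c k u)\<^sup>2) + v k u)) < \<infinity>"
      using elim(1) unfolding infinity_ennreal_def less_top .
    have fv: "(\<Sum>k. 4 ^ k * v k u) < \<infinity>"
    proof -
      have "(\<Sum>k. 4 ^ k * v k u) \<le> (\<Sum>k. 4 ^ k * (ennreal ((c (Suc k) u - c k u)\<^sup>2) + v k u))"
        by (intro suminf_le mult_left_mono) auto
      then show ?thesis using S by (rule le_less_trans)
    qed
    have fc: "(\<Sum>k. ennreal (4 ^ k * (c (Suc k) u - c k u)\<^sup>2)) < \<infinity>"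
    proof -
      have "(\<Sum>k. ennreal (4 ^ k * (c (Suc k) u - c k u)\<^sup>2)) \<le> (\<Sum>k. 4 ^ k * (ennreal ((c (Suc k) u - c k u)\<^sup>2) + v k u))"
      proof (intro suminf_le)
        fix k
        have "ennreal (4 ^ k * (c (Suc k) u - c k u)\<^sup>2) = 4 ^ k * ennreal ((c (Suc k) u - c k u)\<^sup>2)"
          by (simp add: ennreal_mult ennreal_power[symmetric])
        also have "\<dots> \<le> 4 ^ k * (ennreal ((c (Suc k) u - c k u)\<^sup>2) + v k u)" by (rule mult_left_mono) auto
        finally show "ennreal (4 ^ k * (c (Suc k) u - c k u)\<^sup>2) \<le> 4 ^ k * (ennreal ((c (Suc k) u - c k u)\<^sup>2) + v k u)" .
      qed auto
      then show ?thesis using S by (rule le_less_trans)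
    qed
    note ito = ito_approx_construction[OF eL[OF u] fv[unfolded v_def]] ito_integral_construction[OF eL[OF u] fv[unfolded v_def]]
    have has: "has_ito_integral M T F W (Z u) (J u)"
      unfolding Z_def[abs_def] J_def[abs_def] by (rule has_ito_integral_if_ito_approx[OF ito(1,2)])
    have TT: "T \<in> {0..T}" using T by simp
    have JT: "(\<lambda>k. \<integral>\<^sup>+w. ennreal ((el_int (el_sec u (L k)) T w - J u T w)\<^sup>2) \<partial>M) \<longlonglongrightarrow> 0"
      unfolding J_def by (rule ito(4)[OF TT])
    have "(\<lambda>k. c k u) \<longlonglongrightarrow> cc u" using fast_cauchy_sequence(1)[OF fc] unfolding cc_def convergent_LIMSEQ_iff .
    then have "(\<lambda>k. (c k u - cc u)\<^sup>2) \<longlonglongrightarrow> (cc u - cc u)\<^sup>2" by (intro tendsto_intros)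
    then have cl: "(\<lambda>k. ennreal ((c k u - cc u)\<^sup>2)) \<longlonglongrightarrow> 0" using tendsto_ennrealI by fastforce
    have al: "(\<lambda>k. a k u) \<longlonglongrightarrow> 0"
      by (rule ennreal_suminf_finite_tendsto_0) (use elim(2) in simp)
    have Xu: "(\<lambda>w. X (u, w)) \<in> L0 M" by (rule measurable_compose_Pair1[OF _ XM]) (use u in simp)
    have Ju: "J u T \<in> L0 M" using adapted[OF u TT] measurable_F_M[OF _ T order_refl] by blast
    have Iu: "el_int (el_sec u (L k)) T \<in> L0 M" for k by (rule el_int_measurable[OF eL[OF u] T order_refl])
    \<comment> \<open>Three errors: approximation of \<open>X\<close>, convergence of the constants,
      convergence of the integrals at time \<open>T\<close>. All vanish, so both sides of the
      representation agree almost surely.\<close>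
    have le: "sq_norm M (\<lambda>w. X (u, w) - (cc u + J u T w)) \<le> 2 * a k u + 2 * (2 * ennreal ((c k u - cc u)\<^sup>2) +
        2 * sq_norm M (\<lambda>w. el_int (el_sec u (L k)) T w - J u T w))" for k
    proof -
      let ?A = "\<lambda>w. X (u, w) - c k u - el_int (el_sec u (L k)) T w" and ?B = "\<lambda>w. el_int (el_sec u (L k)) T w - J u T w"
      have m: "?A \<in> L0 M" "?B \<in> L0 M" "(\<lambda>_. c k u - cc u) \<in> L0 M" "(\<lambda>w. (c k u - cc u) + ?B w) \<in> L0 M"
        by (intro borel_measurable_add borel_measurable_diff borel_measurable_const Xu Iu Ju)+
      have "sq_norm M (\<lambda>w. X (u, w) - (cc u + J u T w)) = sq_norm M (\<lambda>w. ?A w + ((c k u - cc u) + ?B w))"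
        by (simp add: algebra_simps)
      also have "\<dots> \<le> 2 * sq_norm M ?A + 2 * sq_norm M (\<lambda>w. (c k u - cc u) + ?B w)"
        by (rule nn_integral_sq_add_le[OF m(1,4)])
      also have "\<dots> \<le> 2 * sq_norm M ?A + 2 * (2 * sq_norm M (\<lambda>w. c k u - cc u) + 2 * sq_norm M ?B)"
        by (intro add_left_mono mult_left_mono nn_integral_sq_add_le[OF m(3,2)]) simp
      finally show ?thesis by (simp add: a_def emeasure_space_1)
    qed
    have "(\<lambda>k. 2 * a k u + 2 * (2 * ennreal ((c k u - cc u)\<^sup>2) + 2 * sq_norm M (\<lambda>w. el_int (el_sec u (L k)) T w - J u T w))) \<longlonglongrightarrow> 2 * 0 + 2 * (2 * 0 + 2 * 0)"
      by (intro tendsto_add ennreal_tendsto_cmult al cl JT) auto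
    then have "sq_norm M (\<lambda>w. X (u, w) - (cc u + J u T w)) \<le> 2 * 0 + 2 * (2 * 0 + 2 * 0)"
      by (rule LIMSEQ_le_const) (use le in blast)
    then have z: "sq_norm M (\<lambda>w. X (u, w) - (cc u + J u T w)) = 0" by simp
    have "(\<lambda>w. ennreal ((X (u, w) - (cc u + J u T w))\<^sup>2)) \<in> L0 M"
      by (intro measurable_compose[OF _ measurable_ennreal] borel_measurable_power borel_measurable_diff borel_measurable_add borel_measurable_const Xu Ju)
    from z[unfolded nn_integral_0_iff_AE[OF this]]
    have "AE w in M. X (u, w) = cc u + J u T w" by eventually_elim simp
    with has show ?case by simp
  qed
  then show ?thesis using cc_m cc_fin Z_m J_m Z_fin adapted by (intro exI[of _ cc] exI[of _ Z] exI[of _ J] conjI) auto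
qed

end

section \<open>The a priori estimate\<close>

lemma nn_integral_exp_upto:
  assumes s: "s \<in> {0..T}" and \<beta>: "0 < \<beta>"
  shows "(\<integral>\<^sup>+t. ennreal (\<beta> * exp (\<beta> * t)) * indicator {..s} t \<partial>lborel_upto T) = ennreal (exp (\<beta> * s) - 1)"
proof -
  have "(\<integral>\<^sup>+t. ennreal (\<beta> * exp (\<beta> * t)) * indicator {..s} t \<partial>lborel_upto T)
      = (\<integral>\<^sup>+t. ennreal (\<beta> * exp (\<beta> * t)) * indicator {..s} t * indicator {0..T} t \<partial>lborel)"
    unfolding lborel_upto_def by (rule nn_integral_restrict_space) simp
  also have "\<dots> = (\<integral>\<^sup>+t. ennreal (\<beta> * exp (\<beta> * t)) * indicator {0..s} t \<partial>lborel)"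
    using s by (intro nn_integral_cong) (auto simp: indicator_def)
  also have "\<dots> = ennreal (exp (\<beta> * s) - exp (\<beta> * 0))"
    by (rule nn_integral_FTC_Icc) (use s \<beta> in \<open>auto intro!: derivative_eq_intros\<close>)
  finally show ?thesis by simp
qed

lemma indicator_le_measurable:
  "(\<lambda>p. indicator {p \<in> space (lborel_upto T \<Otimes>\<^sub>M lborel_upto T). fst p \<le> snd p} p :: ennreal)
    \<in> L0 (lborel_upto T \<Otimes>\<^sub>M lborel_upto T)"
  by (intro borel_measurable_indicator borel_measurable_le
      measurable_compose[OF measurable_fst measurable_ident_lborel_upto] measurable_compose[OF measurable_snd measurable_ident_lborel_upto])

lemma measurable_indicator_atLeast_times:
  fixes f :: "real \<Rightarrow> ennreal"
  assumes "f \<in> L0 (lborel_upto T)"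
  shows "(\<lambda>s. indicator {t..} s * f s) \<in> L0 (lborel_upto T)"
  by (rule borel_measurable_times_ennreal[OF borel_measurable_lborel_upto assms]) simp

lemma ennreal_exp_measurable:
  "(\<lambda>t. ennreal (a * exp (\<beta> * t) + b)) \<in> L0 (lborel_upto T)"
  by (rule borel_measurable_lborel_upto) simp

text \<open>Integrate the inequality against \<open>\<beta> * exp (\<beta> * t)\<close>. Exchanging
  the order turns tail integrals into integrals with weight \<open>exp (\<beta> * s) - 1\<close>;
  the missing \<open>1\<close> is supplied by the inequality at \<open>t = 0\<close>.\<close>

lemma weighted_inequality:
  fixes a k m :: "real \<Rightarrow> ennreal"
  assumes T: "0 < T" and \<beta>: "0 < \<beta>"
    and am: "a \<in> L0 (lborel_upto T)" and km: "k \<in> L0 (lborel_upto T)"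
    and mm: "m \<in> L0 (lborel_upto T)"
    and le: "\<And>t. t \<in> {0..T} \<Longrightarrow> a t + (\<integral>\<^sup>+s. indicator {t..} s * k s \<partial>lborel_upto T) \<le> (\<integral>\<^sup>+s. indicator {t..} s * m s \<partial>lborel_upto T)"
  shows "(\<integral>\<^sup>+t. ennreal (\<beta> * exp (\<beta> * t)) * a t \<partial>lborel_upto T) + (\<integral>\<^sup>+t. ennreal (exp (\<beta> * t)) * k t \<partial>lborel_upto T)
    \<le> (\<integral>\<^sup>+t. ennreal (exp (\<beta> * t)) * m t \<partial>lborel_upto T)"
proof -
  let ?lu = "lborel_upto T"
  interpret lu: finite_measure ?lu by (rule finite_measure_lborel_upto)
  interpret P: pair_sigma_finite ?lu ?lu ..
  have w: "(\<lambda>t. ennreal (\<beta> * exp (\<beta> * t))) \<in> L0 ?lu"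
    using ennreal_exp_measurable[of \<beta> \<beta> 0 T] by simp
  have w1: "(\<lambda>t. ennreal (exp (\<beta> * t) - 1)) \<in> L0 ?lu"
    using ennreal_exp_measurable[of 1 \<beta> "-1" T] by simp
  have ii: "(\<lambda>t. indicator {..s} t :: ennreal) \<in> L0 ?lu" for s
    by (rule borel_measurable_lborel_upto) simp
  have fub: "(\<integral>\<^sup>+t. ennreal (\<beta> * exp (\<beta> * t)) * (\<integral>\<^sup>+s. indicator {t..} s * f s \<partial>?lu) \<partial>?lu) + (\<integral>\<^sup>+s. f s \<partial>?lu)
      = (\<integral>\<^sup>+s. ennreal (exp (\<beta> * s)) * f s \<partial>?lu)" if fm: "f \<in> L0 ?lu" for f :: "real \<Rightarrow> ennreal"
  proof -
    note ind = indicator_le_measurable[of T]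
    define h where "h p = ennreal (\<beta> * exp (\<beta> * fst p)) * (indicator {p \<in> space (?lu \<Otimes>\<^sub>M ?lu). fst p \<le> snd p} p * f (snd p))" for p
    have h: "h \<in> L0 (?lu \<Otimes>\<^sub>M ?lu)"
      unfolding h_def by (intro borel_measurable_times_ennreal ind measurable_compose[OF measurable_fst w] measurable_compose[OF measurable_snd fm])
    have "(\<integral>\<^sup>+t. ennreal (\<beta> * exp (\<beta> * t)) * (\<integral>\<^sup>+s. indicator {t..} s * f s \<partial>?lu) \<partial>?lu) = (\<integral>\<^sup>+t. (\<integral>\<^sup>+s. h (t, s) \<partial>?lu) \<partial>?lu)"
    proof (rule nn_integral_cong)
      fix t assume t: "t \<in> space ?lu"
      have "ennreal (\<beta> * exp (\<beta> * t)) * (\<integral>\<^sup>+s. indicator {t..} s * f s \<partial>?lu) = (\<integral>\<^sup>+s. ennreal (\<beta> * exp (\<beta> * t)) * (indicator {t..} s * f s) \<partial>?lu)"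
        by (rule nn_integral_cmult[symmetric, OF measurable_indicator_atLeast_times[OF fm]])
      also have "\<dots> = (\<integral>\<^sup>+s. h (t, s) \<partial>?lu)"
        using t by (intro nn_integral_cong) (auto simp: h_def indicator_def space_pair_measure)
      finally show "ennreal (\<beta> * exp (\<beta> * t)) * (\<integral>\<^sup>+s. indicator {t..} s * f s \<partial>?lu) = (\<integral>\<^sup>+s. h (t, s) \<partial>?lu)" .
    qed
    also have "\<dots> = (\<integral>\<^sup>+s. (\<integral>\<^sup>+t. h (t, s) \<partial>?lu) \<partial>?lu)" by (rule P.Fubini[symmetric, OF h])
    also have "\<dots> = (\<integral>\<^sup>+s. ennreal (exp (\<beta> * s) - 1) * f s \<partial>?lu)"
    proof (rule nn_integral_cong)
      fix s assume s: "s \<in> space ?lu"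
      have "(\<integral>\<^sup>+t. h (t, s) \<partial>?lu) = (\<integral>\<^sup>+t. (ennreal (\<beta> * exp (\<beta> * t)) * indicator {..s} t) * f s \<partial>?lu)"
        using s by (intro nn_integral_cong) (auto simp: h_def indicator_def space_pair_measure)
      also have "\<dots> = (\<integral>\<^sup>+t. ennreal (\<beta> * exp (\<beta> * t)) * indicator {..s} t \<partial>?lu) * f s"
        by (rule nn_integral_multc) (intro borel_measurable_times_ennreal w ii)
      also have "\<dots> = ennreal (exp (\<beta> * s) - 1) * f s" using nn_integral_exp_upto[OF _ \<beta>, of s T] s by simp
      finally show "(\<integral>\<^sup>+t. h (t, s) \<partial>?lu) = ennreal (exp (\<beta> * s) - 1) * f s" .
    qed
    finally have e: "(\<integral>\<^sup>+t. ennreal (\<beta> * exp (\<beta> * t)) * (\<integral>\<^sup>+s. indicator {t..} s * f s \<partial>?lu) \<partial>?lu) = (\<integral>\<^sup>+s. ennreal (exp (\<beta> * s) - 1) * f s \<partial>?lu)" .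
    have m1: "(\<lambda>s. ennreal (exp (\<beta> * s) - 1) * f s) \<in> L0 ?lu"
      by (intro borel_measurable_times_ennreal w1 fm)
    have "(\<integral>\<^sup>+s. ennreal (exp (\<beta> * s) - 1) * f s \<partial>?lu) + (\<integral>\<^sup>+s. f s \<partial>?lu) = (\<integral>\<^sup>+s. ennreal (exp (\<beta> * s) - 1) * f s + f s \<partial>?lu)"
      by (rule nn_integral_add[symmetric, OF m1 fm])
    also have "\<dots> = (\<integral>\<^sup>+s. ennreal (exp (\<beta> * s)) * f s \<partial>?lu)"
    proof (rule nn_integral_cong)
      fix s assume "s \<in> space ?lu"
      then have "0 \<le> \<beta> * s" using \<beta> by simp
      then have "1 \<le> exp (\<beta> * s)" by simp
      then have "ennreal (exp (\<beta> * s)) = ennreal (exp (\<beta> * s) - 1) + 1"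
        using ennreal_plus[of "exp (\<beta> * s) - 1" 1] by simp
      then show "ennreal (exp (\<beta> * s) - 1) * f s + f s = ennreal (exp (\<beta> * s)) * f s" by (simp add: distrib_right)
    qed
    finally show ?thesis unfolding e .
  qed
  have I: "(\<lambda>t. \<integral>\<^sup>+s. indicator {t..} s * f s \<partial>?lu) \<in> L0 ?lu" if fm: "f \<in> L0 ?lu" for f :: "real \<Rightarrow> ennreal"
  proof -
    note ind = indicator_le_measurable[of T]
    have "(\<lambda>p. indicator {p \<in> space (?lu \<Otimes>\<^sub>M ?lu). fst p \<le> snd p} p * f (snd p)) \<in> L0 (?lu \<Otimes>\<^sub>M ?lu)"
      by (intro borel_measurable_times_ennreal ind measurable_compose[OF measurable_snd fm])
    from lu.borel_measurable_nn_integral_fst[OF this]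
    show ?thesis
      by (rule measurable_cong[THEN iffD1, rotated]) (intro nn_integral_cong, auto simp: indicator_def space_pair_measure)
  qed
  have 0: "(\<integral>\<^sup>+s. indicator {0..} s * f s \<partial>?lu) = (\<integral>\<^sup>+s. f s \<partial>?lu)" for f :: "real \<Rightarrow> ennreal"
    by (rule nn_integral_cong) simp
  have "(\<integral>\<^sup>+t. ennreal (\<beta> * exp (\<beta> * t)) * a t \<partial>?lu) + (\<integral>\<^sup>+t. ennreal (exp (\<beta> * t)) * k t \<partial>?lu)
      = ((\<integral>\<^sup>+t. ennreal (\<beta> * exp (\<beta> * t)) * a t \<partial>?lu) + (\<integral>\<^sup>+t. ennreal (\<beta> * exp (\<beta> * t)) * (\<integral>\<^sup>+s. indicator {t..} s * k s \<partial>?lu) \<partial>?lu)) + (\<integral>\<^sup>+s. k s \<partial>?lu)"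
    unfolding fub[OF km, symmetric] by (simp add: add.assoc)
  also have "\<dots> = (\<integral>\<^sup>+t. ennreal (\<beta> * exp (\<beta> * t)) * (a t + (\<integral>\<^sup>+s. indicator {t..} s * k s \<partial>?lu)) \<partial>?lu) + (\<integral>\<^sup>+s. k s \<partial>?lu)"
    unfolding distrib_left by (subst nn_integral_add) (intro borel_measurable_times_ennreal am w I[OF km] refl)+
  also have "\<dots> \<le> (\<integral>\<^sup>+t. ennreal (\<beta> * exp (\<beta> * t)) * (\<integral>\<^sup>+s. indicator {t..} s * m s \<partial>?lu) \<partial>?lu) + (\<integral>\<^sup>+s. m s \<partial>?lu)"
  proof (rule add_mono)
    show "(\<integral>\<^sup>+t. ennreal (\<beta> * exp (\<beta> * t)) * (a t + (\<integral>\<^sup>+s. indicator {t..} s * k s \<partial>?lu)) \<partial>?lu) \<le> (\<integral>\<^sup>+t. ennreal (\<beta> * exp (\<beta> * t)) * (\<integral>\<^sup>+s. indicator {t..} s * m s \<partial>?lu) \<partial>?lu)"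
      by (intro nn_integral_mono mult_left_mono le) auto
    have "a 0 + (\<integral>\<^sup>+s. k s \<partial>?lu) \<le> (\<integral>\<^sup>+s. m s \<partial>?lu)" using le[of 0] T unfolding 0 by simp
    then show "(\<integral>\<^sup>+s. k s \<partial>?lu) \<le> (\<integral>\<^sup>+s. m s \<partial>?lu)" by (rule order_trans[rotated]) simp
  qed
  also have "\<dots> = (\<integral>\<^sup>+t. ennreal (exp (\<beta> * t)) * m t \<partial>?lu)" by (rule fub[OF mm])
  finally show ?thesis .
qed

lemma integrable_indicator_upto:
  fixes g :: "real \<Rightarrow> real"
  assumes g: "integrable (lborel_upto T) g" and A: "A \<in> sets borel"
  shows "integrable (lborel_upto T) (\<lambda>s. indicator A s * g s)"
proof (rule Bochner_Integration.integrable_bound[OF g])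
  show "(\<lambda>s. indicator A s * g s) \<in> L0 (lborel_upto T)"
    by (rule borel_measurable_times[OF borel_measurable_lborel_upto[OF borel_measurable_indicator[OF A]] borel_measurable_integrable[OF g]])
qed (rule AE_I2, simp add: indicator_def)

lemma AE_lborel_upto_neq: "AE s in lborel_upto T. s \<noteq> t"
  unfolding lborel_upto_def
  by (subst AE_restrict_space_iff) (use AE_lborel_singleton[of t] in \<open>auto elim: eventually_mono\<close>)

text \<open>The square of an integral is an integral over a square, whose halves on either side of
  the null diagonal are equal. This takes the place of differentiating the squared tail integral in
  \<open>t\<close>.\<close>

lemma sq_integral_symmetric:
  fixes g :: "real \<Rightarrow> real"
  assumes g: "integrable (lborel_upto T) g"
  shows "(\<integral>s. indicator {t..} s * g s \<partial>lborel_upto T)\<^sup>2 =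
    2 * (\<integral>s. indicator {t..} s * (g s * (\<integral>r. indicator {s..} r * g r \<partial>lborel_upto T)) \<partial>lborel_upto T)"
proof -
  let ?lu = "lborel_upto T"
  interpret lu: finite_measure ?lu by (rule finite_measure_lborel_upto)
  interpret P: pair_sigma_finite ?lu ?lu ..
  define k where "k s = indicator {t..} s * g s" for s
  have indm: "indicator A \<in> L0 ?lu" if "A \<in> sets borel" for A :: "real set"
    using that by (intro borel_measurable_lborel_upto) simp
  have ki: "integrable ?lu k" unfolding k_def by (rule integrable_indicator_upto[OF g]) simp
  have km[measurable]: "k \<in> L0 ?lu" using ki by auto
  have kk: "integrable (?lu \<Otimes>\<^sub>M ?lu) (\<lambda>p. k (fst p) * k (snd p))"
  proof (rule P.Fubini_integrable)
    show "(\<lambda>p. k (fst p) * k (snd p)) \<in> L0 (?lu \<Otimes>\<^sub>M ?lu)" by measurable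
    show "integrable ?lu (\<lambda>x. \<integral>y. norm (k (fst (x, y)) * k (snd (x, y))) \<partial>?lu)" using ki by (simp add: abs_mult)
    show "AE x in ?lu. integrable ?lu (\<lambda>y. k (fst (x, y)) * k (snd (x, y)))" using ki by simp
  qed
  have fs[measurable]: "(\<lambda>p. fst p) \<in> L0 (?lu \<Otimes>\<^sub>M ?lu)" "(\<lambda>p. snd p) \<in> L0 (?lu \<Otimes>\<^sub>M ?lu)"
    by (rule measurable_compose[OF measurable_fst measurable_ident_lborel_upto], rule measurable_compose[OF measurable_snd measurable_ident_lborel_upto])
  have i: "integrable (?lu \<Otimes>\<^sub>M ?lu) (\<lambda>p. of_bool (Q p) * (k (fst p) * k (snd p)))"
    if Q: "{p\<in>space (?lu \<Otimes>\<^sub>M ?lu). Q p} \<in> sets (?lu \<Otimes>\<^sub>M ?lu)" for Q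
  proof (rule Bochner_Integration.integrable_bound[OF kk])
    have "(\<lambda>p. indicator {p\<in>space (?lu \<Otimes>\<^sub>M ?lu). Q p} p * (k (fst p) * k (snd p))) \<in> L0 (?lu \<Otimes>\<^sub>M ?lu)"
      by (rule borel_measurable_times[OF borel_measurable_indicator[OF Q] borel_measurable_integrable[OF kk]])
    then show "(\<lambda>p. of_bool (Q p) * (k (fst p) * k (snd p))) \<in> L0 (?lu \<Otimes>\<^sub>M ?lu)"
      by (rule measurable_cong[THEN iffD1, rotated]) (simp add: indicator_def)
  next
    show "AE p in ?lu \<Otimes>\<^sub>M ?lu. norm (of_bool (Q p) * (k (fst p) * k (snd p))) \<le> norm (k (fst p) * k (snd p))"
      by (rule AE_I2) simp
  qed
  have i1: "integrable (?lu \<Otimes>\<^sub>M ?lu) (\<lambda>p. of_bool (fst p \<le> snd p) * (k (fst p) * k (snd p)))" by (rule i) measurable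
  have i2: "integrable (?lu \<Otimes>\<^sub>M ?lu) (\<lambda>p. of_bool (snd p < fst p) * (k (fst p) * k (snd p)))" by (rule i) measurable
  have i3: "integrable (?lu \<Otimes>\<^sub>M ?lu) (\<lambda>p. of_bool (fst p < snd p) * (k (fst p) * k (snd p)))" by (rule i) measurable
  define A where "A = (\<integral>p. of_bool (fst p \<le> snd p) * (k (fst p) * k (snd p)) \<partial>(?lu \<Otimes>\<^sub>M ?lu))"
  have "(\<integral>s. k s \<partial>?lu)\<^sup>2 = (\<integral>p. k (fst p) * k (snd p) \<partial>(?lu \<Otimes>\<^sub>M ?lu))"
    using P.integral_fst'[OF kk] by (simp add: power2_eq_square)
  also have "\<dots> = (\<integral>p. of_bool (fst p \<le> snd p) * (k (fst p) * k (snd p)) + of_bool (snd p < fst p) * (k (fst p) * k (snd p)) \<partial>(?lu \<Otimes>\<^sub>M ?lu))"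
    by (intro Bochner_Integration.integral_cong refl) auto
  also have "\<dots> = A + (\<integral>p. of_bool (snd p < fst p) * (k (fst p) * k (snd p)) \<partial>(?lu \<Otimes>\<^sub>M ?lu))"
    unfolding A_def by (rule Bochner_Integration.integral_add[OF i1 i2])
  also have "(\<integral>p. of_bool (snd p < fst p) * (k (fst p) * k (snd p)) \<partial>(?lu \<Otimes>\<^sub>M ?lu)) = (\<integral>p. of_bool (fst p < snd p) * (k (fst p) * k (snd p)) \<partial>(?lu \<Otimes>\<^sub>M ?lu))"
    using P.integral_product_swap[OF borel_measurable_integrable[OF i3]] by (simp add: case_prod_beta' mult.commute)
  also have "\<dots> = A"
  proof -
    have "(\<integral>p. of_bool (fst p < snd p) * (k (fst p) * k (snd p)) \<partial>(?lu \<Otimes>\<^sub>M ?lu)) = (\<integral>s. (\<integral>r. of_bool (s < r) * (k s * k r) \<partial>?lu) \<partial>?lu)"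
      using P.integral_fst'[OF i3] by simp
    also have "\<dots> = (\<integral>s. (\<integral>r. of_bool (s \<le> r) * (k s * k r) \<partial>?lu) \<partial>?lu)"
    proof (rule Bochner_Integration.integral_cong[OF refl], rule integral_cong_AE)
      fix s
      have b: "(\<lambda>r. of_bool (Q r) * (k s * k r)) \<in> L0 ?lu" if "{r. Q r} \<in> sets borel" for Q
      proof -
        have "(\<lambda>r. indicator {r. Q r} r * (k s * k r)) \<in> L0 ?lu" using indm[OF that] by measurable
        then show ?thesis by (simp add: indicator_def of_bool_def if_distrib cong: if_cong)
      qed
      show "(\<lambda>r. of_bool (s < r) * (k s * k r)) \<in> L0 ?lu" by (rule b) measurable
      show "(\<lambda>r. of_bool (s \<le> r) * (k s * k r)) \<in> L0 ?lu" by (rule b) measurable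
      show "AE r in ?lu. of_bool (s < r) * (k s * k r) = of_bool (s \<le> r) * (k s * k r)"
        using AE_lborel_upto_neq[of s T] by eventually_elim auto
    qed
    also have "\<dots> = A" unfolding A_def using P.integral_fst'[OF i1] by simp
    finally show ?thesis .
  qed
  finally have "(\<integral>s. k s \<partial>?lu)\<^sup>2 = 2 * A" by simp
  moreover have "A = (\<integral>s. indicator {t..} s * (g s * (\<integral>r. indicator {s..} r * g r \<partial>?lu)) \<partial>?lu)"
  proof -
    have "A = (\<integral>s. (\<integral>r. of_bool (s \<le> r) * (k s * k r) \<partial>?lu) \<partial>?lu)" unfolding A_def using P.integral_fst'[OF i1] by simp
    also have "\<dots> = (\<integral>s. indicator {t..} s * (g s * (\<integral>r. indicator {s..} r * g r \<partial>?lu)) \<partial>?lu)"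
    proof (intro Bochner_Integration.integral_cong refl)
      fix s
      have "(\<lambda>r. of_bool (s \<le> r) * (k s * k r)) = (\<lambda>r. (indicator {t..} s * g s) * (indicator {s..} r * g r))"
        by (auto simp: fun_eq_iff k_def indicator_def)
      then show "(\<integral>r. of_bool (s \<le> r) * (k s * k r) \<partial>?lu) = indicator {t..} s * (g s * (\<integral>r. indicator {s..} r * g r \<partial>?lu))"
        by (simp add: mult.assoc)
    qed
    finally show ?thesis .
  qed
  ultimately show ?thesis by (simp add: k_def)
qed

text \<open>Cauchy--Schwarz on \<open>[0, T]\<close>, where \<open>b\<close> stands for the
  indicator of a set of times; an infinite norm of \<open>g\<close> makes the claim trivial.\<close>

lemma sq_integral_upto_le:
  assumes g: "g \<in> L0 (lborel_upto T)" and b: "b \<in> L0 borel" "\<And>s. \<bar>b s\<bar> \<le> 1" and T: "0 < T"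
  shows "ennreal ((\<integral>s. b s * g s \<partial>lborel_upto T)\<^sup>2) \<le> ennreal T * sq_norm (lborel_upto T) g"
proof (cases "sq_norm (lborel_upto T) g < \<infinity>")
  case True
  then have sg: "sq_integrable (lborel_upto T) g" by (simp add: sq_integrable_iff[OF g])
  have bm: "b \<in> L0 (lborel_upto T)" by (rule borel_measurable_lborel_upto[OF b(1)])
  have sb: "sq_integrable (lborel_upto T) b"
    by (rule sq_integrable_bounded[OF finite_measure_lborel_upto bm, where K=1]) (use b(2) in blast)
  interpret lu: finite_measure "lborel_upto T" by (rule finite_measure_lborel_upto)
  have b2: "(b s)\<^sup>2 \<le> 1" for s using b(2)[of s] by (simp add: abs_square_le_1)
  have ib: "integrable (lborel_upto T) (\<lambda>s. (b s)\<^sup>2)" using sb by (simp add: sq_integrable_def)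
  have "(\<integral>s. (b s)\<^sup>2 \<partial>lborel_upto T) \<le> (\<integral>s. 1 \<partial>lborel_upto T)"
    by (rule integral_mono[OF ib lu.integrable_const b2])
  also have "\<dots> = T" using T by (simp add: measure_def lborel_upto_def emeasure_restrict_space)
  finally have "(\<integral>s. (b s)\<^sup>2 \<partial>lborel_upto T) * (\<integral>s. (g s)\<^sup>2 \<partial>lborel_upto T) \<le> T * (\<integral>s. (g s)\<^sup>2 \<partial>lborel_upto T)"
    by (rule mult_right_mono) simp
  with integral_mult_sq_le[OF sb sg] have "(\<integral>s. b s * g s \<partial>lborel_upto T)\<^sup>2 \<le> T * (\<integral>s. (g s)\<^sup>2 \<partial>lborel_upto T)" by (rule order_trans)
  then have "ennreal ((\<integral>s. b s * g s \<partial>lborel_upto T)\<^sup>2) \<le> ennreal (T * (\<integral>s. (g s)\<^sup>2 \<partial>lborel_upto T))" by (rule ennreal_leI)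
  then show ?thesis unfolding sq_integrable_nn_integral[OF sg] using T by (simp add: ennreal_mult)
next
  case False
  then have "sq_norm (lborel_upto T) g = top" by (simp add: not_less top_unique)
  then show ?thesis using T by (simp add: ennreal_mult_top)
qed

lemma sq_integrable_cong_AE:
  assumes "sq_integrable N X" "Y \<in> L0 N" "AE x in N. X x = Y x"
  shows "sq_integrable N Y"
proof -
  have "sq_norm N Y = sq_norm N X"
    by (rule nn_integral_cong_AE) (use assms(3) in eventually_elim, simp)
  moreover have "sq_norm N X < \<infinity>"
    using assms(1) by (simp add: sq_integrable_nn_integral)
  ultimately show ?thesis by (simp add: sq_integrable_iff[OF assms(2)])
qed

lemma emeasure_lborel_upto: "0 < T \<Longrightarrow> emeasure (lborel_upto T) {0..T} = ennreal T"
  by (simp add: lborel_upto_def emeasure_restrict_space)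

context wiener
begin

lemma nn_integral_TM_weighted:
  fixes g :: "real \<Rightarrow> ennreal" and X :: "real \<Rightarrow> 'a \<Rightarrow> ennreal"
  assumes g: "g \<in> L0 lu" and X: "uncurried X \<in> L0 TM"
  shows "(\<integral>\<^sup>+p. g (fst p) * X (fst p) (snd p) \<partial>TM) = (\<integral>\<^sup>+t. g t * (\<integral>\<^sup>+w. X t w \<partial>M) \<partial>lu)"
proof -
  have "(\<lambda>p. g (fst p) * X (fst p) (snd p)) \<in> L0 TM"
    by (intro borel_measurable_times_ennreal X measurable_compose[OF measurable_fst g])
  from nn_integral_fst[OF this, symmetric]
  have "(\<integral>\<^sup>+p. g (fst p) * X (fst p) (snd p) \<partial>TM) = (\<integral>\<^sup>+t. (\<integral>\<^sup>+w. g t * X t w \<partial>M) \<partial>lu)" by simp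
  also have "\<dots> = (\<integral>\<^sup>+t. g t * (\<integral>\<^sup>+w. X t w \<partial>M) \<partial>lu)"
  proof (rule nn_integral_cong)
    fix t assume t: "t \<in> space lu"
    have "X t \<in> L0 M" using measurable_compose_Pair1[OF t X] by simp
    then show "(\<integral>\<^sup>+w. g t * X t w \<partial>M) = g t * (\<integral>\<^sup>+w. X t w \<partial>M)" by (rule nn_integral_cmult)
  qed
  finally show ?thesis .
qed

lemma integrable_indicator_TM:
  fixes g :: "real \<times> 'a \<Rightarrow> real"
  assumes g: "integrable TM g" and A: "A \<in> sets borel"
  shows "integrable TM (\<lambda>p. indicator A (fst p) * g p)"
proof (rule Bochner_Integration.integrable_bound[OF g])
  show "(\<lambda>p. indicator A (fst p) * g p) \<in> L0 TM"
    by (rule borel_measurable_times[OF measurable_compose[OF fst_measurable_TM borel_measurable_indicator[OF A]] borel_measurable_integrable[OF g]])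
qed (rule AE_I2, simp add: indicator_def)

lemma section_TM:
  assumes "uncurried X \<in> L0 TM"
  shows "t \<in> {0..T} \<Longrightarrow> X t \<in> L0 M"
    and "w \<in> space M \<Longrightarrow> (\<lambda>t. X t w) \<in> L0 lu"
  using measurable_compose_Pair1[OF _ assms, of t] measurable_compose[OF measurable_Pair2' assms, of w] by auto

lemma tail_integral_measurable:
  fixes h :: "real \<Rightarrow> 'a \<Rightarrow> real"
  assumes h: "uncurried h \<in> L0 TM"
  shows "(\<lambda>p. \<integral>s. indicator {fst p..} s * h s (snd p) \<partial>lu) \<in> L0 TM"
proof -
  interpret lu: finite_measure lu by (rule finite_measure_lborel_upto)
  let ?N = "TM \<Otimes>\<^sub>M lu"
  have a: "(\<lambda>x. fst (fst x)) \<in> L0 ?N"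
    by (rule measurable_compose[OF measurable_fst fst_measurable_TM])
  have b: "(\<lambda>x. snd x) \<in> L0 ?N"
    by (rule measurable_compose[OF measurable_snd measurable_ident_lborel_upto])
  have "(\<lambda>x. (snd x, snd (fst x))) \<in> measurable ?N TM"
    by (intro measurable_Pair measurable_snd measurable_compose[OF measurable_fst measurable_snd])
  from measurable_compose[OF this h] have c: "(\<lambda>x. h (snd x) (snd (fst x))) \<in> L0 ?N" by simp
  have "(\<lambda>x. indicator {x\<in>space ?N. fst (fst x) \<le> snd x} x * h (snd x) (snd (fst x))) \<in> L0 ?N"
    by (intro borel_measurable_times borel_measurable_indicator borel_measurable_le a b c)
  then have "(\<lambda>x. indicator {fst (fst x)..} (snd x) * h (snd x) (snd (fst x))) \<in> L0 ?N"
    by (rule measurable_cong[THEN iffD1, rotated]) (simp add: indicator_def)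
  then have "(\<lambda>(p, s). indicator {fst p..} s * h s (snd p)) \<in> L0 ?N" by (simp only: case_prod_beta')
  then show ?thesis by (rule lu.borel_measurable_lebesgue_integral)
qed

lemma nn_integral_part_integral_sq_le:
  fixes h :: "real \<Rightarrow> 'a \<Rightarrow> real"
  assumes h: "uncurried h \<in> L0 TM"
    and b: "b \<in> L0 borel" "\<And>s. \<bar>b s\<bar> \<le> 1"
  shows "sq_norm M (\<lambda>w. \<integral>s. b s * h s w \<partial>lu) \<le> ennreal T * sq_norm TM (uncurried h)"
proof -
  interpret P: pair_sigma_finite lu M by (rule pair_sigma_finite_TM)
  have m: "(\<lambda>p. ennreal ((h (fst p) (snd p))\<^sup>2)) \<in> L0 TM"
    by (intro measurable_compose[OF _ measurable_ennreal] borel_measurable_power h)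
  have "sq_norm M (\<lambda>w. \<integral>s. b s * h s w \<partial>lu) \<le> (\<integral>\<^sup>+w. ennreal T * sq_norm lu (\<lambda>s. h s w) \<partial>M)"
    by (rule nn_integral_mono) (rule sq_integral_upto_le[OF section_TM(2)[OF h] b T_pos])
  also have "\<dots> = ennreal T * (\<integral>\<^sup>+w. sq_norm lu (\<lambda>s. h s w) \<partial>M)"
    by (rule nn_integral_cmult) (use P.M1.borel_measurable_nn_integral_fst[OF measurable_pair_swap[OF m]] in simp)
  also have "(\<integral>\<^sup>+w. sq_norm lu (\<lambda>s. h s w) \<partial>M) = sq_norm TM (uncurried h)"
    by (rule nn_integral_TM_swap[OF m])
  finally show ?thesis .
qed

text \<open>Young's inequality is balanced so that it absorbs only half of the term in
  \<open>D\<close> that the weight produces; the other half stays on the left. Square integrability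
  of each \<open>D t\<close> is not assumed but read off from the equation.\<close>

lemma a_priori_estimate:
  fixes H J D h :: "real \<Rightarrow> 'a \<Rightarrow> real"
  assumes \<beta>: "0 < \<beta>" and ia: "ito_approx L H J"
    and Dm: "uncurried D \<in> L0 TM" and Da: "\<And>t. t \<in> {0..T} \<Longrightarrow> D t \<in> L0 (F t)"
    and hm: "uncurried h \<in> L0 TM" and ha: "\<And>t. t \<in> {0..T} \<Longrightarrow> h t \<in> L0 (F t)"
    and hf: "sq_norm TM (uncurried h) < \<infinity>"
    and eq: "AE w in M. \<forall>t\<in>{0..T}. D t w = (\<integral>s. indicator {t..} s * h s w \<partial>lu) - (J T w - J t w)"
  shows "ennreal (\<beta> / 2) * (\<integral>\<^sup>+p. ennreal (exp (\<beta> * fst p)) * ennreal ((D (fst p) (snd p))\<^sup>2) \<partial>TM)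
      + (\<integral>\<^sup>+p. ennreal (exp (\<beta> * fst p)) * ennreal ((H (fst p) (snd p))\<^sup>2) \<partial>TM)
    \<le> ennreal (2 / \<beta>) * (\<integral>\<^sup>+p. ennreal (exp (\<beta> * fst p)) * ennreal ((h (fst p) (snd p))\<^sup>2) \<partial>TM)"
proof -
  interpret lu: finite_measure lu by (rule finite_measure_lborel_upto)
  interpret P: pair_sigma_finite lu M by (rule pair_sigma_finite_TM)
  have TT: "T \<in> {0..T}" using T_pos by simp
  note facts = ito_approx_facts[OF ia]
  define S where "S t w = (\<integral>s. indicator {t..} s * h s w \<partial>lu)" for t w
  define N where "N = sq_norm TM (uncurried h)"
  have Sm: "uncurried S \<in> L0 TM" unfolding S_def by (rule tail_integral_measurable[OF hm])
  have Hm: "uncurried H \<in> L0 TM" using facts(1) by (simp add: sq_integrable_def)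
  have TN: "ennreal T * N < \<infinity>" using hf unfolding N_def by (rule ennreal_times_finite)
  have SN: "sq_norm M (\<lambda>w. S t w) \<le> ennreal T * N" for t
    unfolding S_def N_def by (rule nn_integral_part_integral_sq_le[OF hm]) (auto simp: indicator_def)
  have Ssq: "sq_integrable M (S t)" if "t \<in> {0..T}" for t
    unfolding sq_integrable_iff[OF section_TM(1)[OF Sm that]] by (rule le_less_trans[OF SN TN])
  have hsq: "sq_integrable TM (uncurried h)" using hf by (simp add: sq_integrable_iff[OF hm])
  have eqt: "AE w in M. D t w = S t w - (J T w - J t w)" if "t \<in> {0..T}" for t
    using eq by eventually_elim (use that in \<open>simp add: S_def\<close>)
  have JD: "sq_integrable M (\<lambda>w. J T w - J t w)" if "t \<in> {0..T}" for t
    by (rule sq_integrable_diff[OF facts(2)[OF TT] facts(2)[OF that]])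
  have DM: "D t \<in> L0 M" if "t \<in> {0..T}" for t by (rule section_TM(1)[OF Dm that])
  have Dsq: "sq_integrable M (D t)" if t: "t \<in> {0..T}" for t
    by (rule sq_integrable_cong_AE[OF sq_integrable_diff[OF Ssq[OF t] JD[OF t]] DM[OF t]])
      (use eqt[OF t] in eventually_elim, simp)
  have sq2: "integrable M (\<lambda>w. (X w)\<^sup>2)" if "sq_integrable M X" for X using that by (simp add: sq_integrable_def)
  \<comment> \<open>\<open>D t\<close> is known at \<open>t\<close>, hence orthogonal to
    \<open>J T - J t\<close>, and the cross term vanishes.\<close>
  have pyth: "(\<integral>w. (S t w)\<^sup>2 \<partial>M) = (\<integral>w. (D t w)\<^sup>2 \<partial>M) + (\<integral>w. (J T w - J t w)\<^sup>2 \<partial>M)" if t: "t \<in> {0..T}" for t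
  proof -
    note i = sq2[OF Dsq[OF t]] sq_integrable_mult[OF Dsq[OF t] JD[OF t]] sq2[OF JD[OF t]]
    have "(\<integral>w. (S t w)\<^sup>2 \<partial>M) = (\<integral>w. ((D t w)\<^sup>2 + 2 * (D t w * (J T w - J t w))) + (J T w - J t w)\<^sup>2 \<partial>M)"
    proof (rule integral_cong_AE)
      show "AE w in M. (S t w)\<^sup>2 = ((D t w)\<^sup>2 + 2 * (D t w * (J T w - J t w))) + (J T w - J t w)\<^sup>2"
        using eqt[OF t]
      proof eventually_elim
        case (elim w)
        then have "S t w = D t w + (J T w - J t w)" by simp
        then show ?case by (simp only: power2_sum)
      qed
      show "(\<lambda>w. (S t w)\<^sup>2) \<in> L0 M" by (rule borel_measurable_integrable[OF sq2[OF Ssq[OF t]]])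
      show "(\<lambda>w. ((D t w)\<^sup>2 + 2 * (D t w * (J T w - J t w))) + (J T w - J t w)\<^sup>2) \<in> L0 M"
        by (rule borel_measurable_integrable) (intro Bochner_Integration.integrable_add Bochner_Integration.integrable_mult_right i)
    qed
    also have "\<dots> = (\<integral>w. (D t w)\<^sup>2 + 2 * (D t w * (J T w - J t w)) \<partial>M) + (\<integral>w. (J T w - J t w)\<^sup>2 \<partial>M)"
      by (intro Bochner_Integration.integral_add Bochner_Integration.integrable_add Bochner_Integration.integrable_mult_right i)
    also have "(\<integral>w. (D t w)\<^sup>2 + 2 * (D t w * (J T w - J t w)) \<partial>M) = (\<integral>w. (D t w)\<^sup>2 \<partial>M) + (\<integral>w. 2 * (D t w * (J T w - J t w)) \<partial>M)"
      by (intro Bochner_Integration.integral_add Bochner_Integration.integrable_mult_right i)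
    also have "(\<integral>w. 2 * (D t w * (J T w - J t w)) \<partial>M) = 0"
      using facts(3)[OF t Da[OF t] Dsq[OF t]] by simp
    finally show ?thesis by simp
  qed
  define a where "a t = sq_norm M (\<lambda>w. D t w)" for t
  define k where "k t = sq_norm M (\<lambda>w. H t w)" for t
  define b where "b t = sq_norm M (\<lambda>w. h t w)" for t
  have em: "(\<lambda>p. ennreal ((X (fst p) (snd p))\<^sup>2)) \<in> L0 TM"
    if "uncurried X \<in> L0 TM" for X :: "real \<Rightarrow> 'a \<Rightarrow> real"
    by (intro measurable_compose[OF _ measurable_ennreal] borel_measurable_power that)
  have am: "a \<in> L0 lu" unfolding a_def using borel_measurable_nn_integral_fst[OF em[OF Dm]] by simp
  have km: "k \<in> L0 lu" unfolding k_def using borel_measurable_nn_integral_fst[OF em[OF Hm]] by simp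
  have bm: "b \<in> L0 lu" unfolding b_def using borel_measurable_nn_integral_fst[OF em[OF hm]] by simp
  have S_sum: "sq_norm M (\<lambda>w. S t w) = a t + (\<integral>\<^sup>+s. indicator {t..} s * k s \<partial>lu)" if t: "t \<in> {0..T}" for t
  proof -
    have "ennreal (\<integral>w. (J T w - J t w)\<^sup>2 \<partial>M) = (\<integral>\<^sup>+p. indicator {t<..} (fst p) * ennreal ((H (fst p) (snd p))\<^sup>2) \<partial>TM)"
    proof -
      have ii: "integrable TM (\<lambda>p. indicator {t<..} (fst p) * (H (fst p) (snd p))\<^sup>2)"
        by (rule integrable_indicator_TM[OF sq_integrable_def[THEN iffD1, OF facts(1), THEN conjunct2]]) simp
      have "ennreal (\<integral>p. indicator {t<..} (fst p) * (H (fst p) (snd p))\<^sup>2 \<partial>TM) = (\<integral>\<^sup>+p. ennreal (indicator {t<..} (fst p) * (H (fst p) (snd p))\<^sup>2) \<partial>TM)"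
        by (rule nn_integral_eq_integral[OF ii, symmetric]) (rule AE_I2, simp add: indicator_def)
      also have "\<dots> = (\<integral>\<^sup>+p. indicator {t<..} (fst p) * ennreal ((H (fst p) (snd p))\<^sup>2) \<partial>TM)"
        by (rule nn_integral_cong) (simp add: indicator_def)
      finally show ?thesis unfolding facts(4)[OF t] .
    qed
    also have "\<dots> = (\<integral>\<^sup>+s. indicator {t<..} s * k s \<partial>lu)"
      unfolding k_def by (rule nn_integral_TM_weighted[OF borel_measurable_lborel_upto em[OF Hm]]) simp
    \<comment> \<open>The isometry yields the interval without \<open>t\<close>, the weighted
      inequality expects it with \<open>t\<close>; a single time carries no mass.\<close>
    also have "\<dots> = (\<integral>\<^sup>+s. indicator {t..} s * k s \<partial>lu)"
    proof (rule nn_integral_cong_AE)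
      show "AE s in lu. indicator {t<..} s * k s = indicator {t..} s * k s"
        using AE_lborel_upto_neq[of t T] by eventually_elim (simp add: indicator_def)
    qed
    finally have kk: "ennreal (\<integral>w. (J T w - J t w)\<^sup>2 \<partial>M) = (\<integral>\<^sup>+s. indicator {t..} s * k s \<partial>lu)" .
    have "sq_norm M (\<lambda>w. S t w) = ennreal ((\<integral>w. (D t w)\<^sup>2 \<partial>M) + (\<integral>w. (J T w - J t w)\<^sup>2 \<partial>M))"
      unfolding sq_integrable_nn_integral[OF Ssq[OF t]] pyth[OF t] ..
    also have "\<dots> = ennreal (\<integral>w. (D t w)\<^sup>2 \<partial>M) + ennreal (\<integral>w. (J T w - J t w)\<^sup>2 \<partial>M)"
      by (rule ennreal_plus) simp_all
    also have "ennreal (\<integral>w. (D t w)\<^sup>2 \<partial>M) = a t" unfolding a_def by (rule sq_integrable_nn_integral[OF Dsq[OF t], symmetric])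
    finally show ?thesis unfolding kk .
  qed
  have aN: "a t \<le> ennreal T * N" if t: "t \<in> {0..T}" for t
    using SN[of t] unfolding S_sum[OF t] by (rule order_trans[rotated]) simp
  have hs: "AE s in lu. sq_integrable M (h s)"
  proof -
    have "(\<integral>\<^sup>+s. b s \<partial>lu) = N" unfolding b_def N_def using nn_integral_fst[OF em[OF hm]] by simp
    then have "AE s in lu. b s \<noteq> \<infinity>" using hf bm unfolding N_def by (intro nn_integral_noteq_infinite) auto
    moreover have "AE s in lu. s \<in> space lu" by (rule AE_space)
    ultimately show ?thesis
    proof eventually_elim
      case (elim s)
      then have "s \<in> {0..T}" by simp
      from section_TM(1)[OF hm this] show ?case using elim(1) by (simp add: sq_integrable_iff b_def less_top)
    qed
  qed
  have SS: "sq_integrable TM (uncurried S)"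
  proof -
    have "sq_norm TM (uncurried S) = (\<integral>\<^sup>+t. sq_norm M (\<lambda>w. S t w) \<partial>lu)"
      using nn_integral_fst[OF em[OF Sm]] by simp
    also have "\<dots> \<le> (\<integral>\<^sup>+t. ennreal T * N \<partial>lu)" by (rule nn_integral_mono) (rule SN)
    also have "\<dots> = ennreal T * (ennreal T * N)" using emeasure_lborel_upto[OF T_pos] by (simp add: mult.commute)
    also have "\<dots> < \<infinity>" by (rule ennreal_times_finite[OF TN])
    finally show ?thesis unfolding sq_integrable_iff[OF Sm] .
  qed
  define f where "f t p = indicator {t..} (fst p) * (h (fst p) (snd p) * S (fst p) (snd p))" for t p
  have fi: "integrable TM (f t)" for t
    unfolding f_def by (rule integrable_indicator_TM[OF sq_integrable_mult[OF hsq SS]]) simp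
  \<comment> \<open>The symmetry identity holds for almost every path and is then integrated over
    \<open>w\<close>; \<open>f\<close> is its integrand as a function on the product, to which
    Fubini applies.\<close>
  have S_prod: "(\<integral>w. (S t w)\<^sup>2 \<partial>M) = 2 * (\<integral>s. indicator {t..} s * (\<integral>w. h s w * S s w \<partial>M) \<partial>lu)" for t
  proof -
    have swap: "integrable (M \<Otimes>\<^sub>M lu) (\<lambda>(w, s). f t (s, w))" by (rule P.integrable_product_swap[OF fi])
    interpret Q: pair_sigma_finite M lu ..
    have hi: "AE w in M. integrable lu (\<lambda>s. h s w)"
      using Q.AE_integrable_fst'[OF P.integrable_product_swap[OF sq_integrable_integrable[OF finite_measure_TM hsq]]] by simp
    have "(\<integral>w. (S t w)\<^sup>2 \<partial>M) = (\<integral>w. 2 * (\<integral>s. f t (s, w) \<partial>lu) \<partial>M)"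
    proof (rule integral_cong_AE)
      show "AE w in M. (S t w)\<^sup>2 = 2 * (\<integral>s. f t (s, w) \<partial>lu)"
        using hi
      proof eventually_elim
        case (elim w)
        show ?case using sq_integral_symmetric[OF elim, of t] by (simp only: S_def f_def fst_conv snd_conv)
      qed
      show "(\<lambda>w. (S t w)\<^sup>2) \<in> L0 M"
      proof -
        have "(\<lambda>(w, s). indicator {t..} s * h s w) \<in> L0 (M \<Otimes>\<^sub>M lu)"
          using measurable_pair_swap[OF hm] by (auto simp: case_prod_beta' intro!: borel_measurable_times measurable_compose[OF measurable_snd borel_measurable_lborel_upto])
        from lu.borel_measurable_lebesgue_integral[OF this] show ?thesis unfolding S_def by (rule borel_measurable_power)
      qed
      show "(\<lambda>w. 2 * (\<integral>s. f t (s, w) \<partial>lu)) \<in> L0 M"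
        using borel_measurable_integrable[OF Q.integrable_fst'[OF swap]] by (intro borel_measurable_times borel_measurable_const) simp
    qed
    also have "\<dots> = 2 * (\<integral>w. (\<integral>s. f t (s, w) \<partial>lu) \<partial>M)" by simp
    also have "(\<integral>w. (\<integral>s. f t (s, w) \<partial>lu) \<partial>M) = integral\<^sup>L TM (f t)"
      using Q.integral_fst'[OF swap] P.integral_product_swap[OF borel_measurable_integrable[OF fi[of t]]] by simp
    also have "\<dots> = (\<integral>s. (\<integral>w. f t (s, w) \<partial>M) \<partial>lu)" by (rule P.integral_fst'[OF fi, symmetric])
    also have "\<dots> = (\<integral>s. indicator {t..} s * (\<integral>w. h s w * S s w \<partial>M) \<partial>lu)"
      by (rule Bochner_Integration.integral_cong[OF refl]) (simp add: f_def)
    finally show ?thesis .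
  qed
  define m where "m s = ennreal (\<beta> / 2) * a s + ennreal (2 / \<beta>) * b s" for s
  have mm: "m \<in> L0 lu" unfolding m_def
    by (intro borel_measurable_add borel_measurable_times_ennreal am bm borel_measurable_const)
  \<comment> \<open>\<open>h s\<close> is known at \<open>s\<close>, so \<open>S s\<close> may be
    replaced by \<open>D s\<close> under the expectation. Square integrability of \<open>h s\<close>
    holds for almost every \<open>s\<close>, which suffices after integration in time.\<close>
  have pt: "AE s in lu. ennreal \<bar>2 * (\<integral>w. h s w * S s w \<partial>M)\<bar> \<le> m s"
  proof -
    have "AE s in lu. s \<in> space lu" by (rule AE_space)
    with hs show ?thesis
    proof eventually_elim
      case (elim s)
      then have s: "s \<in> {0..T}" by simp
      note i = sq_integrable_mult[OF elim(1) Dsq[OF s]] sq_integrable_mult[OF elim(1) JD[OF s]]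
      have "(\<integral>w. h s w * S s w \<partial>M) = (\<integral>w. h s w * D s w + h s w * (J T w - J s w) \<partial>M)"
      proof (rule integral_cong_AE)
        show "AE w in M. h s w * S s w = h s w * D s w + h s w * (J T w - J s w)"
          using eqt[OF s]
        proof eventually_elim
          case (elim w)
          then have "S s w = D s w + (J T w - J s w)" by simp
          then show ?case by (simp only: distrib_left)
        qed
      qed (rule borel_measurable_integrable, (rule sq_integrable_mult[OF elim(1) Ssq[OF s]] Bochner_Integration.integrable_add[OF i]))+
      also have "\<dots> = (\<integral>w. h s w * D s w \<partial>M)"
        unfolding Bochner_Integration.integral_add[OF i] facts(3)[OF s ha[OF s] elim(1)] by simp
      finally have "2 * (\<integral>w. h s w * S s w \<partial>M) = (\<integral>w. 2 * (h s w * D s w) \<partial>M)" by simp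
      then have "ennreal \<bar>2 * (\<integral>w. h s w * S s w \<partial>M)\<bar> \<le> (\<integral>\<^sup>+w. ennreal (norm (2 * (h s w * D s w))) \<partial>M)"
        using integral_norm_bound_ennreal[OF Bochner_Integration.integrable_mult_right[OF i(1)], of 2] by simp
      also have "\<dots> \<le> (\<integral>\<^sup>+w. ennreal (\<beta> / 2) * ennreal ((D s w)\<^sup>2) + ennreal (2 / \<beta>) * ennreal ((h s w)\<^sup>2) \<partial>M)"
      proof (rule nn_integral_mono)
        fix w
        have "\<bar>2 * (x * y)\<bar> \<le> \<beta> / 2 * y\<^sup>2 + 2 / \<beta> * x\<^sup>2" for x y :: real
        proof -
          \<comment> \<open>Expanding this square and dividing by \<open>2 * \<beta>\<close> gives
            Young's inequality with the coefficients \<open>\<beta> / 2\<close> and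
            \<open>2 / \<beta>\<close>.\<close>
          have "0 \<le> (\<beta> * \<bar>y\<bar> - 2 * \<bar>x\<bar>)\<^sup>2" by simp
          then have "4 * \<beta> * (\<bar>x\<bar> * \<bar>y\<bar>) \<le> \<beta>\<^sup>2 * y\<^sup>2 + 4 * x\<^sup>2" by (simp add: power2_diff power_mult_distrib mult_ac)
          then have "(4 * \<beta> * (\<bar>x\<bar> * \<bar>y\<bar>)) / (2 * \<beta>) \<le> (\<beta>\<^sup>2 * y\<^sup>2 + 4 * x\<^sup>2) / (2 * \<beta>)" using \<beta> by (intro divide_right_mono) auto
          moreover have "(4 * \<beta> * (\<bar>x\<bar> * \<bar>y\<bar>)) / (2 * \<beta>) = \<bar>2 * (x * y)\<bar>" using \<beta> by (simp add: abs_mult)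
          moreover have "(\<beta>\<^sup>2 * y\<^sup>2 + 4 * x\<^sup>2) / (2 * \<beta>) = \<beta> / 2 * y\<^sup>2 + 2 / \<beta> * x\<^sup>2" using \<beta> by (simp add: add_divide_distrib power2_eq_square)
          ultimately show ?thesis by simp
        qed
        then have "ennreal (norm (2 * (h s w * D s w))) \<le> ennreal (\<beta> / 2 * (D s w)\<^sup>2 + 2 / \<beta> * (h s w)\<^sup>2)"
          by (intro ennreal_leI) simp
        also have "\<dots> = ennreal (\<beta> / 2) * ennreal ((D s w)\<^sup>2) + ennreal (2 / \<beta>) * ennreal ((h s w)\<^sup>2)"
          using \<beta> by (simp add: ennreal_plus ennreal_mult del: times_divide_eq_left)
        finally show "ennreal (norm (2 * (h s w * D s w))) \<le> ennreal (\<beta> / 2) * ennreal ((D s w)\<^sup>2) + ennreal (2 / \<beta>) * ennreal ((h s w)\<^sup>2)" .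
      qed
      also have "\<dots> = m s"
      proof -
        have e: "(\<lambda>w. ennreal ((D s w)\<^sup>2)) \<in> L0 M" "(\<lambda>w. ennreal ((h s w)\<^sup>2)) \<in> L0 M"
          by (intro measurable_compose[OF _ measurable_ennreal] borel_measurable_power DM[OF s] section_TM(1)[OF hm s])+
        show ?thesis unfolding m_def a_def b_def
          by (subst nn_integral_add) (intro borel_measurable_times_ennreal borel_measurable_const e | simp only: nn_integral_cmult[OF e(1)] nn_integral_cmult[OF e(2)])+
      qed
      finally show ?case .
    qed
  qed
  have key: "a t + (\<integral>\<^sup>+s. indicator {t..} s * k s \<partial>lu) \<le> (\<integral>\<^sup>+s. indicator {t..} s * m s \<partial>lu)" if t: "t \<in> {0..T}" for t
  proof -
    define q where "q s = indicator {t..} s * (2 * (\<integral>w. h s w * S s w \<partial>M))" for s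
    have q2: "q = (\<lambda>s. 2 * (indicator {t..} s * (\<integral>w. h s w * S s w \<partial>M)))"
      unfolding q_def fun_eq_iff by (simp only: mult.left_commute simp_thms)
    have qi: "integrable lu q"
    proof -
      have "(\<integral>w. f t (s, w) \<partial>M) = indicator {t..} s * (\<integral>w. h s w * S s w \<partial>M)" for s
        by (simp only: f_def fst_conv snd_conv integral_mult_right_zero)
      with Bochner_Integration.integrable_mult_right[OF P.integrable_fst'[OF fi], of 2 t] show ?thesis unfolding q2 by simp
    qed
    have "(\<integral>w. (S t w)\<^sup>2 \<partial>M) = (\<integral>s. q s \<partial>lu)" unfolding S_prod q2 by (simp only: integral_mult_right_zero)
    then have "sq_norm M (\<lambda>w. S t w) = ennreal (\<integral>s. q s \<partial>lu)" unfolding sq_integrable_nn_integral[OF Ssq[OF t]] by simp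
    also have "\<dots> \<le> ennreal (norm (\<integral>s. q s \<partial>lu))" by (intro ennreal_leI) simp
    also have "\<dots> \<le> (\<integral>\<^sup>+s. ennreal (norm (q s)) \<partial>lu)" by (rule integral_norm_bound_ennreal[OF qi])
    also have "\<dots> \<le> (\<integral>\<^sup>+s. indicator {t..} s * m s \<partial>lu)"
    proof (rule nn_integral_mono_AE)
      show "AE s in lu. ennreal (norm (q s)) \<le> indicator {t..} s * m s"
        using pt by eventually_elim (simp add: q_def indicator_def)
    qed
    finally show ?thesis unfolding S_sum[OF t] .
  qed
  define A where "A = (\<integral>\<^sup>+t. ennreal (exp (\<beta> * t)) * a t \<partial>lu)"
  define B where "B = (\<integral>\<^sup>+t. ennreal (exp (\<beta> * t)) * b t \<partial>lu)"
  define K where "K = (\<integral>\<^sup>+t. ennreal (exp (\<beta> * t)) * k t \<partial>lu)"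
  have w: "(\<lambda>t. ennreal (exp (\<beta> * t))) \<in> L0 lu" using ennreal_exp_measurable[of 1 \<beta> 0 T] by simp
  have ea: "(\<lambda>t. ennreal (exp (\<beta> * t)) * a t) \<in> L0 lu" by (intro borel_measurable_times_ennreal w am)
  have eb: "(\<lambda>t. ennreal (exp (\<beta> * t)) * b t) \<in> L0 lu" by (intro borel_measurable_times_ennreal w bm)
  \<comment> \<open>Finiteness is what permits cancelling half of \<open>\<beta> * A\<close> in the
    extended nonnegative numbers.\<close>
  have AF: "A < \<infinity>"
  proof -
    have "A \<le> (\<integral>\<^sup>+t. ennreal (exp (\<beta> * T)) * (ennreal T * N) \<partial>lu)"
      unfolding A_def
    proof (rule nn_integral_mono)
      fix t assume "t \<in> space lu"
      then have t: "t \<in> {0..T}" by simp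
      then have "\<beta> * t \<le> \<beta> * T" using \<beta> by simp
      then show "ennreal (exp (\<beta> * t)) * a t \<le> ennreal (exp (\<beta> * T)) * (ennreal T * N)" by (intro mult_mono aN[OF t] ennreal_leI) auto
    qed
    also have "\<dots> = ennreal T * (ennreal (exp (\<beta> * T)) * (ennreal T * N))" using emeasure_lborel_upto[OF T_pos] by (simp add: mult.commute)
    also have "\<dots> < \<infinity>" by (intro ennreal_times_finite TN)
    finally show ?thesis .
  qed
  have "ennreal \<beta> * A + K \<le> ennreal (\<beta> / 2) * A + ennreal (2 / \<beta>) * B"
  proof -
    have "(\<integral>\<^sup>+t. ennreal (\<beta> * exp (\<beta> * t)) * a t \<partial>lu) = ennreal \<beta> * A"
      unfolding A_def nn_integral_cmult[OF ea, symmetric] using \<beta> by (intro nn_integral_cong) (simp add: ennreal_mult mult.assoc)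
    moreover have "(\<integral>\<^sup>+t. ennreal (exp (\<beta> * t)) * m t \<partial>lu) = ennreal (\<beta> / 2) * A + ennreal (2 / \<beta>) * B"
    proof -
      have "(\<integral>\<^sup>+t. ennreal (exp (\<beta> * t)) * m t \<partial>lu) = (\<integral>\<^sup>+t. ennreal (\<beta> / 2) * (ennreal (exp (\<beta> * t)) * a t) + ennreal (2 / \<beta>) * (ennreal (exp (\<beta> * t)) * b t) \<partial>lu)"
        unfolding m_def by (intro nn_integral_cong) (simp only: distrib_left mult.left_commute)
      also have "\<dots> = (\<integral>\<^sup>+t. ennreal (\<beta> / 2) * (ennreal (exp (\<beta> * t)) * a t) \<partial>lu) + (\<integral>\<^sup>+t. ennreal (2 / \<beta>) * (ennreal (exp (\<beta> * t)) * b t) \<partial>lu)"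
        by (rule nn_integral_add) (intro borel_measurable_times_ennreal borel_measurable_const w am bm)+
      finally show ?thesis unfolding nn_integral_cmult[OF ea] nn_integral_cmult[OF eb] A_def B_def .
    qed
    ultimately show ?thesis using weighted_inequality[OF T_pos \<beta> am km mm key] unfolding K_def by simp
  qed
  moreover have "ennreal \<beta> * A = ennreal (\<beta> / 2) * A + ennreal (\<beta> / 2) * A"
  proof -
    have "ennreal \<beta> = ennreal (\<beta> / 2) + ennreal (\<beta> / 2)" using \<beta> by (subst ennreal_plus[symmetric]) auto
    then show ?thesis by (simp only: distrib_right)
  qed
  moreover have "ennreal (\<beta> / 2) * A \<noteq> \<infinity>" using ennreal_times_finite[OF AF] by (simp add: less_top)
  ultimately have "ennreal (\<beta> / 2) * A + K \<le> ennreal (2 / \<beta>) * B" by (simp only: add.assoc ennreal_add_left_cancel_le simp_thms)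
  then show ?thesis
    unfolding A_def B_def K_def a_def b_def k_def nn_integral_TM_weighted[OF w em[OF Dm]] nn_integral_TM_weighted[OF w em[OF Hm]] nn_integral_TM_weighted[OF w em[OF hm]] .
qed

end

section \<open>The linear equation with a frozen driver\<close>

lemma set_integral_lborel_upto:
  fixes g :: "real \<Rightarrow> real"
  assumes "t \<in> {0..T}"
  shows "(LINT s:{t..T}|lborel. g s) = (\<integral>s. indicator {t..} s * g s \<partial>lborel_upto T)"
proof -
  have "(\<integral>s. indicator {t..} s * g s \<partial>lborel_upto T) = (\<integral>s. indicator {0..T} s *\<^sub>R (indicator {t..} s * g s) \<partial>lborel)"
    unfolding lborel_upto_def by (rule integral_restrict_space) simp
  also have "\<dots> = (LINT s:{t..T}|lborel. g s)"
    unfolding set_lebesgue_integral_def using assms by (intro Bochner_Integration.integral_cong) (auto simp: indicator_def)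
  finally show ?thesis by simp
qed

lemma integral_section_measurable:
  fixes X :: "real \<times> 'b \<Rightarrow> real"
  assumes "X \<in> L0 (lborel_upto T \<Otimes>\<^sub>M N)"
  shows "(\<lambda>x. \<integral>s. X (s, x) \<partial>lborel_upto T) \<in> L0 N"
proof -
  interpret lu: finite_measure "lborel_upto T" by (rule finite_measure_lborel_upto)
  show ?thesis
    by (rule lu.borel_measurable_lebesgue_integral) (use measurable_pair_swap[OF assms] in simp)
qed

text \<open>Fields take the parameter first, whereas the product measure takes time first; this
  translates between the two orders.\<close>

definition joint :: "(real \<Rightarrow> real \<Rightarrow> 'a \<Rightarrow> real) \<Rightarrow> real \<times> real \<times> 'a \<Rightarrow> real" where
  "joint Y q = Y (fst (snd q)) (fst q) (snd (snd q))"

lemma joint_apply [simp]: "joint Y (t, u, w) = Y u t w"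
  by (simp add: joint_def)

context wiener
begin

lemma finite_measure_TTM: "finite_measure TTM"
  by (intro finite_measure_pair_measure finite_measure_lborel_upto finite_measure_TM)

lemma ennreal_sq_measurable: "X \<in> L0 N \<Longrightarrow> (\<lambda>x. ennreal ((X x)\<^sup>2)) \<in> L0 N" for X :: "'b \<Rightarrow> real"
  by (intro measurable_compose[OF _ measurable_ennreal] borel_measurable_power)

lemma measurable_section_TTM: "u \<in> {0..T} \<Longrightarrow> (\<lambda>p. (fst p, u, snd p)) \<in> measurable TM TTM"
  by (intro measurable_Pair measurable_fst measurable_snd measurable_const) simp_all

lemma joint_section:
  assumes "joint Y \<in> L0 TTM" "u \<in> {0..T}"
  shows "(uncurried (Y u)) \<in> L0 TM"
  using measurable_compose[OF measurable_section_TTM[OF assms(2)] assms(1)] by simp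

lemma section_finite_TTM:
  assumes g: "g \<in> L0 TTM"
  shows "(\<lambda>u. \<integral>\<^sup>+p. g (fst p, u, snd p) \<partial>TM) \<in> L0 lu"
    and "(\<integral>\<^sup>+q. g q \<partial>TTM) < \<infinity> \<Longrightarrow> AE u in lu. (\<integral>\<^sup>+p. g (fst p, u, snd p) \<partial>TM) < \<infinity>"
proof -
  interpret TM: finite_measure TM by (rule finite_measure_TM)
  have "(\<lambda>x. (fst (snd x), fst x, snd (snd x))) \<in> measurable (lu \<Otimes>\<^sub>M TM) TTM"
    by (intro measurable_Pair measurable_fst measurable_compose[OF measurable_snd measurable_fst] measurable_compose[OF measurable_snd measurable_snd])
  from measurable_compose[OF this g] have "(\<lambda>x. g (fst (snd x), fst x, snd (snd x))) \<in> L0 (lu \<Otimes>\<^sub>M TM)" .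
  from TM.borel_measurable_nn_integral_fst[OF this]
  show m: "(\<lambda>u. \<integral>\<^sup>+p. g (fst p, u, snd p) \<partial>TM) \<in> L0 lu" by simp
  assume "(\<integral>\<^sup>+q. g q \<partial>TTM) < \<infinity>"
  then have "(\<integral>\<^sup>+u. (\<integral>\<^sup>+p. g (fst p, u, snd p) \<partial>TM) \<partial>lu) \<noteq> \<infinity>" unfolding nn_integral_TTM[OF g] by simp
  from nn_integral_noteq_infinite[OF m this]
  show "AE u in lu. (\<integral>\<^sup>+p. g (fst p, u, snd p) \<partial>TM) < \<infinity>"
    by eventually_elim (simp add: less_top)
qed

lemma L2_adapted_field_iff:
  "Y \<in> L2_adapted_field M T F \<longleftrightarrow> sq_integrable TTM (joint Y) \<and> (\<forall>u\<in>{0..T}. \<forall>t\<in>{0..T}. Y u t \<in> L0 (F t))"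
proof -
  have j: "(\<lambda>(t, u, w). Y u t w) = joint Y" by (auto simp: fun_eq_iff)
  have "(\<integral>\<^sup>+w. (\<integral>\<^sup>+t. sq_norm lu (\<lambda>u. Y u t w) \<partial>lu) \<partial>M) = sq_norm TTM (\<lambda>q. joint Y q)"
    if Y: "joint Y \<in> L0 TTM"
  proof -
    interpret lu: finite_measure lu by (rule finite_measure_lborel_upto)
    interpret TM: finite_measure TM by (rule finite_measure_TM)
    note m = ennreal_sq_measurable[OF Y]
    have "(\<lambda>x. (fst (fst x), snd x, snd (fst x))) \<in> measurable (TM \<Otimes>\<^sub>M lu) TTM"
      by (intro measurable_Pair measurable_snd measurable_compose[OF measurable_fst measurable_fst] measurable_compose[OF measurable_fst measurable_snd])
    from measurable_compose[OF this m] have "(\<lambda>x. ennreal ((Y (snd x) (fst (fst x)) (snd (fst x)))\<^sup>2)) \<in> L0 (TM \<Otimes>\<^sub>M lu)" by simp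
    from lu.borel_measurable_nn_integral_fst[OF this]
    have k: "(\<lambda>p. \<integral>\<^sup>+u. ennreal ((Y u (fst p) (snd p))\<^sup>2) \<partial>lu) \<in> L0 TM" by simp
    have "(\<integral>\<^sup>+w. (\<integral>\<^sup>+t. sq_norm lu (\<lambda>u. Y u t w) \<partial>lu) \<partial>M)
        = (\<integral>\<^sup>+p. sq_norm lu (\<lambda>u. Y u (fst p) (snd p)) \<partial>TM)"
      by (rule nn_integral_TM_swap[OF k])
    also have "\<dots> = (\<integral>\<^sup>+t. (\<integral>\<^sup>+w. sq_norm lu (\<lambda>u. Y u t w) \<partial>M) \<partial>lu)"
      using nn_integral_fst[OF k] by simp
    also have "\<dots> = (\<integral>\<^sup>+t. sq_norm TM (\<lambda>p. Y (fst p) t (snd p)) \<partial>lu)"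
    proof (rule nn_integral_cong)
      fix t assume t: "t \<in> space lu"
      have "(\<lambda>p. ennreal ((Y (fst p) t (snd p))\<^sup>2)) \<in> L0 TM"
        using measurable_compose_Pair1[OF t m] by (simp add: joint_def)
      from nn_integral_TM_swap[OF this]
      show "(\<integral>\<^sup>+w. sq_norm lu (\<lambda>u. Y u t w) \<partial>M) = sq_norm TM (\<lambda>p. Y (fst p) t (snd p))" .
    qed
    also have "\<dots> = sq_norm TTM (\<lambda>q. joint Y q)" using TM.nn_integral_fst[OF m] by (simp add: joint_def)
    finally show ?thesis .
  qed
  note e = this
  show ?thesis
  proof (cases "joint Y \<in> L0 TTM")
    case True
    show ?thesis
      unfolding L2_adapted_field_def mem_Collect_eq j adapted_upto_def e[OF True] sq_integrable_iff[OF True] using True by argo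
  next
    case False
    then show ?thesis unfolding L2_adapted_field_def mem_Collect_eq j sq_integrable_def by argo
  qed
qed

text \<open>An adapted, jointly measurable \<open>h\<close> need not be progressive, so Fubini alone
  does not give measurability for \<open>F t\<close>. Restricted to times in \<open>A\<close>, the
  sections of \<open>h\<close> are all known at \<open>t\<close>, so the integrand agrees almost
  everywhere with one that is jointly measurable for \<open>F t\<close>; the null sets in
  \<open>F t\<close> do the rest.\<close>

lemma partial_integral_adapted:
  fixes h :: "real \<Rightarrow> 'a \<Rightarrow> real"
  assumes hm: "uncurried h \<in> L0 TM" and ha: "\<And>s. s \<in> {0..T} \<Longrightarrow> h s \<in> L0 (F s)"
    and hf: "sq_norm TM (uncurried h) < \<infinity>"
    and t: "t \<in> {0..T}" and A: "A \<in> sets borel" "A \<subseteq> {..t}"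
  shows "(\<lambda>w. \<integral>s. indicator A s * h s w \<partial>lu) \<in> L0 (F t)"
proof -
  interpret P: pair_sigma_finite lu M by (rule pair_sigma_finite_TM)
  have t0: "0 \<le> t" "t \<le> T" using t by simp_all
  define X where "X p = indicator A (fst p) * h (fst p) (snd p)" for p
  have Xm: "X \<in> L0 TM"
    unfolding X_def by (intro borel_measurable_times hm measurable_compose[OF fst_measurable_TM] borel_measurable_indicator[OF A(1)])
  have Xi: "integrable TM X"
    unfolding X_def
    by (rule integrable_indicator_TM[OF sq_integrable_integrable[OF finite_measure_TM] A(1)]) (simp only: sq_integrable_iff[OF hm] hf)
  have "AE s in lu. s \<in> space lu" by (rule AE_space)
  then have sec: "AE s in lu. (\<lambda>w. X (s, w)) \<in> L0 (F t)"
  proof eventually_elim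
    case (elim s)
    then have s: "s \<in> {0..T}" by simp
    show ?case
    proof (cases "s \<in> A")
      case True
      then have "s \<le> t" using A by auto
      then have "h s \<in> L0 (F t)" using s t0 by (intro measurable_F_mono[OF ha[OF s]]) auto
      then show ?thesis using True by (simp add: X_def)
    qed (simp add: X_def)
  qed
  obtain X' where X': "X' \<in> L0 (lu \<Otimes>\<^sub>M F t)" "AE p in TM. X p = X' p"
    using section_measurable_modification[OF finite_measure_lborel_upto prob_space_axioms F_sub[OF t0] Xi sec] by (elim exE conjE)
  have X'm: "X' \<in> L0 TM" by (rule measurable_pair_F_M[OF X'(1) t0])
  have "AE s in lu. AE w in M. X (s, w) = X' (s, w)"
    by (rule P.AE_pair[OF X'(2)])
  then have eq: "AE w in M. AE s in lu. X (s, w) = X' (s, w)"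
    by (subst P.AE_commute[symmetric]) (use borel_measurable_eq[OF Xm X'm] in simp_all)
  have "AE w in M. w \<in> space M" by (rule AE_space)
  with eq have "AE w in M. (\<integral>s. X (s, w) \<partial>lu) = (\<integral>s. X' (s, w) \<partial>lu)"
  proof eventually_elim
    case (elim w)
    show ?case
      by (rule integral_cong_AE[OF _ _ elim(1)]) (rule measurable_compose[OF measurable_Pair2'[OF elim(2)]], rule Xm X'm)+
  qed
  from measurable_F_AE_cong[OF integral_section_measurable[OF X'(1)] t0 integral_section_measurable[OF Xm] this]
  show ?thesis by (simp add: X_def)
qed

lemma initial_integral_measurable:
  fixes a :: "'b \<Rightarrow> real" and h :: "real \<Rightarrow> 'b \<Rightarrow> real"
  assumes a: "a \<in> L0 N" and h: "(\<lambda>x. h (snd x) (fst x)) \<in> L0 (N \<Otimes>\<^sub>M lu)"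
  shows "(\<lambda>x. \<integral>s. indicator {..<a x} s * h s x \<partial>lu) \<in> L0 N"
proof -
  interpret lu: finite_measure lu by (rule finite_measure_lborel_upto)
  let ?N = "N \<Otimes>\<^sub>M lu"
  have "(\<lambda>x. indicator {x\<in>space ?N. snd x < a (fst x)} x * h (snd x) (fst x)) \<in> L0 ?N"
    by (intro borel_measurable_times borel_measurable_indicator borel_measurable_less h
        measurable_compose[OF measurable_fst a] measurable_compose[OF measurable_snd measurable_ident_lborel_upto])
  then have "(\<lambda>x. indicator {..<a (fst x)} (snd x) * h (snd x) (fst x)) \<in> L0 ?N"
    by (rule measurable_cong[THEN iffD1, rotated]) (simp add: indicator_def)
  then have "(\<lambda>(x, s). indicator {..<a x} s * h s x) \<in> L0 ?N" by (simp only: case_prod_beta')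
  then show ?thesis by (rule lu.borel_measurable_lebesgue_integral)
qed

text \<open>Bounds uniform in \<open>t\<close> at almost every \<open>u\<close> turn into a bound on
  the whole field. It is used for the stochastic integrals and for the time integrals.\<close>

lemma nn_integral_TTM_le_sections:
  assumes X: "joint X \<in> L0 TTM" and R: "joint R \<in> L0 TTM"
    and le: "AE u in lu. \<forall>t\<in>{0..T}. sq_norm M (\<lambda>w. X u t w) \<le> ennreal K * sq_norm TM (uncurried (R u))"
  shows "sq_norm TTM (\<lambda>q. joint X q) \<le> ennreal T * (ennreal K * sq_norm TTM (\<lambda>q. joint R q))"
proof -
  note m = ennreal_sq_measurable[OF X] ennreal_sq_measurable[OF R]
  have "AE u in lu. u \<in> space lu" by (rule AE_space)
  with le have "AE u in lu. sq_norm TM (uncurried (X u))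
      \<le> ennreal T * (ennreal K * sq_norm TM (uncurried (R u)))"
  proof eventually_elim
    case (elim u)
    then have u: "u \<in> {0..T}" by simp
    have "sq_norm TM (uncurried (X u)) = (\<integral>\<^sup>+t. sq_norm M (\<lambda>w. X u t w) \<partial>lu)"
      using nn_integral_fst[OF ennreal_sq_measurable[OF joint_section[OF X u]]] by simp
    also have "\<dots> \<le> (\<integral>\<^sup>+t. ennreal K * sq_norm TM (uncurried (R u)) \<partial>lu)"
      by (rule nn_integral_mono) (use elim(1) in simp)
    finally show ?case using emeasure_lborel_upto[OF T_pos] by (simp add: mult.commute)
  qed
  then have "(\<integral>\<^sup>+u. sq_norm TM (uncurried (X u)) \<partial>lu)
      \<le> (\<integral>\<^sup>+u. ennreal T * (ennreal K * sq_norm TM (uncurried (R u))) \<partial>lu)" by (rule nn_integral_mono_AE)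
  also have "\<dots> = ennreal T * (ennreal K * (\<integral>\<^sup>+u. sq_norm TM (uncurried (R u)) \<partial>lu))"
  proof -
    have s: "(\<lambda>u. \<integral>\<^sup>+p. ennreal ((R u (fst p) (snd p))\<^sup>2) \<partial>TM) \<in> L0 lu"
      using section_finite_TTM(1)[OF m(2)] by simp
    show ?thesis
      by (simp only: nn_integral_cmult[OF s] nn_integral_cmult[OF borel_measurable_times_ennreal[OF borel_measurable_const s]])
  qed
  finally show ?thesis unfolding nn_integral_TTM[OF m(1)] nn_integral_TTM[OF m(2)] by simp
qed

end

context wiener_generated
begin

text \<open>Represent \<open>\<phi> u\<close> plus the integral of \<open>g u\<close> over
  \<open>[0, T]\<close> as \<open>c u + J u T\<close>. Then \<open>c u + J u t\<close> minus the
  integral of \<open>g u\<close> up to \<open>t\<close> solves the equation and is adapted by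
  construction, so no conditional expectations have to be chosen jointly in \<open>t\<close> and
  \<open>u\<close>.\<close>

lemma linear_equation_solution:
  assumes g: "g \<in> L2_adapted_field M T F" and \<phi>: "\<phi> \<in> L2_terminal M T F"
  shows "\<exists>Y Z. Y \<in> L2_adapted_field M T F \<and> Z \<in> L2_adapted_field M T F \<and>
    (AE u in lu. \<exists>I. has_ito_integral M T F W (Z u) I \<and> (AE w in M. \<forall>t\<in>{0..T}.
       Y u t w = \<phi> u w + (\<integral>s. indicator {t..} s * g u s w \<partial>lu) - (I T w - I t w)))"
proof -
  interpret P: pair_sigma_finite lu M by (rule pair_sigma_finite_TM)
  have T: "0 \<le> T" "T \<in> {0..T}" using T_pos by simp_all
  have gsq: "sq_integrable TTM (joint g)" and ga: "\<And>u t. u \<in> {0..T} \<Longrightarrow> t \<in> {0..T} \<Longrightarrow> g u t \<in> L0 (F t)"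
    using g unfolding L2_adapted_field_iff by auto
  have gm: "joint g \<in> L0 TTM" using gsq by (simp add: sq_integrable_def)
  have gf: "sq_norm TTM (\<lambda>q. joint g q) < \<infinity>" using gsq by (simp add: sq_integrable_iff[OF gm])
  note sec = section_finite_TTM[OF ennreal_sq_measurable[OF gm]]
  \<comment> \<open>Adaptedness is demanded for every \<open>u\<close>, but \<open>g u\<close> has
    finite norm only for almost every \<open>u\<close>. Setting \<open>g\<close> to zero off
    \<open>U\<close> makes the time integrals adapted without exception.\<close>
  define U where "U = {u \<in> space lu. sq_norm TM (uncurried (g u)) < \<infinity>}"
  have Um: "U \<in> sets lu" unfolding U_def by (rule borel_measurable_less) (use sec(1) in simp_all)
  have UAE: "AE u in lu. u \<in> U"
    using sec(2)[OF gf] AE_space by eventually_elim (simp add: U_def)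
  define G where "G u t w = indicator U u * g u t w" for u t w
  have Gm: "joint G \<in> L0 TTM"
    unfolding joint_def[abs_def] G_def
    by (intro borel_measurable_times measurable_compose[OF measurable_snd] measurable_compose[OF measurable_fst borel_measurable_indicator[OF Um]] gm[unfolded joint_def[abs_def]])
  have Ga: "G u t \<in> L0 (F t)" if "u \<in> {0..T}" "t \<in> {0..T}" for u t
    unfolding G_def using ga[OF that] by (intro borel_measurable_times borel_measurable_const) simp
  have Gu: "sq_norm TM (uncurried (G u)) < \<infinity>" for u
    unfolding G_def by (cases "u \<in> U") (simp_all add: U_def)
  have "sq_norm TTM (\<lambda>q. joint G q) \<le> sq_norm TTM (\<lambda>q. joint g q)"
    by (rule nn_integral_mono) (simp add: joint_def G_def indicator_def)
  from le_less_trans[OF this gf] have Gf: "sq_norm TTM (\<lambda>q. joint G q) < \<infinity>" .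
  define S where "S p = (\<integral>s. joint G (s, p) \<partial>lu)" for p
  have Sm: "S \<in> L0 TM" unfolding S_def by (rule integral_section_measurable[OF Gm])
  have S_eq: "S (u, w) = (\<integral>s. indicator {..T} s * G u s w \<partial>lu)" for u w
    unfolding S_def by (rule Bochner_Integration.integral_cong) simp_all
  have Ssq: "sq_integrable TM S"
  proof -
    have "sq_norm TM S = (\<integral>\<^sup>+u. sq_norm M (\<lambda>w. S (u, w)) \<partial>lu)"
      by (rule nn_integral_fst[OF ennreal_sq_measurable[OF Sm], symmetric])
    also have "\<dots> \<le> (\<integral>\<^sup>+u. ennreal T * sq_norm TM (uncurried (G u)) \<partial>lu)"
    proof (rule nn_integral_mono)
      fix u assume "u \<in> space lu"
      then have "(uncurried (G u)) \<in> L0 TM" by (intro joint_section[OF Gm]) simp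
      then show "sq_norm M (\<lambda>w. S (u, w)) \<le> ennreal T * sq_norm TM (uncurried (G u))"
        unfolding S_eq by (rule nn_integral_part_integral_sq_le) (auto simp: indicator_def)
    qed
    also have "\<dots> = ennreal T * sq_norm TTM (\<lambda>q. joint G q)"
      using section_finite_TTM(1)[OF ennreal_sq_measurable[OF Gm]] nn_integral_TTM[OF ennreal_sq_measurable[OF Gm]]
      by (simp add: nn_integral_cmult)
    also have "\<dots> < \<infinity>" by (rule ennreal_times_finite[OF Gf])
    finally show ?thesis by (simp add: sq_integrable_iff[OF Sm])
  qed
  have Ssec: "AE u in lu. (\<lambda>w. S (u, w)) \<in> L0 (F T)"
    using AE_space
  proof eventually_elim
    case (elim u)
    then have u: "u \<in> {0..T}" by simp
    show ?case unfolding S_eq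
      by (rule partial_integral_adapted[OF joint_section[OF Gm u] Ga[OF u] Gu T(2)]) simp_all
  qed
  \<comment> \<open>Sections of \<open>S\<close> are known at \<open>T\<close>, but the
    representation theorem needs joint measurability for the parameter and \<open>F T\<close>; this
    holds for a modification.\<close>
  obtain S' where S': "S' \<in> L0 (lu \<Otimes>\<^sub>M F T)" "AE p in TM. S p = S' p"
    using section_measurable_modification[OF finite_measure_lborel_upto prob_space_axioms F_sub[OF T(1) order_refl] sq_integrable_integrable[OF finite_measure_TM Ssq] Ssec]
    by (elim exE conjE)
  define X where "X p = \<phi> (fst p) (snd p) + S' p" for p
  have \<phi>m: "(uncurried \<phi>) \<in> L0 (lu \<Otimes>\<^sub>M F T)"
    using \<phi> by (simp add: L2_terminal_def case_prod_beta')
  note \<phi>M = measurable_pair_F_M[OF \<phi>m T(1) order_refl]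
  have \<phi>sq: "sq_integrable TM (uncurried \<phi>)"
    using \<phi> nn_integral_TM_swap[OF ennreal_sq_measurable[OF \<phi>M]] by (simp add: L2_terminal_def sq_integrable_iff[OF \<phi>M])
  have Xm: "X \<in> L0 (lu \<Otimes>\<^sub>M F T)" unfolding X_def by (rule borel_measurable_add[OF \<phi>m S'(1)])
  have "sq_integrable TM X" unfolding X_def
    by (rule sq_integrable_add[OF \<phi>sq sq_integrable_cong_AE[OF Ssq measurable_pair_F_M[OF S'(1) T(1) order_refl] S'(2)]])
  then have Xf: "sq_norm TM X < \<infinity>" by (simp add: sq_integrable_nn_integral)
  have jd: "joint Y = (\<lambda>q. Y (fst (snd q)) (fst q) (snd (snd q)))" for Y :: "real \<Rightarrow> real \<Rightarrow> 'a \<Rightarrow> real"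
    by (simp add: joint_def[abs_def])
  obtain c Z J where cm: "c \<in> L0 lu" and cf: "sq_norm lu c < \<infinity>"
    and Zm: "joint Z \<in> L0 TTM" and Jm: "joint J \<in> L0 TTM"
    and Zf: "sq_norm TTM (\<lambda>q. joint Z q) < \<infinity>"
    and ZJa: "\<forall>u\<in>{0..T}. \<forall>t\<in>{0..T}. Z u t \<in> L0 (F t) \<and> J u t \<in> L0 (F t)"
    and ito: "AE u in lu. has_ito_integral M T F W (Z u) (J u) \<and> (AE w in M. X (u, w) = c u + J u T w)"
    using field_representation[OF Xm Xf] unfolding jd by (elim exE conjE)
  \<comment> \<open>The set \<open>{..<t}\<close> is the exact complement of the
    \<open>{t..}\<close> in the equation, so the two integrals add up to \<open>S\<close>.\<close>
  define P where "P u t w = (\<integral>s. indicator {..<t} s * G u s w \<partial>lu)" for u t w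
  define Y where "Y u t w = (c u + J u t w) - P u t w" for u t w
  have Pm: "joint P \<in> L0 TTM"
  proof -
    have "(\<lambda>x. (snd x, snd (fst x))) \<in> measurable (TTM \<Otimes>\<^sub>M lu) TTM"
      by (intro measurable_Pair measurable_snd measurable_compose[OF measurable_fst measurable_snd])
    from measurable_compose[OF this Gm]
    have "(\<lambda>x. G (fst (snd (fst x))) (snd x) (snd (snd (fst x)))) \<in> L0 (TTM \<Otimes>\<^sub>M lu)" by (simp add: joint_def)
    from initial_integral_measurable[OF fst_measurable_TTM this]
    show ?thesis by (simp add: joint_def[abs_def] P_def)
  qed
  have cm': "joint (\<lambda>u t w. c u) \<in> L0 TTM"
    unfolding joint_def[abs_def] by (intro measurable_compose[OF measurable_snd] measurable_compose[OF measurable_fst cm])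
  have jY: "joint Y = (\<lambda>q. (joint (\<lambda>u t w. c u) q + joint J q) - joint P q)" by (simp add: fun_eq_iff joint_def Y_def)
  have csq: "sq_integrable TTM (joint (\<lambda>u t w. c u))"
  proof -
    have "sq_norm TTM (\<lambda>q. joint (\<lambda>u t w. c u) q) = (\<integral>\<^sup>+u. ennreal ((c u)\<^sup>2) * emeasure TM (space TM) \<partial>lu)"
      unfolding nn_integral_TTM[OF ennreal_sq_measurable[OF cm']] by simp
    also have "\<dots> = sq_norm lu c * emeasure TM (space TM)"
      by (rule nn_integral_multc[OF ennreal_sq_measurable[OF cm]])
    also have "\<dots> < \<infinity>"
      using cf finite_measure.finite_emeasure_space[OF finite_measure_TM] by (simp add: ennreal_mult_less_top less_top)
    finally show ?thesis by (simp add: sq_integrable_iff[OF cm'])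
  qed
  have Jsq: "sq_integrable TTM (joint J)"
  proof -
    have "AE u in lu. \<forall>t\<in>{0..T}. sq_norm M (\<lambda>w. J u t w) \<le> ennreal 1 * sq_norm TM (uncurried (Z u))"
      using ito
    proof eventually_elim
      case (elim u)
      from ito_approx_if_has_ito_integral[OF conjunct1[OF elim]] obtain L where L: "ito_approx L (Z u) (J u)" by (elim exE)
      show ?case
      proof
        fix t assume t: "t \<in> {0..T}"
        show "sq_norm M (\<lambda>w. J u t w) \<le> ennreal 1 * sq_norm TM (uncurried (Z u))"
          unfolding sq_integrable_nn_integral[OF ito_approx_facts(2)[OF L t]] sq_integrable_nn_integral[OF ito_approx_facts(1)[OF L]]
          using ennreal_leI[OF ito_approx_facts(5)[OF L t]] by simp
      qed
    qed
    from le_less_trans[OF nn_integral_TTM_le_sections[OF Jm Zm this]] show ?thesis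
      by (simp add: sq_integrable_iff[OF Jm] ennreal_times_finite[unfolded infinity_ennreal_def] Zf[unfolded infinity_ennreal_def])
  qed
  have Psq: "sq_integrable TTM (joint P)"
  proof -
    have "AE u in lu. \<forall>t\<in>{0..T}. sq_norm M (\<lambda>w. P u t w) \<le> ennreal T * sq_norm TM (uncurried (G u))"
      using AE_space
    proof eventually_elim
      case (elim u)
      then have u: "u \<in> {0..T}" by simp
      show ?case unfolding P_def
        by (intro ballI nn_integral_part_integral_sq_le[OF joint_section[OF Gm u]]) (auto simp: indicator_def)
    qed
    from le_less_trans[OF nn_integral_TTM_le_sections[OF Pm Gm this]] show ?thesis
      by (simp add: sq_integrable_iff[OF Pm] ennreal_times_finite[unfolded infinity_ennreal_def] Gf[unfolded infinity_ennreal_def])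
  qed
  have Ysq: "sq_integrable TTM (joint Y)" unfolding jY by (intro sq_integrable_diff sq_integrable_add csq Jsq Psq)
  have Pa: "P u t \<in> L0 (F t)" if "u \<in> {0..T}" "t \<in> {0..T}" for u t
    unfolding P_def by (rule partial_integral_adapted[OF joint_section[OF Gm that(1)] Ga[OF that(1)] Gu that(2)]) auto
  have Ya: "Y u t \<in> L0 (F t)" if "u \<in> {0..T}" "t \<in> {0..T}" for u t
    unfolding Y_def using ZJa that by (intro borel_measurable_diff borel_measurable_add borel_measurable_const Pa) blast+
  have SS': "AE u in lu. AE w in M. S (u, w) = S' (u, w)" by (rule P.AE_pair[OF S'(2)])
  have "AE u in lu. u \<in> space lu" by (rule AE_space)
  with ito SS' UAE have fin: "AE u in lu. \<exists>I. has_ito_integral M T F W (Z u) I \<and> (AE w in M. \<forall>t\<in>{0..T}.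
       Y u t w = \<phi> u w + (\<integral>s. indicator {t..} s * g u s w \<partial>lu) - (I T w - I t w))"
  proof eventually_elim
    case (elim u)
    then have u: "u \<in> {0..T}" by simp
    interpret Q: pair_sigma_finite M lu ..
    note Gum = joint_section[OF Gm u]
    have "sq_integrable TM (uncurried (G u))" using Gu by (simp add: sq_integrable_iff[OF Gum])
    from Q.AE_integrable_fst'[OF P.integrable_product_swap[OF sq_integrable_integrable[OF finite_measure_TM this]]]
    have Gi: "AE w in M. integrable lu (\<lambda>s. G u s w)" by simp
    have "AE w in M. \<forall>t\<in>{0..T}. Y u t w = \<phi> u w + (\<integral>s. indicator {t..} s * g u s w \<partial>lu) - (J u T w - J u t w)"
      using conjunct2[OF elim(1)] elim(2) Gi
    proof eventually_elim
      case (elim w)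
      have gG: "g u s w = G u s w" for s using \<open>u \<in> U\<close> by (simp add: G_def)
      show ?case
      proof
        fix t assume "t \<in> {0..T}"
        have i2: "integrable lu (\<lambda>s. indicator {..<t} s * G u s w)" "integrable lu (\<lambda>s. indicator {t..} s * G u s w)"
          by (rule integrable_indicator_upto[OF elim(3)], simp)+
        have "S (u, w) = (\<integral>s. indicator {..<t} s * G u s w + indicator {t..} s * G u s w \<partial>lu)"
          unfolding S_def by (rule Bochner_Integration.integral_cong) (simp_all add: indicator_def)
        also have "\<dots> = P u t w + (\<integral>s. indicator {t..} s * G u s w \<partial>lu)"
          unfolding P_def by (rule Bochner_Integration.integral_add[OF i2])
        finally have "S (u, w) = P u t w + (\<integral>s. indicator {t..} s * G u s w \<partial>lu)" .
        moreover have "\<phi> u w + S' (u, w) = c u + J u T w" using elim(1) by (simp add: X_def)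
        ultimately show "Y u t w = \<phi> u w + (\<integral>s. indicator {t..} s * g u s w \<partial>lu) - (J u T w - J u t w)"
          using elim(2) unfolding gG Y_def by linarith
      qed
    qed
    with conjunct1[OF elim(1)] show ?case by (intro exI[of _ "J u"] conjI)
  qed
  have Zsq: "sq_integrable TTM (joint Z)" using Zf by (simp add: sq_integrable_iff[OF Zm])
  have "Y \<in> L2_adapted_field M T F" "Z \<in> L2_adapted_field M T F"
    unfolding L2_adapted_field_iff using Ysq Zsq Ya ZJa by simp_all
  with fin show ?thesis by (intro exI[of _ Y] exI[of _ Z] conjI)
qed

end

section \<open>Picard iteration\<close>

lemma borel_measurable_exp_weight: "X \<in> L0 N \<Longrightarrow> (\<lambda>q. ennreal (exp (\<beta> * X q))) \<in> L0 N" for X :: "'b \<Rightarrow> real"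
  by measurable

definition field_diff :: "(real \<Rightarrow> real \<Rightarrow> 'a \<Rightarrow> real) \<Rightarrow> (real \<Rightarrow> real \<Rightarrow> 'a \<Rightarrow> real) \<Rightarrow> real \<Rightarrow> real \<Rightarrow> 'a \<Rightarrow> real" where
  "field_diff Y Y' u t w = Y u t w - Y' u t w"

lemma joint_field_diff: "joint (field_diff Y Y') q = joint Y q - joint Y' q"
  by (simp add: joint_def field_diff_def)

context wiener
begin

text \<open>A squared norm. For nonnegative \<open>\<beta>\<close> the weight lies between
  \<open>1\<close> and \<open>exp (\<beta> * T)\<close> on \<open>[0, T]\<close>, so finiteness and
  convergence are those of the unweighted norm, and \<open>\<beta>\<close> may be taken
  large.\<close>

definition weighted_norm :: "real \<Rightarrow> (real \<Rightarrow> real \<Rightarrow> 'a \<Rightarrow> real) \<Rightarrow> ennreal" where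
  "weighted_norm \<beta> X = (\<integral>\<^sup>+q. ennreal (exp (\<beta> * fst q)) * ennreal ((joint X q)\<^sup>2) \<partial>TTM)"

text \<open>The driver is a given field \<open>g\<close>; solutions of the full equation are the
  fixed points of the passage from \<open>g\<close> to a solution.\<close>

definition linear_solution where
  "linear_solution \<phi> g Y Z \<longleftrightarrow> (AE u in lu. \<exists>I. has_ito_integral M T F W (Z u) I \<and> (AE w in M. \<forall>t\<in>{0..T}.
       Y u t w = \<phi> u w + (\<integral>s. indicator {t..} s * g u s w \<partial>lu) - (I T w - I t w)))"

lemma L2_adapted_fieldD:
  assumes "Y \<in> L2_adapted_field M T F"
  shows "sq_integrable TTM (joint Y)" "joint Y \<in> L0 TTM"
    "u \<in> {0..T} \<Longrightarrow> t \<in> {0..T} \<Longrightarrow> Y u t \<in> L0 (F t)"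
  using assms unfolding L2_adapted_field_iff by (simp_all add: sq_integrable_def)

lemma L2_adapted_field_diff:
  assumes "Y \<in> L2_adapted_field M T F" "Y' \<in> L2_adapted_field M T F"
  shows "field_diff Y Y' \<in> L2_adapted_field M T F"
proof -
  have "sq_integrable TTM (\<lambda>q. joint Y q - joint Y' q)"
    by (rule sq_integrable_diff[OF L2_adapted_fieldD(1)[OF assms(1)] L2_adapted_fieldD(1)[OF assms(2)]])
  moreover have "field_diff Y Y' u t \<in> L0 (F t)" if "u \<in> {0..T}" "t \<in> {0..T}" for u t
    unfolding field_diff_def[abs_def] by (rule borel_measurable_diff[OF L2_adapted_fieldD(3)[OF assms(1) that] L2_adapted_fieldD(3)[OF assms(2) that]])
  ultimately show ?thesis unfolding L2_adapted_field_iff joint_field_diff[abs_def] by simp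
qed

lemma weighted_sq_measurable:
  assumes "joint X \<in> L0 TTM"
  shows "(\<lambda>q. ennreal (exp (\<beta> * fst q)) * ennreal ((joint X q)\<^sup>2)) \<in> L0 TTM"
  by (intro borel_measurable_times_ennreal borel_measurable_exp_weight fst_measurable_TTM ennreal_sq_measurable assms)

lemma weighted_norm_bounds:
  assumes "joint X \<in> L0 TTM" "0 \<le> \<beta>"
  shows "sq_norm TTM (\<lambda>q. joint X q) \<le> weighted_norm \<beta> X"
    and "weighted_norm \<beta> X \<le> ennreal (exp (\<beta> * T)) * sq_norm TTM (\<lambda>q. joint X q)"
proof -
  have s: "0 \<le> fst q" "fst q \<le> T" if "q \<in> space TTM" for q using that by (auto simp: space_pair_measure)
  show "sq_norm TTM (\<lambda>q. joint X q) \<le> weighted_norm \<beta> X"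
    unfolding weighted_norm_def
  proof (rule nn_integral_mono)
    fix q assume "q \<in> space TTM"
    then have "0 \<le> \<beta> * fst q" using s assms(2) by simp
    then have "1 \<le> ennreal (exp (\<beta> * fst q))" by simp
    from mult_right_mono[OF this, of "ennreal ((joint X q)\<^sup>2)"]
    show "ennreal ((joint X q)\<^sup>2) \<le> ennreal (exp (\<beta> * fst q)) * ennreal ((joint X q)\<^sup>2)" by simp
  qed
  have "weighted_norm \<beta> X \<le> (\<integral>\<^sup>+q. ennreal (exp (\<beta> * T)) * ennreal ((joint X q)\<^sup>2) \<partial>TTM)"
    unfolding weighted_norm_def
  proof (rule nn_integral_mono)
    fix q assume "q \<in> space TTM"
    then have "\<beta> * fst q \<le> \<beta> * T" using s assms(2) by (intro mult_left_mono)
    then show "ennreal (exp (\<beta> * fst q)) * ennreal ((joint X q)\<^sup>2) \<le> ennreal (exp (\<beta> * T)) * ennreal ((joint X q)\<^sup>2)"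
      by (intro mult_right_mono ennreal_leI) simp_all
  qed
  also have "\<dots> = ennreal (exp (\<beta> * T)) * sq_norm TTM (\<lambda>q. joint X q)"
    by (rule nn_integral_cmult[OF ennreal_sq_measurable[OF assms(1)]])
  finally show "weighted_norm \<beta> X \<le> ennreal (exp (\<beta> * T)) * sq_norm TTM (\<lambda>q. joint X q)" .
qed

lemma weighted_norm_finite:
  assumes "X \<in> L2_adapted_field M T F" "0 \<le> \<beta>"
  shows "weighted_norm \<beta> X < \<infinity>"
proof (rule le_less_trans[OF weighted_norm_bounds(2)[OF L2_adapted_fieldD(2)[OF assms(1)] assms(2)]])
  have "sq_norm TTM (\<lambda>q. joint X q) < \<infinity>"
    using L2_adapted_fieldD(1)[OF assms(1)] unfolding sq_integrable_iff[OF L2_adapted_fieldD(2)[OF assms(1)]] .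
  then show "ennreal (exp (\<beta> * T)) * sq_norm TTM (\<lambda>q. joint X q) < \<infinity>" by (rule ennreal_times_finite)
qed

lemma AE_eq_if_nn_integral_sq_diff_0:
  fixes X Y :: "'b \<Rightarrow> real"
  assumes "X \<in> L0 N" "Y \<in> L0 N" "sq_norm N (\<lambda>x. X x - Y x) = 0"
  shows "AE x in N. X x = Y x"
proof -
  have "AE x in N. ennreal ((X x - Y x)\<^sup>2) = 0"
    using assms(3) nn_integral_0_iff_AE[OF ennreal_sq_measurable[OF borel_measurable_diff[OF assms(1,2)]]] by simp
  then show ?thesis by eventually_elim simp
qed

lemma AE_section_integrable:
  fixes h :: "real \<Rightarrow> 'a \<Rightarrow> real"
  assumes "sq_integrable TM (uncurried h)"
  shows "AE w in M. integrable lu (\<lambda>s. h s w)"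
proof -
  interpret lu: finite_measure lu by (rule finite_measure_lborel_upto)
  interpret P: pair_sigma_finite lu M by (rule pair_sigma_finite_TM)
  interpret Q: pair_sigma_finite M lu ..
  show ?thesis
    using Q.AE_integrable_fst'[OF P.integrable_product_swap[OF sq_integrable_integrable[OF finite_measure_TM assms]]] by simp
qed

lemma AE_section_sq_integrable:
  assumes "g \<in> L2_adapted_field M T F"
  shows "AE u in lu. sq_integrable TM (uncurried (g u))"
proof -
  note m = L2_adapted_fieldD(2)[OF assms]
  have "sq_norm TTM (\<lambda>q. joint g q) < \<infinity>"
    using L2_adapted_fieldD(1)[OF assms] unfolding sq_integrable_iff[OF m] .
  from section_finite_TTM(2)[OF ennreal_sq_measurable[OF m] this] AE_space show ?thesis
  proof eventually_elim
    case (elim u)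
    then have "u \<in> {0..T}" by simp
    from elim(1) show ?case unfolding sq_integrable_iff[OF joint_section[OF m \<open>u \<in> {0..T}\<close>]] joint_apply .
  qed
qed

text \<open>Only time integrals of the driver enter the equation, and for almost every
  \<open>u\<close> and \<open>w\<close> these agree at all \<open>t\<close> simultaneously. This is
  needed because the limit of the iteration is reproduced only almost everywhere.\<close>

lemma linear_solution_cong:
  assumes g: "g \<in> L2_adapted_field M T F" and g': "g' \<in> L2_adapted_field M T F"
    and eq: "AE q in TTM. joint g q = joint g' q" and sol: "linear_solution \<phi> g Y Z"
  shows "linear_solution \<phi> g' Y Z"
proof -
  interpret P: pair_sigma_finite lu M by (rule pair_sigma_finite_TM)
  note m = L2_adapted_fieldD(2)[OF g] L2_adapted_fieldD(2)[OF g']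
  have d: "(\<lambda>q. ennreal ((joint g q - joint g' q)\<^sup>2)) \<in> L0 TTM"
    by (rule ennreal_sq_measurable[OF borel_measurable_diff[OF m]])
  have "sq_norm TTM (\<lambda>q. joint g q - joint g' q) = (\<integral>\<^sup>+q. 0 \<partial>TTM)"
    by (rule nn_integral_cong_AE) (use eq in eventually_elim, simp)
  then have "(\<integral>\<^sup>+u. sq_norm TM (\<lambda>p. g u (fst p) (snd p) - g' u (fst p) (snd p)) \<partial>lu) = 0"
    unfolding nn_integral_TTM[OF d] joint_apply by simp
  then have "AE u in lu. sq_norm TM (\<lambda>p. g u (fst p) (snd p) - g' u (fst p) (snd p)) = 0"
    using nn_integral_0_iff_AE[OF section_finite_TTM(1)[OF d]] by simp
  from this sol[unfolded linear_solution_def] AE_space show ?thesis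
    unfolding linear_solution_def
  proof eventually_elim
    case (elim u)
    then have u: "u \<in> {0..T}" by simp
    note s = joint_section[OF m(1) u] joint_section[OF m(2) u]
    have e: "AE p in TM. g u (fst p) (snd p) = g' u (fst p) (snd p)"
      by (rule AE_eq_if_nn_integral_sq_diff_0[OF s elim(1)])
    have "AE s in lu. AE w in M. g u s w = g' u s w" using P.AE_pair[OF e] by simp
    then have "AE w in M. AE s in lu. g u s w = g' u s w"
      by (subst P.AE_commute[symmetric]) (use borel_measurable_eq[OF s] in simp_all)
    from this AE_space have i: "AE w in M. \<forall>t. (\<integral>s. indicator {t..} s * g u s w \<partial>lu) = (\<integral>s. indicator {t..} s * g' u s w \<partial>lu)"
    proof eventually_elim
      case (elim w)
      have im: "indicator {t..} \<in> L0 lu" for t :: real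
        by (rule borel_measurable_lborel_upto[OF borel_measurable_indicator]) simp
      show ?case
      proof
        fix t
        show "(\<integral>s. indicator {t..} s * g u s w \<partial>lu) = (\<integral>s. indicator {t..} s * g' u s w \<partial>lu)"
        proof (rule integral_cong_AE)
          show "AE s in lu. indicator {t..} s * g u s w = indicator {t..} s * g' u s w"
            using elim(1) by eventually_elim (simp only:)
        qed (intro borel_measurable_times im section_TM(2)[OF s(1) elim(2)] section_TM(2)[OF s(2) elim(2)])+
      qed
    qed
    from elim(2) obtain I where I: "has_ito_integral M T F W (Z u) I" "AE w in M. \<forall>t\<in>{0..T}.
       Y u t w = \<phi> u w + (\<integral>s. indicator {t..} s * g u s w \<partial>lu) - (I T w - I t w)" by (elim exE conjE)
    from i I(2) have "AE w in M. \<forall>t\<in>{0..T}. Y u t w = \<phi> u w + (\<integral>s. indicator {t..} s * g' u s w \<partial>lu) - (I T w - I t w)"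
      by eventually_elim simp
    with I(1) show ?case by (intro exI[of _ I] conjI)
  qed
qed

text \<open>The terminal value cancels in the difference, which for almost every \<open>u\<close>
  has the form covered by the a priori estimate; then integrate over \<open>u\<close>.\<close>

lemma linear_solution_diff_estimate:
  assumes \<beta>: "0 < \<beta>"
    and Y: "Y1 \<in> L2_adapted_field M T F" "Y2 \<in> L2_adapted_field M T F"
    and Z: "Z1 \<in> L2_adapted_field M T F" "Z2 \<in> L2_adapted_field M T F"
    and g: "g1 \<in> L2_adapted_field M T F" "g2 \<in> L2_adapted_field M T F"
    and sol: "linear_solution \<phi> g1 Y1 Z1" "linear_solution \<phi> g2 Y2 Z2"
  shows "ennreal (\<beta> / 2) * weighted_norm \<beta> (field_diff Y1 Y2) + weighted_norm \<beta> (field_diff Z1 Z2)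
    \<le> ennreal (2 / \<beta>) * weighted_norm \<beta> (field_diff g1 g2)"
proof -
  define sn where "sn X u = (\<integral>\<^sup>+p. ennreal (exp (\<beta> * fst p)) * ennreal ((X u (fst p) (snd p))\<^sup>2) \<partial>TM)" for X :: "real \<Rightarrow> real \<Rightarrow> 'a \<Rightarrow> real" and u
  note y = L2_adapted_field_diff[OF Y] and z = L2_adapted_field_diff[OF Z] and h = L2_adapted_field_diff[OF g]
  have sm: "sn X \<in> L0 lu" and wn: "weighted_norm \<beta> X = (\<integral>\<^sup>+u. sn X u \<partial>lu)"
    if "X \<in> L2_adapted_field M T F" for X
    using section_finite_TTM(1)[OF weighted_sq_measurable[OF L2_adapted_fieldD(2)[OF that]], of \<beta>]
      nn_integral_TTM[OF weighted_sq_measurable[OF L2_adapted_fieldD(2)[OF that]], of \<beta>]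
    unfolding sn_def weighted_norm_def by simp_all
  have "AE u in lu. ennreal (\<beta> / 2) * sn (field_diff Y1 Y2) u + sn (field_diff Z1 Z2) u \<le> ennreal (2 / \<beta>) * sn (field_diff g1 g2) u"
    using sol[unfolded linear_solution_def] AE_section_sq_integrable[OF g(1)] AE_section_sq_integrable[OF g(2)] AE_space
  proof eventually_elim
    case (elim u)
    then have u: "u \<in> {0..T}" by simp
    obtain I1 where I1: "has_ito_integral M T F W (Z1 u) I1" "AE w in M. \<forall>t\<in>{0..T}.
       Y1 u t w = \<phi> u w + (\<integral>s. indicator {t..} s * g1 u s w \<partial>lu) - (I1 T w - I1 t w)" using elim(1) by (elim exE conjE)
    obtain I2 where I2: "has_ito_integral M T F W (Z2 u) I2" "AE w in M. \<forall>t\<in>{0..T}.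
       Y2 u t w = \<phi> u w + (\<integral>s. indicator {t..} s * g2 u s w \<partial>lu) - (I2 T w - I2 t w)" using elim(2) by (elim exE conjE)
    obtain L1 where L1: "ito_approx L1 (Z1 u) I1" using ito_approx_if_has_ito_integral[OF I1(1)] by (elim exE)
    obtain L2 where L2: "ito_approx L2 (Z2 u) I2" using ito_approx_if_has_ito_integral[OF I2(1)] by (elim exE)
    note ia = ito_approx_diff[OF L1 L2]
    have hf: "sq_norm TM (uncurried (field_diff g1 g2 u)) < \<infinity>"
      using sq_integrable_diff[OF elim(3,4)] unfolding field_diff_def by (simp add: sq_integrable_nn_integral)
    have eq: "AE w in M. \<forall>t\<in>{0..T}. field_diff Y1 Y2 u t w =
      (\<integral>s. indicator {t..} s * field_diff g1 g2 u s w \<partial>lu) - ((I1 T w - I2 T w) - (I1 t w - I2 t w))"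
      using I1(2) I2(2) AE_section_integrable[OF elim(3)] AE_section_integrable[OF elim(4)]
    proof eventually_elim
      case (elim w)
      show ?case
      proof
        fix t assume t: "t \<in> {0..T}"
        have tb: "{t..} \<in> sets borel" for t :: real by simp
        have "(\<integral>s. indicator {t..} s * field_diff g1 g2 u s w \<partial>lu) =
            (\<integral>s. indicator {t..} s * g1 u s w \<partial>lu) - (\<integral>s. indicator {t..} s * g2 u s w \<partial>lu)"
          unfolding field_diff_def right_diff_distrib by (rule Bochner_Integration.integral_diff[OF integrable_indicator_upto[OF elim(3) tb] integrable_indicator_upto[OF elim(4) tb]])
        then show "field_diff Y1 Y2 u t w =
          (\<integral>s. indicator {t..} s * field_diff g1 g2 u s w \<partial>lu) - ((I1 T w - I2 T w) - (I1 t w - I2 t w))"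
          using bspec[OF elim(1) t] bspec[OF elim(2) t] unfolding field_diff_def by linarith
      qed
    qed
    have ia': "ito_approx (\<lambda>k. el_diff (L1 k) (L2 k)) (field_diff Z1 Z2 u) (\<lambda>t w. I1 t w - I2 t w)"
      using ia unfolding field_diff_def[abs_def] .
    show ?case unfolding sn_def
      by (rule a_priori_estimate[OF \<beta> ia' joint_section[OF L2_adapted_fieldD(2)[OF y] u] L2_adapted_fieldD(3)[OF y u]
            joint_section[OF L2_adapted_fieldD(2)[OF h] u] L2_adapted_fieldD(3)[OF h u] hf eq])
  qed
  then have "(\<integral>\<^sup>+u. ennreal (\<beta> / 2) * sn (field_diff Y1 Y2) u + sn (field_diff Z1 Z2) u \<partial>lu) \<le> (\<integral>\<^sup>+u. ennreal (2 / \<beta>) * sn (field_diff g1 g2) u \<partial>lu)"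
    by (rule nn_integral_mono_AE)
  then show ?thesis
    unfolding nn_integral_add[OF borel_measurable_times_ennreal[OF borel_measurable_const sm[OF y]] sm[OF z]]
      nn_integral_cmult[OF sm[OF y]] nn_integral_cmult[OF sm[OF h]] wn[OF y] wn[OF z] wn[OF h] .
qed

end

context wiener_generated
begin

text \<open>The iteration runs on functions rather than on equivalence classes, so its limit is a
  fixed point only almost everywhere; one further application of the solution map gives a pair that
  solves the equation itself. Uniqueness is the same contraction applied to two solutions.\<close>

theorem field_equation_well_posed:
  fixes f :: "real \<Rightarrow> 'a \<Rightarrow> real \<Rightarrow> real \<Rightarrow> real \<Rightarrow> real"
  assumes fm: "\<And>y z. joint (\<lambda>u s w. f u w s y z) \<in> L0 TTM"
    and fa: "\<And>y z u s. u \<in> {0..T} \<Longrightarrow> s \<in> {0..T} \<Longrightarrow> (\<lambda>w. f u w s y z) \<in> L0 (F s)"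
    and C: "0 < C"
    and lip: "\<And>w s u y y' z z'. w \<in> space M \<Longrightarrow> s \<in> {0..T} \<Longrightarrow> u \<in> {0..T} \<Longrightarrow>
           \<bar>f u w s y z - f u w s y' z'\<bar> \<le> C * (\<bar>y - y'\<bar> + \<bar>z - z'\<bar>)"
    and growth: "\<And>w s u y z. w \<in> space M \<Longrightarrow> s \<in> {0..T} \<Longrightarrow> u \<in> {0..T} \<Longrightarrow> \<bar>f u w s y z\<bar> \<le> C * (1 + \<bar>y\<bar> + \<bar>z\<bar>)"
    and \<phi>: "\<phi> \<in> L2_terminal M T F"
  shows "\<exists>Y Z. bsde_field_solution M T F W f \<phi> Y Z \<and>
    (\<forall>Y' Z'. bsde_field_solution M T F W f \<phi> Y' Z' \<longrightarrow> (AE q in TTM. joint Y' q = joint Y q \<and> joint Z' q = joint Z q))"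
proof -
  define L2 where "L2 = L2_adapted_field M T F"
  define d where "d Y Z u s w = f u w s (Y u s w) (Z u s w)" for Y Z :: "real \<Rightarrow> real \<Rightarrow> 'a \<Rightarrow> real" and u s w
  have sp: "fst q \<in> {0..T}" "fst (snd q) \<in> {0..T}" "snd (snd q) \<in> space M" if "q \<in> space TTM" for q
    using that by (auto simp: space_pair_measure)
  \<comment> \<open>The Lipschitz bound gives measurability of the composed driver, the growth bound
    its square integrability.\<close>
  have dL2: "d Y Z \<in> L2" if YZ: "Y \<in> L2" "Z \<in> L2" for Y Z
  proof -
    note Y = L2_adapted_fieldD[OF YZ(1)[unfolded L2_def]] and Z = L2_adapted_fieldD[OF YZ(2)[unfolded L2_def]]
    have "(\<lambda>q. f (fst (snd q)) (snd (snd q)) (fst q) (joint Y q) (joint Z q)) \<in> L0 TTM"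
      by (rule borel_measurable_lipschitz_compose[OF fm[unfolded joint_def[abs_def]] _ Y(2) Z(2)]) (rule lip[OF sp(3) sp(1) sp(2)])
    then have m: "joint (d Y Z) \<in> L0 TTM" by (simp add: joint_def[abs_def] d_def)
    define b where "b q = C * (1 + \<bar>joint Y q\<bar> + \<bar>joint Z q\<bar>)" for q
    have ab: "sq_integrable TTM (\<lambda>q. \<bar>X q\<bar>)" if "sq_integrable TTM X" for X :: "real \<times> real \<times> 'a \<Rightarrow> real"
      using that unfolding sq_integrable_def power2_abs by (intro conjI borel_measurable_abs) simp_all
    have "sq_integrable TTM (\<lambda>q. 1 + \<bar>joint Y q\<bar> + \<bar>joint Z q\<bar>)"
      by (intro sq_integrable_add ab Y(1) Z(1) sq_integrable_bounded[OF finite_measure_TTM, where K=1]) simp_all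
    then have b: "sq_integrable TTM b" unfolding b_def by (rule sq_integrable_cmult)
    have "integrable TTM (\<lambda>q. (joint (d Y Z) q)\<^sup>2)"
    proof (rule Bochner_Integration.integrable_bound)
      show "integrable TTM (\<lambda>q. (b q)\<^sup>2)" using b by (simp add: sq_integrable_def)
      show "(\<lambda>q. (joint (d Y Z) q)\<^sup>2) \<in> L0 TTM" by (rule borel_measurable_power[OF m])
      show "AE q in TTM. norm ((joint (d Y Z) q)\<^sup>2) \<le> norm ((b q)\<^sup>2)"
      proof (rule AE_I2)
        fix q assume "q \<in> space TTM"
        from growth[OF sp(3)[OF this] sp(1)[OF this] sp(2)[OF this]]
        have "\<bar>joint (d Y Z) q\<bar> \<le> b q" by (simp add: joint_def d_def b_def)
        then have "(joint (d Y Z) q)\<^sup>2 \<le> (b q)\<^sup>2" using power_mono[of "\<bar>joint (d Y Z) q\<bar>" "b q" 2] by simp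
        then show "norm ((joint (d Y Z) q)\<^sup>2) \<le> norm ((b q)\<^sup>2)" by simp
      qed
    qed
    then have "sq_integrable TTM (joint (d Y Z))" using m by (simp add: sq_integrable_def)
    moreover have "d Y Z u t \<in> L0 (F t)" if ut: "u \<in> {0..T}" "t \<in> {0..T}" for u t
      unfolding d_def[abs_def]
    proof (rule borel_measurable_lipschitz_compose[OF fa[OF ut] _ Y(3)[OF ut] Z(3)[OF ut]])
      fix x y z y' z' assume "x \<in> space (F t)"
      then have "x \<in> space M" using space_F ut by simp
      then show "\<bar>f u x t y z - f u x t y' z'\<bar> \<le> C * (\<bar>y - y'\<bar> + \<bar>z - z'\<bar>)" by (rule lip[OF _ ut(2,1)])
    qed
    ultimately show ?thesis unfolding L2_def L2_adapted_field_iff by simp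
  qed
  have sol_iff: "bsde_field_solution M T F W f \<phi> Y Z \<longleftrightarrow> Y \<in> L2 \<and> Z \<in> L2 \<and> linear_solution \<phi> (d Y Z) Y Z" for Y Z
    unfolding bsde_field_solution_def L2_def linear_solution_def d_def
    by (simp only: set_integral_lborel_upto cong: ball_cong)
  \<comment> \<open>The summand \<open>64 * C^2\<close> yields the contraction factor
    \<open>1/16\<close>, small enough for the weight \<open>4 ^ k\<close>. The summand
    \<open>2\<close> ensures \<open>\<beta> / 2 \<ge> 1\<close>, so that the estimate also bounds
    the norm of the first component.\<close>
  define \<beta> where "\<beta> = 2 + 64 * C\<^sup>2"
  have \<beta>: "2 \<le> \<beta>" "0 < \<beta>" "0 \<le> \<beta>" and \<beta>C: "2 / \<beta> * (2 * C\<^sup>2) \<le> 1 / 16"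
  proof -
    have "0 \<le> C\<^sup>2" by simp
    then show "2 \<le> \<beta>" "0 < \<beta>" "0 \<le> \<beta>" unfolding \<beta>_def by linarith+
    then show "2 / \<beta> * (2 * C\<^sup>2) \<le> 1 / 16" by (simp add: \<beta>_def field_simps)
  qed
  define E where "E p = weighted_norm \<beta> (fst p) + weighted_norm \<beta> (snd p)" for p :: "(real \<Rightarrow> real \<Rightarrow> 'a \<Rightarrow> real) \<times> (real \<Rightarrow> real \<Rightarrow> 'a \<Rightarrow> real)"
  define pd where "pd p p' = (field_diff (fst p) (fst p'), field_diff (snd p) (snd p'))" for p p' :: "(real \<Rightarrow> real \<Rightarrow> 'a \<Rightarrow> real) \<times> (real \<Rightarrow> real \<Rightarrow> 'a \<Rightarrow> real)"
  define good where "good p \<longleftrightarrow> fst p \<in> L2 \<and> snd p \<in> L2" for p :: "(real \<Rightarrow> real \<Rightarrow> 'a \<Rightarrow> real) \<times> (real \<Rightarrow> real \<Rightarrow> 'a \<Rightarrow> real)"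
  \<comment> \<open>A relation rather than a function, because the linear equation determines its
    solution only up to null sets; the contraction holds for any choice.\<close>
  define step where "step p p' \<longleftrightarrow> good p' \<and> linear_solution \<phi> (d (fst p) (snd p)) (fst p') (snd p')" for p p'
  have stepD: "good p'" if "step p p'" for p p' using that by (simp add: step_def)
  have good_pd: "fst (pd p p') \<in> L2" "snd (pd p p') \<in> L2" if "good p" "good p'" for p p'
    using that unfolding good_def pd_def L2_def fst_conv snd_conv by (auto intro: L2_adapted_field_diff)
  have E_fin: "E (pd p p') < \<infinity>" if "good p" "good p'" for p p'
    using weighted_norm_finite[OF good_pd(1)[OF that, unfolded L2_def] \<beta>(3)] weighted_norm_finite[OF good_pd(2)[OF that, unfolded L2_def] \<beta>(3)]
    unfolding E_def by simp
  have contraction: "E (pd p p') \<le> ennreal (1/16) * E (pd r r')" if g: "good r" "good r'" and s: "step r p" "step r' p'" for r r' p p'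
  proof -
    obtain y z y' z' where r: "r = (y, z)" "r' = (y', z')" by (metis surj_pair)
    have L: "y \<in> L2" "z \<in> L2" "y' \<in> L2" "z' \<in> L2" using g by (simp_all add: good_def r)
    have G: "fst p \<in> L2_adapted_field M T F" "fst p' \<in> L2_adapted_field M T F" "snd p \<in> L2_adapted_field M T F" "snd p' \<in> L2_adapted_field M T F"
      using s by (simp_all add: step_def good_def L2_def)
    have dd: "d y z \<in> L2_adapted_field M T F" "d y' z' \<in> L2_adapted_field M T F" using dL2 L by (simp_all add: L2_def)
    have sols: "linear_solution \<phi> (d y z) (fst p) (snd p)" "linear_solution \<phi> (d y' z') (fst p') (snd p')"
      using s by (simp_all add: step_def r)
    have my: "joint (field_diff y y') \<in> L0 TTM" and mz: "joint (field_diff z z') \<in> L0 TTM"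
      using L2_adapted_fieldD(2)[OF L2_adapted_field_diff] L by (simp_all add: L2_def)
    have "E (pd p p') \<le> ennreal (\<beta> / 2) * weighted_norm \<beta> (field_diff (fst p) (fst p')) + weighted_norm \<beta> (field_diff (snd p) (snd p'))"
      unfolding E_def pd_def fst_conv snd_conv
    proof (rule add_right_mono)
      have "1 \<le> ennreal (\<beta> / 2)" using \<beta>(1) by simp
      from mult_right_mono[OF this, of "weighted_norm \<beta> (field_diff (fst p) (fst p'))"]
      show "weighted_norm \<beta> (field_diff (fst p) (fst p')) \<le> ennreal (\<beta> / 2) * weighted_norm \<beta> (field_diff (fst p) (fst p'))" by simp
    qed
    also have "\<dots> \<le> ennreal (2 / \<beta>) * weighted_norm \<beta> (field_diff (d y z) (d y' z'))"
      by (rule linear_solution_diff_estimate[OF \<beta>(2) G dd sols])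
    \<comment> \<open>The Lipschitz bound and \<open>(a + b)^2 \<le> 2 * (a^2 + b^2)\<close> give
      the constant \<open>2 * C^2\<close>.\<close>
    also have "weighted_norm \<beta> (field_diff (d y z) (d y' z')) \<le> ennreal (2 * C\<^sup>2) * E (pd r r')"
    proof -
      have "weighted_norm \<beta> (field_diff (d y z) (d y' z')) \<le> (\<integral>\<^sup>+q. ennreal (2 * C\<^sup>2) * (ennreal (exp (\<beta> * fst q)) * ennreal ((joint (field_diff y y') q)\<^sup>2)
          + ennreal (exp (\<beta> * fst q)) * ennreal ((joint (field_diff z z') q)\<^sup>2)) \<partial>TTM)"
        unfolding weighted_norm_def
      proof (rule nn_integral_mono)
        fix q assume q: "q \<in> space TTM"
        define a where "a = \<bar>joint (field_diff y y') q\<bar>"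
        define b where "b = \<bar>joint (field_diff z z') q\<bar>"
        have "\<bar>joint (field_diff (d y z) (d y' z')) q\<bar> \<le> C * (a + b)"
          using lip[OF sp(3)[OF q] sp(1)[OF q] sp(2)[OF q]] by (simp add: joint_def field_diff_def d_def a_def b_def)
        then have "(joint (field_diff (d y z) (d y' z')) q)\<^sup>2 \<le> (C * (a + b))\<^sup>2"
          using power_mono[of "\<bar>joint (field_diff (d y z) (d y' z')) q\<bar>" "C * (a + b)" 2] by simp
        also have "\<dots> = C\<^sup>2 * (a + b)\<^sup>2" by (rule power_mult_distrib)
        also have "\<dots> \<le> C\<^sup>2 * (2 * (a\<^sup>2 + b\<^sup>2))"
          using sum_squares_bound[of a b] by (intro mult_left_mono) (simp_all add: power2_sum)
        finally have "(joint (field_diff (d y z) (d y' z')) q)\<^sup>2 \<le> 2 * C\<^sup>2 * (a\<^sup>2 + b\<^sup>2)" by (simp only: mult_ac)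
        then have "ennreal ((joint (field_diff (d y z) (d y' z')) q)\<^sup>2) \<le> ennreal (2 * C\<^sup>2) * (ennreal (a\<^sup>2) + ennreal (b\<^sup>2))"
          by (simp add: ennreal_mult[symmetric] ennreal_plus[symmetric] ennreal_leI del: ennreal_plus)
        from mult_left_mono[OF this, of "ennreal (exp (\<beta> * fst q))"]
        show "ennreal (exp (\<beta> * fst q)) * ennreal ((joint (field_diff (d y z) (d y' z')) q)\<^sup>2) \<le>
          ennreal (2 * C\<^sup>2) * (ennreal (exp (\<beta> * fst q)) * ennreal ((joint (field_diff y y') q)\<^sup>2)
          + ennreal (exp (\<beta> * fst q)) * ennreal ((joint (field_diff z z') q)\<^sup>2))"
          unfolding a_def b_def power2_abs by (simp only: distrib_left mult.left_commute) simp
      qed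
      also have "\<dots> = ennreal (2 * C\<^sup>2) * E (pd r r')"
        unfolding E_def pd_def r fst_conv snd_conv weighted_norm_def
          nn_integral_cmult[OF borel_measurable_add[OF weighted_sq_measurable[OF my] weighted_sq_measurable[OF mz]]]
          nn_integral_add[OF weighted_sq_measurable[OF my] weighted_sq_measurable[OF mz]] ..
      finally show ?thesis .
    qed
    finally have "E (pd p p') \<le> ennreal (2 / \<beta>) * (ennreal (2 * C\<^sup>2) * E (pd r r'))" by (simp add: mult_left_mono)
    also have "\<dots> = ennreal (2 / \<beta> * (2 * C\<^sup>2)) * E (pd r r')" 
    proof -
      have "ennreal (2 / \<beta> * (2 * C\<^sup>2)) = ennreal (2 / \<beta>) * ennreal (2 * C\<^sup>2)" by (rule ennreal_mult) (use \<beta> in simp_all)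
      then show ?thesis by (simp only: mult.assoc)
    qed
    also have "\<dots> \<le> ennreal (1/16) * E (pd r r')" by (intro mult_right_mono ennreal_leI \<beta>C) simp
    finally show ?thesis .
  qed
  have E_zero: "AE q in TTM. joint (fst p) q = joint (fst p') q \<and> joint (snd p) q = joint (snd p') q"
    if g: "good p" "good p'" and E0: "E (pd p p') = 0" for p p'
  proof -
    have z: "AE q in TTM. joint X q = joint X' q"
      if X: "X \<in> L2_adapted_field M T F" "X' \<in> L2_adapted_field M T F" and 0: "weighted_norm \<beta> (field_diff X X') = 0" for X X'
    proof (rule AE_eq_if_nn_integral_sq_diff_0[OF L2_adapted_fieldD(2)[OF X(1)] L2_adapted_fieldD(2)[OF X(2)]])
      show "sq_norm TTM (\<lambda>q. joint X q - joint X' q) = 0"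
        using weighted_norm_bounds(1)[OF L2_adapted_fieldD(2)[OF L2_adapted_field_diff[OF X]] \<beta>(3)] 0
        unfolding joint_field_diff by simp
    qed
    have "AE q in TTM. joint (fst p) q = joint (fst p') q" "AE q in TTM. joint (snd p) q = joint (snd p') q"
      using g E0 by (intro z; simp add: good_def L2_def E_def pd_def)+
    then show ?thesis by eventually_elim simp
  qed
  have "\<forall>p. \<exists>p'. good p \<longrightarrow> step p p'"
  proof
    fix p
    show "\<exists>p'. good p \<longrightarrow> step p p'"
    proof (cases "good p")
      case True
      then have "d (fst p) (snd p) \<in> L2_adapted_field M T F" using dL2 by (simp add: good_def L2_def)
      from linear_equation_solution[OF this \<phi>, folded linear_solution_def]
      obtain Y Z where "Y \<in> L2_adapted_field M T F" "Z \<in> L2_adapted_field M T F" "linear_solution \<phi> (d (fst p) (snd p)) Y Z" by (elim exE conjE)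
      then have "step p (Y, Z)" by (simp add: step_def good_def L2_def)
      then show ?thesis by (intro exI[of _ "(Y, Z)"] impI)
    qed simp
  qed
  from choice[OF this] obtain \<Phi> where \<Phi>': "\<forall>p. good p \<longrightarrow> step p (\<Phi> p)" by (elim exE)
  have \<Phi>: "step p (\<Phi> p)" if "good p" for p by (rule mp[OF spec[OF \<Phi>'] that])
  define s where "s k = (\<Phi> ^^ k) (\<lambda>u t w. 0, \<lambda>u t w. 0)" for k
  have j0: "joint (\<lambda>u t w. 0) = (\<lambda>q. 0)" by (simp add: joint_def[abs_def])
  have "(\<lambda>u t w. 0) \<in> L2" unfolding L2_def L2_adapted_field_iff j0 by (simp add: sq_integrable_def)
  then have gs: "good (s k)" for k
    by (induction k) (simp_all add: s_def good_def stepD[OF \<Phi>, unfolded good_def])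
  have ss: "step (s k) (s (Suc k))" for k using \<Phi>[OF gs[of k]] by (simp add: s_def)
  define E0 where "E0 = E (pd (s 1) (s 0))"
  have E0: "E0 < \<infinity>" unfolding E0_def by (rule E_fin[OF gs gs])
  have Ek: "E (pd (s (Suc k)) (s k)) \<le> ennreal ((1/16) ^ k) * E0" for k
  proof (induction k)
    case (Suc k)
    have "E (pd (s (Suc (Suc k))) (s (Suc k))) \<le> ennreal (1/16) * E (pd (s (Suc k)) (s k))"
      by (rule contraction[OF gs gs ss ss])
    also have "\<dots> \<le> ennreal (1/16) * (ennreal ((1/16) ^ k) * E0)" by (rule mult_left_mono[OF Suc]) simp
    also have "\<dots> = ennreal ((1/16) ^ Suc k) * E0" 
    proof -
      have "ennreal (1/16 * (1/16) ^ k) = ennreal (1/16) * ennreal ((1/16) ^ k)" by (rule ennreal_mult) simp_all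
      then show ?thesis by (simp only: mult.assoc power_Suc)
    qed
    finally show ?case .
  qed (simp add: E0_def)
  \<comment> \<open>Stated for one component \<open>x\<close> and applied to both; the increments of
    either are bounded by the joint quantity \<open>E\<close>.\<close>
  have lim_L2: "(\<lambda>u t w. lim (\<lambda>k. x k u t w)) \<in> L2"
      "(\<lambda>k. weighted_norm \<beta> (field_diff (x k) (\<lambda>u t w. lim (\<lambda>k. x k u t w)))) \<longlonglongrightarrow> 0"
    if x: "\<And>k. x k \<in> L2" and le: "\<And>k. weighted_norm \<beta> (field_diff (x (Suc k)) (x k)) \<le> E (pd (s (Suc k)) (s k))" for x
  proof -
    note xD = L2_adapted_fieldD[OF x[unfolded L2_def]]
    define y where "y = (\<lambda>u t w. lim (\<lambda>k. x k u t w))"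
    have jy: "joint y q = lim (\<lambda>k. joint (x k) q)" for q by (simp add: y_def joint_def)
    have sum: "(\<Sum>k. 4 ^ k * sq_norm TTM (\<lambda>q. joint (x (Suc k)) q - joint (x k) q)) < \<infinity>"
    proof -
      have "4 ^ k * sq_norm TTM (\<lambda>q. joint (x (Suc k)) q - joint (x k) q) \<le> ennreal ((1/4) ^ k) * E0" for k
      proof -
        have "sq_norm TTM (\<lambda>q. joint (x (Suc k)) q - joint (x k) q) \<le> weighted_norm \<beta> (field_diff (x (Suc k)) (x k))"
          using weighted_norm_bounds(1)[OF L2_adapted_fieldD(2)[OF L2_adapted_field_diff[OF x[unfolded L2_def] x[unfolded L2_def]]] \<beta>(3)]
          unfolding joint_field_diff .
        also have "\<dots> \<le> ennreal ((1/16) ^ k) * E0" by (rule order_trans[OF le Ek])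
        finally have "4 ^ k * sq_norm TTM (\<lambda>q. joint (x (Suc k)) q - joint (x k) q) \<le> 4 ^ k * (ennreal ((1/16) ^ k) * E0)"
          by (rule mult_left_mono) simp
        also have "\<dots> = ennreal (4 ^ k) * ennreal ((1/16) ^ k) * E0" by (simp add: ennreal_power[symmetric] mult.assoc)
        also have "ennreal (4 ^ k) * ennreal ((1/16) ^ k) = ennreal ((1/4) ^ k)"
          by (simp add: ennreal_mult[symmetric] power_mult_distrib[symmetric])
        finally show ?thesis .
      qed
      then have "(\<Sum>k. 4 ^ k * sq_norm TTM (\<lambda>q. joint (x (Suc k)) q - joint (x k) q)) \<le> (\<Sum>k. ennreal ((1/4) ^ k) * E0)"
        by (intro suminf_le summableI)
      also have "\<dots> = (\<Sum>k. ennreal ((1/4) ^ k)) * E0" by (rule ennreal_suminf_multc)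
      also have "(\<Sum>k. ennreal ((1/4) ^ k)) = ennreal (\<Sum>k. (1/4) ^ k)"
        by (rule suminf_ennreal2) (simp_all add: summable_geometric)
      also have "ennreal (\<Sum>k. (1/4) ^ k) * E0 < \<infinity>" by (rule ennreal_times_finite[OF E0])
      finally show ?thesis .
    qed
    note fc = fast_cauchy_L2[of "\<lambda>k. joint (x k)", OF xD(2) sum, folded jy]
    have ym: "joint y \<in> L0 TTM" unfolding jy[abs_def] by (rule borel_measurable_lim_metric[OF xD(2)])
    have "sq_norm TTM (\<lambda>q. joint (x 0) q - joint y q) < \<infinity>"
      by (rule le_less_trans[OF fc(2)[of 0] ennreal_times_finite[OF sum]])
    then have "sq_integrable TTM (\<lambda>q. joint (x 0) q - joint y q)"
      unfolding sq_integrable_iff[OF borel_measurable_diff[OF xD(2) ym]] .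
    from sq_integrable_diff[OF xD(1)[of 0] this] have "sq_integrable TTM (joint y)" by simp
    moreover have "y u t \<in> L0 (F t)" if "u \<in> {0..T}" "t \<in> {0..T}" for u t
      unfolding y_def by (rule borel_measurable_lim_metric[OF xD(3)[OF that]])
    ultimately have yL: "y \<in> L2" unfolding L2_def L2_adapted_field_iff by simp
    then show "(\<lambda>u t w. lim (\<lambda>k. x k u t w)) \<in> L2" unfolding y_def .
    have "(\<lambda>k. ennreal (exp (\<beta> * T)) * sq_norm TTM (\<lambda>q. joint (x k) q - joint y q)) \<longlonglongrightarrow> ennreal (exp (\<beta> * T)) * 0"
      by (rule ennreal_tendsto_cmult[OF _ fc(3)]) simp
    then have l: "(\<lambda>k. ennreal (exp (\<beta> * T)) * sq_norm TTM (\<lambda>q. joint (x k) q - joint y q)) \<longlonglongrightarrow> 0" by simp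
    have "(\<lambda>k. weighted_norm \<beta> (field_diff (x k) y)) \<longlonglongrightarrow> 0"
    proof (rule tendsto_sandwich[OF _ _ tendsto_const l])
      show "\<forall>\<^sub>F k in sequentially. weighted_norm \<beta> (field_diff (x k) y) \<le> ennreal (exp (\<beta> * T)) * sq_norm TTM (\<lambda>q. joint (x k) q - joint y q)"
        using weighted_norm_bounds(2)[OF L2_adapted_fieldD(2)[OF L2_adapted_field_diff[OF x[unfolded L2_def] yL[unfolded L2_def]]] \<beta>(3)]
        unfolding joint_field_diff by (intro always_eventually allI)
    qed simp
    then show "(\<lambda>k. weighted_norm \<beta> (field_diff (x k) (\<lambda>u t w. lim (\<lambda>k. x k u t w)))) \<longlonglongrightarrow> 0" unfolding y_def .
  qed
  define p where "p = (\<lambda>u t w. lim (\<lambda>k. fst (s k) u t w), \<lambda>u t w. lim (\<lambda>k. snd (s k) u t w))"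
  have le: "weighted_norm \<beta> (field_diff (fst (s (Suc k))) (fst (s k))) \<le> E (pd (s (Suc k)) (s k))"
      "weighted_norm \<beta> (field_diff (snd (s (Suc k))) (snd (s k))) \<le> E (pd (s (Suc k)) (s k))" for k
    by (simp_all add: E_def pd_def)
  have gL: "fst (s k) \<in> L2" "snd (s k) \<in> L2" for k using gs[of k] by (simp_all add: good_def)
  note l1 = lim_L2[of "\<lambda>k. fst (s k)", OF gL(1) le(1)] and l2 = lim_L2[of "\<lambda>k. snd (s k)", OF gL(2) le(2)]
  have gp: "good p" using l1(1) l2(1) by (simp add: good_def p_def)
  have Ep: "(\<lambda>k. E (pd (s k) p)) \<longlonglongrightarrow> 0"
    using tendsto_add[OF l1(2) l2(2)] by (simp add: E_def pd_def p_def)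
  \<comment> \<open>It is \<open>p'\<close> and not \<open>p\<close> that will solve the equation:
    it solves the linear equation with the driver taken at \<open>p\<close>, and the driver at
    \<open>p'\<close> coincides with that one almost everywhere.\<close>
  define p' where "p' = \<Phi> p"
  have sp': "step p p'" unfolding p'_def by (rule \<Phi>[OF gp])
  note gp' = stepD[OF sp']
  \<comment> \<open>\<open>E\<close> is a sum of squared norms, hence the factor 2 in its triangle
    inequality.\<close>
  have E_tri: "E (pd a b) \<le> 2 * (E (pd c a) + E (pd c b))" if g: "good a" "good b" "good c" for a b c
  proof -
    have t: "weighted_norm \<beta> (field_diff X Y) \<le> 2 * (weighted_norm \<beta> (field_diff V X) + weighted_norm \<beta> (field_diff V Y))"
      if X: "X \<in> L2" "Y \<in> L2" "V \<in> L2" for X Y V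
    proof -
      have m: "joint (field_diff V X) \<in> L0 TTM" "joint (field_diff V Y) \<in> L0 TTM"
        using L2_adapted_fieldD(2)[OF L2_adapted_field_diff] X by (simp_all add: L2_def)
      have "weighted_norm \<beta> (field_diff X Y) \<le> (\<integral>\<^sup>+q. 2 * (ennreal (exp (\<beta> * fst q)) * ennreal ((joint (field_diff V X) q)\<^sup>2)
          + ennreal (exp (\<beta> * fst q)) * ennreal ((joint (field_diff V Y) q)\<^sup>2)) \<partial>TTM)"
        unfolding weighted_norm_def
      proof (rule nn_integral_mono)
        fix q
        have "joint (field_diff X Y) q = joint (field_diff V Y) q + - joint (field_diff V X) q" by (simp add: joint_field_diff)
        then have "ennreal ((joint (field_diff X Y) q)\<^sup>2) \<le> 2 * ennreal ((joint (field_diff V X) q)\<^sup>2) + 2 * ennreal ((joint (field_diff V Y) q)\<^sup>2)"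
          using ennreal_sq_add_le[of "joint (field_diff V Y) q" "- joint (field_diff V X) q"] by (simp add: add.commute)
        from mult_left_mono[OF this, of "ennreal (exp (\<beta> * fst q))"]
        show "ennreal (exp (\<beta> * fst q)) * ennreal ((joint (field_diff X Y) q)\<^sup>2) \<le> 2 * (ennreal (exp (\<beta> * fst q)) * ennreal ((joint (field_diff V X) q)\<^sup>2)
          + ennreal (exp (\<beta> * fst q)) * ennreal ((joint (field_diff V Y) q)\<^sup>2))"
          by (simp only: distrib_left mult.left_commute) simp
      qed
      also have "\<dots> = 2 * (weighted_norm \<beta> (field_diff V X) + weighted_norm \<beta> (field_diff V Y))"
        unfolding weighted_norm_def
          nn_integral_cmult[OF borel_measurable_add[OF weighted_sq_measurable[OF m(1)] weighted_sq_measurable[OF m(2)]]]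
          nn_integral_add[OF weighted_sq_measurable[OF m(1)] weighted_sq_measurable[OF m(2)]] ..
      finally show ?thesis .
    qed
    have "E (pd a b) \<le> 2 * (weighted_norm \<beta> (field_diff (fst c) (fst a)) + weighted_norm \<beta> (field_diff (fst c) (fst b)))
        + 2 * (weighted_norm \<beta> (field_diff (snd c) (snd a)) + weighted_norm \<beta> (field_diff (snd c) (snd b)))"
      unfolding E_def pd_def fst_conv snd_conv using g by (intro add_mono t) (simp_all add: good_def)
    also have "\<dots> = 2 * (E (pd c a) + E (pd c b))"
      unfolding E_def pd_def fst_conv snd_conv by (simp only: distrib_left ac_simps)
    finally show ?thesis .
  qed
  \<comment> \<open>Both are compared with \<open>s (Suc k)\<close>: it tends to \<open>p\<close>,
    and its distance to \<open>p'\<close> is contracted from the distance of \<open>s k\<close> to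
    \<open>p\<close>.\<close>
  have "E (pd p p') = 0"
  proof -
    have "E (pd p p') \<le> 2 * (E (pd (s (Suc k)) p) + ennreal (1/16) * E (pd (s k) p))" for k
      by (rule order_trans[OF E_tri[OF gp gp' gs[of "Suc k"]]], intro mult_left_mono add_left_mono contraction[OF gs gp ss sp']) simp
    moreover have "(\<lambda>k. 2 * (E (pd (s (Suc k)) p) + ennreal (1/16) * E (pd (s k) p))) \<longlonglongrightarrow> 2 * (0 + ennreal (1/16) * 0)"
      by (intro ennreal_tendsto_cmult tendsto_add LIMSEQ_Suc Ep) simp_all
    ultimately have "E (pd p p') \<le> 2 * (0 + ennreal (1/16) * 0)"
      by (intro LIMSEQ_le_const[of _ _ "E (pd p p')"]) auto
    then show ?thesis by simp
  qed
  from E_zero[OF gp gp' this] have eq: "AE q in TTM. joint (d (fst p) (snd p)) q = joint (d (fst p') (snd p')) q"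
    by eventually_elim (simp add: joint_def d_def)
  have "linear_solution \<phi> (d (fst p') (snd p')) (fst p') (snd p')"
    by (rule linear_solution_cong[OF _ _ eq]) (use dL2 gp gp' sp' in \<open>simp_all add: good_def step_def L2_def\<close>)
  then have st: "step p' p'" using gp' by (simp add: step_def)
  then have "bsde_field_solution M T F W f \<phi> (fst p') (snd p')" unfolding sol_iff by (simp add: step_def good_def)
  moreover have "\<forall>Y' Z'. bsde_field_solution M T F W f \<phi> Y' Z' \<longrightarrow> (AE q in TTM. joint Y' q = joint (fst p') q \<and> joint Z' q = joint (snd p') q)"
  proof (intro allI impI)
    fix Y' Z' assume "bsde_field_solution M T F W f \<phi> Y' Z'"
    then have gY: "good (Y', Z')" and sY: "step (Y', Z') (Y', Z')" unfolding sol_iff by (simp_all add: good_def step_def)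
    have fin: "E (pd (Y', Z') p') < \<infinity>" by (rule E_fin[OF gY gp'])
    have c: "E (pd (Y', Z') p') \<le> ennreal (1/16) * E (pd (Y', Z') p')" by (rule contraction[OF gY gp' sY st])
    \<comment> \<open>A finite quantity bounded by a sixteenth of itself vanishes; finiteness comes
      from square integrability of both solutions.\<close>
    have "E (pd (Y', Z') p') = 0"
    proof (cases "E (pd (Y', Z') p')")
      case (real r)
      have "ennreal (1/16 * r) = ennreal (1/16) * ennreal r" by (rule ennreal_mult) (use real(1) in simp_all)
      then have "ennreal r \<le> ennreal (1/16 * r)" using c by (simp only: real(2))
      then have "r \<le> 1/16 * r" using real(1) by (subst (asm) ennreal_le_iff) simp_all
      then show ?thesis using real by simp
    next
      case top
      then show ?thesis using fin by simp
    qed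
    from E_zero[OF gY gp' this] show "AE q in TTM. joint Y' q = joint (fst p') q \<and> joint Z' q = joint (snd p') q" by simp
  qed
  ultimately show ?thesis by (intro exI[of _ "fst p'"] exI[of _ "snd p'"] conjI)
qed

end

section \<open>The Brownian filtration\<close>

locale brownian = prob_space M for M :: "'a measure" +
  fixes T :: real and B :: "real \<Rightarrow> 'a \<Rightarrow> real"
  assumes T_pos: "0 < T" and bm: "brownian_motion M T B"
begin

lemma B_measurable: "t \<in> {0..T} \<Longrightarrow> B t \<in> L0 M"
  using bm[unfolded brownian_motion_def, THEN conjunct1] by (rule bspec)

lemma B_0: "AE w in M. B 0 w = 0"
  by (rule bm[unfolded brownian_motion_def, THEN conjunct2, THEN conjunct1])

lemma B_continuous: "AE w in M. continuous_on {0..T} (\<lambda>t. B t w)"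
  by (rule bm[unfolded brownian_motion_def, THEN conjunct2, THEN conjunct2, THEN conjunct1])

lemma B_normal: "0 \<le> s \<Longrightarrow> s < t \<Longrightarrow> t \<le> T \<Longrightarrow>
    distributed M lborel (\<lambda>w. B t w - B s w) (normal_density 0 (sqrt (t - s)))"
  by (rule bm[unfolded brownian_motion_def, THEN conjunct2, THEN conjunct2, THEN conjunct2, THEN conjunct1, rule_format]) simp

lemma B_increments:
  assumes "\<And>i. i \<le> n \<Longrightarrow> \<tau> i \<in> {0..T}" "\<And>i. i < n \<Longrightarrow> \<tau> i \<le> \<tau> (Suc i)"
  shows "indep_vars (\<lambda>_. borel) (\<lambda>i w. B (\<tau> (Suc i)) w - B (\<tau> i) w) {..<n::nat}"
  by (rule mp[OF spec[OF spec[OF bm[unfolded brownian_motion_def, THEN conjunct2, THEN conjunct2, THEN conjunct2, THEN conjunct2]]]])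
    (intro conjI allI impI assms)

text \<open>Intersection-stable events that, together with the null sets, generate the history;
  encoded by lists as in \<open>path_event\<close>.\<close>

definition events_upto :: "real \<Rightarrow> 'a set set" where
  "events_upto s = {{w\<in>space M. \<forall>(q, a)\<in>set xs. B q w \<le> a} |xs. \<forall>(q, a)\<in>set xs. 0 \<le> q \<and> q \<le> s}"

lemma events_upto_sets:
  assumes "s \<le> T" "A \<in> events_upto s"
  shows "A \<in> sets M"
proof -
  obtain xs where A: "A = {w\<in>space M. \<forall>(q, a)\<in>set xs. B q w \<le> a}" and xs: "\<forall>(q, a)\<in>set xs. 0 \<le> q \<and> q \<le> s"
    using assms(2) unfolding events_upto_def by blast
  show ?thesis
    unfolding A
  proof (rule sets.sets_Collect_finite_All)
    fix p assume p: "p \<in> set xs"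
    obtain q a where qa: "p = (q, a)" by (cases p)
    have "B q \<in> L0 M" using xs p qa assms(1) by (intro B_measurable) auto
    from borel_measurable_le[OF this borel_measurable_const]
    show "{w\<in>space M. case p of (q, a) \<Rightarrow> B q w \<le> a} \<in> sets M" unfolding qa by simp
  qed simp
qed

lemma Int_stable_events_upto: "Int_stable (events_upto s)"
proof (rule Int_stableI)
  fix E E' assume "E \<in> events_upto s" "E' \<in> events_upto s"
  then obtain xs ys where "E = {w\<in>space M. \<forall>(q, a)\<in>set xs. B q w \<le> a}" "\<forall>(q, a)\<in>set xs. 0 \<le> q \<and> q \<le> s"
    "E' = {w\<in>space M. \<forall>(q, a)\<in>set ys. B q w \<le> a}" "\<forall>(q, a)\<in>set ys. 0 \<le> q \<and> q \<le> s"
    unfolding events_upto_def by blast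
  then have "E \<inter> E' = {w\<in>space M. \<forall>(q, a)\<in>set (xs @ ys). B q w \<le> a}" "\<forall>(q, a)\<in>set (xs @ ys). 0 \<le> q \<and> q \<le> s" by auto
  then show "E \<inter> E' \<in> events_upto s" unfolding events_upto_def by blast
qed

text \<open>The definition of Brownian motion speaks of consecutive increments, so an event about
  values has to be rewritten: each value is a sum of increments starting from time \<open>0\<close>,
  up to the null set where \<open>B 0\<close> is not zero.\<close>

lemma events_upto_indep_increment:
  assumes s: "0 \<le> s" "s \<le> t" "t \<le> T" and A: "A \<in> events_upto s" and D: "D \<in> sets borel"
  shows "prob (A \<inter> ((\<lambda>w. B t w - B s w) -` D \<inter> space M)) = prob A * prob ((\<lambda>w. B t w - B s w) -` D \<inter> space M)"
proof -
  obtain xs where A_eq: "A = {w\<in>space M. \<forall>(q, a)\<in>set xs. B q w \<le> a}" and xs: "\<forall>(q, a)\<in>set xs. 0 \<le> q \<and> q \<le> s"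
    using A unfolding events_upto_def by blast
  \<comment> \<open>The times of the event in order, preceded by \<open>0\<close> and, through
    \<open>\<tau>\<close>, followed by \<open>s\<close> and \<open>t\<close>; the increment with
    index \<open>m\<close> is then the one from \<open>s\<close> to \<open>t\<close>.\<close>
  define ts where "ts = 0 # sort (map fst xs)"
  define m where "m = length ts"
  define \<tau> where "\<tau> i = (if i < m then ts ! i else if i = m then s else t)" for i
  define X where "X i w = B (\<tau> (Suc i)) w - B (\<tau> i) w" for i w
  have ts: "0 \<le> x \<and> x \<le> s" if "x \<in> set ts" for x
    using that xs s(1) by (auto simp: ts_def)
  have sorted: "sorted ts" using ts by (auto simp: ts_def)
  have \<tau>0: "\<tau> 0 = 0" by (simp add: \<tau>_def m_def ts_def)
  have \<tau>r: "\<tau> i \<in> {0..T}" for i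
    using ts[OF nth_mem[of i ts]] s by (auto simp: \<tau>_def m_def)
  have \<tau>m: "\<tau> i \<le> \<tau> (Suc i)" for i
  proof (cases "Suc i < m")
    case True
    then show ?thesis using sorted by (simp add: \<tau>_def m_def sorted_nth_mono)
  next
    case False
    then show ?thesis using ts[OF nth_mem[of i ts]] s(2) by (auto simp: \<tau>_def m_def)
  qed
  have iv: "indep_vars (\<lambda>_. borel) X {..<Suc m}" unfolding X_def[abs_def] by (rule B_increments[where n="Suc m" and \<tau>=\<tau>]) (rule \<tau>r, rule \<tau>m)
  have Xm: "X m w = B t w - B s w" for w by (simp add: X_def \<tau>_def)
  have tel: "B (\<tau> j) w = B 0 w + (\<Sum>i<j. X i w)" for j w
    by (induction j) (simp_all add: \<tau>0 X_def)
  \<comment> \<open>A time may occur at several positions in \<open>ts\<close>; any of them will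
    do.\<close>
  define idx where "idx q = (SOME j. j < m \<and> \<tau> j = q)" for q
  have idx: "idx q < m \<and> \<tau> (idx q) = q" if "q \<in> fst ` set xs" for q
  proof -
    have "q \<in> set ts" using that by (simp add: ts_def)
    then have "\<exists>j. j < m \<and> \<tau> j = q" by (auto simp: in_set_conv_nth m_def \<tau>_def)
    then show ?thesis unfolding idx_def by (rule someI_ex)
  qed
  let ?P = "PiM {..<m} (\<lambda>_. borel) :: (nat \<Rightarrow> real) measure" and ?R = "PiM {m} (\<lambda>_. borel) :: (nat \<Rightarrow> real) measure"
  define C where "C = {g \<in> space ?P. \<forall>(q, a)\<in>set xs. (\<Sum>i<idx q. g i) \<le> a}"
  have Cs: "C \<in> sets ?P"
    unfolding C_def
  proof (rule sets.sets_Collect_finite_All)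
    fix p assume p: "p \<in> set xs"
    obtain q a where qa: "p = (q, a)" by (cases p)
    then have "q \<in> fst ` set xs" using p by (auto intro: rev_image_eqI)
    then have "idx q < m" using idx by blast
    then have "(\<lambda>g. \<Sum>i<idx q. g i) \<in> L0 ?P"
      by (intro borel_measurable_sum measurable_component_singleton) auto
    from borel_measurable_le[OF this borel_measurable_const]
    show "{g \<in> space ?P. case p of (q, a) \<Rightarrow> (\<Sum>i<idx q. g i) \<le> a} \<in> sets ?P" unfolding qa by simp
  qed simp
  have "(\<lambda>g. g m) \<in> L0 ?R" by (rule measurable_component_singleton) simp
  then have Ds: "(\<lambda>g. g m) -` D \<inter> space ?R \<in> sets ?R" using D by (rule measurable_sets)
  have rv: "X i \<in> L0 M" for i
    unfolding X_def[abs_def] by (intro borel_measurable_diff B_measurable \<tau>r)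
  have iv2: "indep_var ?P (\<lambda>w. restrict (\<lambda>i. X i w) {..<m}) ?R (\<lambda>w. restrict (\<lambda>i. X i w) {m})"
    by (rule indep_var_restrict[OF iv]) auto
  have prod: "prob ((\<lambda>w. restrict (\<lambda>i. X i w) {..<m}) -` C \<inter> space M \<inter> ((\<lambda>w. X m w) -` D \<inter> space M))
      = prob ((\<lambda>w. restrict (\<lambda>i. X i w) {..<m}) -` C \<inter> space M) * prob ((\<lambda>w. X m w) -` D \<inter> space M)"
  proof -
    have e: "(\<lambda>w. restrict (\<lambda>i. X i w) {m}) -` ((\<lambda>g. g m) -` D \<inter> space ?R) \<inter> space M = (\<lambda>w. X m w) -` D \<inter> space M"
      by (auto simp: space_PiM)
    have "prob ((\<lambda>w. (restrict (\<lambda>i. X i w) {..<m}, restrict (\<lambda>i. X i w) {m})) -` (C \<times> ((\<lambda>g. g m) -` D \<inter> space ?R)) \<inter> space M)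
      = prob ((\<lambda>w. restrict (\<lambda>i. X i w) {..<m}) -` C \<inter> space M) * prob ((\<lambda>w. restrict (\<lambda>i. X i w) {m}) -` ((\<lambda>g. g m) -` D \<inter> space ?R) \<inter> space M)"
      by (rule indep_varD[OF iv2 Cs Ds])
    moreover have "(\<lambda>w. (restrict (\<lambda>i. X i w) {..<m}, restrict (\<lambda>i. X i w) {m})) -` (C \<times> ((\<lambda>g. g m) -` D \<inter> space ?R)) \<inter> space M
      = (\<lambda>w. restrict (\<lambda>i. X i w) {..<m}) -` C \<inter> space M \<inter> ((\<lambda>w. restrict (\<lambda>i. X i w) {m}) -` ((\<lambda>g. g m) -` D \<inter> space ?R) \<inter> space M)" by blast
    ultimately show ?thesis unfolding e by simp
  qed
  let ?A' = "(\<lambda>w. restrict (\<lambda>i. X i w) {..<m}) -` C \<inter> space M" and ?D = "(\<lambda>w. X m w) -` D \<inter> space M"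
  have A's: "?A' \<in> sets M"
    using indep_var_rv1[OF iv2] Cs by (rule measurable_sets)
  have Dm: "?D \<in> sets M" using rv[of m] D by (rule measurable_sets)
  have As: "A \<in> sets M" by (rule events_upto_sets[OF _ A]) (use s in simp)
  \<comment> \<open>The equality is only almost sure because the sums of increments reproduce
    \<open>B q - B 0\<close>.\<close>
  have "AE w in M. w \<in> A \<longleftrightarrow> w \<in> ?A'"
    using B_0 AE_space
  proof eventually_elim
    case (elim w)
    have Bq: "(\<Sum>i<idx q. restrict (\<lambda>i. X i w) {..<m} i) = B q w" if "(q, a) \<in> set xs" for q a
    proof -
      have "q \<in> fst ` set xs" by (rule image_eqI[OF _ that]) simp
      then have i: "idx q < m" "\<tau> (idx q) = q" using idx by blast+
      then have "(\<Sum>i<idx q. restrict (\<lambda>i. X i w) {..<m} i) = (\<Sum>i<idx q. X i w)" by (intro sum.cong) auto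
      then show ?thesis using tel[of "idx q" w] i(2) elim(1) by simp
    qed
    have "(\<forall>(q, a)\<in>set xs. (\<Sum>i<idx q. restrict (\<lambda>i. X i w) {..<m} i) \<le> a) \<longleftrightarrow> (\<forall>(q, a)\<in>set xs. B q w \<le> a)"
    proof (rule ball_cong[OF refl])
      fix p assume p: "p \<in> set xs"
      obtain q a where qa: "p = (q, a)" by (cases p)
      show "(case p of (q, a) \<Rightarrow> (\<Sum>i<idx q. restrict (\<lambda>i. X i w) {..<m} i) \<le> a) = (case p of (q, a) \<Rightarrow> B q w \<le> a)"
        unfolding qa case_prod_conv Bq[OF p[unfolded qa]] ..
    qed
    moreover have "restrict (\<lambda>i. X i w) {..<m} \<in> space ?P" by (simp add: space_PiM)
    ultimately show ?case using elim(2) unfolding A_eq C_def vimage_def Int_iff mem_Collect_eq by argo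
  qed
  note eq = this
  have "prob A = prob ?A'" by (rule finite_measure_eq_AE[OF eq As A's])
  moreover have "prob (A \<inter> ?D) = prob (?A' \<inter> ?D)"
    by (rule finite_measure_eq_AE[OF _ sets.Int[OF As Dm] sets.Int[OF A's Dm]]) (use eq in eventually_elim, blast)
  ultimately show ?thesis using prod unfolding Xm by simp
qed

abbreviation history where "history \<equiv> completed_history M T B"
abbreviation \<F> where "\<F> \<equiv> brownian_filtration M T B"

lemma history_gen_sets: "{B r -` A \<inter> space M | r A. 0 \<le> r \<and> r \<le> T \<and> r \<le> s \<and> A \<in> sets borel} \<union> null_sets M \<subseteq> sets M"
proof (rule Un_least; rule subsetI)
  fix E assume "E \<in> {B r -` A \<inter> space M | r A. 0 \<le> r \<and> r \<le> T \<and> r \<le> s \<and> A \<in> sets borel}"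
  then obtain r A where "E = B r -` A \<inter> space M" "r \<in> {0..T}" "A \<in> sets borel" unfolding atLeastAtMost_iff by blast
  then show "E \<in> sets M" using measurable_sets[OF B_measurable] by (simp only:)
qed (rule null_setsD2)

lemma history_sets: "history s \<subseteq> sets M"
  unfolding completed_history_def by (rule sets.sigma_sets_subset[OF history_gen_sets])

lemma history_gen: "0 \<le> r \<Longrightarrow> r \<le> T \<Longrightarrow> r \<le> s \<Longrightarrow> A \<in> sets borel \<Longrightarrow> B r -` A \<inter> space M \<in> history s"
  unfolding completed_history_def by (rule sigma_sets.Basic, rule UnI1) blast

lemma history_sigma_algebra: "sigma_algebra (space M) (history s)"
  unfolding completed_history_def
  by (rule sigma_algebra_sigma_sets) (use history_gen_sets[of s] sets.space_closed in blast)

lemma history_null: "A \<in> null_sets M \<Longrightarrow> A \<in> history s"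
  unfolding completed_history_def by (rule sigma_sets.Basic) blast

lemma histories_Pow: "(\<Inter>s\<in>{t<..}. history s) \<subseteq> Pow (space M)"
proof -
  have "(\<Inter>s\<in>{t<..}. history s) \<subseteq> history (t + 1)" by (rule INF_lower) simp
  also have "\<dots> \<subseteq> Pow (space M)" using history_sets sets.space_closed by (rule order_trans)
  finally show ?thesis .
qed

lemma space_filtration: "space (\<F> t) = space M"
  unfolding brownian_filtration_def by (rule space_measure_of[OF histories_Pow])

text \<open>The intersection of the histories is itself a sigma-algebra, so generating adds
  nothing.\<close>

lemma sets_filtration: "sets (\<F> t) = (\<Inter>s\<in>{t<..}. history s)"
proof -
  have sub: "(\<Inter>s\<in>{t<..}. history s) \<subseteq> history s" if "t < s" for s using that by blast
  have "sets (\<F> t) = sigma_sets (space M) (\<Inter>s\<in>{t<..}. history s)"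
    unfolding brownian_filtration_def by (rule sets_measure_of[OF histories_Pow])
  moreover have "sigma_sets (space M) (\<Inter>s\<in>{t<..}. history s) \<subseteq> history s" if "t < s" for s
    by (rule sigma_algebra.sigma_sets_subset[OF history_sigma_algebra sub[OF that]])
  ultimately show ?thesis by blast
qed

lemma sets_filtration_history: "sets (\<F> t) \<subseteq> history s" if "t < s"
  unfolding sets_filtration using that by blast

lemma B_filtration:
  assumes t: "t \<in> {0..T}"
  shows "B t \<in> L0 (\<F> t)"
proof (rule measurableI)
  fix A :: "real set" assume A: "A \<in> sets borel"
  have "B t -` A \<inter> space M \<in> history s" if "t < s" for s
    by (rule history_gen[OF _ _ _ A]) (use t that in simp_all)
  then show "B t -` A \<inter> space (\<F> t) \<in> sets (\<F> t)" unfolding sets_filtration space_filtration by blast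
qed simp

text \<open>Finite-dimensional events and null sets together form an intersection-stable generator
  of the history, and each of them is independent of the increment.\<close>

lemma history_indep:
  assumes s: "0 \<le> s" "s \<le> t" "t \<le> T" and A: "A \<in> history s" and D: "D \<in> sets borel"
  shows "prob (A \<inter> ((\<lambda>w. B t w - B s w) -` D \<inter> space M)) = prob A * prob ((\<lambda>w. B t w - B s w) -` D \<inter> space M)"
proof -
  let ?X = "\<lambda>w. B t w - B s w"
  let ?G = "events_upto s \<union> null_sets M"
  define H where "H = {?X -` D \<inter> space M | D. D \<in> sets borel}"
  have Xm: "?X \<in> L0 M" using s by (intro borel_measurable_diff B_measurable) auto
  have HM: "H \<subseteq> sets M" using measurable_sets[OF Xm] by (auto simp: H_def)
  have sT: "s \<le> T" using s by simp
  have GM: "?G \<subseteq> sets M" using events_upto_sets[OF sT] by (auto simp: null_sets_def)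
  have "indep_set ?G H"
  proof (rule indep_setI[OF GM HM])
    fix a b assume a: "a \<in> ?G" and b: "b \<in> H"
    then obtain D where D: "b = ?X -` D \<inter> space M" "D \<in> sets borel" unfolding H_def by blast
    show "prob (a \<inter> b) = prob a * prob b"
    proof (cases "a \<in> null_sets M")
      case True
      have "a \<inter> b \<in> null_sets M" using b HM by (intro null_set_Int2[OF True]) blast
      then show ?thesis using True by (simp add: measure_def null_sets_def)
    next
      case False
      then show ?thesis using a events_upto_indep_increment[OF s _ D(2)] unfolding D(1) by blast
    qed
  qed
  moreover have "Int_stable ?G"
  proof (rule Int_stableI)
    fix a b assume ab: "a \<in> ?G" "b \<in> ?G"
    show "a \<inter> b \<in> ?G"
    proof (cases "a \<in> events_upto s \<and> b \<in> events_upto s")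
      case True
      then show ?thesis using Int_stable_events_upto[of s] by (auto simp: Int_stable_def)
    next
      case False
      then have "a \<inter> b \<in> null_sets M" using null_set_Int1[of b M a] null_set_Int2[of a M b] ab GM by blast
      then show ?thesis by blast
    qed
  qed
  moreover have "Int_stable H"
  proof (rule Int_stableI)
    fix a b assume "a \<in> H" "b \<in> H"
    then obtain D D' where "a = ?X -` D \<inter> space M" "D \<in> sets borel" "b = ?X -` D' \<inter> space M" "D' \<in> sets borel" unfolding H_def by blast
    then have "a \<inter> b = ?X -` (D \<inter> D') \<inter> space M" "D \<inter> D' \<in> sets borel" by auto
    then show "a \<inter> b \<in> H" unfolding H_def by blast
  qed
  ultimately have ind: "indep_set (sigma_sets (space M) ?G) (sigma_sets (space M) H)" by (rule indep_set_sigma_sets)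
  have "history s \<subseteq> sigma_sets (space M) ?G"
    unfolding completed_history_def
  proof (rule sigma_sets_mono, rule subsetI)
    fix E assume "E \<in> {B r -` A \<inter> space M | r A. 0 \<le> r \<and> r \<le> T \<and> r \<le> s \<and> A \<in> sets borel} \<union> null_sets M"
    then consider (null) "E \<in> null_sets M" | (gen) r A where "E = B r -` A \<inter> space M" "0 \<le> r" "r \<le> s" "A \<in> sets borel" by blast
    then show "E \<in> sigma_sets (space M) ?G"
    proof cases
      case null
      then show ?thesis by (intro sigma_sets.Basic) blast
    next
      case gen
      have GP: "?G \<subseteq> Pow (space M)" using GM sets.space_closed by blast
      have "B r \<in> L0 (sigma (space M) ?G)"
        unfolding borel_measurable_iff_le
      proof
        fix a
        have "{w\<in>space M. B r w \<le> a} = {w\<in>space M. \<forall>(q, a)\<in>set [(r, a)]. B q w \<le> a}" by simp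
        moreover have "\<forall>(q, a)\<in>set [(r, a)]. 0 \<le> q \<and> q \<le> s" using gen by simp
        ultimately have "{w\<in>space M. B r w \<le> a} \<in> events_upto s" unfolding events_upto_def by blast
        then show "{w \<in> space (sigma (space M) ?G). B r w \<le> a} \<in> sets (sigma (space M) ?G)"
          using GP by (simp add: space_measure_of sets_measure_of sigma_sets.Basic)
      qed
      from measurable_sets[OF this gen(4)] show ?thesis unfolding gen(1) using GP by (simp add: space_measure_of sets_measure_of)
    qed
  qed
  then have "A \<in> sigma_sets (space M) ?G" using A by blast
  moreover have "?X -` D \<inter> space M \<in> sigma_sets (space M) H" by (rule sigma_sets.Basic) (use D in \<open>auto simp: H_def\<close>)
  ultimately show ?thesis by (rule indep_setD[OF ind])
qed

text \<open>An event of \<open>\<F> s\<close> belongs to the history at every later time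
  \<open>r\<close>, hence is independent of \<open>B t - B r\<close>; let \<open>r\<close> decrease
  to \<open>s\<close> along continuous paths. Probabilities are compared on half-lines, whose
  endpoints carry no mass because the increment is normal.\<close>

lemma filtration_indep:
  assumes s: "0 \<le> s" "s \<le> t" "t \<le> T" and A: "A \<in> sets (\<F> s)" and D: "D \<in> sets borel"
  shows "prob (A \<inter> ((\<lambda>w. B t w - B s w) -` D \<inter> space M)) = prob A * prob ((\<lambda>w. B t w - B s w) -` D \<inter> space M)"
proof (cases "s = t")
  case True
  have "A \<subseteq> space M" using sets.sets_into_space[OF A] unfolding space_filtration .
  then have "A \<inter> space M = A" by blast
  then show ?thesis using True by (cases "0 \<in> D") (simp_all add: prob_space)
next
  case False
  then have st: "s < t" using s by simp
  have AM: "A \<in> sets M" using A sets_filtration_history[of s "s + 1"] history_sets by auto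
  \<comment> \<open>Strictly above \<open>s\<close>, so that events of \<open>\<F> s\<close> lie in
    the history at \<open>r n\<close>, and at most \<open>t\<close>, so that the remaining increment
    ends at \<open>t\<close>.\<close>
  define r where "r n = s + (t - s) * inverse (real (Suc n))" for n
  have r: "s < r n" "r n \<le> t" for n
  proof -
    have i: "0 < inverse (real (Suc n))" "inverse (real (Suc n)) \<le> 1" by (simp_all add: inverse_le_1_iff)
    define q where "q = (t - s) * inverse (real (Suc n))"
    have "0 < q" unfolding q_def by (rule mult_pos_pos[OF _ i(1)]) (use st in simp)
    moreover have "q \<le> t - s" using mult_left_mono[OF i(2), of "t - s"] st unfolding q_def by simp
    ultimately show "s < r n" "r n \<le> t" unfolding r_def q_def[symmetric] by linarith+
  qed
  have "r \<longlonglongrightarrow> s + (t - s) * 0" unfolding r_def by (intro tendsto_intros LIMSEQ_inverse_real_of_nat)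
  then have rs: "r \<longlonglongrightarrow> s" by simp
  define X where "X w = B t w - B s w" for w
  define Xn where "Xn n w = B t w - B (r n) w" for n w
  have rT: "r n \<in> {0..T}" for n using r[of n] s by simp
  have Xm: "X \<in> L0 M" unfolding X_def[abs_def] using s by (intro borel_measurable_diff B_measurable) simp_all
  have Xnm: "Xn n \<in> L0 M" for n
    unfolding Xn_def[abs_def] by (intro borel_measurable_diff B_measurable rT) (use s in simp)
  have half: "Z -` {..a} \<inter> space M \<in> sets M" if "Z \<in> L0 M" for Z :: "'a \<Rightarrow> real" and a
    using that by (rule measurable_sets) simp
  have conv: "(\<lambda>n. prob (E \<inter> (Xn n -` {..a} \<inter> space M))) \<longlonglongrightarrow> prob (E \<inter> (X -` {..a} \<inter> space M))" if E: "E \<in> sets M" for E a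
  proof -
    have lb: "Measurable.pred lborel (\<lambda>x. x \<noteq> a)" by simp
    have "AE x in lborel. x \<noteq> a" by (rule AE_lborel_singleton)
    then have "AE x in lborel. 0 < ennreal (normal_density 0 (sqrt (t - s)) x) \<longrightarrow> x \<noteq> a" by eventually_elim simp
    then have na: "AE w in M. X w \<noteq> a"
      using distributed_AE2[OF B_normal[OF s(1) st s(3)] lb] unfolding X_def by blast
    have m: "E \<inter> (Xn n -` {..a} \<inter> space M) \<in> sets M" "E \<inter> (X -` {..a} \<inter> space M) \<in> sets M" for n
      by (rule sets.Int[OF E half[OF Xnm]], rule sets.Int[OF E half[OF Xm]])
    have "(\<lambda>n. \<integral>w. indicator (E \<inter> (Xn n -` {..a} \<inter> space M)) w \<partial>M) \<longlonglongrightarrow> (\<integral>w. indicator (E \<inter> (X -` {..a} \<inter> space M)) w \<partial>M :: real)"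
    proof (rule integral_dominated_convergence[where w="\<lambda>_. 1"])
      show "AE w in M. (\<lambda>n. indicator (E \<inter> (Xn n -` {..a} \<inter> space M)) w) \<longlonglongrightarrow> (indicator (E \<inter> (X -` {..a} \<inter> space M)) w :: real)"
        using na B_continuous
      proof eventually_elim
        case (elim w)
        have sT: "s \<in> {0..T}" using s by simp
        have "(\<lambda>n. B (r n) w) \<longlonglongrightarrow> B s w"
          by (rule continuous_on_tendsto_compose[OF elim(2) rs sT]) (rule always_eventually, rule allI, rule rT)
        then have l: "(\<lambda>n. Xn n w) \<longlonglongrightarrow> X w" unfolding Xn_def X_def by (intro tendsto_intros)
        have "\<forall>\<^sub>F n in sequentially. Xn n w \<le> a \<longleftrightarrow> X w \<le> a"
        proof (cases "X w < a")
          case True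
          from order_tendstoD(2)[OF l this] show ?thesis by eventually_elim (use True in auto)
        next
          case False
          then have a: "a < X w" using elim(1) by simp
          from order_tendstoD(1)[OF l a] show ?thesis by eventually_elim (use a in auto)
        qed
        then show ?case by (rule tendsto_eventually[OF eventually_mono]) (simp add: indicator_def)
      qed
    qed (rule borel_measurable_indicator[OF m(2)] borel_measurable_indicator[OF m(1)] integrable_const AE_I2 | simp add: indicator_def)+
    then show ?thesis using m by simp
  qed
  have key: "prob (A \<inter> (X -` {..a} \<inter> space M)) = prob A * prob (X -` {..a} \<inter> space M)" for a
  proof (rule LIMSEQ_unique[OF conv[OF AM]])
    have e: "space M \<inter> (Z -` {..a} \<inter> space M) = Z -` {..a} \<inter> space M" for Z :: "'a \<Rightarrow> real" by blast
    have "prob (A \<inter> (Xn n -` {..a} \<inter> space M)) = prob A * prob (Xn n -` {..a} \<inter> space M)" for n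
      unfolding Xn_def[abs_def]
    proof (rule history_indep)
      show "A \<in> history (r n)" using A sets_filtration_history[OF r(1)] by blast
    qed (use rT[of n] r[of n] s in simp_all)
    then show "(\<lambda>n. prob (A \<inter> (Xn n -` {..a} \<inter> space M))) \<longlonglongrightarrow> prob A * prob (X -` {..a} \<inter> space M)"
      using tendsto_mult_left[OF conv[OF sets.top, of a, unfolded e], of "prob A"] by simp
  qed
  define H where "H = {X -` {..a} \<inter> space M | a. True}"
  have HM: "H \<subseteq> sets M" using half[OF Xm] by (auto simp: H_def)
  have "indep_set {A} H"
  proof (rule indep_setI)
    show "prob (a \<inter> b) = prob a * prob b" if "a \<in> {A}" "b \<in> H" for a b
      using that key unfolding H_def by blast
  qed (use AM HM in auto)
  moreover have "Int_stable {A}" by (rule Int_stableI) simp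
  moreover have "Int_stable H"
  proof (rule Int_stableI)
    fix a b assume "a \<in> H" "b \<in> H"
    then obtain x y where "a = X -` {..x} \<inter> space M" "b = X -` {..y} \<inter> space M" unfolding H_def by blast
    then have "a \<inter> b = X -` {..min x y} \<inter> space M" by auto
    then show "a \<inter> b \<in> H" unfolding H_def by blast
  qed
  ultimately have ind: "indep_set (sigma_sets (space M) {A}) (sigma_sets (space M) H)" by (rule indep_set_sigma_sets)
  have HP: "H \<subseteq> Pow (space M)" using HM sets.space_closed by (rule order_trans)
  have "X \<in> L0 (sigma (space M) H)"
    unfolding borel_measurable_iff_le
  proof
    fix a
    have "{w\<in>space M. X w \<le> a} = X -` {..a} \<inter> space M" by auto
    then have "{w\<in>space M. X w \<le> a} \<in> H" unfolding H_def by blast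
    then show "{w \<in> space (sigma (space M) H). X w \<le> a} \<in> sets (sigma (space M) H)"
      by (simp add: space_measure_of[OF HP] sets_measure_of[OF HP] sigma_sets.Basic)
  qed
  from measurable_sets[OF this D] have "X -` D \<inter> space M \<in> sigma_sets (space M) H"
    by (simp add: space_measure_of[OF HP] sets_measure_of[OF HP])
  from indep_setD[OF ind sigma_sets.Basic[of A] this] show ?thesis unfolding X_def[abs_def] by simp
qed

text \<open>On a null set the path is replaced by \<open>0\<close>; null sets belong to the filtration from time \<open>0\<close> on.\<close>

lemma continuous_version:
  "\<exists>N\<in>null_sets M. wiener_generated M T \<F> (\<lambda>t w. if w \<in> N then 0 else B t w)"
proof -
  have "AE w in M. B 0 w = 0 \<and> continuous_on {0..T} (\<lambda>t. B t w)" using B_0 B_continuous by eventually_elim simp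
  then obtain N where N: "{w\<in>space M. \<not> (B 0 w = 0 \<and> continuous_on {0..T} (\<lambda>t. B t w))} \<subseteq> N" "emeasure M N = 0" "N \<in> sets M"
    by (rule AE_E)
  have N0: "N \<in> null_sets M" using N(2,3) by (rule null_setsI)
  define W where "W t w = (if w \<in> N then 0 else B t w)" for t w
  have WB: "AE w in M. \<forall>t. W t w = B t w" using AE_not_in[OF N0] by eventually_elim (simp add: W_def)
  have F_space: "space (\<F> t) = space M" for t by (rule space_filtration)
  have F_M: "sets (\<F> t) \<subseteq> sets M" for t using sets_filtration_history[of t "t + 1"] history_sets[of "t + 1"] by simp
  have F_null: "A \<in> sets (\<F> t)" if "A \<in> null_sets M" for A t
    unfolding sets_filtration using history_null[OF that] by blast
  have W_F: "W t \<in> L0 (\<F> t)" if "t \<in> {0..T}" for t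
    unfolding W_def[abs_def]
  proof (rule measurable_If_set[OF borel_measurable_const B_filtration[OF that]])
    have "N \<inter> space M = N" using N(3) sets.sets_into_space by blast
    then show "N \<inter> space (\<F> t) \<in> sets (\<F> t)" unfolding F_space using F_null[OF N0] by simp
  qed
  have sub: "subalgebra M (\<F> t)" for t unfolding subalgebra_def using F_space F_M by blast
  have W_M: "W t \<in> L0 M" if "t \<in> {0..T}" for t by (rule measurable_from_subalg[OF sub W_F[OF that]])
  have "wiener_generated M T \<F> W"
  proof unfold_locales
    show "0 < T" by (rule T_pos)
    show "subalgebra M (\<F> t)" for t by (rule sub)
    show "sets (\<F> s) \<subseteq> sets (\<F> t)" if "s \<le> t" for s t unfolding sets_filtration using that by (intro INF_superset_mono) auto
    show "A \<in> sets (\<F> t)" if "A \<in> null_sets M" for t A by (rule F_null[OF that])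
    show "W t \<in> L0 (\<F> t)" if "0 \<le> t" "t \<le> T" for t by (rule W_F) (simp add: that)
    show "continuous_on {0..T} (\<lambda>t. W t w)" if "w \<in> space M" for w
      using N(1) that by (cases "w \<in> N") (auto simp: W_def)
    show "W 0 w = 0" if "w \<in> space M" for w using N(1) that by (cases "w \<in> N") (auto simp: W_def)
    show "distributed M lborel (\<lambda>w. W t w - W s w) (normal_density 0 (sqrt (t - s)))" if st: "0 \<le> s" "s < t" "t \<le> T" for s t
    proof -
      note d = B_normal[OF st]
      have mW: "(\<lambda>w. W t w - W s w) \<in> L0 M" using st by (intro borel_measurable_diff W_M) simp_all
      have mB: "(\<lambda>w. B t w - B s w) \<in> L0 M" using st by (intro borel_measurable_diff B_measurable) simp_all
      have "distr M lborel (\<lambda>w. W t w - W s w) = distr M lborel (\<lambda>w. B t w - B s w)"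
      proof (rule distr_cong_AE)
        show "AE w in M. W t w - W s w = B t w - B s w" using WB by eventually_elim simp
      qed (use mW mB in simp_all)
      then show ?thesis using d mW unfolding distributed_def by simp
    qed
    show "prob (A \<inter> ((\<lambda>w. W t w - W s w) -` D \<inter> space M)) = prob A * prob ((\<lambda>w. W t w - W s w) -` D \<inter> space M)"
      if st: "0 \<le> s" "s \<le> t" "t \<le> T" and A: "A \<in> sets (\<F> s)" and D: "D \<in> sets borel" for s t A D
    proof -
      have mW: "(\<lambda>w. W t w - W s w) \<in> L0 M" using st by (intro borel_measurable_diff W_M) simp_all
      have mB: "(\<lambda>w. B t w - B s w) \<in> L0 M" using st by (intro borel_measurable_diff B_measurable) simp_all
      note m = measurable_sets[OF mW D] measurable_sets[OF mB D]
      have AM: "A \<in> sets M" using A F_M by blast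
      have "prob ((\<lambda>w. W t w - W s w) -` D \<inter> space M) = prob ((\<lambda>w. B t w - B s w) -` D \<inter> space M)"
        by (rule finite_measure_eq_AE[OF _ m]) (use WB in eventually_elim, simp)
      moreover have "prob (A \<inter> ((\<lambda>w. W t w - W s w) -` D \<inter> space M)) = prob (A \<inter> ((\<lambda>w. B t w - B s w) -` D \<inter> space M))"
        by (rule finite_measure_eq_AE[OF _ sets.Int[OF AM m(1)] sets.Int[OF AM m(2)]]) (use WB in eventually_elim, simp)
      ultimately show ?thesis using filtration_indep[OF st A D] by simp
    qed
    let ?G = "{W r -` {..a} \<inter> space M |r a. 0 \<le> r \<and> r \<le> T} \<union> null_sets M"
    have GM: "?G \<subseteq> sets M"
    proof (rule Un_least; rule subsetI)
      fix E assume "E \<in> {W r -` {..a} \<inter> space M |r a. 0 \<le> r \<and> r \<le> T}"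
      then obtain r a where "E = W r -` {..a} \<inter> space M" "r \<in> {0..T}" unfolding atLeastAtMost_iff by blast
      then show "E \<in> sets M" using measurable_sets[OF W_M, of r "{..a}"] by simp
    qed (rule null_setsD2)
    have GP: "?G \<subseteq> Pow (space M)" using GM sets.space_closed by (rule order_trans)
    define S where "S = sigma (space M) ?G"
    have S: "space S = space M" "sets S = sigma_sets (space M) ?G"
      unfolding S_def by (rule space_measure_of[OF GP], rule sets_measure_of[OF GP])
    have GS: "E \<in> sets S" if "E \<in> ?G" for E unfolding S(2) by (rule sigma_sets.Basic[OF that])
    have NS: "E \<in> sets S" if "E \<in> null_sets M" for E by (rule GS[OF UnI2[OF that]])
    have WS: "W r \<in> L0 S" if r: "0 \<le> r" "r \<le> T" for r
      unfolding borel_measurable_iff_le S(1)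
    proof
      fix a
      have "{w\<in>space M. W r w \<le> a} = W r -` {..a} \<inter> space M" unfolding vimage_def atMost_def by blast
      with r have "{w\<in>space M. W r w \<le> a} \<in> ?G" by (intro UnI1 CollectI exI[of _ r] exI[of _ a] conjI)
      then show "{w\<in>space M. W r w \<le> a} \<in> sets S" by (rule GS)
    qed
    \<comment> \<open>Off \<open>N\<close> the two processes coincide; the part of the preimage
      inside \<open>N\<close> is a null set, and null sets are among the generators.\<close>
    have BS: "B r -` A \<inter> space M \<in> sets S" if r: "0 \<le> r" "r \<le> T" and A: "A \<in> sets borel" for r A
    proof -
      have rT: "r \<in> {0..T}" using r by simp
      have 1: "W r -` A \<inter> space M \<in> sets S" using measurable_sets[OF WS[OF r] A] unfolding S(1) .
      have 2: "(B r -` A \<inter> space M) \<inter> N \<in> sets S"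
        by (rule NS[OF null_set_Int1[OF N0 measurable_sets[OF B_measurable[OF rT] A]]])
      have "W r w = B r w" if "w \<notin> N" for w using that by (simp add: W_def)
      then have "B r -` A \<inter> space M = ((W r -` A \<inter> space M) - N) \<union> ((B r -` A \<inter> space M) \<inter> N)" unfolding vimage_def by force
      also have "\<dots> \<in> sets S" by (intro sets.Un sets.Diff 1 2 NS[OF N0])
      finally show ?thesis .
    qed
    \<comment> \<open>Any time beyond \<open>T\<close> serves here, since the history stops growing
      at \<open>T\<close>.\<close>
    have "history (T + 1) \<subseteq> sigma_sets (space M) ?G"
      unfolding completed_history_def
    proof (rule sigma_sets_mono, rule subsetI)
      fix E assume "E \<in> {B r -` A \<inter> space M | r A. 0 \<le> r \<and> r \<le> T \<and> r \<le> T + 1 \<and> A \<in> sets borel} \<union> null_sets M"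
      then have "E \<in> sets S" using BS NS by blast
      then show "E \<in> sigma_sets (space M) ?G" unfolding S(2) .
    qed
    then show "sets (\<F> T) \<subseteq> sigma_sets (space M) ?G" using sets_filtration_history[of T "T + 1"] by simp
  qed
  then show ?thesis using N0 unfolding W_def[abs_def] by blast
qed

end

text \<open>The integrator enters only through mean square distances, which do not see null
  sets.\<close>

lemma has_ito_integral_cong_integrator:
  assumes "AE w in M. \<forall>t. W t w = B t w"
  shows "has_ito_integral M T F W H I \<longleftrightarrow> has_ito_integral M T F B H I"
proof -
  have "sq_norm M (\<lambda>w. simple_ito_integral W n \<tau> \<xi> t w - I t w) = sq_norm M (\<lambda>w. simple_ito_integral B n \<tau> \<xi> t w - I t w)" for n \<tau> \<xi> t
    by (rule nn_integral_cong_AE) (use assms in eventually_elim, simp add: simple_ito_integral_def)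
  then show ?thesis unfolding has_ito_integral_def by simp
qed

theorem theorem3p5:
  fixes M :: "'a measure" and T C :: real
    and B :: "real \<Rightarrow> 'a \<Rightarrow> real"
    and F :: "real \<Rightarrow> 'a measure"
    and f :: "real \<Rightarrow> 'a \<Rightarrow> real \<Rightarrow> real \<Rightarrow> real \<Rightarrow> real"
    and \<phi> :: "real \<Rightarrow> 'a \<Rightarrow> real"
  assumes "0 < T"
    and "prob_space M" and "complete_measure M"
    and "brownian_motion M T B"
    and "F = brownian_filtration M T B"
    and f_measurable: "\<And>y z. (\<lambda>(s, u, \<omega>). f u \<omega> s y z) \<in>
           borel_measurable (lborel_upto T \<Otimes>\<^sub>M (lborel_upto T \<Otimes>\<^sub>M M))"
    and f_adapted: "\<And>y z u. u \<in> {0..T} \<Longrightarrow> adapted_upto T F (\<lambda>s \<omega>. f u \<omega> s y z)"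
    and "0 < C"
    and f_lipschitz: "\<And>\<omega> s u y y' z z'.
           \<omega> \<in> space M \<Longrightarrow> s \<in> {0..T} \<Longrightarrow> u \<in> {0..T} \<Longrightarrow>
           \<bar>f u \<omega> s y z - f u \<omega> s y' z'\<bar> \<le> C * (\<bar>y - y'\<bar> + \<bar>z - z'\<bar>)"
    and f_growth: "\<And>\<omega> s u y z.
           \<omega> \<in> space M \<Longrightarrow> s \<in> {0..T} \<Longrightarrow> u \<in> {0..T} \<Longrightarrow>
           \<bar>f u \<omega> s y z\<bar> \<le> C * (1 + \<bar>y\<bar> + \<bar>z\<bar>)"
    and "\<phi> \<in> L2_terminal M T F"
  shows "\<exists>Y Z. bsde_field_solution M T F B f \<phi> Y Z \<and>
           (\<forall>Y' Z'. bsde_field_solution M T F B f \<phi> Y' Z' \<longrightarrow>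
              (AE (t, u, \<omega>) in lborel_upto T \<Otimes>\<^sub>M (lborel_upto T \<Otimes>\<^sub>M M).
                 Y' u t \<omega> = Y u t \<omega> \<and> Z' u t \<omega> = Z u t \<omega>))"
proof -
  interpret brownian M T B
    by (rule brownian.intro[OF \<open>prob_space M\<close> brownian_axioms.intro[OF \<open>0 < T\<close> \<open>brownian_motion M T B\<close>]])
  obtain N where N: "N \<in> null_sets M" and wg: "wiener_generated M T F (\<lambda>t w. if w \<in> N then 0 else B t w)"
    using continuous_version unfolding \<open>F = brownian_filtration M T B\<close> by blast
  define W where "W t w = (if w \<in> N then 0 else B t w)" for t w
  interpret W: wiener_generated M T F W using wg unfolding W_def[abs_def] .
  have WB: "AE w in M. \<forall>t. W t w = B t w" using AE_not_in[OF N] by eventually_elim (simp add: W_def)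
  have sol: "bsde_field_solution M T F B f \<phi> Y Z \<longleftrightarrow> bsde_field_solution M T F W f \<phi> Y Z" for Y Z
    unfolding bsde_field_solution_def has_ito_integral_cong_integrator[OF WB] ..
  have j: "(\<lambda>(s, u, w). g u s w) = joint g" for g :: "real \<Rightarrow> real \<Rightarrow> 'a \<Rightarrow> real"
    by (simp add: fun_eq_iff joint_def)
  have "\<exists>Y Z. bsde_field_solution M T F W f \<phi> Y Z \<and>
    (\<forall>Y' Z'. bsde_field_solution M T F W f \<phi> Y' Z' \<longrightarrow> (AE q in W.TTM. joint Y' q = joint Y q \<and> joint Z' q = joint Z q))"
  proof (rule W.field_equation_well_posed[where C=C])
    show "joint (\<lambda>u s w. f u w s y z) \<in> L0 W.TTM" for y z
      using f_measurable[of y z] unfolding j[of "\<lambda>u s w. f u w s y z"] .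
    show "(\<lambda>w. f u w s y z) \<in> L0 (F s)" if "u \<in> {0..T}" "s \<in> {0..T}" for y z u s
      using f_adapted[OF that(1), of y z] that(2) unfolding adapted_upto_def by blast
  qed (fact \<open>0 < C\<close> f_lipschitz f_growth \<open>\<phi> \<in> L2_terminal M T F\<close>)+
  then show ?thesis unfolding sol by (simp add: case_prod_beta' joint_def)
qed

end
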